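(* Let $\mathfrak{U}:\mathfrak{J}_{\vee}\to\mathfrak{J}$ be the inclusion 2-functor from the 2-category of monoidal categories with a distinguished object having a right dual to the 2-category of monoidal categories with a distinguished object (both defined in the context). Then $\mathfrak{U}$ has a left biadjoint whose value at $(\mathcal{C},J)$ is $(\mathcal{C}[J^{\vee}],J)$. Moreover, $\Omega:(\mathcal{C},J)\to(\mathcal{C}[J^{\vee}],J)$ is the component at $(\mathcal{C},J)$ of the unit of the biadjunction.
   Context: A right dual of an object $X$ in a monoidal category is an object $Y$ with morphisms $\varepsilon:X\otimes Y\to\mathbb{I}$ (counit) and $\eta:\mathbb{I}\to Y\otimes X$ (unit) such that $(\varepsilon\otimes X)(X\otimes\eta)=1_X$ and $(Y\otimes\varepsilon)(\eta\otimes Y)=1_Y$; one writes $X\dashv Y$. The 2-category $\mathfrak{J}$: objects $(\mathcal{C},J)$ are monoidal categories $\mathcal{C}$ with a distinguished object $J\in\mathcal{C}$; 1-morphisms $(F,\phi):(\mathcal{C},J)\to(\mathcal{C}',J')$ are strong monoidal functors $F:\mathcal{C}\to\mathcal{C}'$ with an isomorphism $\phi:FJ\cong J'$; 2-morphisms $\sigma:(F,\phi)\Rightarrow(G,\psi)$ are monoidal natural transformations $\sigma:F\Rightarrow G$ with $\psi\circ\sigma_J=\phi$. The 2-category $\mathfrak{J}_{\vee}$ is the full sub-2-category of $\mathfrak{J}$ on those $(\mathcal{C},J)$ for which $J$ has a right dual. Construction of $\mathcal{C}[J^{\vee}]$. Since every monoidal category is monoidally equivalent to a strict one, $\mathcal{C}$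 is taken to be strict in the construction (for general $\mathcal{C}$, replace $(\mathcal{C},J)$ by an equivalent strict one and let $\Omega$ be the composite with the equivalence). Let $\mathcal{C}$ be strict monoidal with tensor $\otimes$ and unit $\mathbb{I}$, and $J\in\mathcal{C}$. Write $[m]=\{0,1,\dots,m\}$. Let $\mathcal{G}_0$ be the set of all functions $U:[m]\to \mathrm{ob}\,\mathcal{C}$ ($m\ge 0$), written $U=(U_0,\dots,U_m)$; objects of $\mathcal{C}$ are identified with functions $[0]\to\mathrm{ob}\,\mathcal{C}$. For $U:[m]\to\mathrm{ob}\,\mathcal{C}$ and $V:[n]\to\mathrm{ob}\,\mathcal{C}$ define $U\otimes V:[m+n]\to\mathrm{ob}\,\mathcal{C}$ by $(U\otimes V)_i=U_i$ for $i<m$, $(U\otimes V)_m=U_m\otimes V_0$, $(U\otimes V)_i=V_{i-m}$ for $i>m$. This makes $\mathcal{G}_0$ a monoid with unit $\mathbb{I}$. Put $J^{\vee}=(\mathbb{I},\mathbb{I}):[1]\to\mathrm{ob}\,\mathcal{C}$; then every $U$ decomposes uniquely as $U=U_0\otimes J^{\vee}\otimes U_1\otimes J^{\vee}\otimes\dots\otimes J^{\vee}\otimes U_m$ with $U_i\in\mathcal{C}$. Let $\mathcal{G}$ be the directed graph with vertex set $\mathcal{G}_0$ and the following edges. The primitive edges are symbols $\varepsilon: J\otimes J^{\vee}\to\mathbb{I}$, $\eta:\mathbb{I}\to J^{\vee}\otimes J$, and $\bar f: C\to D$ for each morphism $f:C\to D$ of $\mathcal{C}$. The general edges are the formal whiskerings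 $U\otimes p\otimes V: U\otimes A\otimes V\to U\otimes B\otimes V$ with $p:A\to B$ primitive and $U,V\in\mathcal{G}_0$ (with $p$ identified with $\mathbb{I}\otimes p\otimes\mathbb{I}$); put $T\otimes(U\otimes p\otimes V)\otimes W=(T\otimes U)\otimes p\otimes(V\otimes W)$ and extend $U\otimes -\otimes V$ to paths edge by edge. Let $\mathcal{F}\mathcal{G}$ be the free category on $\mathcal{G}$, and let $\sim$ be the congruence on $\mathcal{F}\mathcal{G}$ generated by the following relations ($C,D,E,F\in\mathcal{C}$; $U,V,W,X,Y,Z\in\mathcal{G}_0$): (i) $\overline{E\otimes f\otimes F}\sim E\otimes\bar f\otimes F$ for $f\in\mathcal{C}(C,D)$; (ii) $\overline{1_C}\sim 1_C$, and $\overline{gf}\sim\bar g\,\bar f$ for $f\in\mathcal{C}(C,D)$, $g\in\mathcal{C}(D,E)$; (iii) $(V\otimes b)(a\otimes W)\sim(a\otimes X)(U\otimes b)$ for all edges $a:U\to V$, $b:W\to X$; (iv) $(\varepsilon\otimes J)(J\otimes\eta)\sim 1_J$; (v) $(J^{\vee}\otimes\varepsilon)(\eta\otimes J^{\vee})\sim 1_{J^{\vee}}$; (vi) if $\ell\sim\ell'$ is any of the relations (i)–(v), then $Y\otimes\ell\otimes Z\sim Y\otimes\ell'\otimes Z$. Put $\mathcal{C}[J^{\vee}]=\mathcal{F}\mathcal{G}/\sim$. It is strict monoidal: the tensor of objects $U:[m]\to\mathrm{ob}\,\mathcal{C}$ and $V:[n]\to\mathrm{ob}\,\mathcal{C}$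 is the product in the monoid $\mathcal{G}_0$, i.e. the function $U\otimes V:[m+n]\to\mathrm{ob}\,\mathcal{C}$ with $(U\otimes V)_i=U_i$ for $i<m$, $(U\otimes V)_m=U_m\otimes V_0$, $(U\otimes V)_i=V_{i-m}$ for $i>m$, and for morphisms $[a]\otimes[b]$ is the class of both sides of (iii), extended to paths. The functor $\Omega:\mathcal{C}\to\mathcal{C}[J^{\vee}]$, $\Omega C=C$, $\Omega f=[\bar f]$, is strict monoidal, and $J\dashv J^{\vee}$ in $\mathcal{C}[J^{\vee}]$ with counit $\varepsilon$ and unit $\eta$. It is regarded as a 1-morphism $(\mathcal{C},J)\to(\mathcal{C}[J^{\vee}],J)$ with the identity isomorphism. *)

theory Defs
  imports "HOL-Library.FuncSet" "HOL-Library.Infinite_Typeclass"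
begin

section \<open>Categories\<close>

text \<open>Only the behaviour of the operations on the carriers \<open>ob\<close> and \<open>ar\<close> is meaningful.
  \<open>g \<cdot> f\<close> is composition in the order ``first \<open>f\<close>, then \<open>g\<close>''.\<close>

record ('o, 'm) cat =
  ob :: "'o set"
  ar :: "'m set"
  src :: "'m \<Rightarrow> 'o"
  tgt :: "'m \<Rightarrow> 'o"
  idn :: "'o \<Rightarrow> 'm"
  cmp :: "'m \<Rightarrow> 'm \<Rightarrow> 'm"  (infixr "\<cdot>\<index>" 75)

definition hom :: "('o, 'm, 'x) cat_scheme \<Rightarrow> 'o \<Rightarrow> 'o \<Rightarrow> 'm set" where
  "hom C a b = {f \<in> ar C. src C f = a \<and> tgt C f = b}"

locale category =
  fixes C :: "('o, 'm, 'x) cat_scheme" (structure)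
  assumes src_ob: "f \<in> ar C \<Longrightarrow> src C f \<in> ob C"
    and tgt_ob: "f \<in> ar C \<Longrightarrow> tgt C f \<in> ob C"
    and idn_hom: "a \<in> ob C \<Longrightarrow> idn C a \<in> hom C a a"
    and cmp_hom: "f \<in> hom C a b \<Longrightarrow> g \<in> hom C b c \<Longrightarrow> g \<cdot> f \<in> hom C a c"
    and cmp_assoc: "f \<in> hom C a b \<Longrightarrow> g \<in> hom C b c \<Longrightarrow> h \<in> hom C c d \<Longrightarrow>
                      (h \<cdot> g) \<cdot> f = h \<cdot> (g \<cdot> f)"
    and cmp_idn_left: "f \<in> hom C a b \<Longrightarrow> idn C b \<cdot> f = f"
    and cmp_idn_right: "f \<in> hom C a b \<Longrightarrow> f \<cdot> idn C a = f"

definition inverse_pair :: "('o, 'm, 'x) cat_scheme \<Rightarrow> 'm \<Rightarrow> 'm \<Rightarrow> bool" where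
  "inverse_pair C f g \<longleftrightarrow> f \<in> ar C \<and> g \<in> hom C (tgt C f) (src C f) \<and>
     cmp C g f = idn C (src C f) \<and> cmp C f g = idn C (tgt C f)"

definition iso :: "('o, 'm, 'x) cat_scheme \<Rightarrow> 'o \<Rightarrow> 'o \<Rightarrow> 'm set" where
  "iso C a b = {f \<in> hom C a b. \<exists>g. inverse_pair C f g}"

definition inv_ar :: "('o, 'm, 'x) cat_scheme \<Rightarrow> 'm \<Rightarrow> 'm" where
  "inv_ar C f = (THE g. inverse_pair C f g)"

definition full_subcat :: "('o, 'm) cat \<Rightarrow> 'o set \<Rightarrow> ('o, 'm) cat" where
  "full_subcat C A = C\<lparr>ob := ob C \<inter> A, ar := {f \<in> ar C. src C f \<in> A \<and> tgt C f \<in> A}\<rparr>"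

text \<open>Functors between categories, given by an object map and an arrow map.\<close>

definition is_functor ::
  "('o, 'm, 'x) cat_scheme \<Rightarrow> ('p, 'n, 'y) cat_scheme \<Rightarrow> ('o \<Rightarrow> 'p) \<Rightarrow> ('m \<Rightarrow> 'n) \<Rightarrow> bool" where
  "is_functor C D Fo Fa \<longleftrightarrow> category C \<and> category D \<and>
     (\<forall>a\<in>ob C. Fo a \<in> ob D) \<and>
     (\<forall>f\<in>ar C. Fa f \<in> hom D (Fo (src C f)) (Fo (tgt C f))) \<and>
     (\<forall>a\<in>ob C. Fa (idn C a) = idn D (Fo a)) \<and>
     (\<forall>f\<in>ar C. \<forall>g\<in>ar C. tgt C f = src C g \<longrightarrow> Fa (cmp C g f) = cmp D (Fa g) (Fa f))"

definition naturally_isomorphic ::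
  "('o, 'm, 'x) cat_scheme \<Rightarrow> ('p, 'n, 'y) cat_scheme \<Rightarrow>
     ('o \<Rightarrow> 'p) \<Rightarrow> ('m \<Rightarrow> 'n) \<Rightarrow> ('o \<Rightarrow> 'p) \<Rightarrow> ('m \<Rightarrow> 'n) \<Rightarrow> bool" where
  "naturally_isomorphic C D Fo Fa Go Ga \<longleftrightarrow>
     (\<exists>\<tau>. (\<forall>a\<in>ob C. \<tau> a \<in> iso D (Fo a) (Go a)) \<and>
          (\<forall>f\<in>ar C. cmp D (\<tau> (tgt C f)) (Fa f) = cmp D (Ga f) (\<tau> (src C f))))"

definition is_equivalence ::
  "('o, 'm, 'x) cat_scheme \<Rightarrow> ('p, 'n, 'y) cat_scheme \<Rightarrow> ('o \<Rightarrow> 'p) \<Rightarrow> ('m \<Rightarrow> 'n) \<Rightarrow> bool" where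
  "is_equivalence C D Fo Fa \<longleftrightarrow> is_functor C D Fo Fa \<and>
     (\<exists>Go Ga. is_functor D C Go Ga \<and>
        naturally_isomorphic C C (Go \<circ> Fo) (Ga \<circ> Fa) (\<lambda>a. a) (\<lambda>f. f) \<and>
        naturally_isomorphic D D (Fo \<circ> Go) (Fa \<circ> Ga) (\<lambda>b. b) (\<lambda>g. g))"


section \<open>Strict 2-categories, pseudofunctors and biadjunctions\<close>

text \<open>The objects and arrows of \<open>vert\<close> are the 1-cells and 2-cells, composed vertically;
  \<open>\<bullet>\<close> and \<open>\<star>\<close> are the horizontal compositions of 1-cells and of 2-cells.\<close>

record ('z, 'f, 't) twocat =
  cell0 :: "'z set"
  vert :: "('f, 't) cat"
  src0 :: "'f \<Rightarrow> 'z"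
  tgt0 :: "'f \<Rightarrow> 'z"
  one :: "'z \<Rightarrow> 'f"
  hcmp1 :: "'f \<Rightarrow> 'f \<Rightarrow> 'f"  (infixr "\<bullet>\<index>" 75)
  hcmp2 :: "'t \<Rightarrow> 't \<Rightarrow> 't"  (infixr "\<star>\<index>" 75)

definition cell1 :: "('z, 'f, 't) twocat \<Rightarrow> 'z \<Rightarrow> 'z \<Rightarrow> 'f set" where
  "cell1 T X Y = {f \<in> ob (vert T). src0 T f = X \<and> tgt0 T f = Y}"

abbreviation cell2 :: "('z, 'f, 't) twocat \<Rightarrow> 'f \<Rightarrow> 'f \<Rightarrow> 't set" where
  "cell2 T \<equiv> hom (vert T)"

abbreviation invcell2 :: "('z, 'f, 't) twocat \<Rightarrow> 'f \<Rightarrow> 'f \<Rightarrow> 't set" where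
  "invcell2 T \<equiv> iso (vert T)"

abbreviation one2 :: "('z, 'f, 't) twocat \<Rightarrow> 'f \<Rightarrow> 't" where
  "one2 T \<equiv> idn (vert T)"

abbreviation vcmp :: "('z, 'f, 't) twocat \<Rightarrow> 't \<Rightarrow> 't \<Rightarrow> 't"  (infixr "\<odot>\<index>" 70) where
  "vcmp T \<equiv> cmp (vert T)"

definition homcat :: "('z, 'f, 't) twocat \<Rightarrow> 'z \<Rightarrow> 'z \<Rightarrow> ('f, 't) cat" where
  "homcat T X Y = full_subcat (vert T) (cell1 T X Y)"

locale two_category =
  fixes T :: "('z, 'f, 't) twocat" (structure)
  assumes vert_category: "category (vert T)"
    and src0_cell0: "f \<in> ob (vert T) \<Longrightarrow> src0 T f \<in> cell0 T"
    and tgt0_cell0: "f \<in> ob (vert T) \<Longrightarrow> tgt0 T f \<in> cell0 T"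
    and globular: "\<alpha> \<in> cell2 T f f' \<Longrightarrow> src0 T f = src0 T f' \<and> tgt0 T f = tgt0 T f'"
    and one_cell1: "X \<in> cell0 T \<Longrightarrow> one T X \<in> cell1 T X X"
    and hcmp1_cell1: "f \<in> cell1 T X Y \<Longrightarrow> g \<in> cell1 T Y Z \<Longrightarrow> g \<bullet> f \<in> cell1 T X Z"
    and hcmp2_cell2: "f \<in> cell1 T X Y \<Longrightarrow> g \<in> cell1 T Y Z \<Longrightarrow>
          \<alpha> \<in> cell2 T f f' \<Longrightarrow> \<beta> \<in> cell2 T g g' \<Longrightarrow> \<beta> \<star> \<alpha> \<in> cell2 T (g \<bullet> f) (g' \<bullet> f')"
    and hcmp2_one2: "f \<in> cell1 T X Y \<Longrightarrow> g \<in> cell1 T Y Z \<Longrightarrow>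
          one2 T g \<star> one2 T f = one2 T (g \<bullet> f)"
    and interchange: "f \<in> cell1 T X Y \<Longrightarrow> g \<in> cell1 T Y Z \<Longrightarrow>
          \<alpha> \<in> cell2 T f f' \<Longrightarrow> \<alpha>' \<in> cell2 T f' f'' \<Longrightarrow> \<beta> \<in> cell2 T g g' \<Longrightarrow> \<beta>' \<in> cell2 T g' g'' \<Longrightarrow>
          (\<beta>' \<odot> \<beta>) \<star> (\<alpha>' \<odot> \<alpha>) = (\<beta>' \<star> \<alpha>') \<odot> (\<beta> \<star> \<alpha>)"
    and hcmp1_assoc: "f \<in> cell1 T W X \<Longrightarrow> g \<in> cell1 T X Y \<Longrightarrow> h \<in> cell1 T Y Z \<Longrightarrow>
          (h \<bullet> g) \<bullet> f = h \<bullet> (g \<bullet> f)"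
    and hcmp2_assoc: "f \<in> cell1 T W X \<Longrightarrow> g \<in> cell1 T X Y \<Longrightarrow> h \<in> cell1 T Y Z \<Longrightarrow>
          \<alpha> \<in> cell2 T f f' \<Longrightarrow> \<beta> \<in> cell2 T g g' \<Longrightarrow> \<gamma> \<in> cell2 T h h' \<Longrightarrow>
          (\<gamma> \<star> \<beta>) \<star> \<alpha> = \<gamma> \<star> (\<beta> \<star> \<alpha>)"
    and hcmp1_one_left: "f \<in> cell1 T X Y \<Longrightarrow> one T Y \<bullet> f = f"
    and hcmp1_one_right: "f \<in> cell1 T X Y \<Longrightarrow> f \<bullet> one T X = f"
    and hcmp2_one_left: "f \<in> cell1 T X Y \<Longrightarrow> \<alpha> \<in> cell2 T f f' \<Longrightarrow> one2 T (one T Y) \<star> \<alpha> = \<alpha>"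
    and hcmp2_one_right: "f \<in> cell1 T X Y \<Longrightarrow> \<alpha> \<in> cell2 T f f' \<Longrightarrow> \<alpha> \<star> one2 T (one T X) = \<alpha>"

definition equivalence_cell1 :: "('z, 'f, 't) twocat \<Rightarrow> 'z \<Rightarrow> 'z \<Rightarrow> 'f \<Rightarrow> bool" where
  "equivalence_cell1 T X Y f \<longleftrightarrow> f \<in> cell1 T X Y \<and>
     (\<exists>g \<in> cell1 T Y X. invcell2 T (hcmp1 T g f) (one T X) \<noteq> {} \<and>
                        invcell2 T (hcmp1 T f g) (one T Y) \<noteq> {})"

definition full_sub2cat :: "('z, 'f, 't) twocat \<Rightarrow> 'z set \<Rightarrow> ('z, 'f, 't) twocat" where
  "full_sub2cat T S = T\<lparr>cell0 := cell0 T \<inter> S,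
     vert := full_subcat (vert T) {f. src0 T f \<in> S \<and> tgt0 T f \<in> S}\<rparr>"

record ('z, 'f, 't, 'z', 'f', 't') tfun =
  on0 :: "'z \<Rightarrow> 'z'"
  on1 :: "'f \<Rightarrow> 'f'"
  on2 :: "'t \<Rightarrow> 't'"

definition local_functor ::
  "('z, 'f, 't) twocat \<Rightarrow> ('z', 'f', 't') twocat \<Rightarrow> ('z, 'f, 't, 'z', 'f', 't', 'x) tfun_scheme \<Rightarrow> bool"
  where
  "local_functor S T F \<longleftrightarrow> (\<forall>X\<in>cell0 S. on0 F X \<in> cell0 T) \<and>
     (\<forall>X\<in>cell0 S. \<forall>Y\<in>cell0 S.
        is_functor (homcat S X Y) (homcat T (on0 F X) (on0 F Y)) (on1 F) (on2 F))"

locale two_functor = S: two_category S + T: two_category T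
  for S :: "('z, 'f, 't) twocat" (structure) and T :: "('z', 'f', 't') twocat" (structure) +
  fixes F :: "('z, 'f, 't, 'z', 'f', 't') tfun"
  assumes local_functor: "local_functor S T F"
    and on1_one: "X \<in> cell0 S \<Longrightarrow> on1 F (one S X) = one T (on0 F X)"
    and on1_hcmp1: "f \<in> cell1 S X Y \<Longrightarrow> g \<in> cell1 S Y Z \<Longrightarrow>
          on1 F (g \<bullet>\<^bsub>S\<^esub> f) = on1 F g \<bullet>\<^bsub>T\<^esub> on1 F f"
    and on2_hcmp2: "f \<in> cell1 S X Y \<Longrightarrow> g \<in> cell1 S Y Z \<Longrightarrow>
          \<alpha> \<in> cell2 S f f' \<Longrightarrow> \<beta> \<in> cell2 S g g' \<Longrightarrow>
          on2 F (\<beta> \<star>\<^bsub>S\<^esub> \<alpha>) = on2 F \<beta> \<star>\<^bsub>T\<^esub> on2 F \<alpha>"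

record ('z, 'f, 't, 'z', 'f', 't') pfun = "('z, 'f, 't, 'z', 'f', 't') tfun" +
  pcmp :: "'f \<Rightarrow> 'f \<Rightarrow> 't'"
  pone :: "'z \<Rightarrow> 't'"

text \<open>The constraints are \<open>pcmp F g f : F g \<bullet> F f \<Rightarrow> F (g \<bullet> f)\<close> and \<open>pone F X : 1 \<Rightarrow> F 1\<close>.\<close>

locale pseudofunctor = S: two_category S + T: two_category T
  for S :: "('z, 'f, 't) twocat" (structure) and T :: "('z', 'f', 't') twocat" (structure) +
  fixes F :: "('z, 'f, 't, 'z', 'f', 't') pfun"
  assumes local_functor: "local_functor S T F"
    and pcmp_cell: "f \<in> cell1 S X Y \<Longrightarrow> g \<in> cell1 S Y Z \<Longrightarrow>
          pcmp F g f \<in> invcell2 T (on1 F g \<bullet>\<^bsub>T\<^esub> on1 F f) (on1 F (g \<bullet>\<^bsub>S\<^esub> f))"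
    and pone_cell: "X \<in> cell0 S \<Longrightarrow>
          pone F X \<in> invcell2 T (one T (on0 F X)) (on1 F (one S X))"
    and pcmp_natural: "f \<in> cell1 S X Y \<Longrightarrow> g \<in> cell1 S Y Z \<Longrightarrow>
          \<alpha> \<in> cell2 S f f' \<Longrightarrow> \<beta> \<in> cell2 S g g' \<Longrightarrow>
          pcmp F g' f' \<odot>\<^bsub>T\<^esub> (on2 F \<beta> \<star>\<^bsub>T\<^esub> on2 F \<alpha>) = on2 F (\<beta> \<star>\<^bsub>S\<^esub> \<alpha>) \<odot>\<^bsub>T\<^esub> pcmp F g f"
    and pcmp_assoc: "f \<in> cell1 S W X \<Longrightarrow> g \<in> cell1 S X Y \<Longrightarrow> h \<in> cell1 S Y Z \<Longrightarrow>
          pcmp F (h \<bullet>\<^bsub>S\<^esub> g) f \<odot>\<^bsub>T\<^esub> (pcmp F h g \<star>\<^bsub>T\<^esub> one2 T (on1 F f))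
          = pcmp F h (g \<bullet>\<^bsub>S\<^esub> f) \<odot>\<^bsub>T\<^esub> (one2 T (on1 F h) \<star>\<^bsub>T\<^esub> pcmp F g f)"
    and pcmp_one_right: "f \<in> cell1 S X Y \<Longrightarrow>
          pcmp F f (one S X) \<odot>\<^bsub>T\<^esub> (one2 T (on1 F f) \<star>\<^bsub>T\<^esub> pone F X) = one2 T (on1 F f)"
    and pcmp_one_left: "f \<in> cell1 S X Y \<Longrightarrow>
          pcmp F (one S Y) f \<odot>\<^bsub>T\<^esub> (pone F Y \<star>\<^bsub>T\<^esub> one2 T (on1 F f)) = one2 T (on1 F f)"

text \<open>A biadjunction \<open>F \<stileturn> U\<close>: equivalences of categories
  \<open>\<Theta> X A : K(F X, A) \<rightarrow> L(X, U A)\<close>, with object part \<open>\<Theta>o\<close> and arrow part \<open>\<Theta>a\<close>, which are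
  pseudonatural in \<open>X\<close> and \<open>A\<close>.  The pseudonaturality constraint at \<open>h : X \<rightarrow> Y\<close> and
  \<open>k : A \<rightarrow> B\<close> is the natural isomorphism
  \<open>\<theta> h k u : U k \<bullet> \<Theta> Y A u \<bullet> h \<Rightarrow> \<Theta> X B (k \<bullet> u \<bullet> F h)\<close> for \<open>u : F Y \<rightarrow> A\<close>; it is natural in
  the 2-cells between \<open>h\<close>, between \<open>k\<close> and between \<open>u\<close>, and coherent for identities and
  composition, i.e. \<open>\<Theta>\<close> is a pseudonatural transformation between the pseudofunctors
  \<open>K(F -, -)\<close> and \<open>L(-, U -)\<close> on \<open>L\<^sup>o\<^sup>p \<times> K\<close>.\<close>

locale biadjunction = U: two_functor K L U + F: pseudofunctor L K F
  for K :: "('z, 'f, 't) twocat" (structure) and L :: "('z', 'f', 't') twocat" (structure)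
    and U :: "('z, 'f, 't, 'z', 'f', 't') tfun" and F :: "('z', 'f', 't', 'z, 'f, 't) pfun" +
  fixes \<Theta>o :: "'z' \<Rightarrow> 'z \<Rightarrow> 'f \<Rightarrow> 'f'" and \<Theta>a :: "'z' \<Rightarrow> 'z \<Rightarrow> 't \<Rightarrow> 't'"
    and \<theta> :: "'f' \<Rightarrow> 'f \<Rightarrow> 'f \<Rightarrow> 't'"
  assumes transpose_equivalence: "X \<in> cell0 L \<Longrightarrow> A \<in> cell0 K \<Longrightarrow>
      is_equivalence (homcat K (on0 F X) A) (homcat L X (on0 U A)) (\<Theta>o X A) (\<Theta>a X A)"
    and constraint_cell: "X \<in> cell0 L \<Longrightarrow> Y \<in> cell0 L \<Longrightarrow> h \<in> cell1 L X Y \<Longrightarrow>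
      k \<in> cell1 K A B \<Longrightarrow> u \<in> cell1 K (on0 F Y) A \<Longrightarrow>
      \<theta> h k u \<in> invcell2 L (on1 U k \<bullet>\<^bsub>L\<^esub> \<Theta>o Y A u \<bullet>\<^bsub>L\<^esub> h) (\<Theta>o X B (k \<bullet>\<^bsub>K\<^esub> u \<bullet>\<^bsub>K\<^esub> on1 F h))"
    and constraint_natural: "h \<in> cell1 L X Y \<Longrightarrow> k \<in> cell1 K A B \<Longrightarrow> u \<in> cell1 K (on0 F Y) A \<Longrightarrow>
      \<alpha> \<in> cell2 L h h' \<Longrightarrow> \<beta> \<in> cell2 K k k' \<Longrightarrow> \<mu> \<in> cell2 K u u' \<Longrightarrow>
      \<theta> h' k' u' \<odot>\<^bsub>L\<^esub> (on2 U \<beta> \<star>\<^bsub>L\<^esub> \<Theta>a Y A \<mu> \<star>\<^bsub>L\<^esub> \<alpha>)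
      = \<Theta>a X B (\<beta> \<star>\<^bsub>K\<^esub> \<mu> \<star>\<^bsub>K\<^esub> on2 F \<alpha>) \<odot>\<^bsub>L\<^esub> \<theta> h k u"
    and constraint_one: "X \<in> cell0 L \<Longrightarrow> A \<in> cell0 K \<Longrightarrow> u \<in> cell1 K (on0 F X) A \<Longrightarrow>
      \<theta> (one L X) (one K A) u = \<Theta>a X A (one2 K u \<star>\<^bsub>K\<^esub> pone F X)"
    and constraint_hcmp: "h' \<in> cell1 L W X \<Longrightarrow> h \<in> cell1 L X Y \<Longrightarrow>
      k \<in> cell1 K A B \<Longrightarrow> k' \<in> cell1 K B D \<Longrightarrow> u \<in> cell1 K (on0 F Y) A \<Longrightarrow>
      \<theta> (h \<bullet>\<^bsub>L\<^esub> h') (k' \<bullet>\<^bsub>K\<^esub> k) u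
      = \<Theta>a W D (one2 K (k' \<bullet>\<^bsub>K\<^esub> k \<bullet>\<^bsub>K\<^esub> u) \<star>\<^bsub>K\<^esub> pcmp F h h')
        \<odot>\<^bsub>L\<^esub> \<theta> h' k' (k \<bullet>\<^bsub>K\<^esub> u \<bullet>\<^bsub>K\<^esub> on1 F h)
        \<odot>\<^bsub>L\<^esub> (one2 L (on1 U k') \<star>\<^bsub>L\<^esub> \<theta> h k u \<star>\<^bsub>L\<^esub> one2 L h')"

text \<open>\<open>U\<close> has a left biadjoint with values \<open>F0\<close> on objects, and the unit of the biadjunction
  (the transpose of the identity) has components \<open>\<eta>\<close>.\<close>

definition has_left_biadjoint ::
  "('z, 'f, 't) twocat \<Rightarrow> ('z', 'f', 't') twocat \<Rightarrow> ('z, 'f, 't, 'z', 'f', 't') tfun \<Rightarrow>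
   ('z' \<Rightarrow> 'z) \<Rightarrow> ('z' \<Rightarrow> 'f') \<Rightarrow> bool" where
  "has_left_biadjoint K L U F0 \<eta> \<longleftrightarrow>
     (\<exists>F \<Theta>o \<Theta>a \<theta>. biadjunction K L U F \<Theta>o \<Theta>a \<theta> \<and>
        (\<forall>X\<in>cell0 L. on0 F X = F0 X \<and> \<Theta>o X (on0 F X) (one K (on0 F X)) = \<eta> X))"


section \<open>Monoidal categories with a distinguished object\<close>

record ('o, 'm) moncat = "('o, 'm) cat" +
  tob :: "'o \<Rightarrow> 'o \<Rightarrow> 'o"  (infixr "\<otimes>\<index>" 80)
  tar :: "'m \<Rightarrow> 'm \<Rightarrow> 'm"  (infixr "\<otimes>\<^sub>a\<index>" 80)
  unit :: 'o
  asc :: "'o \<Rightarrow> 'o \<Rightarrow> 'o \<Rightarrow> 'm"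
  lun :: "'o \<Rightarrow> 'm"
  run :: "'o \<Rightarrow> 'm"

locale monoidal_category = category C
  for C :: "('o, 'm, 'x) moncat_scheme" (structure) +
  assumes unit_ob: "unit C \<in> ob C"
    and tob_ob: "a \<in> ob C \<Longrightarrow> b \<in> ob C \<Longrightarrow> a \<otimes> b \<in> ob C"
    and tar_hom: "f \<in> hom C a b \<Longrightarrow> g \<in> hom C c d \<Longrightarrow> f \<otimes>\<^sub>a g \<in> hom C (a \<otimes> c) (b \<otimes> d)"
    and tar_idn: "a \<in> ob C \<Longrightarrow> b \<in> ob C \<Longrightarrow> idn C a \<otimes>\<^sub>a idn C b = idn C (a \<otimes> b)"
    and tar_cmp: "f \<in> hom C a b \<Longrightarrow> f' \<in> hom C b c \<Longrightarrow> g \<in> hom C a' b' \<Longrightarrow> g' \<in> hom C b' c' \<Longrightarrow>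
          (f' \<cdot> f) \<otimes>\<^sub>a (g' \<cdot> g) = (f' \<otimes>\<^sub>a g') \<cdot> (f \<otimes>\<^sub>a g)"
    and asc_iso: "a \<in> ob C \<Longrightarrow> b \<in> ob C \<Longrightarrow> c \<in> ob C \<Longrightarrow>
          asc C a b c \<in> iso C ((a \<otimes> b) \<otimes> c) (a \<otimes> (b \<otimes> c))"
    and lun_iso: "a \<in> ob C \<Longrightarrow> lun C a \<in> iso C (unit C \<otimes> a) a"
    and run_iso: "a \<in> ob C \<Longrightarrow> run C a \<in> iso C (a \<otimes> unit C) a"
    and asc_natural: "f \<in> hom C a a' \<Longrightarrow> g \<in> hom C b b' \<Longrightarrow> h \<in> hom C c c' \<Longrightarrow>
          asc C a' b' c' \<cdot> ((f \<otimes>\<^sub>a g) \<otimes>\<^sub>a h) = (f \<otimes>\<^sub>a (g \<otimes>\<^sub>a h)) \<cdot> asc C a b c"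
    and lun_natural: "f \<in> hom C a b \<Longrightarrow> lun C b \<cdot> (idn C (unit C) \<otimes>\<^sub>a f) = f \<cdot> lun C a"
    and run_natural: "f \<in> hom C a b \<Longrightarrow> run C b \<cdot> (f \<otimes>\<^sub>a idn C (unit C)) = f \<cdot> run C a"
    and pentagon: "a \<in> ob C \<Longrightarrow> b \<in> ob C \<Longrightarrow> c \<in> ob C \<Longrightarrow> d \<in> ob C \<Longrightarrow>
          asc C a b (c \<otimes> d) \<cdot> asc C (a \<otimes> b) c d
          = (idn C a \<otimes>\<^sub>a asc C b c d) \<cdot> asc C a (b \<otimes> c) d \<cdot> (asc C a b c \<otimes>\<^sub>a idn C d)"
    and triangle: "a \<in> ob C \<Longrightarrow> b \<in> ob C \<Longrightarrow>
          (idn C a \<otimes>\<^sub>a lun C b) \<cdot> asc C a (unit C) b = run C a \<otimes>\<^sub>a idn C b"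

locale strict_monoidal_category = monoidal_category C
  for C :: "('o, 'm, 'x) moncat_scheme" (structure) +
  assumes tob_assoc: "a \<in> ob C \<Longrightarrow> b \<in> ob C \<Longrightarrow> c \<in> ob C \<Longrightarrow> (a \<otimes> b) \<otimes> c = a \<otimes> (b \<otimes> c)"
    and tob_unit_left: "a \<in> ob C \<Longrightarrow> unit C \<otimes> a = a"
    and tob_unit_right: "a \<in> ob C \<Longrightarrow> a \<otimes> unit C = a"
    and asc_idn: "a \<in> ob C \<Longrightarrow> b \<in> ob C \<Longrightarrow> c \<in> ob C \<Longrightarrow> asc C a b c = idn C (a \<otimes> b \<otimes> c)"
    and lun_idn: "a \<in> ob C \<Longrightarrow> lun C a = idn C a"
    and run_idn: "a \<in> ob C \<Longrightarrow> run C a = idn C a"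

text \<open>The triangle equations of a dual pair, with the coherence isomorphisms written out.\<close>

definition is_right_dual ::
  "('o, 'm, 'x) moncat_scheme \<Rightarrow> 'o \<Rightarrow> 'o \<Rightarrow> 'm \<Rightarrow> 'm \<Rightarrow> bool" where
  "is_right_dual C x y e n \<longleftrightarrow> x \<in> ob C \<and> y \<in> ob C \<and>
     e \<in> hom C (x \<otimes>\<^bsub>C\<^esub> y) (unit C) \<and> n \<in> hom C (unit C) (y \<otimes>\<^bsub>C\<^esub> x) \<and>
     lun C x \<cdot>\<^bsub>C\<^esub> (e \<otimes>\<^sub>a\<^bsub>C\<^esub> idn C x) \<cdot>\<^bsub>C\<^esub> inv_ar C (asc C x y x) \<cdot>\<^bsub>C\<^esub> (idn C x \<otimes>\<^sub>a\<^bsub>C\<^esub> n)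
       \<cdot>\<^bsub>C\<^esub> inv_ar C (run C x) = idn C x \<and>
     run C y \<cdot>\<^bsub>C\<^esub> (idn C y \<otimes>\<^sub>a\<^bsub>C\<^esub> e) \<cdot>\<^bsub>C\<^esub> asc C y x y \<cdot>\<^bsub>C\<^esub> (n \<otimes>\<^sub>a\<^bsub>C\<^esub> idn C y)
       \<cdot>\<^bsub>C\<^esub> inv_ar C (lun C y) = idn C y"

definition has_right_dual :: "('o, 'm, 'x) moncat_scheme \<Rightarrow> 'o \<Rightarrow> bool" where
  "has_right_dual C x \<longleftrightarrow> (\<exists>y e n. is_right_dual C x y e n)"

record ('o, 'm) pmoncat = "('o, 'm) moncat" +
  pt :: 'o

text \<open>1-cells: \<open>fmul F a b : F a \<otimes> F b \<rightarrow> F (a \<otimes> b)\<close>, \<open>funit F : I \<rightarrow> F I\<close>, \<open>fpt F : F J \<rightarrow> J'\<close>.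
  Functions are \<open>undefined\<close> outside their domains, so that equality of 1-cells (and, below, of
  2-cells) is the intended one.\<close>

record ('o, 'm, 'p, 'n) pmonfun =
  fdom :: "('o, 'm) pmoncat"
  fcod :: "('p, 'n) pmoncat"
  fob :: "'o \<Rightarrow> 'p"
  far :: "'m \<Rightarrow> 'n"
  fmul :: "'o \<Rightarrow> 'o \<Rightarrow> 'n"
  funit :: 'n
  fpt :: 'n

locale pointed_monoidal_category = monoidal_category C
  for C :: "('o, 'm) pmoncat" (structure) +
  assumes pt_ob: "pt C \<in> ob C"

locale pointed_monoidal_functor =
  C: pointed_monoidal_category C + D: pointed_monoidal_category D
  for C :: "('o, 'm) pmoncat" (structure) and D :: "('p, 'n) pmoncat" (structure) +
  fixes F :: "('o, 'm, 'p, 'n) pmonfun"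
  assumes fdom: "fdom F = C"
    and fcod: "fcod F = D"
    and is_functor: "is_functor C D (fob F) (far F)"
    and fmul_iso: "a \<in> ob C \<Longrightarrow> b \<in> ob C \<Longrightarrow>
          fmul F a b \<in> iso D (fob F a \<otimes>\<^bsub>D\<^esub> fob F b) (fob F (a \<otimes>\<^bsub>C\<^esub> b))"
    and funit_iso: "funit F \<in> iso D (unit D) (fob F (unit C))"
    and fmul_natural: "f \<in> hom C a a' \<Longrightarrow> g \<in> hom C b b' \<Longrightarrow>
          fmul F a' b' \<cdot>\<^bsub>D\<^esub> (far F f \<otimes>\<^sub>a\<^bsub>D\<^esub> far F g) = far F (f \<otimes>\<^sub>a\<^bsub>C\<^esub> g) \<cdot>\<^bsub>D\<^esub> fmul F a b"
    and fmul_assoc: "a \<in> ob C \<Longrightarrow> b \<in> ob C \<Longrightarrow> c \<in> ob C \<Longrightarrow>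
          far F (asc C a b c) \<cdot>\<^bsub>D\<^esub> fmul F (a \<otimes>\<^bsub>C\<^esub> b) c \<cdot>\<^bsub>D\<^esub> (fmul F a b \<otimes>\<^sub>a\<^bsub>D\<^esub> idn D (fob F c))
          = fmul F a (b \<otimes>\<^bsub>C\<^esub> c) \<cdot>\<^bsub>D\<^esub> (idn D (fob F a) \<otimes>\<^sub>a\<^bsub>D\<^esub> fmul F b c)
            \<cdot>\<^bsub>D\<^esub> asc D (fob F a) (fob F b) (fob F c)"
    and fmul_lun: "a \<in> ob C \<Longrightarrow>
          far F (lun C a) \<cdot>\<^bsub>D\<^esub> fmul F (unit C) a \<cdot>\<^bsub>D\<^esub> (funit F \<otimes>\<^sub>a\<^bsub>D\<^esub> idn D (fob F a))
          = lun D (fob F a)"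
    and fmul_run: "a \<in> ob C \<Longrightarrow>
          far F (run C a) \<cdot>\<^bsub>D\<^esub> fmul F a (unit C) \<cdot>\<^bsub>D\<^esub> (idn D (fob F a) \<otimes>\<^sub>a\<^bsub>D\<^esub> funit F)
          = run D (fob F a)"
    and fpt_iso: "fpt F \<in> iso D (fob F (pt C)) (pt D)"
    and fob_extensional: "fob F \<in> extensional (ob C)"
    and far_extensional: "far F \<in> extensional (ar C)"
    and fmul_extensional: "fmul F \<in> extensional (ob C)"
    and fmul_extensional': "a \<in> ob C \<Longrightarrow> fmul F a \<in> extensional (ob C)"

record ('o, 'm, 'p, 'n) pmonnat =
  ndom :: "('o, 'm, 'p, 'n) pmonfun"
  ncod :: "('o, 'm, 'p, 'n) pmonfun"
  ncmp :: "'o \<Rightarrow> 'n"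

locale pointed_monoidal_transformation =
  F: pointed_monoidal_functor C D F + G: pointed_monoidal_functor C D G
  for C :: "('o, 'm) pmoncat" (structure) and D :: "('p, 'n) pmoncat" (structure)
    and F :: "('o, 'm, 'p, 'n) pmonfun" and G :: "('o, 'm, 'p, 'n) pmonfun" +
  fixes \<sigma> :: "('o, 'm, 'p, 'n) pmonnat"
  assumes ndom: "ndom \<sigma> = F"
    and ncod: "ncod \<sigma> = G"
    and ncmp_hom: "a \<in> ob C \<Longrightarrow> ncmp \<sigma> a \<in> hom D (fob F a) (fob G a)"
    and ncmp_natural: "f \<in> hom C a b \<Longrightarrow>
          ncmp \<sigma> b \<cdot>\<^bsub>D\<^esub> far F f = far G f \<cdot>\<^bsub>D\<^esub> ncmp \<sigma> a"
    and ncmp_fmul: "a \<in> ob C \<Longrightarrow> b \<in> ob C \<Longrightarrow>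
          ncmp \<sigma> (a \<otimes>\<^bsub>C\<^esub> b) \<cdot>\<^bsub>D\<^esub> fmul F a b = fmul G a b \<cdot>\<^bsub>D\<^esub> (ncmp \<sigma> a \<otimes>\<^sub>a\<^bsub>D\<^esub> ncmp \<sigma> b)"
    and ncmp_funit: "ncmp \<sigma> (unit C) \<cdot>\<^bsub>D\<^esub> funit F = funit G"
    and ncmp_fpt: "fpt G \<cdot>\<^bsub>D\<^esub> ncmp \<sigma> (pt C) = fpt F"
    and ncmp_extensional: "ncmp \<sigma> \<in> extensional (ob C)"

definition id_pmonfun :: "('o, 'm) pmoncat \<Rightarrow> ('o, 'm, 'o, 'm) pmonfun" where
  "id_pmonfun C = \<lparr>fdom = C, fcod = C,
     fob = (\<lambda>a\<in>ob C. a), far = (\<lambda>f\<in>ar C. f),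
     fmul = (\<lambda>a\<in>ob C. \<lambda>b\<in>ob C. idn C (a \<otimes>\<^bsub>C\<^esub> b)), funit = idn C (unit C), fpt = idn C (pt C)\<rparr>"

definition comp_pmonfun ::
  "('p, 'n, 'q, 'k) pmonfun \<Rightarrow> ('o, 'm, 'p, 'n) pmonfun \<Rightarrow> ('o, 'm, 'q, 'k) pmonfun" where
  "comp_pmonfun G F = (let C = fdom F; E = fcod G in
     \<lparr>fdom = C, fcod = E,
      fob = (\<lambda>a\<in>ob C. fob G (fob F a)), far = (\<lambda>f\<in>ar C. far G (far F f)),
      fmul = (\<lambda>a\<in>ob C. \<lambda>b\<in>ob C. far G (fmul F a b) \<cdot>\<^bsub>E\<^esub> fmul G (fob F a) (fob F b)),
      funit = far G (funit F) \<cdot>\<^bsub>E\<^esub> funit G,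
      fpt = fpt G \<cdot>\<^bsub>E\<^esub> far G (fpt F)\<rparr>)"

definition pmoncat_vert :: "(('o, 'm, 'p, 'n) pmonfun, ('o, 'm, 'p, 'n) pmonnat) cat" where
  "pmoncat_vert =
     \<lparr>ob = {F. pointed_monoidal_functor (fdom F) (fcod F) F},
      ar = {\<sigma>. pointed_monoidal_transformation (fdom (ndom \<sigma>)) (fcod (ndom \<sigma>))
                   (ndom \<sigma>) (ncod \<sigma>) \<sigma>},
      src = ndom, tgt = ncod,
      idn = (\<lambda>F. \<lparr>ndom = F, ncod = F, ncmp = (\<lambda>a\<in>ob (fdom F). idn (fcod F) (fob F a))\<rparr>),
      cmp = (\<lambda>\<tau> \<sigma>. \<lparr>ndom = ndom \<sigma>, ncod = ncod \<tau>,
               ncmp = (\<lambda>a\<in>ob (fdom (ndom \<sigma>)). ncmp \<tau> a \<cdot>\<^bsub>fcod (ndom \<sigma>)\<^esub> ncmp \<sigma> a)\<rparr>)\<rparr>"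

definition hcomp_pmonnat ::
  "('p, 'n, 'q, 'k) pmonnat \<Rightarrow> ('o, 'm, 'p, 'n) pmonnat \<Rightarrow> ('o, 'm, 'q, 'k) pmonnat" where
  "hcomp_pmonnat \<tau> \<sigma> =
     \<lparr>ndom = comp_pmonfun (ndom \<tau>) (ndom \<sigma>), ncod = comp_pmonfun (ncod \<tau>) (ncod \<sigma>),
      ncmp = (\<lambda>a\<in>ob (fdom (ndom \<sigma>)).
        ncmp \<tau> (fob (ncod \<sigma>) a) \<cdot>\<^bsub>fcod (ndom \<tau>)\<^esub> far (ndom \<tau>) (ncmp \<sigma> a))\<rparr>"

text \<open>The type \<open>'u\<close> plays the role of the universe of sets over which (small) monoidal categories
  are formed: the 0-cells are the monoidal categories whose objects and arrows are elements
  of \<open>'u\<close>.\<close>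

type_synonym 'u pmc = "('u, 'u) pmoncat"
type_synonym 'u pmf = "('u, 'u, 'u, 'u) pmonfun"
type_synonym 'u pmn = "('u, 'u, 'u, 'u) pmonnat"

definition JJ :: "('u pmc, 'u pmf, 'u pmn) twocat" where
  "JJ = \<lparr>cell0 = {C. pointed_monoidal_category C},
         vert = pmoncat_vert, src0 = fdom, tgt0 = fcod,
         one = id_pmonfun, hcmp1 = comp_pmonfun, hcmp2 = hcomp_pmonnat\<rparr>"

definition JJ_dual :: "('u pmc, 'u pmf, 'u pmn) twocat" where
  "JJ_dual = full_sub2cat JJ {C. has_right_dual C (pt C)}"

definition inclusion :: "('z, 'f, 't, 'z, 'f, 't) tfun" where
  "inclusion = \<lparr>on0 = (\<lambda>X. X), on1 = (\<lambda>f. f), on2 = (\<lambda>\<alpha>. \<alpha>)\<rparr>"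

text \<open>A choice, for every 0-cell \<open>X\<close>, of an equivalent strict one \<open>S X\<close> with an equivalence
  \<open>E X : X \<rightarrow> S X\<close>.\<close>

definition strictification :: "('u pmc \<Rightarrow> 'u pmc) \<Rightarrow> ('u pmc \<Rightarrow> 'u pmf) \<Rightarrow> bool" where
  "strictification S E \<longleftrightarrow> (\<forall>X\<in>cell0 JJ. S X \<in> cell0 JJ \<and> strict_monoidal_category (S X) \<and>
     equivalence_cell1 JJ X (S X) (E X))"


section \<open>Adjoining a right dual to the distinguished object\<close>

text \<open>\<open>C\<close> is strict throughout.  A function \<open>[m] \<rightarrow> ob C\<close> is a list of length \<open>m + 1\<close>.\<close>

definition words :: "('o, 'm) pmoncat \<Rightarrow> 'o list set" where
  "words C = {U. U \<noteq> [] \<and> set U \<subseteq> ob C}"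

definition wtensor :: "('o, 'm) pmoncat \<Rightarrow> 'o list \<Rightarrow> 'o list \<Rightarrow> 'o list"  (infixr "\<otimes>\<^sub>w\<index>" 80) where
  "U \<otimes>\<^sub>w\<^bsub>C\<^esub> V = butlast U @ [last U \<otimes>\<^bsub>C\<^esub> hd V] @ tl V"

definition wunit :: "('o, 'm) pmoncat \<Rightarrow> 'o list" where
  "wunit C = [unit C]"

definition jdual :: "('o, 'm) pmoncat \<Rightarrow> 'o list" where
  "jdual C = [unit C, unit C]"

datatype 'm prim = Counit | Unit | Bar 'm

fun prim_src :: "('o, 'm) pmoncat \<Rightarrow> 'm prim \<Rightarrow> 'o list" where
  "prim_src C Counit = [pt C] \<otimes>\<^sub>w\<^bsub>C\<^esub> jdual C"
| "prim_src C Unit = wunit C"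
| "prim_src C (Bar f) = [src C f]"

fun prim_tgt :: "('o, 'm) pmoncat \<Rightarrow> 'm prim \<Rightarrow> 'o list" where
  "prim_tgt C Counit = wunit C"
| "prim_tgt C Unit = jdual C \<otimes>\<^sub>w\<^bsub>C\<^esub> [pt C]"
| "prim_tgt C (Bar f) = [tgt C f]"

text \<open>The edge \<open>U \<otimes> p \<otimes> V\<close> is the triple \<open>(U, p, V)\<close>; the primitive edge \<open>p\<close> is
  \<open>(wunit C, p, wunit C)\<close>.\<close>

type_synonym ('o, 'm) edge = "'o list \<times> 'm prim \<times> 'o list"

definition edges :: "('o, 'm) pmoncat \<Rightarrow> ('o, 'm) edge set" where
  "edges C = words C \<times> {p. \<forall>f. p = Bar f \<longrightarrow> f \<in> ar C} \<times> words C"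

fun edge_src :: "('o, 'm) pmoncat \<Rightarrow> ('o, 'm) edge \<Rightarrow> 'o list" where
  "edge_src C (U, p, V) = U \<otimes>\<^sub>w\<^bsub>C\<^esub> prim_src C p \<otimes>\<^sub>w\<^bsub>C\<^esub> V"

fun edge_tgt :: "('o, 'm) pmoncat \<Rightarrow> ('o, 'm) edge \<Rightarrow> 'o list" where
  "edge_tgt C (U, p, V) = U \<otimes>\<^sub>w\<^bsub>C\<^esub> prim_tgt C p \<otimes>\<^sub>w\<^bsub>C\<^esub> V"

definition prim_edge :: "('o, 'm) pmoncat \<Rightarrow> 'm prim \<Rightarrow> ('o, 'm) edge" where
  "prim_edge C p = (wunit C, p, wunit C)"

fun whisker_edge :: "('o, 'm) pmoncat \<Rightarrow> 'o list \<Rightarrow> ('o, 'm) edge \<Rightarrow> 'o list \<Rightarrow> ('o, 'm) edge" where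
  "whisker_edge C T (U, p, V) W = (T \<otimes>\<^sub>w\<^bsub>C\<^esub> U, p, V \<otimes>\<^sub>w\<^bsub>C\<^esub> W)"

text \<open>A path is its source together with the list of its edges in the order in which they are
  traversed, so the composite of \<open>p\<close> followed by \<open>q\<close> concatenates the edges of \<open>p\<close> and \<open>q\<close>.\<close>

type_synonym ('o, 'm) path = "'o list \<times> ('o, 'm) edge list"

fun is_chain :: "('o, 'm) pmoncat \<Rightarrow> 'o list \<Rightarrow> ('o, 'm) edge list \<Rightarrow> bool" where
  "is_chain C U [] \<longleftrightarrow> U \<in> words C"
| "is_chain C U (e # es) \<longleftrightarrow> e \<in> edges C \<and> edge_src C e = U \<and> is_chain C (edge_tgt C e) es"

definition paths :: "('o, 'm) pmoncat \<Rightarrow> ('o, 'm) path set" where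
  "paths C = {(U, es). is_chain C U es}"

fun path_src :: "('o, 'm) path \<Rightarrow> 'o list" where
  "path_src (U, es) = U"

fun path_tgt :: "('o, 'm) pmoncat \<Rightarrow> ('o, 'm) path \<Rightarrow> 'o list" where
  "path_tgt C (U, es) = (if es = [] then U else edge_tgt C (last es))"

fun path_comp :: "('o, 'm) path \<Rightarrow> ('o, 'm) path \<Rightarrow> ('o, 'm) path" where
  "path_comp (V, fs) (U, es) = (U, es @ fs)"

fun whisker_path :: "('o, 'm) pmoncat \<Rightarrow> 'o list \<Rightarrow> ('o, 'm) path \<Rightarrow> 'o list \<Rightarrow> ('o, 'm) path" where
  "whisker_path C T (U, es) W = (T \<otimes>\<^sub>w\<^bsub>C\<^esub> U \<otimes>\<^sub>w\<^bsub>C\<^esub> W, map (\<lambda>e. whisker_edge C T e W) es)"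

definition empty_path :: "'o list \<Rightarrow> ('o, 'm) path" where
  "empty_path U = (U, [])"

definition edge_path :: "('o, 'm) pmoncat \<Rightarrow> ('o, 'm) edge \<Rightarrow> ('o, 'm) path" where
  "edge_path C e = (edge_src C e, [e])"

definition bar :: "('o, 'm) pmoncat \<Rightarrow> 'm \<Rightarrow> ('o, 'm) path" where
  "bar C f = edge_path C (prim_edge C (Bar f))"

inductive relator :: "('o, 'm) pmoncat \<Rightarrow> ('o, 'm) path \<Rightarrow> ('o, 'm) path \<Rightarrow> bool"
  for C :: "('o, 'm) pmoncat" where
  bar_tensor: "x \<in> ob C \<Longrightarrow> y \<in> ob C \<Longrightarrow> f \<in> ar C \<Longrightarrow>
    relator C (bar C (idn C x \<otimes>\<^sub>a\<^bsub>C\<^esub> f \<otimes>\<^sub>a\<^bsub>C\<^esub> idn C y)) (whisker_path C [x] (bar C f) [y])"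
| bar_idn: "x \<in> ob C \<Longrightarrow> relator C (bar C (idn C x)) (empty_path [x])"
| bar_cmp: "f \<in> hom C x y \<Longrightarrow> g \<in> hom C y z \<Longrightarrow>
    relator C (bar C (g \<cdot>\<^bsub>C\<^esub> f)) (path_comp (bar C g) (bar C f))"
| exchange: "a \<in> edges C \<Longrightarrow> b \<in> edges C \<Longrightarrow>
    edge_src C a = U \<Longrightarrow> edge_tgt C a = V \<Longrightarrow> edge_src C b = W \<Longrightarrow> edge_tgt C b = X \<Longrightarrow>
    relator C
      (path_comp (edge_path C (whisker_edge C V b (wunit C)))
                 (edge_path C (whisker_edge C (wunit C) a W)))
      (path_comp (edge_path C (whisker_edge C (wunit C) a X))
                 (edge_path C (whisker_edge C U b (wunit C))))"
| triangle_J: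
    "relator C
      (path_comp (edge_path C (whisker_edge C (wunit C) (prim_edge C Counit) [pt C]))
                 (edge_path C (whisker_edge C [pt C] (prim_edge C Unit) (wunit C))))
      (empty_path [pt C])"
| triangle_jdual:
    "relator C
      (path_comp (edge_path C (whisker_edge C (jdual C) (prim_edge C Counit) (wunit C)))
                 (edge_path C (whisker_edge C (wunit C) (prim_edge C Unit) (jdual C))))
      (empty_path (jdual C))"
| whisker: "relator C l l' \<Longrightarrow> Y \<in> words C \<Longrightarrow> Z \<in> words C \<Longrightarrow>
    relator C (whisker_path C Y l Z) (whisker_path C Y l' Z)"

inductive congr :: "('o, 'm) pmoncat \<Rightarrow> ('o, 'm) path \<Rightarrow> ('o, 'm) path \<Rightarrow> bool"
  for C :: "('o, 'm) pmoncat" where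
  relator: "relator C p q \<Longrightarrow> congr C p q"
| refl: "p \<in> paths C \<Longrightarrow> congr C p p"
| sym: "congr C p q \<Longrightarrow> congr C q p"
| trans: "congr C p q \<Longrightarrow> congr C q r \<Longrightarrow> congr C p r"
| comp: "congr C p p' \<Longrightarrow> congr C q q' \<Longrightarrow> path_tgt C p = path_src q \<Longrightarrow>
    congr C (path_comp q p) (path_comp q' p')"

definition path_class :: "('o, 'm) pmoncat \<Rightarrow> ('o, 'm) path \<Rightarrow> ('o, 'm) path set" where
  "path_class C p = {q. congr C p q}"

definition rep :: "('o, 'm) path set \<Rightarrow> ('o, 'm) path" where
  "rep c = (SOME p. p \<in> c)"

text \<open>For \<open>p : U \<rightarrow> V\<close> and \<open>q : W \<rightarrow> X\<close> this is \<open>(V \<otimes> q)(p \<otimes> W)\<close>.\<close>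

definition path_tensor :: "('o, 'm) pmoncat \<Rightarrow> ('o, 'm) path \<Rightarrow> ('o, 'm) path \<Rightarrow> ('o, 'm) path" where
  "path_tensor C p q = path_comp (whisker_path C (path_tgt C p) q (wunit C))
                                 (whisker_path C (wunit C) p (path_src q))"

definition adjoin_dual :: "('o, 'm) pmoncat \<Rightarrow> ('o list, ('o, 'm) path set) pmoncat" where
  "adjoin_dual C =
     \<lparr>ob = words C,
      ar = path_class C ` paths C,
      src = (\<lambda>c. path_src (rep c)),
      tgt = (\<lambda>c. path_tgt C (rep c)),
      idn = (\<lambda>U. path_class C (empty_path U)),
      cmp = (\<lambda>d c. path_class C (path_comp (rep d) (rep c))),
      tob = wtensor C,
      tar = (\<lambda>c d. path_class C (path_tensor C (rep c) (rep d))),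
      unit = wunit C,
      asc = (\<lambda>U V W. path_class C (empty_path (U \<otimes>\<^sub>w\<^bsub>C\<^esub> V \<otimes>\<^sub>w\<^bsub>C\<^esub> W))),
      lun = (\<lambda>U. path_class C (empty_path U)),
      run = (\<lambda>U. path_class C (empty_path U)),
      pt = [pt C]\<rparr>"

definition Omega ::
  "('o, 'm) pmoncat \<Rightarrow> ('o, 'm, 'o list, ('o, 'm) path set) pmonfun" where
  "Omega C = \<lparr>fdom = C, fcod = adjoin_dual C,
     fob = (\<lambda>a\<in>ob C. [a]),
     far = (\<lambda>f\<in>ar C. path_class C (bar C f)),
     fmul = (\<lambda>a\<in>ob C. \<lambda>b\<in>ob C. idn (adjoin_dual C) [a \<otimes>\<^bsub>C\<^esub> b]),
     funit = idn (adjoin_dual C) (wunit C),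
     fpt = idn (adjoin_dual C) [pt C]\<rparr>"


section \<open>Renaming objects and arrows\<close>

text \<open>The objects and arrows of \<open>adjoin_dual C\<close> do not belong to the type \<open>'u\<close> of the
  objects and arrows of \<open>C\<close>.  If \<open>'u\<close> is infinite, they can be injected into \<open>'u\<close>, and
  \<open>adjoin_dual C\<close> is regarded as a category over \<open>'u\<close> by renaming along these injections.\<close>

definition rename :: "('o \<Rightarrow> 'p) \<Rightarrow> ('m \<Rightarrow> 'n) \<Rightarrow> ('o, 'm) pmoncat \<Rightarrow> ('p, 'n) pmoncat" where
  "rename i j C = (let i' = inv_into (ob C) i; j' = inv_into (ar C) j in
     \<lparr>ob = i ` ob C, ar = j ` ar C,
      src = (\<lambda>f. i (src C (j' f))),
      tgt = (\<lambda>f. i (tgt C (j' f))),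
      idn = (\<lambda>a. j (idn C (i' a))),
      cmp = (\<lambda>g f. j (j' g \<cdot>\<^bsub>C\<^esub> j' f)),
      tob = (\<lambda>a b. i (i' a \<otimes>\<^bsub>C\<^esub> i' b)),
      tar = (\<lambda>f g. j (j' f \<otimes>\<^sub>a\<^bsub>C\<^esub> j' g)),
      unit = i (unit C),
      asc = (\<lambda>a b c. j (asc C (i' a) (i' b) (i' c))),
      lun = (\<lambda>a. j (lun C (i' a))),
      run = (\<lambda>a. j (run C (i' a))),
      pt = i (pt C)\<rparr>)"

definition rename_cod ::
  "('p \<Rightarrow> 'q) \<Rightarrow> ('n \<Rightarrow> 'k) \<Rightarrow> ('o, 'm, 'p, 'n) pmonfun \<Rightarrow> ('o, 'm, 'q, 'k) pmonfun" where
  "rename_cod i j F = \<lparr>fdom = fdom F, fcod = rename i j (fcod F),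
     fob = (\<lambda>a\<in>ob (fdom F). i (fob F a)),
     far = (\<lambda>f\<in>ar (fdom F). j (far F f)),
     fmul = (\<lambda>a\<in>ob (fdom F). \<lambda>b\<in>ob (fdom F). j (fmul F a b)),
     funit = j (funit F),
     fpt = j (fpt F)\<rparr>"

definition injection :: "'a set \<Rightarrow> 'a \<Rightarrow> 'b" where
  "injection A = (SOME i. inj_on i A)"

text \<open>The injections exist:\<close>

lemma ex_inj_list: "\<exists>l :: 'u::infinite list \<Rightarrow> 'u. inj l"
proof -
  obtain p :: "'u \<times> 'u \<Rightarrow> 'u" where p: "inj p"
    using card_of_Times_same_infinite[OF infinite_UNIV[where 'a = 'u]]
    by (metis UNIV_Times_UNIV bij_betw_imp_inj_on card_of_ordIso)
  obtain n :: "nat \<Rightarrow> 'u" where n: "inj n"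
    using arb_countable_map[of "{}"] by auto
  define c where "c = rec_list undefined (\<lambda>x (_::'u list) y. p (x, y))"
  have c: "c (x # xs) = p (x, c xs)" for x xs by (simp add: c_def)
  have "xs = ys" if "length xs = length ys" "c xs = c ys" for xs ys
    using that
    by (induction xs ys rule: list_induct2) (auto simp: c dest: injD[OF p])
  then have "inj (\<lambda>xs. p (n (length xs), c xs))"
    by (intro injI) (metis injD n p prod.inject)
  then show ?thesis by blast
qed

lemma ex_inj_path: "\<exists>l :: ('u::infinite, 'u) path \<Rightarrow> 'u. inj l"
proof -
  obtain l :: "'u list \<Rightarrow> 'u" where l: "inj l" using ex_inj_list by blast
  obtain a b :: 'u where ab: "a \<noteq> b" by (metis arb_element finite.emptyI finite.insertI insertI1)
  define pe where "pe = case_prim [] [a] (\<lambda>f :: 'u. [a, f])"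
  have pe: "inj pe" by (auto simp: inj_def pe_def split: prim.split)
  define e where "e = (\<lambda>(U, q, V). l [l U, l (pe q), l V])"
  have e: "inj e" by (auto simp: inj_def e_def dest!: injD[OF l] injD[OF pe])
  have "inj (\<lambda>(U, es). l (l U # map e es))"
    by (auto simp: inj_def dest!: injD[OF l] map_injective[OF _ e])
  then show ?thesis by blast
qed

lemma inj_on_rep: "inj_on rep (ar (adjoin_dual C))"
proof (rule inj_onI)
  fix c d assume *: "c \<in> ar (adjoin_dual C)" "d \<in> ar (adjoin_dual C)" "rep c = rep d"
  have r: "c = path_class C (rep c)" if "c \<in> ar (adjoin_dual C)" for c
  proof -
    from that obtain p where p: "p \<in> paths C" "c = path_class C p" by (auto simp: adjoin_dual_def)
    then have "p \<in> c" by (simp add: path_class_def congr.refl)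
    then have "congr C p (rep c)" unfolding rep_def using p(2)
      by (metis mem_Collect_eq path_class_def someI)
    then show ?thesis unfolding p(2) path_class_def by (auto intro: congr.trans congr.sym)
  qed
  show "c = d" using r * by metis
qed

lemma inj_on_injection_ob:
  "inj_on (injection (ob (adjoin_dual C)) :: _ \<Rightarrow> 'u) (ob (adjoin_dual (C :: 'u::infinite pmc)))"
  unfolding injection_def using ex_inj_list by (metis someI_ex subset_UNIV inj_on_subset)

lemma inj_on_injection_ar:
  "inj_on (injection (ar (adjoin_dual C)) :: _ \<Rightarrow> 'u) (ar (adjoin_dual (C :: 'u::infinite pmc)))"
proof -
  obtain l :: "('u, 'u) path \<Rightarrow> 'u" where "inj l" using ex_inj_path by blast
  then have "inj_on (l \<circ> rep) (ar (adjoin_dual C))"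
    by (intro comp_inj_on inj_on_rep) (auto intro: inj_on_subset)
  then show ?thesis unfolding injection_def by (rule someI[where P = "\<lambda>i. inj_on i (ar (adjoin_dual C))"])
qed

definition adjoin_dual_u :: "'u pmc \<Rightarrow> 'u pmc" where
  "adjoin_dual_u C =
     rename (injection (ob (adjoin_dual C))) (injection (ar (adjoin_dual C))) (adjoin_dual C)"

definition Omega_u :: "'u pmc \<Rightarrow> 'u pmf" where
  "Omega_u C =
     rename_cod (injection (ob (adjoin_dual C))) (injection (ar (adjoin_dual C))) (Omega C)"

end

theory Submission
  imports Defs
begin

text \<open>A left biadjoint is given by 1-cells \<open>\<eta> X : X \<rightarrow> F X\<close> such that precomposition with \<open>\<eta> X\<close> is an
  equivalence \<open>T(F X, A) \<rightarrow> T(X, A)\<close> for every \<open>A\<close> in the full sub-2-category. This condition is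
  invariant under equivalences on either side, so by strictification it suffices to treat
  \<open>\<Omega> : C \<rightarrow> C[J\<^sup>\<or>]\<close> and strict targets \<open>D\<close>. Given \<open>H : C \<rightarrow> D\<close> and a right dual \<open>K\<close> of \<open>H J\<close>, send a
  word \<open>(a\<^sub>0, \<dots>, a\<^sub>m)\<close> to \<open>H a\<^sub>0 \<otimes> K \<otimes> \<dots> \<otimes> K \<otimes> H a\<^sub>m\<close>. Pulling the homs of \<open>D\<close> back along this
  assignment makes the words the objects of a strict monoidal category equipped with a fully
  faithful strong monoidal functor to \<open>D\<close>; the generators and relations of \<open>C[J\<^sup>\<or>]\<close> are interpreted in it,
  and the composite extends \<open>H\<close> on the nose. The same pullback along the list tensor product gives
  strictification. A monoidal transformation of functors restricted along \<open>\<Omega>\<close> is invertible at \<open>J\<close>,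
  since 2-cells respect the distinguished objects; its component at \<open>J\<^sup>\<or>\<close> must then be the mate of
  the inverse, and those at words are tensor products of these components.\<close>

section \<open>Categories and monoidal categories\<close>

text \<open>Functors and transformations carry constraints, whereas the relations of
  \<open>adjoin_dual C\<close> are strict equations; the proof is shaped by keeping the two apart.
  The constraints of a functor out of words are packed into a coherent family, for which the
  conjugated tensor product \<open>box\<close> is strictly associative and unital. Strict algebra is
  done with boxes, and the constraints reappear only on projecting to \<open>D\<close>. The same
  device turns monoidality of a transformation into a strict multiplication rule for its components.
  The word \<open>J\<^sup>\<or> = (I, I)\<close> is sent to
  \<open>H I \<otimes> K \<otimes> H I\<close> and not to \<open>K\<close>, so the chosen dual has
  to be transported along the unit constraint of \<open>H\<close>. A second obstacle is size: words
  and classes of paths lie over types other than \<open>'u\<close>. The constructions are therefore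
  carried out over arbitrary types and moved into \<open>'u\<close> by renaming, which is an
  isomorphism and not merely an equivalence.\<close>

definition isos :: "('o, 'm, 'x) cat_scheme \<Rightarrow> 'm \<Rightarrow> bool" where
  "isos C f \<longleftrightarrow> (\<exists>g. inverse_pair C f g)"

lemma hom_iff: "f \<in> hom C a b \<longleftrightarrow> f \<in> ar C \<and> src C f = a \<and> tgt C f = b"
  by (auto simp: hom_def)

lemma iso_iff: "f \<in> iso C a b \<longleftrightarrow> f \<in> ar C \<and> src C f = a \<and> tgt C f = b \<and> isos C f"
  by (auto simp: iso_def hom_iff isos_def)

context category
begin

declare src_ob [simp] tgt_ob [simp]

lemma idn_simps [simp]:
  assumes "a \<in> ob C"
  shows "idn C a \<in> ar C" "src C (idn C a) = a" "tgt C (idn C a) = a"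
  using idn_hom[OF assms] by (auto simp: hom_iff)

lemma cmp_simps [simp]:
  assumes "f \<in> ar C" "g \<in> ar C" "src C g = tgt C f"
  shows "g \<cdot> f \<in> ar C" "src C (g \<cdot> f) = src C f" "tgt C (g \<cdot> f) = tgt C g"
  using cmp_hom[of f "src C f" "tgt C f" g "tgt C g"] assms by (auto simp: hom_iff)

lemma cmp_assoc' [simp]:
  assumes "f \<in> ar C" "g \<in> ar C" "h \<in> ar C" "src C g = tgt C f" "src C h = tgt C g"
  shows "(h \<cdot> g) \<cdot> f = h \<cdot> g \<cdot> f"
  using cmp_assoc[of f "src C f" "tgt C f" g "tgt C g" h "tgt C h"] assms by (auto simp: hom_iff)

lemma cmp_idn [simp]:
  "f \<in> ar C \<Longrightarrow> tgt C f = b \<Longrightarrow> idn C b \<cdot> f = f"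
  "f \<in> ar C \<Longrightarrow> src C f = b \<Longrightarrow> f \<cdot> idn C b = f"
  using cmp_idn_left[of f "src C f"] cmp_idn_right[of f _ "tgt C f"] by (auto simp: hom_iff)

lemma inverse_pair_unique: "inverse_pair C f g \<Longrightarrow> inverse_pair C f h \<Longrightarrow> g = h"
  unfolding inverse_pair_def hom_iff using cmp_assoc'[of g f h] cmp_idn(1)[of g "src C f"] cmp_idn(2)[of h "tgt C f"]
  by auto

lemma inverse_pair_inv: "isos C f \<Longrightarrow> inverse_pair C f (inv_ar C f)"
  unfolding isos_def inv_ar_def by (erule exE, rule theI, assumption, rule inverse_pair_unique)

lemma inv_ar_eq: "inverse_pair C f g \<Longrightarrow> inv_ar C f = g"
  by (rule inverse_pair_unique[OF inverse_pair_inv]) (auto simp: isos_def)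

lemma isos_ar: "isos C f \<Longrightarrow> f \<in> ar C"
  by (auto simp: isos_def inverse_pair_def)

lemma inv_simps [simp]:
  assumes "isos C f"
  shows "inv_ar C f \<in> ar C" "src C (inv_ar C f) = tgt C f" "tgt C (inv_ar C f) = src C f"
    "inv_ar C f \<cdot> f = idn C (src C f)" "f \<cdot> inv_ar C f = idn C (tgt C f)"
  using inverse_pair_inv[OF assms] by (auto simp: inverse_pair_def hom_iff)

lemma isosI:
  assumes "f \<in> ar C" "g \<in> ar C" "src C g = tgt C f" "tgt C g = src C f"
    "g \<cdot> f = idn C (src C f)" "f \<cdot> g = idn C (tgt C f)"
  shows "isos C f" "inv_ar C f = g"
  using assms by (auto simp: isos_def inverse_pair_def hom_iff intro!: inv_ar_eq)

lemma inv_cancel [simp]: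
  assumes "isos C f" "g \<in> ar C"
  shows "tgt C g = src C f \<Longrightarrow> inv_ar C f \<cdot> f \<cdot> g = g" "tgt C g = tgt C f \<Longrightarrow> f \<cdot> inv_ar C f \<cdot> g = g"
  using assms isos_ar[OF assms(1)] by (simp_all flip: cmp_assoc')

lemma isos_inv [simp]: "isos C f \<Longrightarrow> isos C (inv_ar C f)"
  and inv_inv [simp]: "isos C f \<Longrightarrow> inv_ar C (inv_ar C f) = f"
  using isosI[of "inv_ar C f" f] isos_ar[of f] by auto

lemma isos_idn [simp]: "a \<in> ob C \<Longrightarrow> isos C (idn C a)"
  and inv_idn [simp]: "a \<in> ob C \<Longrightarrow> inv_ar C (idn C a) = idn C a"
  using isosI[of "idn C a" "idn C a"] by auto

lemma isos_cmp [simp]: "isos C f \<Longrightarrow> isos C g \<Longrightarrow> src C g = tgt C f \<Longrightarrow> isos C (g \<cdot> f)"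
  using isosI[of "g \<cdot> f" "inv_ar C f \<cdot> inv_ar C g"] isos_ar[of f] isos_ar[of g] by auto

lemma iso_cancel_left:
  assumes "isos C f" "g \<in> ar C" "h \<in> ar C" "tgt C g = src C f" "tgt C h = src C f" "f \<cdot> g = f \<cdot> h"
  shows "g = h"
  using assms inv_cancel(1)[of f] by metis

lemma iso_cancel_right:
  assumes "isos C f" "g \<in> ar C" "h \<in> ar C" "src C g = tgt C f" "src C h = tgt C f" "g \<cdot> f = h \<cdot> f"
  shows "g = h"
proof -
  have "g \<cdot> f \<cdot> inv_ar C f = h \<cdot> f \<cdot> inv_ar C f"
    using assms isos_ar[OF assms(1)] by (simp del: inv_simps(5) flip: cmp_assoc')
  then show ?thesis using assms by simp
qed

lemma reassoc:
  "g \<cdot> f = k \<Longrightarrow> f \<in> ar C \<Longrightarrow> g \<in> ar C \<Longrightarrow> src C g = tgt C f \<Longrightarrow> h \<in> ar C \<Longrightarrow> tgt C h = src C f \<Longrightarrow>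
    g \<cdot> f \<cdot> h = k \<cdot> h"
  by (metis cmp_assoc')

lemma inv_eq_left: "isos C f \<Longrightarrow> g \<in> ar C \<Longrightarrow> tgt C g = src C f \<Longrightarrow> f \<cdot> g = h \<Longrightarrow> inv_ar C f \<cdot> h = g"
  by (metis inv_cancel(1))

lemma inv_eq_right:
  assumes "isos C f" "g \<in> ar C" "src C g = tgt C f" "g \<cdot> f = h"
  shows "h \<cdot> inv_ar C f = g"
  using assms isos_ar[OF assms(1)] by auto

end

context monoidal_category
begin

declare unit_ob [simp] tob_ob [simp]

lemma tar_simps [simp]:
  assumes "f \<in> ar C" "g \<in> ar C"
  shows "f \<otimes>\<^sub>a g \<in> ar C" "src C (f \<otimes>\<^sub>a g) = src C f \<otimes> src C g" "tgt C (f \<otimes>\<^sub>a g) = tgt C f \<otimes> tgt C g"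
  using tar_hom[of f "src C f" "tgt C f" g "src C g" "tgt C g"] assms by (auto simp: hom_iff)

declare tar_idn [simp]

lemma tar_merge:
  assumes "f \<in> ar C" "f' \<in> ar C" "g \<in> ar C" "g' \<in> ar C" "src C f' = tgt C f" "src C g' = tgt C g"
  shows "(f' \<otimes>\<^sub>a g') \<cdot> (f \<otimes>\<^sub>a g) = (f' \<cdot> f) \<otimes>\<^sub>a (g' \<cdot> g)"
  using tar_cmp[of f _ _ f' _ g _ _ g'] assms by (simp add: hom_iff)

lemma tar_merge':
  assumes "f \<in> ar C" "f' \<in> ar C" "g \<in> ar C" "g' \<in> ar C" "src C f' = tgt C f" "src C g' = tgt C g"
    "h \<in> ar C" "tgt C h = src C f \<otimes> src C g"
  shows "(f' \<otimes>\<^sub>a g') \<cdot> (f \<otimes>\<^sub>a g) \<cdot> h = ((f' \<cdot> f) \<otimes>\<^sub>a (g' \<cdot> g)) \<cdot> h"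
  using assms by (simp add: tar_merge flip: cmp_assoc')

lemma asc_simps [simp]:
  assumes "a \<in> ob C" "b \<in> ob C" "c \<in> ob C"
  shows "asc C a b c \<in> ar C" "src C (asc C a b c) = (a \<otimes> b) \<otimes> c" "tgt C (asc C a b c) = a \<otimes> b \<otimes> c"
    "isos C (asc C a b c)"
  using asc_iso[OF assms] by (auto simp: iso_iff)

lemma lun_simps [simp]:
  assumes "a \<in> ob C"
  shows "lun C a \<in> ar C" "src C (lun C a) = unit C \<otimes> a" "tgt C (lun C a) = a" "isos C (lun C a)"
  using lun_iso[OF assms] by (auto simp: iso_iff)

lemma run_simps [simp]:
  assumes "a \<in> ob C"
  shows "run C a \<in> ar C" "src C (run C a) = a \<otimes> unit C" "tgt C (run C a) = a" "isos C (run C a)"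
  using run_iso[OF assms] by (auto simp: iso_iff)

lemma isos_tar [simp]: "isos C f \<Longrightarrow> isos C g \<Longrightarrow> isos C (f \<otimes>\<^sub>a g)"
  and inv_tar: "isos C f \<Longrightarrow> isos C g \<Longrightarrow> inv_ar C (f \<otimes>\<^sub>a g) = inv_ar C f \<otimes>\<^sub>a inv_ar C g"
  using isosI[of "f \<otimes>\<^sub>a g" "inv_ar C f \<otimes>\<^sub>a inv_ar C g"] isos_ar[of f] isos_ar[of g]
  by (auto simp: tar_merge)

lemma asc_nat:
  "f \<in> ar C \<Longrightarrow> g \<in> ar C \<Longrightarrow> h \<in> ar C \<Longrightarrow>
    asc C (tgt C f) (tgt C g) (tgt C h) \<cdot> ((f \<otimes>\<^sub>a g) \<otimes>\<^sub>a h)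
    = (f \<otimes>\<^sub>a g \<otimes>\<^sub>a h) \<cdot> asc C (src C f) (src C g) (src C h)"
  by (rule asc_natural) (auto simp: hom_iff)

lemma lun_nat: "f \<in> ar C \<Longrightarrow> lun C (tgt C f) \<cdot> (idn C (unit C) \<otimes>\<^sub>a f) = f \<cdot> lun C (src C f)"
  by (rule lun_natural) (auto simp: hom_iff)

lemma run_nat: "f \<in> ar C \<Longrightarrow> run C (tgt C f) \<cdot> (f \<otimes>\<^sub>a idn C (unit C)) = f \<cdot> run C (src C f)"
  by (rule run_natural) (auto simp: hom_iff)

text \<open>By naturality, \<open>f\<close> composed with \<open>lun\<close> is determined by
  \<open>idn C (unit C) \<otimes>\<^sub>a f\<close>, and \<open>lun\<close> is invertible. The unit
  laws below are therefore proved after tensoring with the unit, where pentagon and triangle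
  apply.\<close>

lemma lun_faithful:
  assumes "f \<in> ar C" "g \<in> ar C" "src C f = src C g" "tgt C f = tgt C g"
    "idn C (unit C) \<otimes>\<^sub>a f = idn C (unit C) \<otimes>\<^sub>a g"
  shows "f = g"
  by (rule iso_cancel_right[of "lun C (src C f)"]) (use assms lun_nat[of f] lun_nat[of g] in auto)

lemma run_faithful:
  assumes "f \<in> ar C" "g \<in> ar C" "src C f = src C g" "tgt C f = tgt C g"
    "f \<otimes>\<^sub>a idn C (unit C) = g \<otimes>\<^sub>a idn C (unit C)"
  shows "f = g"
  by (rule iso_cancel_right[of "run C (src C f)"]) (use assms run_nat[of f] run_nat[of g] in auto)

text \<open>The axioms contain only the triangle with the unit in the middle; this is Kelly's
  derivation of the one with the unit on the left. The pentagon for \<open>I, I, a, b\<close> and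
  two triangles equate both sides after tensoring with the unit and composing with the invertible
  \<open>?X\<close>.\<close>

lemma lun_tob:
  assumes [simp]: "a \<in> ob C" "b \<in> ob C"
  shows "lun C (a \<otimes> b) \<cdot> asc C (unit C) a b = lun C a \<otimes>\<^sub>a idn C b"
proof (rule lun_faithful)
  let ?I = "unit C"
  let ?X = "asc C ?I (?I \<otimes> a) b \<cdot> (asc C ?I ?I a \<otimes>\<^sub>a idn C b)"
  have "(idn C ?I \<otimes>\<^sub>a (lun C (a \<otimes> b) \<cdot> asc C ?I a b)) \<cdot> ?X
      = (idn C ?I \<otimes>\<^sub>a lun C (a \<otimes> b)) \<cdot> (idn C ?I \<otimes>\<^sub>a asc C ?I a b) \<cdot> ?X"
    by (simp add: tar_merge')
  also have "\<dots> = (idn C ?I \<otimes>\<^sub>a lun C (a \<otimes> b)) \<cdot> asc C ?I ?I (a \<otimes> b) \<cdot> asc C (?I \<otimes> ?I) a b"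
    by (simp add: pentagon)
  also have "\<dots> = (run C ?I \<otimes>\<^sub>a idn C a \<otimes>\<^sub>a idn C b) \<cdot> asc C (?I \<otimes> ?I) a b"
    by (simp add: triangle flip: cmp_assoc')
  also have "\<dots> = asc C ?I a b \<cdot> ((run C ?I \<otimes>\<^sub>a idn C a) \<otimes>\<^sub>a idn C b)"
    using asc_nat[of "run C ?I" "idn C a" "idn C b"] by (simp del: tar_idn)
  also have "\<dots> = asc C ?I a b \<cdot> ((idn C ?I \<otimes>\<^sub>a lun C a) \<otimes>\<^sub>a idn C b) \<cdot> (asc C ?I ?I a \<otimes>\<^sub>a idn C b)"
    by (simp add: tar_merge flip: triangle)
  also have "\<dots> = (idn C ?I \<otimes>\<^sub>a lun C a \<otimes>\<^sub>a idn C b) \<cdot> ?X"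
    using asc_nat[of "idn C ?I" "lun C a" "idn C b"] by (simp flip: cmp_assoc')
  finally show "idn C ?I \<otimes>\<^sub>a (lun C (a \<otimes> b) \<cdot> asc C ?I a b) = idn C ?I \<otimes>\<^sub>a lun C a \<otimes>\<^sub>a idn C b"
    by (rule iso_cancel_right[rotated -1]) auto
qed auto

text \<open>The mirror image of \<open>lun_tob\<close>: the pentagon for \<open>a, b, I, I\<close>,
  with the unit tensored on the right and the associator of \<open>a, b, I\<close> cancelled on the
  left.\<close>

lemma run_tob:
  assumes [simp]: "a \<in> ob C" "b \<in> ob C"
  shows "run C (a \<otimes> b) = (idn C a \<otimes>\<^sub>a run C b) \<cdot> asc C a b (unit C)"
proof (rule run_faithful)
  let ?I = "unit C"
  have "asc C a b ?I \<cdot> (run C (a \<otimes> b) \<otimes>\<^sub>a idn C ?I)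
      = asc C a b ?I \<cdot> ((idn C a \<otimes>\<^sub>a idn C b) \<otimes>\<^sub>a lun C ?I) \<cdot> asc C (a \<otimes> b) ?I ?I"
    by (simp add: triangle)
  also have "\<dots> = (idn C a \<otimes>\<^sub>a idn C b \<otimes>\<^sub>a lun C ?I) \<cdot> asc C a b (?I \<otimes> ?I) \<cdot> asc C (a \<otimes> b) ?I ?I"
    using asc_nat[of "idn C a" "idn C b" "lun C ?I"] by (simp del: tar_idn flip: cmp_assoc')
  also have "\<dots> = (idn C a \<otimes>\<^sub>a idn C b \<otimes>\<^sub>a lun C ?I) \<cdot> (idn C a \<otimes>\<^sub>a asc C b ?I ?I)
      \<cdot> asc C a (b \<otimes> ?I) ?I \<cdot> (asc C a b ?I \<otimes>\<^sub>a idn C ?I)"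
    by (simp add: pentagon)
  also have "\<dots> = (idn C a \<otimes>\<^sub>a run C b \<otimes>\<^sub>a idn C ?I) \<cdot> asc C a (b \<otimes> ?I) ?I \<cdot> (asc C a b ?I \<otimes>\<^sub>a idn C ?I)"
    by (simp add: tar_merge' triangle)
  also have "\<dots> = asc C a b ?I \<cdot> ((idn C a \<otimes>\<^sub>a run C b) \<otimes>\<^sub>a idn C ?I) \<cdot> (asc C a b ?I \<otimes>\<^sub>a idn C ?I)"
    using asc_nat[of "idn C a" "run C b" "idn C ?I"] by (simp flip: cmp_assoc')
  also have "\<dots> = asc C a b ?I \<cdot> (((idn C a \<otimes>\<^sub>a run C b) \<cdot> asc C a b ?I) \<otimes>\<^sub>a idn C ?I)"
    by (simp add: tar_merge)
  finally show "run C (a \<otimes> b) \<otimes>\<^sub>a idn C ?I = ((idn C a \<otimes>\<^sub>a run C b) \<cdot> asc C a b ?I) \<otimes>\<^sub>a idn C ?I"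
    by (rule iso_cancel_left[rotated -1]) auto
qed auto

lemma lun_unit: "lun C (unit C) = run C (unit C)"
proof (rule run_faithful)
  let ?I = "unit C"
  \<comment> \<open>Naturality of \<open>lun\<close> at the arrow \<open>lun C ?I\<close> itself,
    with that arrow cancelled. The unit laws with the unit on the left and in the middle then have
    the same left-hand side.\<close>
  have "lun C (?I \<otimes> ?I) = idn C ?I \<otimes>\<^sub>a lun C ?I"
    using lun_nat[of "lun C ?I"] by (auto intro: iso_cancel_left[of "lun C ?I"])
  then show "lun C ?I \<otimes>\<^sub>a idn C ?I = run C ?I \<otimes>\<^sub>a idn C ?I"
    using lun_tob[of ?I ?I] triangle[of ?I ?I] by simp
qed auto

end

context strict_monoidal_category
begin

declare tob_assoc [simp] tob_unit_left [simp] tob_unit_right [simp]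

text \<open>When the associator is an identity, its naturality square says that the tensor product
  of arrows is strictly associative.\<close>

lemma tar_assoc [simp]:
  "f \<in> ar C \<Longrightarrow> g \<in> ar C \<Longrightarrow> h \<in> ar C \<Longrightarrow> (f \<otimes>\<^sub>a g) \<otimes>\<^sub>a h = f \<otimes>\<^sub>a g \<otimes>\<^sub>a h"
  using asc_nat[of f g h] by (simp add: asc_idn)

lemma tar_unit [simp]:
  "f \<in> ar C \<Longrightarrow> idn C (unit C) \<otimes>\<^sub>a f = f" "f \<in> ar C \<Longrightarrow> f \<otimes>\<^sub>a idn C (unit C) = f"
  using lun_nat[of f] run_nat[of f] by (simp_all add: lun_idn run_idn)

end

declare (in pointed_monoidal_category) pt_ob [simp]

context pointed_monoidal_functor
begin

lemma fob_ob [simp]: "a \<in> ob C \<Longrightarrow> fob F a \<in> ob D"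
  using is_functor by (simp add: is_functor_def)

lemma far_simps [simp]:
  assumes "f \<in> ar C"
  shows "far F f \<in> ar D" "src D (far F f) = fob F (src C f)" "tgt D (far F f) = fob F (tgt C f)"
  using is_functor assms by (auto simp add: is_functor_def hom_iff)

lemma far_idn [simp]: "a \<in> ob C \<Longrightarrow> far F (idn C a) = idn D (fob F a)"
  using is_functor by (simp add: is_functor_def)

lemma far_cmp [simp]:
  "f \<in> ar C \<Longrightarrow> g \<in> ar C \<Longrightarrow> src C g = tgt C f \<Longrightarrow> far F (g \<cdot>\<^bsub>C\<^esub> f) = far F g \<cdot>\<^bsub>D\<^esub> far F f"
  using is_functor by (simp add: is_functor_def)

lemma fmul_simps [simp]:
  assumes "a \<in> ob C" "b \<in> ob C"
  shows "fmul F a b \<in> ar D" "src D (fmul F a b) = fob F a \<otimes>\<^bsub>D\<^esub> fob F b"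
    "tgt D (fmul F a b) = fob F (a \<otimes>\<^bsub>C\<^esub> b)" "isos D (fmul F a b)"
  using fmul_iso[OF assms] by (auto simp: iso_iff)

lemma funit_simps [simp]:
  "funit F \<in> ar D" "src D (funit F) = unit D" "tgt D (funit F) = fob F (unit C)" "isos D (funit F)"
  using funit_iso by (auto simp: iso_iff)

lemma fpt_simps [simp]:
  "fpt F \<in> ar D" "src D (fpt F) = fob F (pt C)" "tgt D (fpt F) = pt D" "isos D (fpt F)"
  using fpt_iso by (auto simp: iso_iff)

lemma fmul_nat:
  "f \<in> ar C \<Longrightarrow> g \<in> ar C \<Longrightarrow>
    fmul F (tgt C f) (tgt C g) \<cdot>\<^bsub>D\<^esub> (far F f \<otimes>\<^sub>a\<^bsub>D\<^esub> far F g)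
    = far F (f \<otimes>\<^sub>a\<^bsub>C\<^esub> g) \<cdot>\<^bsub>D\<^esub> fmul F (src C f) (src C g)"
  by (rule fmul_natural) (auto simp: hom_iff)

lemma fmul_nat':
  "f \<in> ar C \<Longrightarrow> g \<in> ar C \<Longrightarrow> tgt C f = a \<Longrightarrow> tgt C g = b \<Longrightarrow>
    fmul F a b \<cdot>\<^bsub>D\<^esub> far F f \<otimes>\<^sub>a\<^bsub>D\<^esub> far F g = far F (f \<otimes>\<^sub>a\<^bsub>C\<^esub> g) \<cdot>\<^bsub>D\<^esub> fmul F (src C f) (src C g)"
  "f \<in> ar C \<Longrightarrow> g \<in> ar C \<Longrightarrow> tgt C f = a \<Longrightarrow> tgt C g = b \<Longrightarrow>
    h \<in> ar D \<Longrightarrow> tgt D h = fob F (src C f) \<otimes>\<^bsub>D\<^esub> fob F (src C g) \<Longrightarrow>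
    fmul F a b \<cdot>\<^bsub>D\<^esub> far F f \<otimes>\<^sub>a\<^bsub>D\<^esub> far F g \<cdot>\<^bsub>D\<^esub> h = far F (f \<otimes>\<^sub>a\<^bsub>C\<^esub> g) \<cdot>\<^bsub>D\<^esub> fmul F (src C f) (src C g) \<cdot>\<^bsub>D\<^esub> h"
  using fmul_nat[of f g] D.reassoc[OF fmul_nat[of f g], of h] by auto

lemma isos_far [simp]: "isos C f \<Longrightarrow> isos D (far F f)"
  and inv_far: "isos C f \<Longrightarrow> inv_ar D (far F f) = far F (inv_ar C f)"
  using D.isosI[of "far F f" "far F (inv_ar C f)"] C.isos_ar[of f] by (auto simp flip: far_cmp)

lemma fmul_undefined: "a \<notin> ob C \<Longrightarrow> fmul F a = undefined" "b \<notin> ob C \<Longrightarrow> a \<in> ob C \<Longrightarrow> fmul F a b = undefined"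
  using fmul_extensional fmul_extensional' by (auto simp: extensional_def)

end

context pointed_monoidal_transformation
begin

lemma ncmp_simps [simp]:
  assumes "a \<in> ob C"
  shows "ncmp \<sigma> a \<in> ar D" "src D (ncmp \<sigma> a) = fob F a" "tgt D (ncmp \<sigma> a) = fob G a"
  using ncmp_hom[OF assms] by (auto simp: hom_iff)

lemma ncmp_nat: "f \<in> ar C \<Longrightarrow>
    ncmp \<sigma> (tgt C f) \<cdot>\<^bsub>D\<^esub> far F f = far G f \<cdot>\<^bsub>D\<^esub> ncmp \<sigma> (src C f)"
  by (rule ncmp_natural) (auto simp: hom_iff)

lemma ncmp_nat':
  "f \<in> ar C \<Longrightarrow> tgt C f = b \<Longrightarrow> ncmp \<sigma> b \<cdot>\<^bsub>D\<^esub> far F f = far G f \<cdot>\<^bsub>D\<^esub> ncmp \<sigma> (src C f)"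
  "f \<in> ar C \<Longrightarrow> tgt C f = b \<Longrightarrow> h \<in> ar D \<Longrightarrow> tgt D h = fob F (src C f) \<Longrightarrow>
    ncmp \<sigma> b \<cdot>\<^bsub>D\<^esub> far F f \<cdot>\<^bsub>D\<^esub> h = far G f \<cdot>\<^bsub>D\<^esub> ncmp \<sigma> (src C f) \<cdot>\<^bsub>D\<^esub> h"
  using ncmp_nat[of f] F.D.reassoc[OF ncmp_nat[of f], of h] by auto

end

section \<open>The 2-category of pointed monoidal categories\<close>

abbreviation "pmcat \<equiv> pointed_monoidal_category"
abbreviation "pmfun \<equiv> pointed_monoidal_functor"
abbreviation "pmnat \<equiv> pointed_monoidal_transformation"

text \<open>Functors are \<open>undefined\<close> off their domains, so agreement on the carriers is
  equality of 1-cells. The strict equations between composites, such as those for renamings and for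
  restriction along \<open>Omega\<close>, rest on this.\<close>

lemma pmonfun_eqI:
  assumes "pmfun C D F" "pmfun C D F'"
    "\<And>a. a \<in> ob C \<Longrightarrow> fob F a = fob F' a" "\<And>f. f \<in> ar C \<Longrightarrow> far F f = far F' f"
    "\<And>a b. a \<in> ob C \<Longrightarrow> b \<in> ob C \<Longrightarrow> fmul F a b = fmul F' a b"
    "funit F = funit F'" "fpt F = fpt F'"
  shows "F = F'"
proof -
  interpret F: pointed_monoidal_functor C D F by fact
  interpret F': pointed_monoidal_functor C D F' by fact
  have "fmul F a b = fmul F' a b" for a b
    using assms(5)[of a b] by (cases "a \<in> ob C"; cases "b \<in> ob C") (auto simp: F.fmul_undefined F'.fmul_undefined)
  moreover have "fob F = fob F'" "far F = far F'"
    using assms(3,4) F.fob_extensional F'.fob_extensional F.far_extensional F'.far_extensional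
    by (blast intro: extensionalityI)+
  ultimately show ?thesis
    using assms(6,7) F.fdom F.fcod F'.fdom F'.fcod by (intro pmonfun.equality) auto
qed

lemma pmonnat_eqI:
  assumes "pmnat C D F G \<sigma>" "pmnat C D F G \<tau>" "\<And>a. a \<in> ob C \<Longrightarrow> ncmp \<sigma> a = ncmp \<tau> a"
  shows "\<sigma> = \<tau>"
proof -
  interpret \<sigma>: pointed_monoidal_transformation C D F G \<sigma> by fact
  interpret \<tau>: pointed_monoidal_transformation C D F G \<tau> by fact
  have "ncmp \<sigma> = ncmp \<tau>"
    using \<sigma>.ncmp_extensional \<tau>.ncmp_extensional assms(3) by (blast intro: extensionalityI)
  then show ?thesis
    using \<sigma>.ndom \<sigma>.ncod \<tau>.ndom \<tau>.ncod by (intro pmonnat.equality) auto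
qed

lemma id_pmonfun_simps [simp]:
  "fdom (id_pmonfun C) = C" "fcod (id_pmonfun C) = C"
  "a \<in> ob C \<Longrightarrow> fob (id_pmonfun C) a = a" "f \<in> ar C \<Longrightarrow> far (id_pmonfun C) f = f"
  "a \<in> ob C \<Longrightarrow> b \<in> ob C \<Longrightarrow> fmul (id_pmonfun C) a b = idn C (a \<otimes>\<^bsub>C\<^esub> b)"
  "funit (id_pmonfun C) = idn C (unit C)" "fpt (id_pmonfun C) = idn C (pt C)"
  by (simp_all add: id_pmonfun_def)

lemma comp_pmonfun_simps [simp]:
  "fdom (comp_pmonfun G F) = fdom F" "fcod (comp_pmonfun G F) = fcod G"
  "a \<in> ob (fdom F) \<Longrightarrow> fob (comp_pmonfun G F) a = fob G (fob F a)"
  "f \<in> ar (fdom F) \<Longrightarrow> far (comp_pmonfun G F) f = far G (far F f)"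
  "a \<in> ob (fdom F) \<Longrightarrow> b \<in> ob (fdom F) \<Longrightarrow>
    fmul (comp_pmonfun G F) a b = far G (fmul F a b) \<cdot>\<^bsub>fcod G\<^esub> fmul G (fob F a) (fob F b)"
  "funit (comp_pmonfun G F) = far G (funit F) \<cdot>\<^bsub>fcod G\<^esub> funit G"
  "fpt (comp_pmonfun G F) = fpt G \<cdot>\<^bsub>fcod G\<^esub> far G (fpt F)"
  by (simp_all add: comp_pmonfun_def Let_def)

lemma (in pointed_monoidal_category) id_pmfun: "pmfun C C (id_pmonfun C)"
proof -
  have *: "category C" "pmcat C" by unfold_locales
  have "is_functor C C (fob (id_pmonfun C)) (far (id_pmonfun C))"
    unfolding is_functor_def using * by (simp add: hom_iff)
  then show ?thesis
    using * by unfold_locales (auto simp: hom_iff iso_iff id_pmonfun_def)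
qed

text \<open>Each coherence law of the composite combines that of \<open>F\<close>, taken under
  \<open>far G\<close>, with that of \<open>G\<close>; in between, naturality of
  \<open>fmul G\<close> moves the constraints of \<open>F\<close> past it.\<close>

lemma comp_pmfun:
  fixes E (structure)
  assumes "pmfun C D F" "pmfun D E G"
  shows "pmfun C E (comp_pmonfun G F)"
proof -
  interpret F: pointed_monoidal_functor C D F by fact
  interpret G: pointed_monoidal_functor D E G by fact
  note [simp] = F.fdom F.fcod G.fdom G.fcod
  let ?H = "comp_pmonfun G F"
  have "is_functor C E (fob ?H) (far ?H)"
    unfolding is_functor_def using F.C.category_axioms G.D.category_axioms by (simp add: hom_iff)
  moreover
  { fix f g assume [simp]: "f \<in> ar C" "g \<in> ar C"
    have "fmul ?H (tgt C f) (tgt C g) \<cdot> far ?H f \<otimes>\<^sub>a far ?H g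
        = far G (fmul F (tgt C f) (tgt C g) \<cdot>\<^bsub>D\<^esub> far F f \<otimes>\<^sub>a\<^bsub>D\<^esub> far F g) \<cdot> fmul G (fob F (src C f)) (fob F (src C g))"
      using G.fmul_nat[of "far F f" "far F g"] by simp
    also have "\<dots> = far ?H (f \<otimes>\<^sub>a\<^bsub>C\<^esub> g) \<cdot> fmul ?H (src C f) (src C g)"
      by (simp add: F.fmul_nat)
    finally have "fmul ?H (tgt C f) (tgt C g) \<cdot> far ?H f \<otimes>\<^sub>a far ?H g
        = far ?H (f \<otimes>\<^sub>a\<^bsub>C\<^esub> g) \<cdot> fmul ?H (src C f) (src C g)" . }
  moreover
  { fix a b c assume [simp]: "a \<in> ob C" "b \<in> ob C" "c \<in> ob C"
    let ?a = "fob F a" and ?b = "fob F b" and ?c = "fob F c"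
    let ?m = "fmul F" and ?n = "fmul G"
    have "(far G (?m (a \<otimes>\<^bsub>C\<^esub> b) c) \<cdot> ?n (fob F (a \<otimes>\<^bsub>C\<^esub> b)) ?c)
          \<cdot> (far G (?m a b) \<cdot> ?n ?a ?b) \<otimes>\<^sub>a idn E (fob G ?c)
        = far G (?m (a \<otimes>\<^bsub>C\<^esub> b) c) \<cdot> (?n (fob F (a \<otimes>\<^bsub>C\<^esub> b)) ?c \<cdot> far G (?m a b) \<otimes>\<^sub>a far G (idn D ?c))
          \<cdot> ?n ?a ?b \<otimes>\<^sub>a idn E (fob G ?c)"
      by (simp add: G.D.tar_merge)
    also have "\<dots> = far G (?m (a \<otimes>\<^bsub>C\<^esub> b) c \<cdot>\<^bsub>D\<^esub> ?m a b \<otimes>\<^sub>a\<^bsub>D\<^esub> idn D ?c) \<cdot> ?n (?a \<otimes>\<^bsub>D\<^esub> ?b) ?c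
          \<cdot> ?n ?a ?b \<otimes>\<^sub>a idn E (fob G ?c)"
      using G.fmul_nat[of "?m a b" "idn D ?c"] by (simp del: G.far_idn)
    finally have "far ?H (asc C a b c) \<cdot> fmul ?H (a \<otimes>\<^bsub>C\<^esub> b) c \<cdot> fmul ?H a b \<otimes>\<^sub>a idn E (fob ?H c)
        = far G (far F (asc C a b c) \<cdot>\<^bsub>D\<^esub> ?m (a \<otimes>\<^bsub>C\<^esub> b) c \<cdot>\<^bsub>D\<^esub> ?m a b \<otimes>\<^sub>a\<^bsub>D\<^esub> idn D ?c) \<cdot> ?n (?a \<otimes>\<^bsub>D\<^esub> ?b) ?c
          \<cdot> ?n ?a ?b \<otimes>\<^sub>a idn E (fob G ?c)" by simp
    also have "\<dots> = far G (?m a (b \<otimes>\<^bsub>C\<^esub> c) \<cdot>\<^bsub>D\<^esub> idn D ?a \<otimes>\<^sub>a\<^bsub>D\<^esub> ?m b c) \<cdot>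
          far G (asc D ?a ?b ?c) \<cdot> ?n (?a \<otimes>\<^bsub>D\<^esub> ?b) ?c \<cdot> ?n ?a ?b \<otimes>\<^sub>a idn E (fob G ?c)"
      by (simp add: F.fmul_assoc)
    also have "\<dots> = far G (?m a (b \<otimes>\<^bsub>C\<^esub> c)) \<cdot> (far G (idn D ?a \<otimes>\<^sub>a\<^bsub>D\<^esub> ?m b c) \<cdot>
          ?n ?a (?b \<otimes>\<^bsub>D\<^esub> ?c)) \<cdot> idn E (fob G ?a) \<otimes>\<^sub>a ?n ?b ?c \<cdot> asc E (fob G ?a) (fob G ?b) (fob G ?c)"
      by (simp add: G.fmul_assoc)
    also have "\<dots> = far G (?m a (b \<otimes>\<^bsub>C\<^esub> c)) \<cdot> (?n ?a (fob F (b \<otimes>\<^bsub>C\<^esub> c)) \<cdot> far G (idn D ?a) \<otimes>\<^sub>a far G (?m b c))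
         \<cdot> idn E (fob G ?a) \<otimes>\<^sub>a ?n ?b ?c \<cdot> asc E (fob G ?a) (fob G ?b) (fob G ?c)"
      using G.fmul_nat[of "idn D ?a" "?m b c"] by (simp del: G.far_idn)
    also have "\<dots> = fmul ?H a (b \<otimes>\<^bsub>C\<^esub> c) \<cdot> idn E (fob ?H a) \<otimes>\<^sub>a fmul ?H b c
        \<cdot> asc E (fob ?H a) (fob ?H b) (fob ?H c)"
      by (simp add: G.D.tar_merge')
    finally have "far ?H (asc C a b c) \<cdot> fmul ?H (a \<otimes>\<^bsub>C\<^esub> b) c \<cdot> fmul ?H a b \<otimes>\<^sub>a idn E (fob ?H c)
        = fmul ?H a (b \<otimes>\<^bsub>C\<^esub> c) \<cdot> idn E (fob ?H a) \<otimes>\<^sub>a fmul ?H b c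
        \<cdot> asc E (fob ?H a) (fob ?H b) (fob ?H c)" . }
  moreover
  { fix a assume [simp]: "a \<in> ob C"
    have "far ?H (lun C a) \<cdot> fmul ?H (unit C) a \<cdot> funit ?H \<otimes>\<^sub>a idn E (fob ?H a)
        = far G (far F (lun C a) \<cdot>\<^bsub>D\<^esub> fmul F (unit C) a) \<cdot> (fmul G (fob F (unit C)) (fob F a)
          \<cdot> far G (funit F) \<otimes>\<^sub>a far G (idn D (fob F a))) \<cdot> funit G \<otimes>\<^sub>a idn E (fob G (fob F a))"
      by (simp add: G.D.tar_merge)
    also have "\<dots> = far G (far F (lun C a) \<cdot>\<^bsub>D\<^esub> fmul F (unit C) a \<cdot>\<^bsub>D\<^esub> funit F \<otimes>\<^sub>a\<^bsub>D\<^esub> idn D (fob F a))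
         \<cdot> fmul G (unit D) (fob F a) \<cdot> funit G \<otimes>\<^sub>a idn E (fob G (fob F a))"
      using G.fmul_nat[of "funit F" "idn D (fob F a)"] by (simp del: G.far_idn)
    also have "\<dots> = lun E (fob ?H a)" by (simp only: F.fmul_lun \<open>a \<in> ob C\<close>) (simp add: G.fmul_lun)
    finally have "far ?H (lun C a) \<cdot> fmul ?H (unit C) a \<cdot> funit ?H \<otimes>\<^sub>a idn E (fob ?H a) = lun E (fob ?H a)" .
    have "far ?H (run C a) \<cdot> fmul ?H a (unit C) \<cdot> idn E (fob ?H a) \<otimes>\<^sub>a funit ?H
        = far G (far F (run C a) \<cdot>\<^bsub>D\<^esub> fmul F a (unit C)) \<cdot> (fmul G (fob F a) (fob F (unit C))
          \<cdot> far G (idn D (fob F a)) \<otimes>\<^sub>a far G (funit F)) \<cdot> idn E (fob G (fob F a)) \<otimes>\<^sub>a funit G"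
      by (simp add: G.D.tar_merge)
    also have "\<dots> = far G (far F (run C a) \<cdot>\<^bsub>D\<^esub> fmul F a (unit C) \<cdot>\<^bsub>D\<^esub> idn D (fob F a) \<otimes>\<^sub>a\<^bsub>D\<^esub> funit F)
         \<cdot> fmul G (fob F a) (unit D) \<cdot> idn E (fob G (fob F a)) \<otimes>\<^sub>a funit G"
      using G.fmul_nat[of "idn D (fob F a)" "funit F"] by (simp del: G.far_idn)
    also have "\<dots> = run E (fob ?H a)" by (simp only: F.fmul_run \<open>a \<in> ob C\<close>) (simp add: G.fmul_run)
    finally have "far ?H (run C a) \<cdot> fmul ?H a (unit C) \<cdot> idn E (fob ?H a) \<otimes>\<^sub>a funit ?H = run E (fob ?H a)" .
    note * = this \<open>far ?H (lun C a) \<cdot> fmul ?H (unit C) a \<cdot> funit ?H \<otimes>\<^sub>a idn E (fob ?H a) = lun E (fob ?H a)\<close> }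
  note units = this
  ultimately show ?thesis
    by unfold_locales
      (auto simp del: comp_pmonfun_simps(4-7) simp: hom_iff units, auto simp: iso_iff comp_pmonfun_def Let_def)
qed

lemma
  assumes "pmfun C D F"
  shows comp_pmonfun_id_left: "comp_pmonfun (id_pmonfun D) F = F"
    and comp_pmonfun_id_right: "comp_pmonfun F (id_pmonfun C) = F"
proof -
  interpret F: pointed_monoidal_functor C D F by fact
  note [simp] = F.fdom F.fcod
  show "comp_pmonfun (id_pmonfun D) F = F"
    by (rule pmonfun_eqI[where C = C and D = D]) (auto intro: assms comp_pmfun F.D.id_pmfun)
  show "comp_pmonfun F (id_pmonfun C) = F"
    by (rule pmonfun_eqI[where C = C and D = D]) (auto intro: assms comp_pmfun F.C.id_pmfun)
qed

lemma comp_pmonfun_assoc: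
  assumes "pmfun A B F" "pmfun B C G" "pmfun C D H"
  shows "comp_pmonfun (comp_pmonfun H G) F = comp_pmonfun H (comp_pmonfun G F)"
proof -
  interpret F: pointed_monoidal_functor A B F by fact
  interpret G: pointed_monoidal_functor B C G by fact
  interpret H: pointed_monoidal_functor C D H by fact
  note [simp] = F.fdom F.fcod G.fdom G.fcod H.fdom H.fcod
  show ?thesis
    by (rule pmonfun_eqI[where C = A and D = D]) (auto intro: assms comp_pmfun)
qed

lemma pmoncat_vert_simps [simp]:
  "src pmoncat_vert = ndom" "tgt pmoncat_vert = ncod"
  "ob pmoncat_vert = {F. pmfun (fdom F) (fcod F) F}"
  "ar pmoncat_vert = {\<sigma>. pmnat (fdom (ndom \<sigma>)) (fcod (ndom \<sigma>)) (ndom \<sigma>) (ncod \<sigma>) \<sigma>}"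
  by (auto simp: pmoncat_vert_def)

lemma idn_vert_simps [simp]:
  "ndom (idn pmoncat_vert F) = F" "ncod (idn pmoncat_vert F) = F"
  "a \<in> ob (fdom F) \<Longrightarrow> ncmp (idn pmoncat_vert F) a = idn (fcod F) (fob F a)"
  "fdom F = C \<Longrightarrow> ncmp (idn pmoncat_vert F) \<in> extensional (ob C)"
  by (simp_all add: pmoncat_vert_def)

lemma cmp_vert_simps [simp]:
  "ndom (\<tau> \<cdot>\<^bsub>pmoncat_vert\<^esub> \<sigma>) = ndom \<sigma>" "ncod (\<tau> \<cdot>\<^bsub>pmoncat_vert\<^esub> \<sigma>) = ncod \<tau>"
  "a \<in> ob (fdom (ndom \<sigma>)) \<Longrightarrow>
    ncmp (\<tau> \<cdot>\<^bsub>pmoncat_vert\<^esub> \<sigma>) a = ncmp \<tau> a \<cdot>\<^bsub>fcod (ndom \<sigma>)\<^esub> ncmp \<sigma> a"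
  "ndom \<sigma> = F \<Longrightarrow> fdom F = C \<Longrightarrow> ncmp (\<tau> \<cdot>\<^bsub>pmoncat_vert\<^esub> \<sigma>) \<in> extensional (ob C)"
  by (simp_all add: pmoncat_vert_def)

lemma hcomp_pmonnat_simps [simp]:
  "ndom (hcomp_pmonnat \<tau> \<sigma>) = comp_pmonfun (ndom \<tau>) (ndom \<sigma>)"
  "ncod (hcomp_pmonnat \<tau> \<sigma>) = comp_pmonfun (ncod \<tau>) (ncod \<sigma>)"
  "a \<in> ob (fdom (ndom \<sigma>)) \<Longrightarrow> ncmp (hcomp_pmonnat \<tau> \<sigma>) a =
     ncmp \<tau> (fob (ncod \<sigma>) a) \<cdot>\<^bsub>fcod (ndom \<tau>)\<^esub> far (ndom \<tau>) (ncmp \<sigma> a)"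
  "ndom \<sigma> = F \<Longrightarrow> fdom F = C \<Longrightarrow> ncmp (hcomp_pmonnat \<tau> \<sigma>) \<in> extensional (ob C)"
  by (simp_all add: hcomp_pmonnat_def)

lemma id_pmnat:
  assumes "pmfun C D F"
  shows "pmnat C D F F (idn pmoncat_vert F)"
proof -
  interpret F: pointed_monoidal_functor C D F by fact
  note [simp] = F.fdom F.fcod
  show ?thesis
    by unfold_locales (auto simp: hom_iff)
qed

lemma vcomp_pmnat:
  fixes D (structure)
  assumes "pmnat C D F G \<sigma>" "pmnat C D G H \<tau>"
  shows "pmnat C D F H (\<tau> \<cdot>\<^bsub>pmoncat_vert\<^esub> \<sigma>)"
proof -
  interpret \<sigma>: pointed_monoidal_transformation C D F G \<sigma> by fact
  interpret \<tau>: pointed_monoidal_transformation C D G H \<tau> by fact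
  note [simp] = \<sigma>.F.fdom \<sigma>.F.fcod \<sigma>.ndom \<sigma>.ncod \<tau>.ndom \<tau>.ncod
  have 1: "ncmp \<tau> (tgt C f) \<cdot> ncmp \<sigma> (tgt C f) \<cdot> far F f = far H f \<cdot> ncmp \<tau> (src C f) \<cdot> ncmp \<sigma> (src C f)"
    if [simp]: "f \<in> ar C" for f
  proof -
    have "(ncmp \<tau> (tgt C f) \<cdot> ncmp \<sigma> (tgt C f)) \<cdot> far F f = (ncmp \<tau> (tgt C f) \<cdot> far G f) \<cdot> ncmp \<sigma> (src C f)"
      by (simp add: \<sigma>.ncmp_nat)
    then show ?thesis by (simp add: \<tau>.ncmp_nat)
  qed
  have 2: "ncmp \<tau> (a \<otimes>\<^bsub>C\<^esub> b) \<cdot> ncmp \<sigma> (a \<otimes>\<^bsub>C\<^esub> b) \<cdot> fmul F a b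
      = fmul H a b \<cdot> (ncmp \<tau> a \<cdot> ncmp \<sigma> a) \<otimes>\<^sub>a (ncmp \<tau> b \<cdot> ncmp \<sigma> b)"
    if [simp]: "a \<in> ob C" "b \<in> ob C" for a b
  proof -
    have "(ncmp \<tau> (a \<otimes>\<^bsub>C\<^esub> b) \<cdot> ncmp \<sigma> (a \<otimes>\<^bsub>C\<^esub> b)) \<cdot> fmul F a b
        = (ncmp \<tau> (a \<otimes>\<^bsub>C\<^esub> b) \<cdot> fmul G a b) \<cdot> ncmp \<sigma> a \<otimes>\<^sub>a ncmp \<sigma> b"
      by (simp add: \<sigma>.ncmp_fmul)
    then show ?thesis by (simp add: \<tau>.ncmp_fmul \<sigma>.F.D.tar_merge)
  qed
  have 3: "(fpt H \<cdot> ncmp \<tau> (pt C)) \<cdot> ncmp \<sigma> (pt C) = fpt F"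
    by (simp only: \<tau>.ncmp_fpt \<sigma>.ncmp_fpt)
  show ?thesis
    by unfold_locales
      (simp_all add: hom_iff 1 2 3[simplified] \<sigma>.ncmp_funit \<tau>.ncmp_funit)
qed

text \<open>Every axiom combines that of \<sigma>, taken under \<open>far G\<close>, with that of
  \<tau>; naturality of \<tau> at the structure arrows of \<open>F'\<close> exchanges
  \<open>far G\<close> for \<open>far G'\<close> in between.\<close>

lemma hcomp_pmnat:
  fixes E (structure)
  assumes "pmnat C D F F' \<sigma>" "pmnat D E G G' \<tau>"
  shows "pmnat C E (comp_pmonfun G F) (comp_pmonfun G' F') (hcomp_pmonnat \<tau> \<sigma>)"
proof -
  interpret \<sigma>: pointed_monoidal_transformation C D F F' \<sigma> by fact
  interpret \<tau>: pointed_monoidal_transformation D E G G' \<tau> by fact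
  interpret GF: pointed_monoidal_functor C E "comp_pmonfun G F"
    by (intro comp_pmfun) unfold_locales
  interpret GF': pointed_monoidal_functor C E "comp_pmonfun G' F'"
    by (intro comp_pmfun) unfold_locales
  note [simp] = \<sigma>.F.fdom \<sigma>.F.fcod \<sigma>.ndom \<sigma>.ncod \<tau>.ndom \<tau>.ncod \<sigma>.G.fdom \<sigma>.G.fcod
    \<tau>.F.fdom \<tau>.F.fcod \<tau>.G.fdom \<tau>.G.fcod
  let ?h = "\<lambda>a. ncmp \<tau> (fob F' a) \<cdot> far G (ncmp \<sigma> a)"
  have 1: "ncmp \<tau> (fob F' (tgt C f)) \<cdot> far G (ncmp \<sigma> (tgt C f)) \<cdot> far G (far F f)
      = far G' (far F' f) \<cdot> ?h (src C f)"
    if [simp]: "f \<in> ar C" for f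
  proof -
    have "?h (tgt C f) \<cdot> far G (far F f) = ncmp \<tau> (fob F' (tgt C f)) \<cdot> far G (ncmp \<sigma> (tgt C f) \<cdot>\<^bsub>D\<^esub> far F f)"
      by simp
    also have "\<dots> = (ncmp \<tau> (fob F' (tgt C f)) \<cdot> far G (far F' f)) \<cdot> far G (ncmp \<sigma> (src C f))"
      by (subst \<sigma>.ncmp_nat) auto
    finally show ?thesis by (simp add: \<tau>.ncmp_nat')
  qed
  have 2: "ncmp \<tau> (fob F' (a \<otimes>\<^bsub>C\<^esub> b)) \<cdot> far G (ncmp \<sigma> (a \<otimes>\<^bsub>C\<^esub> b)) \<cdot> far G (fmul F a b)
        \<cdot> fmul G (fob F a) (fob F b)
      = far G' (fmul F' a b) \<cdot> fmul G' (fob F' a) (fob F' b) \<cdot> ?h a \<otimes>\<^sub>a ?h b"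
    if [simp]: "a \<in> ob C" "b \<in> ob C" for a b
  proof -
    have "?h (a \<otimes>\<^bsub>C\<^esub> b) \<cdot> far G (fmul F a b) \<cdot> fmul G (fob F a) (fob F b)
        = ncmp \<tau> (fob F' (a \<otimes>\<^bsub>C\<^esub> b)) \<cdot> far G (ncmp \<sigma> (a \<otimes>\<^bsub>C\<^esub> b) \<cdot>\<^bsub>D\<^esub> fmul F a b) \<cdot> fmul G (fob F a) (fob F b)"
      by simp
    also have "\<dots> = ncmp \<tau> (fob F' (a \<otimes>\<^bsub>C\<^esub> b)) \<cdot> far G (fmul F' a b)
        \<cdot> far G (ncmp \<sigma> a \<otimes>\<^sub>a\<^bsub>D\<^esub> ncmp \<sigma> b) \<cdot> fmul G (fob F a) (fob F b)"
      by (subst \<sigma>.ncmp_fmul) auto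
    also have "\<dots> = (ncmp \<tau> (fob F' (a \<otimes>\<^bsub>C\<^esub> b)) \<cdot> far G (fmul F' a b))
        \<cdot> fmul G (fob F' a) (fob F' b) \<cdot> far G (ncmp \<sigma> a) \<otimes>\<^sub>a far G (ncmp \<sigma> b)"
      by (simp add: \<tau>.F.fmul_nat')
    also have "\<dots> = far G' (fmul F' a b) \<cdot> (ncmp \<tau> (fob F' a \<otimes>\<^bsub>D\<^esub> fob F' b)
        \<cdot> fmul G (fob F' a) (fob F' b)) \<cdot> far G (ncmp \<sigma> a) \<otimes>\<^sub>a far G (ncmp \<sigma> b)"
      by (simp add: \<tau>.ncmp_nat')
    also have "\<dots> = (far G' (fmul F' a b) \<cdot> fmul G' (fob F' a) (fob F' b)) \<cdot> ?h a \<otimes>\<^sub>a ?h b"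
      by (simp add: \<tau>.ncmp_fmul \<tau>.F.D.tar_merge)
    finally show ?thesis by simp
  qed
  have "?h (unit C) \<cdot> far G (funit F) \<cdot> funit G
      = (ncmp \<tau> (fob F' (unit C)) \<cdot> far G (ncmp \<sigma> (unit C) \<cdot>\<^bsub>D\<^esub> funit F)) \<cdot> funit G" by simp
  also have "\<dots> = far G' (funit F') \<cdot> funit G'"
    by (simp only: \<sigma>.ncmp_funit) (simp add: \<tau>.ncmp_nat' \<tau>.ncmp_funit)
  finally have 3: "?h (unit C) \<cdot> far G (funit F) \<cdot> funit G = far G' (funit F') \<cdot> funit G'" .
  have "(fpt G' \<cdot> far G' (fpt F')) \<cdot> ?h (pt C)
      = fpt G' \<cdot> (far G' (fpt F') \<cdot> ncmp \<tau> (fob F' (pt C))) \<cdot> far G (ncmp \<sigma> (pt C))" by simp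
  also have "\<dots> = (fpt G' \<cdot> ncmp \<tau> (pt D)) \<cdot> far G (fpt F' \<cdot>\<^bsub>D\<^esub> ncmp \<sigma> (pt C))"
    by (simp add: \<tau>.ncmp_nat')
  also have "\<dots> = fpt G \<cdot> far G (fpt F)"
    by (simp only: \<sigma>.ncmp_fpt \<tau>.ncmp_fpt)
  finally have 4: "(fpt G' \<cdot> far G' (fpt F')) \<cdot> ?h (pt C) = fpt G \<cdot> far G (fpt F)" .
  show ?thesis
    by unfold_locales
      (simp_all add: hom_iff 1 2 3[simplified] 4[simplified])
qed

lemma pmnatD: "pmnat C D F G \<sigma> \<Longrightarrow> pmfun C D F \<and> pmfun C D G \<and> ndom \<sigma> = F \<and> ncod \<sigma> = G"
  by (simp add: pointed_monoidal_transformation_def pointed_monoidal_transformation_axioms_def)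

lemma pmfunD: "pmfun C D F \<Longrightarrow> pmcat C \<and> pmcat D \<and> fdom F = C \<and> fcod F = D"
  by (simp add: pointed_monoidal_functor_def pointed_monoidal_functor_axioms_def)

lemma pmfun_self: "pmfun C D F \<Longrightarrow> pmfun (fdom F) (fcod F) F"
  by (frule pmfunD) simp

lemma pmnat_dom: "pmnat C D F G \<sigma> \<Longrightarrow> pmfun C D F"
  and pmnat_cod: "pmnat C D F G \<sigma> \<Longrightarrow> pmfun C D G"
  by (drule pmnatD, simp)+

lemma pmnat_fdom: "pmnat C D F G \<sigma> \<Longrightarrow> fdom G = C \<and> fcod G = D"
  by (blast dest: pmnat_cod pmfunD)

lemma pmnat_ar: "pmnat C D F G \<sigma> \<longleftrightarrow> \<sigma> \<in> ar pmoncat_vert \<and> ndom \<sigma> = F \<and> ncod \<sigma> = G \<and> fdom F = C \<and> fcod F = D"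
proof
  assume *: "pmnat C D F G \<sigma>"
  then have [simp]: "ndom \<sigma> = F" "ncod \<sigma> = G" "fdom F = C" "fcod F = D"
    using pmnatD[OF *] pmfunD[of C D F] by blast+
  show "\<sigma> \<in> ar pmoncat_vert \<and> ndom \<sigma> = F \<and> ncod \<sigma> = G \<and> fdom F = C \<and> fcod F = D"
    using * by simp
qed auto

lemma hom_vert: "hom pmoncat_vert F G = {\<sigma>. pmnat (fdom F) (fcod F) F G \<sigma>}"
  by (rule set_eqI) (simp del: pmoncat_vert_simps(4) add: hom_iff pmnat_ar)

lemma vcomp_assoc:
  assumes "pmnat C D F G f" "pmnat C D G H g" "pmnat C D H K h"
  shows "(h \<cdot>\<^bsub>pmoncat_vert\<^esub> g) \<cdot>\<^bsub>pmoncat_vert\<^esub> f = h \<cdot>\<^bsub>pmoncat_vert\<^esub> g \<cdot>\<^bsub>pmoncat_vert\<^esub> f"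
proof -
  interpret f: pointed_monoidal_transformation C D F G f by fact
  interpret g: pointed_monoidal_transformation C D G H g by fact
  interpret h: pointed_monoidal_transformation C D H K h by fact
  show ?thesis
    by (rule pmonnat_eqI[OF vcomp_pmnat[OF assms(1) vcomp_pmnat[OF assms(2,3)]]
        vcomp_pmnat[OF vcomp_pmnat[OF assms(1,2)] assms(3)]])
      (simp_all add: f.ndom g.ndom f.F.fdom f.F.fcod f.G.fdom f.G.fcod)
qed

lemma
  assumes "pmnat C D F G f"
  shows vcomp_idn_left: "idn pmoncat_vert G \<cdot>\<^bsub>pmoncat_vert\<^esub> f = f"
    and vcomp_idn_right: "f \<cdot>\<^bsub>pmoncat_vert\<^esub> idn pmoncat_vert F = f"
proof -
  interpret f: pointed_monoidal_transformation C D F G f by fact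
  show "idn pmoncat_vert G \<cdot>\<^bsub>pmoncat_vert\<^esub> f = f"
    by (rule pmonnat_eqI[OF vcomp_pmnat[OF assms id_pmnat[OF pmnat_cod[OF assms]]] assms])
      (simp add: f.ndom f.F.fdom f.F.fcod f.G.fdom f.G.fcod)
  show "f \<cdot>\<^bsub>pmoncat_vert\<^esub> idn pmoncat_vert F = f"
    by (rule pmonnat_eqI[OF vcomp_pmnat[OF id_pmnat[OF pmnat_dom[OF assms]] assms] assms])
      (simp add: f.ndom f.F.fdom f.F.fcod f.G.fdom f.G.fcod)
qed

lemma category_vert:
  "category (pmoncat_vert :: (('o, 'm, 'p, 'n) pmonfun, ('o, 'm, 'p, 'n) pmonnat) cat)"
proof unfold_locales
  fix f :: "('o, 'm, 'p, 'n) pmonnat" assume "f \<in> ar pmoncat_vert"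
  then have *: "pmnat (fdom (ndom f)) (fcod (ndom f)) (ndom f) (ncod f) f" by simp
  show "src pmoncat_vert f \<in> ob pmoncat_vert" "tgt pmoncat_vert f \<in> ob pmoncat_vert"
    using pmfun_self[OF pmnat_dom[OF *]] pmfun_self[OF pmnat_cod[OF *]] by simp_all
next
  fix F :: "('o, 'm, 'p, 'n) pmonfun" assume "F \<in> ob pmoncat_vert"
  then show "idn pmoncat_vert F \<in> hom pmoncat_vert F F" by (simp add: hom_vert id_pmnat)
next
  fix F G H :: "('o, 'm, 'p, 'n) pmonfun" and f g
  assume *: "f \<in> hom pmoncat_vert F G" "g \<in> hom pmoncat_vert G H"
  then show "g \<cdot>\<^bsub>pmoncat_vert\<^esub> f \<in> hom pmoncat_vert F H"
    using vcomp_pmnat[of "fdom F" "fcod F" F G f H g] pmnat_fdom[of _ _ F G f] by (auto simp: hom_vert)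
next
  fix F G H K :: "('o, 'm, 'p, 'n) pmonfun" and f g h
  assume a: "f \<in> hom pmoncat_vert F G" "g \<in> hom pmoncat_vert G H" "h \<in> hom pmoncat_vert H K"
  have "fdom G = fdom F \<and> fcod G = fcod F" "fdom H = fdom G \<and> fcod H = fcod G"
    using a(1,2) unfolding hom_vert mem_Collect_eq by (auto dest: pmnat_fdom)
  with a have *: "pmnat (fdom F) (fcod F) F G f" "pmnat (fdom F) (fcod F) G H g" "pmnat (fdom F) (fcod F) H K h"
    by (simp_all add: hom_vert)
  then show "(h \<cdot>\<^bsub>pmoncat_vert\<^esub> g) \<cdot>\<^bsub>pmoncat_vert\<^esub> f = h \<cdot>\<^bsub>pmoncat_vert\<^esub> g \<cdot>\<^bsub>pmoncat_vert\<^esub> f"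
    by (rule vcomp_assoc)
next
  fix F G :: "('o, 'm, 'p, 'n) pmonfun" and f
  assume "f \<in> hom pmoncat_vert F G"
  then have *: "pmnat (fdom F) (fcod F) F G f" by (simp add: hom_vert)
  then show "idn pmoncat_vert G \<cdot>\<^bsub>pmoncat_vert\<^esub> f = f" "f \<cdot>\<^bsub>pmoncat_vert\<^esub> idn pmoncat_vert F = f"
    by (rule vcomp_idn_left, rule vcomp_idn_right)
qed

lemma hcomp_assoc:
  assumes "pmnat A B F F' \<sigma>" "pmnat B C G G' \<tau>" "pmnat C D H H' \<rho>"
  shows "hcomp_pmonnat (hcomp_pmonnat \<rho> \<tau>) \<sigma> = hcomp_pmonnat \<rho> (hcomp_pmonnat \<tau> \<sigma>)"
proof (rule pmonnat_eqI)
  interpret \<sigma>: pointed_monoidal_transformation A B F F' \<sigma> by fact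
  interpret \<tau>: pointed_monoidal_transformation B C G G' \<tau> by fact
  interpret \<rho>: pointed_monoidal_transformation C D H H' \<rho> by fact
  note [simp] = \<sigma>.F.fdom \<sigma>.F.fcod \<sigma>.ndom \<sigma>.ncod \<tau>.ndom \<tau>.ncod \<sigma>.G.fdom \<sigma>.G.fcod \<rho>.ndom \<rho>.ncod
    \<tau>.F.fdom \<tau>.F.fcod \<tau>.G.fdom \<tau>.G.fcod \<rho>.F.fdom \<rho>.F.fcod \<rho>.G.fdom \<rho>.G.fcod
  note pf = \<sigma>.F.pointed_monoidal_functor_axioms \<tau>.F.pointed_monoidal_functor_axioms \<rho>.F.pointed_monoidal_functor_axioms
    \<sigma>.G.pointed_monoidal_functor_axioms \<tau>.G.pointed_monoidal_functor_axioms \<rho>.G.pointed_monoidal_functor_axioms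
  show "pmnat A D (comp_pmonfun H (comp_pmonfun G F)) (comp_pmonfun H' (comp_pmonfun G' F'))
      (hcomp_pmonnat (hcomp_pmonnat \<rho> \<tau>) \<sigma>)"
    using hcomp_pmnat[OF assms(1) hcomp_pmnat[OF assms(2,3)]]
    by (simp add: comp_pmonfun_assoc[OF pf(1-3)] comp_pmonfun_assoc[OF pf(4-6)])
  show "pmnat A D (comp_pmonfun H (comp_pmonfun G F)) (comp_pmonfun H' (comp_pmonfun G' F'))
      (hcomp_pmonnat \<rho> (hcomp_pmonnat \<tau> \<sigma>))"
    by (rule hcomp_pmnat[OF hcomp_pmnat[OF assms(1,2)] assms(3)])
  fix a assume "a \<in> ob A"
  then show "ncmp (hcomp_pmonnat (hcomp_pmonnat \<rho> \<tau>) \<sigma>) a = ncmp (hcomp_pmonnat \<rho> (hcomp_pmonnat \<tau> \<sigma>)) a"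
    by simp
qed

text \<open>Interchange is naturality of \<tau> at the components of
  \<open>\<sigma>'\<close>.\<close>

lemma hcomp_vcomp:
  assumes "pmnat A B F F' \<sigma>" "pmnat A B F' F'' \<sigma>'" "pmnat B C G G' \<tau>" "pmnat B C G' G'' \<tau>'"
  shows "hcomp_pmonnat (\<tau>' \<cdot>\<^bsub>pmoncat_vert\<^esub> \<tau>) (\<sigma>' \<cdot>\<^bsub>pmoncat_vert\<^esub> \<sigma>)
    = hcomp_pmonnat \<tau>' \<sigma>' \<cdot>\<^bsub>pmoncat_vert\<^esub> hcomp_pmonnat \<tau> \<sigma>"
proof (rule pmonnat_eqI)
  interpret \<sigma>: pointed_monoidal_transformation A B F F' \<sigma> by fact
  interpret \<tau>: pointed_monoidal_transformation B C G G' \<tau> by fact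
  interpret \<sigma>': pointed_monoidal_transformation A B F' F'' \<sigma>' by fact
  interpret \<tau>': pointed_monoidal_transformation B C G' G'' \<tau>' by fact
  note [simp] = \<sigma>.F.fdom \<sigma>.F.fcod \<sigma>.ndom \<sigma>.ncod \<tau>.ndom \<tau>.ncod \<sigma>.G.fdom \<sigma>.G.fcod
    \<tau>.F.fdom \<tau>.F.fcod \<tau>.G.fdom \<tau>.G.fcod \<sigma>'.ndom \<sigma>'.ncod \<tau>'.ndom \<tau>'.ncod
  show "pmnat A C (comp_pmonfun G F) (comp_pmonfun G'' F'')
      (hcomp_pmonnat (\<tau>' \<cdot>\<^bsub>pmoncat_vert\<^esub> \<tau>) (\<sigma>' \<cdot>\<^bsub>pmoncat_vert\<^esub> \<sigma>))"
    "pmnat A C (comp_pmonfun G F) (comp_pmonfun G'' F'')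
      (hcomp_pmonnat \<tau>' \<sigma>' \<cdot>\<^bsub>pmoncat_vert\<^esub> hcomp_pmonnat \<tau> \<sigma>)"
    by (rule hcomp_pmnat[OF vcomp_pmnat[OF assms(1,2)] vcomp_pmnat[OF assms(3,4)]]
        vcomp_pmnat[OF hcomp_pmnat[OF assms(1,3)] hcomp_pmnat[OF assms(2,4)]])+
  fix a assume [simp]: "a \<in> ob A"
  show "ncmp (hcomp_pmonnat (\<tau>' \<cdot>\<^bsub>pmoncat_vert\<^esub> \<tau>) (\<sigma>' \<cdot>\<^bsub>pmoncat_vert\<^esub> \<sigma>)) a
      = ncmp (hcomp_pmonnat \<tau>' \<sigma>' \<cdot>\<^bsub>pmoncat_vert\<^esub> hcomp_pmonnat \<tau> \<sigma>) a"
    by (simp add: \<tau>.ncmp_nat')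
qed

lemma hcomp_idn:
  assumes "pmfun A B F" "pmfun B C G"
  shows "hcomp_pmonnat (idn pmoncat_vert G) (idn pmoncat_vert F) = idn pmoncat_vert (comp_pmonfun G F)"
proof (rule pmonnat_eqI)
  interpret F: pointed_monoidal_functor A B F by fact
  interpret G: pointed_monoidal_functor B C G by fact
  show "pmnat A C (comp_pmonfun G F) (comp_pmonfun G F) (hcomp_pmonnat (idn pmoncat_vert G) (idn pmoncat_vert F))"
    "pmnat A C (comp_pmonfun G F) (comp_pmonfun G F) (idn pmoncat_vert (comp_pmonfun G F))"
    by (rule hcomp_pmnat[OF id_pmnat[OF assms(1)] id_pmnat[OF assms(2)]] id_pmnat[OF comp_pmfun[OF assms]])+
  fix a assume "a \<in> ob A"
  then show "ncmp (hcomp_pmonnat (idn pmoncat_vert G) (idn pmoncat_vert F)) a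
      = ncmp (idn pmoncat_vert (comp_pmonfun G F)) a"
    by (simp add: F.fdom F.fcod G.fdom G.fcod)
qed

lemma hcomp_idn_left:
  assumes "pmnat A B F F' \<sigma>"
  shows "hcomp_pmonnat (idn pmoncat_vert (id_pmonfun B)) \<sigma> = \<sigma>"
    and "hcomp_pmonnat \<sigma> (idn pmoncat_vert (id_pmonfun A)) = \<sigma>"
proof -
  interpret \<sigma>: pointed_monoidal_transformation A B F F' \<sigma> by fact
  note pf = \<sigma>.F.pointed_monoidal_functor_axioms \<sigma>.G.pointed_monoidal_functor_axioms
  note [simp] = \<sigma>.F.fdom \<sigma>.F.fcod \<sigma>.ndom \<sigma>.ncod \<sigma>.G.fdom \<sigma>.G.fcod
    pf[THEN comp_pmonfun_id_left] pf[THEN comp_pmonfun_id_right]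
  show "hcomp_pmonnat (idn pmoncat_vert (id_pmonfun B)) \<sigma> = \<sigma>"
    using hcomp_pmnat[OF assms id_pmnat[OF \<sigma>.F.D.id_pmfun]] assms by (intro pmonnat_eqI) auto
  show "hcomp_pmonnat \<sigma> (idn pmoncat_vert (id_pmonfun A)) = \<sigma>"
    using hcomp_pmnat[OF id_pmnat[OF \<sigma>.F.C.id_pmfun] assms] assms by (intro pmonnat_eqI) auto
qed

lemma JJ_simps [simp]:
  "cell0 JJ = {C. pmcat C}" "vert JJ = pmoncat_vert" "src0 JJ = fdom" "tgt0 JJ = fcod"
  "one JJ = id_pmonfun" "hcmp1 JJ = comp_pmonfun" "hcmp2 JJ = hcomp_pmonnat"
  by (simp_all add: JJ_def)

lemma cell1_JJ [simp]: "F \<in> cell1 JJ X Y \<longleftrightarrow> pmfun X Y F"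
  using pmfunD by (auto simp: cell1_def)

lemma cell2_JJ: "F \<in> cell1 JJ X Y \<Longrightarrow> cell2 JJ F G = {\<sigma>. pmnat X Y F G \<sigma>}"
  using pmfunD[of X Y F] by (auto simp: hom_vert)

theorem two_category_JJ: "two_category (JJ :: ('u pmc, 'u pmf, 'u pmn) twocat)"
proof (rule two_category.intro)
  note [simp del] = pmoncat_vert_simps(4)
  show "category (vert (JJ :: ('u pmc, 'u pmf, 'u pmn) twocat))"
    by (simp add: category_vert)
  fix f f' f'' g g' g'' h h' :: "'u pmf" and \<alpha> \<alpha>' \<beta> \<beta>' \<gamma> :: "'u pmn" and W X Y Z :: "'u pmc"
  { assume "f \<in> ob (vert JJ)"
    then show "src0 JJ f \<in> cell0 JJ" "tgt0 JJ f \<in> cell0 JJ"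
      using pmfunD[of "fdom f" "fcod f" f] by auto }
  { assume "\<alpha> \<in> cell2 JJ f f'"
    then show "src0 JJ f = src0 JJ f' \<and> tgt0 JJ f = tgt0 JJ f'"
      using pmnat_fdom[of "fdom f" "fcod f" f f' \<alpha>] by (simp add: hom_vert) }
  { assume "X \<in> cell0 JJ"
    then show "one JJ X \<in> cell1 JJ X X" by (simp add: pointed_monoidal_category.id_pmfun) }
  { assume fg: "f \<in> cell1 JJ X Y" "g \<in> cell1 JJ Y Z"
    then show "g \<bullet>\<^bsub>JJ\<^esub> f \<in> cell1 JJ X Z" by (auto intro: comp_pmfun)
    show "one2 JJ g \<star>\<^bsub>JJ\<^esub> one2 JJ f = one2 JJ (g \<bullet>\<^bsub>JJ\<^esub> f)"
      using fg by (simp add: hcomp_idn)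
    { assume "\<alpha> \<in> cell2 JJ f f'" "\<beta> \<in> cell2 JJ g g'"
      then have "pmnat X Y f f' \<alpha>" "pmnat Y Z g g' \<beta>" using fg by (simp_all add: cell2_JJ del: JJ_simps cell1_JJ)
      from hcomp_pmnat[OF this] show "\<beta> \<star>\<^bsub>JJ\<^esub> \<alpha> \<in> cell2 JJ (g \<bullet>\<^bsub>JJ\<^esub> f) (g' \<bullet>\<^bsub>JJ\<^esub> f')"
        by (simp add: hom_iff pmnat_ar) }
    { assume "\<alpha> \<in> cell2 JJ f f'" "\<alpha>' \<in> cell2 JJ f' f''" "\<beta> \<in> cell2 JJ g g'" "\<beta>' \<in> cell2 JJ g' g''"
      moreover from this have "f' \<in> cell1 JJ X Y" "g' \<in> cell1 JJ Y Z"
        using fg by (auto simp: cell2_JJ simp del: JJ_simps cell1_JJ) (auto intro: pmnat_cod)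
      ultimately have "pmnat X Y f f' \<alpha>" "pmnat X Y f' f'' \<alpha>'" "pmnat Y Z g g' \<beta>" "pmnat Y Z g' g'' \<beta>'"
        using fg by (simp_all add: cell2_JJ del: JJ_simps cell1_JJ)
      from hcomp_vcomp[OF this]
      show "(\<beta>' \<odot>\<^bsub>JJ\<^esub> \<beta>) \<star>\<^bsub>JJ\<^esub> (\<alpha>' \<odot>\<^bsub>JJ\<^esub> \<alpha>) = (\<beta>' \<star>\<^bsub>JJ\<^esub> \<alpha>') \<odot>\<^bsub>JJ\<^esub> (\<beta> \<star>\<^bsub>JJ\<^esub> \<alpha>)" by simp } }
  { assume fgh: "f \<in> cell1 JJ W X" "g \<in> cell1 JJ X Y" "h \<in> cell1 JJ Y Z"
    then show "(h \<bullet>\<^bsub>JJ\<^esub> g) \<bullet>\<^bsub>JJ\<^esub> f = h \<bullet>\<^bsub>JJ\<^esub> (g \<bullet>\<^bsub>JJ\<^esub> f)" by (auto intro: comp_pmonfun_assoc)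
    assume "\<alpha> \<in> cell2 JJ f f'" "\<beta> \<in> cell2 JJ g g'" "\<gamma> \<in> cell2 JJ h h'"
    then have "pmnat W X f f' \<alpha>" "pmnat X Y g g' \<beta>" "pmnat Y Z h h' \<gamma>"
      using fgh by (simp_all add: cell2_JJ del: JJ_simps cell1_JJ)
    from hcomp_assoc[OF this] show "(\<gamma> \<star>\<^bsub>JJ\<^esub> \<beta>) \<star>\<^bsub>JJ\<^esub> \<alpha> = \<gamma> \<star>\<^bsub>JJ\<^esub> (\<beta> \<star>\<^bsub>JJ\<^esub> \<alpha>)" by simp }
  { assume f: "f \<in> cell1 JJ X Y"
    then show "one JJ Y \<bullet>\<^bsub>JJ\<^esub> f = f" "f \<bullet>\<^bsub>JJ\<^esub> one JJ X = f"
      by (simp_all add: comp_pmonfun_id_left comp_pmonfun_id_right)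
    assume "\<alpha> \<in> cell2 JJ f f'"
    then have "pmnat X Y f f' \<alpha>" using f by (simp add: cell2_JJ del: JJ_simps cell1_JJ)
    from hcomp_idn_left[OF this]
    show "one2 JJ (one JJ Y) \<star>\<^bsub>JJ\<^esub> \<alpha> = \<alpha>" "\<alpha> \<star>\<^bsub>JJ\<^esub> one2 JJ (one JJ X) = \<alpha>" by simp_all }
qed

text \<open>The inverses of the components satisfy the axioms of a 2-cell automatically: each axiom
  of \<sigma>, composed with inverse components, is the same axiom in the opposite
  direction.\<close>

lemma isos_vertI:
  fixes D (structure)
  assumes "pmnat C D F G \<sigma>" "\<And>a. a \<in> ob C \<Longrightarrow> isos D (ncmp \<sigma> a)"
  shows "isos pmoncat_vert \<sigma>"
proof -
  interpret \<sigma>: pointed_monoidal_transformation C D F G \<sigma> by fact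
  note [simp] = assms(2) \<sigma>.ndom \<sigma>.ncod \<sigma>.F.fdom \<sigma>.F.fcod \<sigma>.G.fdom \<sigma>.G.fcod
  interpret V: category "pmoncat_vert :: (('a, 'b, 'c, 'd) pmonfun, ('a, 'b, 'c, 'd) pmonnat) cat"
    by (rule category_vert)
  define \<tau> where "\<tau> = \<lparr>ndom = G, ncod = F, ncmp = (\<lambda>a\<in>ob C. inv_ar D (ncmp \<sigma> a))\<rparr>"
  have \<tau>: "pmnat C D G F \<tau>"
  proof unfold_locales
    fix f a b assume "f \<in> hom C a b"
    then have [simp]: "f \<in> ar C" "src C f = a" "tgt C f = b" "a \<in> ob C" "b \<in> ob C" by (auto simp: hom_iff)
    have "ncmp \<sigma> b \<cdot> far F f \<cdot> inv_ar D (ncmp \<sigma> a) = far G f"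
      using \<sigma>.ncmp_nat[of f] by (simp flip: \<sigma>.F.D.cmp_assoc')  (simp add: \<sigma>.F.D.inv_eq_right)
    then show "ncmp \<tau> b \<cdot> far G f = far F f \<cdot> ncmp \<tau> a"
      by (simp add: \<tau>_def \<sigma>.F.D.inv_eq_left)
  next
    fix a b assume [simp]: "a \<in> ob C" "b \<in> ob C"
    have "ncmp \<sigma> (a \<otimes>\<^bsub>C\<^esub> b) \<cdot> fmul F a b \<cdot> inv_ar D (ncmp \<sigma> a) \<otimes>\<^sub>a inv_ar D (ncmp \<sigma> b)
        = (ncmp \<sigma> (a \<otimes>\<^bsub>C\<^esub> b) \<cdot> fmul F a b) \<cdot> inv_ar D (ncmp \<sigma> a) \<otimes>\<^sub>a inv_ar D (ncmp \<sigma> b)"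
      by simp
    also have "\<dots> = fmul G a b" by (subst \<sigma>.ncmp_fmul) (auto simp: \<sigma>.F.D.tar_merge)
    finally show "ncmp \<tau> (a \<otimes>\<^bsub>C\<^esub> b) \<cdot> fmul G a b = fmul F a b \<cdot> ncmp \<tau> a \<otimes>\<^sub>a ncmp \<tau> b"
      by (simp add: \<tau>_def \<sigma>.F.D.inv_eq_left)
  next
    show "ncmp \<tau> (unit C) \<cdot> funit G = funit F"
      by (simp add: \<tau>_def \<sigma>.F.D.inv_eq_left \<sigma>.ncmp_funit)
    show "fpt F \<cdot> ncmp \<tau> (pt C) = fpt G"
      by (simp add: \<tau>_def \<sigma>.F.D.inv_eq_right \<sigma>.ncmp_fpt)
  qed (auto simp: \<tau>_def hom_iff)
  moreover from this interpret \<tau>: pointed_monoidal_transformation C D G F \<tau> .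
  have "\<tau> \<cdot>\<^bsub>pmoncat_vert\<^esub> \<sigma> = idn pmoncat_vert F" "\<sigma> \<cdot>\<^bsub>pmoncat_vert\<^esub> \<tau> = idn pmoncat_vert G"
    by (rule pmonnat_eqI[OF vcomp_pmnat[OF assms(1) \<tau>] id_pmnat[OF pmnat_dom[OF assms(1)]]]
        pmonnat_eqI[OF vcomp_pmnat[OF \<tau> assms(1)] id_pmnat[OF pmnat_cod[OF assms(1)]]];
      simp add: \<tau>_def)+
  ultimately show ?thesis
    using assms(1) by (intro V.isosI(1)[of \<sigma> \<tau>]) (auto simp: \<tau>_def)
qed

section \<open>Biadjunctions from free objects\<close>

lemma full_subcat_simps [simp]:
  "ob (full_subcat C A) = ob C \<inter> A" "ar (full_subcat C A) = {f \<in> ar C. src C f \<in> A \<and> tgt C f \<in> A}"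
  "src (full_subcat C A) = src C" "tgt (full_subcat C A) = tgt C"
  "idn (full_subcat C A) = idn C" "cmp (full_subcat C A) = cmp C"
  by (simp_all add: full_subcat_def)

lemma full_subcat_category:
  assumes "category C"
  shows "category (full_subcat C A)"
proof -
  interpret category C by fact
  show ?thesis by unfold_locales (auto simp: hom_iff)
qed

lemma isos_full_subcat:
  "isos (full_subcat C A) f \<longleftrightarrow> isos C f \<and> src C f \<in> A \<and> tgt C f \<in> A"
  by (auto simp: isos_def inverse_pair_def hom_iff)

text \<open>\<open>is_equivalence\<close> asks for a functor back. Its object part is chosen by
  essential surjectivity and its arrow part is the unique preimage of a conjugate, so that
  functoriality and naturality can be verified after applying \<open>Fa\<close>, which is
  faithful.\<close>

lemma equivalenceI:
  assumes "is_functor C D Fo Fa"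
    and es: "\<And>b. b \<in> ob D \<Longrightarrow> \<exists>a\<in>ob C. iso D b (Fo a) \<noteq> {}"
    and ff: "\<And>a a' g. a \<in> ob C \<Longrightarrow> a' \<in> ob C \<Longrightarrow> g \<in> hom D (Fo a) (Fo a') \<Longrightarrow> \<exists>!f. f \<in> hom C a a' \<and> Fa f = g"
  shows "is_equivalence C D Fo Fa"
proof -
  interpret C: category C using assms(1) by (simp add: is_functor_def)
  interpret D: category D using assms(1) by (simp add: is_functor_def)
  have F [simp]: "\<And>a. a \<in> ob C \<Longrightarrow> Fo a \<in> ob D" "\<And>f. f \<in> ar C \<Longrightarrow> Fa f \<in> ar D"
     "\<And>f. f \<in> ar C \<Longrightarrow> src D (Fa f) = Fo (src C f)" "\<And>f. f \<in> ar C \<Longrightarrow> tgt D (Fa f) = Fo (tgt C f)"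
     "\<And>a. a \<in> ob C \<Longrightarrow> Fa (idn C a) = idn D (Fo a)"
     "\<And>f g. f \<in> ar C \<Longrightarrow> g \<in> ar C \<Longrightarrow> src C g = tgt C f \<Longrightarrow> Fa (g \<cdot>\<^bsub>C\<^esub> f) = Fa g \<cdot>\<^bsub>D\<^esub> Fa f"
    using assms(1) by (auto simp: is_functor_def hom_iff)
  have faithful: "f = f'" if "f \<in> ar C" "f' \<in> ar C" "src C f = src C f'" "tgt C f = tgt C f'" "Fa f = Fa f'" for f f'
    using ff[of "src C f" "tgt C f" "Fa f"] that by (auto simp: hom_iff)
  define L where "L a a' g = (THE f. f \<in> hom C a a' \<and> Fa f = g)" for a a' g
  have L [simp]: "L a a' g \<in> ar C" "src C (L a a' g) = a" "tgt C (L a a' g) = a'" "Fa (L a a' g) = g"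
    if "a \<in> ob C" "a' \<in> ob C" "g \<in> ar D" "src D g = Fo a" "tgt D g = Fo a'" for a a' g
  proof -
    have "g \<in> hom D (Fo a) (Fo a')" using that by (simp add: hom_iff)
    from theI'[OF ff[OF that(1,2) this]]
    have *: "L a a' g \<in> hom C a a' \<and> Fa (L a a' g) = g" unfolding L_def .
    then show "L a a' g \<in> ar C" "src C (L a a' g) = a" "tgt C (L a a' g) = a'" "Fa (L a a' g) = g"
      by (simp_all add: hom_iff)
  qed
  define Go where "Go b = (SOME a. a \<in> ob C \<and> iso D b (Fo a) \<noteq> {})" for b
  define n where "n b = (SOME f. f \<in> iso D b (Fo (Go b)))" for b
  have Go: "Go b \<in> ob C \<and> iso D b (Fo (Go b)) \<noteq> {}" if "b \<in> ob D" for b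
    unfolding Go_def by (rule someI_ex[OF es[OF that, unfolded Bex_def]])
  have n [simp]: "Go b \<in> ob C" "n b \<in> ar D" "src D (n b) = b" "tgt D (n b) = Fo (Go b)" "isos D (n b)"
    if "b \<in> ob D" for b
  proof -
    have "n b \<in> iso D b (Fo (Go b))" unfolding n_def using Go[OF that] by (simp add: some_in_eq)
    then show "Go b \<in> ob C" "n b \<in> ar D" "src D (n b) = b" "tgt D (n b) = Fo (Go b)" "isos D (n b)"
      using Go[OF that] by (simp_all add: iso_iff)
  qed
  define Ga where "Ga g = L (Go (src D g)) (Go (tgt D g)) (n (tgt D g) \<cdot>\<^bsub>D\<^esub> g \<cdot>\<^bsub>D\<^esub> inv_ar D (n (src D g)))" for g
  have Ga [simp]: "Ga g \<in> ar C" "src C (Ga g) = Go (src D g)" "tgt C (Ga g) = Go (tgt D g)"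
    "Fa (Ga g) = n (tgt D g) \<cdot>\<^bsub>D\<^esub> g \<cdot>\<^bsub>D\<^esub> inv_ar D (n (src D g))" if "g \<in> ar D" for g
    using that by (simp_all add: Ga_def)
  have "is_functor D C Go Ga"
    unfolding is_functor_def using C.category_axioms D.category_axioms by (auto simp: hom_iff intro!: faithful)
  moreover have "naturally_isomorphic C C (Go \<circ> Fo) (Ga \<circ> Fa) (\<lambda>a. a) (\<lambda>f. f)"
    unfolding naturally_isomorphic_def
  \<comment> \<open>The component at \<open>a\<close> is the preimage of the inverse of
    \<open>n (Fo a)\<close>; the preimage of \<open>n (Fo a)\<close> inverts it.\<close>
  proof (intro exI[of _ "\<lambda>a. L (Go (Fo a)) a (inv_ar D (n (Fo a)))"] conjI ballI)
    fix a assume [simp]: "a \<in> ob C"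
    show "L (Go (Fo a)) a (inv_ar D (n (Fo a))) \<in> iso C ((Go \<circ> Fo) a) a"
      by (auto simp: iso_iff intro!: faithful C.isosI(1)[of _ "L a (Go (Fo a)) (n (Fo a))"])
  qed (auto intro!: faithful)
  moreover have "naturally_isomorphic D D (Fo \<circ> Go) (Fa \<circ> Ga) (\<lambda>a. a) (\<lambda>f. f)"
    unfolding naturally_isomorphic_def
    by (rule exI[of _ "\<lambda>b. inv_ar D (n b)"]) (auto simp: iso_iff)
  ultimately show ?thesis using assms(1) unfolding is_equivalence_def by blast
qed

section \<open>Whiskering in a strict 2-category\<close>

definition whisker_left :: "('z, 'f, 't) twocat \<Rightarrow> 'f \<Rightarrow> 't \<Rightarrow> 't"  (infixr "\<rhd>\<index>" 73) where
  "f \<rhd>\<^bsub>T\<^esub> \<alpha> = hcmp2 T (one2 T f) \<alpha>"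

definition whisker_right :: "('z, 'f, 't) twocat \<Rightarrow> 't \<Rightarrow> 'f \<Rightarrow> 't"  (infixl "\<lhd>\<index>" 74) where
  "\<alpha> \<lhd>\<^bsub>T\<^esub> f = hcmp2 T \<alpha> (one2 T f)"

sublocale two_category \<subseteq> V: category "vert T"
  by (rule vert_category)

context two_category
begin

abbreviation "obj \<equiv> ob (vert T)"
abbreviation "arr \<equiv> ar (vert T)"
abbreviation "dom2 \<equiv> src (vert T)"
abbreviation "cod2 \<equiv> tgt (vert T)"
abbreviation "isos2 \<equiv> isos (vert T)"

lemma cell1_iff: "f \<in> cell1 T X Y \<longleftrightarrow> f \<in> obj \<and> src0 T f = X \<and> tgt0 T f = Y"
  by (auto simp: cell1_def)

declare src0_cell0 [simp] tgt0_cell0 [simp]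

lemma globular' [simp]:
  "\<alpha> \<in> arr \<Longrightarrow> src0 T (cod2 \<alpha>) = src0 T (dom2 \<alpha>)" "\<alpha> \<in> arr \<Longrightarrow> tgt0 T (cod2 \<alpha>) = tgt0 T (dom2 \<alpha>)"
  using globular[of \<alpha> "dom2 \<alpha>" "cod2 \<alpha>"] by (auto simp: hom_iff)

lemma one_simps [simp]:
  "X \<in> cell0 T \<Longrightarrow> one T X \<in> obj" "X \<in> cell0 T \<Longrightarrow> src0 T (one T X) = X" "X \<in> cell0 T \<Longrightarrow> tgt0 T (one T X) = X"
  using one_cell1[of X] by (auto simp: cell1_iff)

lemma hcmp1_simps [simp]:
  assumes "f \<in> obj" "g \<in> obj" "src0 T g = tgt0 T f"
  shows "g \<bullet> f \<in> obj" "src0 T (g \<bullet> f) = src0 T f" "tgt0 T (g \<bullet> f) = tgt0 T g"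
  using hcmp1_cell1[of f "src0 T f" "tgt0 T f" g "tgt0 T g"] assms by (auto simp: cell1_iff)

lemma hcmp2_simps:
  assumes "\<alpha> \<in> arr" "\<beta> \<in> arr" "src0 T (dom2 \<beta>) = tgt0 T (dom2 \<alpha>)"
  shows "\<beta> \<star> \<alpha> \<in> arr" "dom2 (\<beta> \<star> \<alpha>) = dom2 \<beta> \<bullet> dom2 \<alpha>" "cod2 (\<beta> \<star> \<alpha>) = cod2 \<beta> \<bullet> cod2 \<alpha>"
  using hcmp2_cell2[of "dom2 \<alpha>" _ _ "dom2 \<beta>" _ \<alpha> "cod2 \<alpha>" \<beta> "cod2 \<beta>"] assms by (auto simp: cell1_iff hom_iff)

lemma hcmp1_assoc' [simp]:
  "f \<in> obj \<Longrightarrow> g \<in> obj \<Longrightarrow> h \<in> obj \<Longrightarrow> src0 T g = tgt0 T f \<Longrightarrow> src0 T h = tgt0 T g \<Longrightarrow>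
    (h \<bullet> g) \<bullet> f = h \<bullet> g \<bullet> f"
  by (rule hcmp1_assoc) (auto simp: cell1_iff)

lemma hcmp1_one' [simp]:
  "f \<in> obj \<Longrightarrow> tgt0 T f = X \<Longrightarrow> one T X \<bullet> f = f" "f \<in> obj \<Longrightarrow> src0 T f = X \<Longrightarrow> f \<bullet> one T X = f"
  by (rule hcmp1_one_left hcmp1_one_right, auto simp: cell1_iff)+

lemma hcmp2_assoc':
  "\<alpha> \<in> arr \<Longrightarrow> \<beta> \<in> arr \<Longrightarrow> \<gamma> \<in> arr \<Longrightarrow> src0 T (dom2 \<beta>) = tgt0 T (dom2 \<alpha>) \<Longrightarrow>
    src0 T (dom2 \<gamma>) = tgt0 T (dom2 \<beta>) \<Longrightarrow> (\<gamma> \<star> \<beta>) \<star> \<alpha> = \<gamma> \<star> \<beta> \<star> \<alpha>"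
  by (rule hcmp2_assoc[of "dom2 \<alpha>" _ _ "dom2 \<beta>" _ "dom2 \<gamma>" _ _ "cod2 \<alpha>" _ "cod2 \<beta>" _ "cod2 \<gamma>"])
    (auto simp: cell1_iff hom_iff)

lemma one2_hcmp1: "f \<in> obj \<Longrightarrow> g \<in> obj \<Longrightarrow> src0 T g = tgt0 T f \<Longrightarrow> one2 T (g \<bullet> f) = one2 T g \<star> one2 T f"
  by (subst hcmp2_one2) (auto simp: cell1_iff)

lemma interchange':
  assumes "\<alpha> \<in> arr" "\<alpha>' \<in> arr" "\<beta> \<in> arr" "\<beta>' \<in> arr" "dom2 \<alpha>' = cod2 \<alpha>" "dom2 \<beta>' = cod2 \<beta>"
    "src0 T (dom2 \<beta>) = tgt0 T (dom2 \<alpha>)"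
  shows "(\<beta>' \<odot> \<beta>) \<star> (\<alpha>' \<odot> \<alpha>) = (\<beta>' \<star> \<alpha>') \<odot> (\<beta> \<star> \<alpha>)"
  by (rule interchange[of "dom2 \<alpha>" _ _ "dom2 \<beta>" _ \<alpha> "cod2 \<alpha>" \<alpha>' "cod2 \<alpha>'" \<beta> "cod2 \<beta>" \<beta>' "cod2 \<beta>'"])
    (use assms in \<open>auto simp: cell1_iff hom_iff\<close>)

lemma whisker_left_simps [simp]:
  assumes "f \<in> obj" "\<alpha> \<in> arr" "src0 T f = tgt0 T (dom2 \<alpha>)"
  shows "f \<rhd> \<alpha> \<in> arr" "dom2 (f \<rhd> \<alpha>) = f \<bullet> dom2 \<alpha>" "cod2 (f \<rhd> \<alpha>) = f \<bullet> cod2 \<alpha>"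
  using assms by (auto simp: whisker_left_def hcmp2_simps)

lemma whisker_right_simps [simp]:
  assumes "f \<in> obj" "\<alpha> \<in> arr" "src0 T (dom2 \<alpha>) = tgt0 T f"
  shows "\<alpha> \<lhd> f \<in> arr" "dom2 (\<alpha> \<lhd> f) = dom2 \<alpha> \<bullet> f" "cod2 (\<alpha> \<lhd> f) = cod2 \<alpha> \<bullet> f"
  using assms by (auto simp: whisker_right_def hcmp2_simps)

lemma whisker_left_cmp [simp]:
  "f \<in> obj \<Longrightarrow> \<alpha> \<in> arr \<Longrightarrow> \<beta> \<in> arr \<Longrightarrow> dom2 \<beta> = cod2 \<alpha> \<Longrightarrow> src0 T f = tgt0 T (dom2 \<alpha>) \<Longrightarrow>
    f \<rhd> (\<beta> \<odot> \<alpha>) = (f \<rhd> \<beta>) \<odot> (f \<rhd> \<alpha>)"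
  unfolding whisker_left_def by (subst interchange'[symmetric]) auto

lemma whisker_right_cmp [simp]:
  "f \<in> obj \<Longrightarrow> \<alpha> \<in> arr \<Longrightarrow> \<beta> \<in> arr \<Longrightarrow> dom2 \<beta> = cod2 \<alpha> \<Longrightarrow> src0 T (dom2 \<alpha>) = tgt0 T f \<Longrightarrow>
    (\<beta> \<odot> \<alpha>) \<lhd> f = (\<beta> \<lhd> f) \<odot> (\<alpha> \<lhd> f)"
  unfolding whisker_right_def by (subst interchange'[symmetric]) auto

lemma whisker_one2 [simp]:
  "f \<in> obj \<Longrightarrow> g \<in> obj \<Longrightarrow> src0 T g = tgt0 T f \<Longrightarrow> g \<rhd> one2 T f = one2 T (g \<bullet> f)"
  "f \<in> obj \<Longrightarrow> g \<in> obj \<Longrightarrow> src0 T g = tgt0 T f \<Longrightarrow> one2 T g \<lhd> f = one2 T (g \<bullet> f)"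
  by (simp_all add: whisker_left_def whisker_right_def one2_hcmp1)

lemma whisker_one [simp]:
  "\<alpha> \<in> arr \<Longrightarrow> tgt0 T (dom2 \<alpha>) = X \<Longrightarrow> one T X \<rhd> \<alpha> = \<alpha>"
  "\<alpha> \<in> arr \<Longrightarrow> src0 T (dom2 \<alpha>) = X \<Longrightarrow> \<alpha> \<lhd> one T X = \<alpha>"
  unfolding whisker_left_def whisker_right_def
  by (rule hcmp2_one_left[of "dom2 \<alpha>" _ _ _ "cod2 \<alpha>"] hcmp2_one_right[of "dom2 \<alpha>" _ _ _ "cod2 \<alpha>"],
      auto simp: cell1_iff hom_iff)+

lemma whisker_left_left [simp]:
  "f \<in> obj \<Longrightarrow> g \<in> obj \<Longrightarrow> \<alpha> \<in> arr \<Longrightarrow> src0 T f = tgt0 T (dom2 \<alpha>) \<Longrightarrow> src0 T g = tgt0 T f \<Longrightarrow>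
    g \<rhd> f \<rhd> \<alpha> = (g \<bullet> f) \<rhd> \<alpha>"
  by (simp add: whisker_left_def one2_hcmp1 hcmp2_assoc')

lemma whisker_right_right [simp]:
  "f \<in> obj \<Longrightarrow> g \<in> obj \<Longrightarrow> \<alpha> \<in> arr \<Longrightarrow> src0 T (dom2 \<alpha>) = tgt0 T f \<Longrightarrow> src0 T f = tgt0 T g \<Longrightarrow>
    \<alpha> \<lhd> f \<lhd> g = \<alpha> \<lhd> (f \<bullet> g)"
  by (simp add: whisker_right_def one2_hcmp1 hcmp2_assoc')

lemma whisker_left_right [simp]:
  "f \<in> obj \<Longrightarrow> g \<in> obj \<Longrightarrow> \<alpha> \<in> arr \<Longrightarrow> src0 T (dom2 \<alpha>) = tgt0 T f \<Longrightarrow> src0 T g = tgt0 T (dom2 \<alpha>) \<Longrightarrow>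
    (g \<rhd> \<alpha>) \<lhd> f = g \<rhd> (\<alpha> \<lhd> f)"
  by (simp add: whisker_left_def whisker_right_def hcmp2_assoc')

text \<open>Whiskerings have a normal form under simplification, general horizontal composites do
  not; the latter are therefore split into whiskerings, in either of the two orders.\<close>

lemma hcmp2_whisker:
  assumes "\<alpha> \<in> arr" "\<beta> \<in> arr" "src0 T (dom2 \<beta>) = tgt0 T (dom2 \<alpha>)"
  shows "\<beta> \<star> \<alpha> = (cod2 \<beta> \<rhd> \<alpha>) \<odot> (\<beta> \<lhd> dom2 \<alpha>)" "\<beta> \<star> \<alpha> = (\<beta> \<lhd> cod2 \<alpha>) \<odot> (dom2 \<beta> \<rhd> \<alpha>)"
  using assms unfolding whisker_left_def whisker_right_def by (simp_all flip: interchange')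

text \<open>Interchange, oriented so that the whiskered \<alpha> moves to the left past \<beta>; the
  second form carries a tail \<gamma> for use inside composites nested to the right.\<close>

lemma exchange:
  assumes "\<alpha> \<in> arr" "\<beta> \<in> arr" "src0 T (dom2 \<beta>) = tgt0 T (dom2 \<alpha>)" "dom2 \<beta> = g" "cod2 \<alpha> = f'"
  shows "(\<beta> \<lhd> f') \<odot> (g \<rhd> \<alpha>) = (cod2 \<beta> \<rhd> \<alpha>) \<odot> (\<beta> \<lhd> dom2 \<alpha>)"
    and "\<gamma> \<in> arr \<Longrightarrow> cod2 \<gamma> = g \<bullet> dom2 \<alpha> \<Longrightarrow>
      (\<beta> \<lhd> f') \<odot> (g \<rhd> \<alpha>) \<odot> \<gamma> = (cod2 \<beta> \<rhd> \<alpha>) \<odot> (\<beta> \<lhd> dom2 \<alpha>) \<odot> \<gamma>"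
proof -
  show *: "(\<beta> \<lhd> f') \<odot> (g \<rhd> \<alpha>) = (cod2 \<beta> \<rhd> \<alpha>) \<odot> (\<beta> \<lhd> dom2 \<alpha>)"
    using hcmp2_whisker[OF assms(1-3)] assms by simp
  show "\<gamma> \<in> arr \<Longrightarrow> cod2 \<gamma> = g \<bullet> dom2 \<alpha> \<Longrightarrow>
      (\<beta> \<lhd> f') \<odot> (g \<rhd> \<alpha>) \<odot> \<gamma> = (cod2 \<beta> \<rhd> \<alpha>) \<odot> (\<beta> \<lhd> dom2 \<alpha>) \<odot> \<gamma>"
    using V.reassoc[OF *, of \<gamma>] assms by auto
qed

lemma isos_whisker [simp]:
  "isos2 \<alpha> \<Longrightarrow> f \<in> obj \<Longrightarrow> src0 T f = tgt0 T (dom2 \<alpha>) \<Longrightarrow> isos2 (f \<rhd> \<alpha>)"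
  "isos2 \<alpha> \<Longrightarrow> f \<in> obj \<Longrightarrow> src0 T (dom2 \<alpha>) = tgt0 T f \<Longrightarrow> isos2 (\<alpha> \<lhd> f)"
proof -
  assume *: "isos2 \<alpha>" "f \<in> obj"
  note [simp] = *(2) V.isos_ar[OF *(1)] *(1)
  have [simp]: "src0 T (cod2 \<alpha>) = src0 T (dom2 \<alpha>)" "tgt0 T (cod2 \<alpha>) = tgt0 T (dom2 \<alpha>)" by auto
  { assume "src0 T f = tgt0 T (dom2 \<alpha>)"
    then show "isos2 (f \<rhd> \<alpha>)"
      by (intro V.isosI(1)[of _ "f \<rhd> inv_ar (vert T) \<alpha>"]) (auto simp flip: whisker_left_cmp) }
  { assume "src0 T (dom2 \<alpha>) = tgt0 T f"
    then show "isos2 (\<alpha> \<lhd> f)"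
      by (intro V.isosI(1)[of _ "inv_ar (vert T) \<alpha> \<lhd> f"]) (auto simp flip: whisker_right_cmp) }
qed

end

text \<open>Precomposition with \<open>e\<close> is an equivalence \<open>T(P, A) \<rightarrow> T(X, A)\<close>.\<close>

definition free_for :: "('z, 'f, 't) twocat \<Rightarrow> 'z \<Rightarrow> 'z \<Rightarrow> 'f \<Rightarrow> 'z \<Rightarrow> bool" where
  "free_for T X P e A \<longleftrightarrow> e \<in> cell1 T X P \<and>
     (\<forall>f \<in> cell1 T X A. \<exists>g \<in> cell1 T P A. invcell2 T f (hcmp1 T g e) \<noteq> {}) \<and>
     (\<forall>g \<in> cell1 T P A. \<forall>g' \<in> cell1 T P A. \<forall>\<sigma> \<in> cell2 T (hcmp1 T g e) (hcmp1 T g' e).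
        \<exists>!\<tau>. \<tau> \<in> cell2 T g g' \<and> \<tau> \<lhd>\<^bsub>T\<^esub> e = \<sigma>)"

lemma full_sub2cat_simps [simp]:
  "cell0 (full_sub2cat T S) = cell0 T \<inter> S"
  "vert (full_sub2cat T S) = full_subcat (vert T) {f. src0 T f \<in> S \<and> tgt0 T f \<in> S}"
  "src0 (full_sub2cat T S) = src0 T" "tgt0 (full_sub2cat T S) = tgt0 T"
  "one (full_sub2cat T S) = one T" "hcmp1 (full_sub2cat T S) = hcmp1 T" "hcmp2 (full_sub2cat T S) = hcmp2 T"
  by (simp_all add: full_sub2cat_def)

lemma inclusion_simps [simp]: "on0 inclusion X = X" "on1 inclusion f = f" "on2 inclusion \<alpha> = \<alpha>"
  by (simp_all add: inclusion_def)

lemma homcat_simps [simp]: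
  "ob (homcat T X Y) = {f \<in> ob (vert T). src0 T f = X \<and> tgt0 T f = Y}"
  "ar (homcat T X Y) = {\<alpha> \<in> ar (vert T). src (vert T) \<alpha> \<in> cell1 T X Y \<and> tgt (vert T) \<alpha> \<in> cell1 T X Y}"
  "src (homcat T X Y) = src (vert T)" "tgt (homcat T X Y) = tgt (vert T)"
  "idn (homcat T X Y) = idn (vert T)" "cmp (homcat T X Y) = cmp (vert T)"
  by (auto simp: homcat_def cell1_def)

lemma isos_homcat:
  "isos (homcat T X Y) \<alpha> \<longleftrightarrow> isos (vert T) \<alpha> \<and> src (vert T) \<alpha> \<in> cell1 T X Y \<and> tgt (vert T) \<alpha> \<in> cell1 T X Y"
  unfolding homcat_def by (rule isos_full_subcat)

context two_category
begin

lemma full_sub2cat: "two_category (full_sub2cat T S)"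
  by unfold_locales
    (auto simp: hom_iff cell1_def hcmp2_simps hcmp2_assoc' interchange' one2_hcmp1
      whisker_one[unfolded whisker_left_def whisker_right_def])

lemma homcat_category: "category (homcat T X Y)"
  unfolding homcat_def by (rule full_subcat_category[OF vert_category])

lemma inclusion_two_functor: "two_functor (full_sub2cat T S) T inclusion"
proof -
  interpret K: two_category "full_sub2cat T S" by (rule full_sub2cat)
  show ?thesis
    using K.homcat_category homcat_category
    by unfold_locales (auto simp: local_functor_def is_functor_def hom_iff cell1_def)
qed

end

section \<open>The pseudofunctor and the biadjunction of a family of free objects\<close>

locale free_objects = two_category T
  for T :: "('z, 'f, 't) twocat" (structure) +
  fixes S :: "'z set" and F0 :: "'z \<Rightarrow> 'z" and \<eta> :: "'z \<Rightarrow> 'f"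
  assumes F0_S: "X \<in> cell0 T \<Longrightarrow> F0 X \<in> cell0 T" "X \<in> cell0 T \<Longrightarrow> F0 X \<in> S"
    and free: "X \<in> cell0 T \<Longrightarrow> A \<in> cell0 T \<Longrightarrow> A \<in> S \<Longrightarrow> free_for T X (F0 X) (\<eta> X) A"
begin

declare F0_S [simp]

abbreviation "K \<equiv> full_sub2cat T S"

lemma eta_simps [simp]:
  assumes "X \<in> cell0 T"
  shows "\<eta> X \<in> obj" "src0 T (\<eta> X) = X" "tgt0 T (\<eta> X) = F0 X"
  using free[OF assms, of "F0 X"] assms by (auto simp: free_for_def cell1_iff)

lemma factor_unique:
  assumes "X \<in> cell0 T" "A \<in> S" "g \<in> obj" "src0 T g = F0 X" "tgt0 T g = A"
    "g' \<in> obj" "src0 T g' = F0 X" "tgt0 T g' = A" "\<sigma> \<in> arr" "dom2 \<sigma> = g \<bullet> \<eta> X" "cod2 \<sigma> = g' \<bullet> \<eta> X"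
  shows "\<exists>!\<tau>. \<tau> \<in> arr \<and> dom2 \<tau> = g \<and> cod2 \<tau> = g' \<and> \<tau> \<lhd> \<eta> X = \<sigma>"
proof -
  have "A \<in> cell0 T" using assms by auto
  from free[OF assms(1) this assms(2)] assms show ?thesis
    unfolding free_for_def by (auto simp: cell1_iff hom_iff)
qed

text \<open>Whiskering with \<open>\<eta> X\<close> is injective on 2-cells out of
  \<open>F0 X\<close>, and the invertible \<alpha> can be cancelled. The latter is needed because
  the 2-cells below are known through their composites with pastings of \<open>nu\<close>.\<close>

lemma faithful:
  assumes "X \<in> cell0 T" "A \<in> S" "g \<in> obj" "src0 T g = F0 X" "tgt0 T g = A" "tgt0 T g' = A" "\<tau> \<in> arr" "\<tau>' \<in> arr"
    "dom2 \<tau> = g" "dom2 \<tau>' = g" "cod2 \<tau> = g'" "cod2 \<tau>' = g'" "isos2 \<alpha>" "cod2 \<alpha> = g \<bullet> \<eta> X"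
    "(\<tau> \<lhd> \<eta> X) \<odot> \<alpha> = (\<tau>' \<lhd> \<eta> X) \<odot> \<alpha>"
  shows "\<tau> = \<tau>'"
proof -
  have [simp]: "src0 T g' = F0 X" "g' \<in> obj" using assms globular'(1)[of \<tau>] by auto
  have "\<tau> \<lhd> \<eta> X = \<tau>' \<lhd> \<eta> X"
    by (rule V.iso_cancel_right[OF assms(13)]) (use assms in auto)
  then show ?thesis
    using factor_unique[of X A g g' "\<tau> \<lhd> \<eta> X"] assms by auto
qed

text \<open>For an invertible \<open>\<alpha> : s \<Rightarrow> g \<bullet> \<eta> X\<close> and any
  \<open>\<beta> : s \<Rightarrow> g' \<bullet> \<eta> X\<close> this is the unique 2-cell
  \<open>g \<Rightarrow> g'\<close> that carries \<alpha> to \<beta>. The 2-cells of the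
  pseudofunctor are all of this form.\<close>

definition lift :: "'z \<Rightarrow> 'f \<Rightarrow> 'f \<Rightarrow> 't \<Rightarrow> 't \<Rightarrow> 't" where
  "lift X g g' \<alpha> \<beta> = (THE \<tau>. \<tau> \<in> arr \<and> dom2 \<tau> = g \<and> cod2 \<tau> = g' \<and>
     \<tau> \<lhd> \<eta> X = \<beta> \<odot> inv_ar (vert T) \<alpha>)"

lemma lift:
  assumes "X \<in> cell0 T" "A \<in> S" "g \<in> obj" "src0 T g = F0 X" "tgt0 T g = A"
    "g' \<in> obj" "src0 T g' = F0 X" "tgt0 T g' = A"
    "isos2 \<alpha>" "cod2 \<alpha> = g \<bullet> \<eta> X" "\<beta> \<in> arr" "dom2 \<beta> = dom2 \<alpha>" "cod2 \<beta> = g' \<bullet> \<eta> X"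
  shows "lift X g g' \<alpha> \<beta> \<in> arr" "dom2 (lift X g g' \<alpha> \<beta>) = g" "cod2 (lift X g g' \<alpha> \<beta>) = g'"
    "(lift X g g' \<alpha> \<beta> \<lhd> \<eta> X) \<odot> \<alpha> = \<beta>"
proof -
  have *: "lift X g g' \<alpha> \<beta> \<in> arr \<and> dom2 (lift X g g' \<alpha> \<beta>) = g \<and> cod2 (lift X g g' \<alpha> \<beta>) = g' \<and>
     lift X g g' \<alpha> \<beta> \<lhd> \<eta> X = \<beta> \<odot> inv_ar (vert T) \<alpha>"
    unfolding lift_def by (rule theI'[OF factor_unique[of X A]]) (use assms V.isos_ar[OF assms(9)] in auto)
  then show "lift X g g' \<alpha> \<beta> \<in> arr" "dom2 (lift X g g' \<alpha> \<beta>) = g" "cod2 (lift X g g' \<alpha> \<beta>) = g'" by auto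
  show "(lift X g g' \<alpha> \<beta> \<lhd> \<eta> X) \<odot> \<alpha> = \<beta>" using * assms V.isos_ar[OF assms(9)] by simp
qed

text \<open>The inverse is the lift with \<alpha> and \<beta> exchanged; both composites are
  identities because, after whiskering, they fix \<alpha> or \<beta>.\<close>

lemma isos_lift:
  assumes "X \<in> cell0 T" "A \<in> S" "g \<in> obj" "src0 T g = F0 X" "tgt0 T g = A"
    "g' \<in> obj" "src0 T g' = F0 X" "tgt0 T g' = A"
    "isos2 \<alpha>" "cod2 \<alpha> = g \<bullet> \<eta> X" "isos2 \<beta>" "dom2 \<beta> = dom2 \<alpha>" "cod2 \<beta> = g' \<bullet> \<eta> X"
  shows "isos2 (lift X g g' \<alpha> \<beta>)"
proof -
  note [simp] = assms V.isos_ar[OF assms(9)] V.isos_ar[OF assms(11)]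
  note 1 [simp] = lift[of X A g g' \<alpha> \<beta>, simplified] and 2 [simp] = lift[of X A g' g \<beta> \<alpha>, simplified]
  let ?f = "lift X g g' \<alpha> \<beta>" and ?g = "lift X g' g \<beta> \<alpha>"
  have "?g \<odot> ?f = one2 T g" by (rule faithful[of X A g g _ _ \<alpha>]) simp_all
  moreover have "?f \<odot> ?g = one2 T g'" by (rule faithful[of X A g' g' _ _ \<beta>]) simp_all
  ultimately show ?thesis by (intro V.isosI(1)[of _ ?g]) simp_all
qed

text \<open>The pseudofunctor is determined by the invertible 2-cells \<open>nu h : \<eta> Y \<bullet> h \<Rightarrow> F h \<bullet> \<eta> X\<close>; all its
  coherence laws follow since whiskering with \<open>\<eta> X\<close> is faithful.\<close>

definition F1 :: "'f \<Rightarrow> 'f" where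
  "F1 h = (SOME g. g \<in> cell1 T (F0 (src0 T h)) (F0 (tgt0 T h)) \<and>
     invcell2 T (\<eta> (tgt0 T h) \<bullet> h) (g \<bullet> \<eta> (src0 T h)) \<noteq> {})"

definition nu :: "'f \<Rightarrow> 't" where
  "nu h = (SOME \<sigma>. \<sigma> \<in> invcell2 T (\<eta> (tgt0 T h) \<bullet> h) (F1 h \<bullet> \<eta> (src0 T h)))"

lemma F1_nu:
  assumes "h \<in> obj"
  shows "F1 h \<in> cell1 T (F0 (src0 T h)) (F0 (tgt0 T h))"
    and "nu h \<in> invcell2 T (\<eta> (tgt0 T h) \<bullet> h) (F1 h \<bullet> \<eta> (src0 T h))"
proof -
  have "\<exists>g. g \<in> cell1 T (F0 (src0 T h)) (F0 (tgt0 T h)) \<and>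
     invcell2 T (\<eta> (tgt0 T h) \<bullet> h) (g \<bullet> \<eta> (src0 T h)) \<noteq> {}"
  proof -
    have "\<eta> (tgt0 T h) \<bullet> h \<in> cell1 T (src0 T h) (F0 (tgt0 T h))" using assms by (simp add: cell1_iff)
    moreover have "free_for T (src0 T h) (F0 (src0 T h)) (\<eta> (src0 T h)) (F0 (tgt0 T h))"
      using free assms by simp
    ultimately show ?thesis unfolding free_for_def by blast
  qed
  from someI_ex[OF this] have *: "F1 h \<in> cell1 T (F0 (src0 T h)) (F0 (tgt0 T h)) \<and>
     invcell2 T (\<eta> (tgt0 T h) \<bullet> h) (F1 h \<bullet> \<eta> (src0 T h)) \<noteq> {}" unfolding F1_def .
  then show "F1 h \<in> cell1 T (F0 (src0 T h)) (F0 (tgt0 T h))" by blast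
  show "nu h \<in> invcell2 T (\<eta> (tgt0 T h) \<bullet> h) (F1 h \<bullet> \<eta> (src0 T h))"
    unfolding nu_def using * by (simp add: some_in_eq)
qed

lemma F1_simps [simp]:
  assumes "h \<in> obj"
  shows "F1 h \<in> obj" "src0 T (F1 h) = F0 (src0 T h)" "tgt0 T (F1 h) = F0 (tgt0 T h)"
    "nu h \<in> arr" "isos2 (nu h)" "dom2 (nu h) = \<eta> (tgt0 T h) \<bullet> h" "cod2 (nu h) = F1 h \<bullet> \<eta> (src0 T h)"
  using F1_nu[OF assms] by (auto simp: cell1_iff iso_iff)

text \<open>The only choice that makes \<open>nu\<close> natural in \<open>h\<close>.\<close>

definition F2 :: "'t \<Rightarrow> 't" where
  "F2 \<alpha> = (let h = dom2 \<alpha>; h' = cod2 \<alpha> in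
     lift (src0 T h) (F1 h) (F1 h') (nu h) (nu h' \<odot> (\<eta> (tgt0 T h) \<rhd> \<alpha>)))"

lemma F2_simps:
  assumes "\<alpha> \<in> arr" "dom2 \<alpha> = h" "cod2 \<alpha> = h'" "src0 T h = X" "tgt0 T h = Y"
  shows "F2 \<alpha> \<in> arr" "dom2 (F2 \<alpha>) = F1 h" "cod2 (F2 \<alpha>) = F1 h'"
    "(F2 \<alpha> \<lhd> \<eta> X) \<odot> nu h = nu h' \<odot> (\<eta> Y \<rhd> \<alpha>)"
proof -
  have [simp]: "h \<in> obj" "h' \<in> obj" "src0 T h' = X" "tgt0 T h' = Y" "X \<in> cell0 T" "Y \<in> cell0 T" using assms by auto
  show "F2 \<alpha> \<in> arr" "dom2 (F2 \<alpha>) = F1 h" "cod2 (F2 \<alpha>) = F1 h'"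
    "(F2 \<alpha> \<lhd> \<eta> X) \<odot> nu h = nu h' \<odot> (\<eta> Y \<rhd> \<alpha>)"
    using lift[of X "F0 Y" "F1 h" "F1 h'" "nu h" "nu h' \<odot> (\<eta> Y \<rhd> \<alpha>)"] assms
    by (simp_all add: F2_def Let_def)
qed

text \<open>Two factorizations of \<open>\<eta> \<bullet> g \<bullet> f\<close> are compared:
  through \<open>F1 g \<bullet> F1 f\<close>, by pasting \<open>nu g\<close> and
  \<open>nu f\<close>, and through \<open>F1 (g \<bullet> f)\<close>, by
  \<open>nu (g \<bullet> f)\<close>.\<close>

definition Fcmp :: "'f \<Rightarrow> 'f \<Rightarrow> 't" where
  "Fcmp g f = lift (src0 T f) (F1 g \<bullet> F1 f) (F1 (g \<bullet> f)) ((F1 g \<rhd> nu f) \<odot> (nu g \<lhd> f)) (nu (g \<bullet> f))"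

lemma Fcmp_simps:
  assumes "f \<in> obj" "g \<in> obj" "src0 T f = X" "src0 T g = tgt0 T f"
  shows "Fcmp g f \<in> arr" "isos2 (Fcmp g f)" "dom2 (Fcmp g f) = F1 g \<bullet> F1 f" "cod2 (Fcmp g f) = F1 (g \<bullet> f)"
    "(Fcmp g f \<lhd> \<eta> X) \<odot> (F1 g \<rhd> nu f) \<odot> (nu g \<lhd> f) = nu (g \<bullet> f)"
proof -
  have [simp]: "X \<in> cell0 T" using assms by auto
  show "Fcmp g f \<in> arr" "isos2 (Fcmp g f)" "dom2 (Fcmp g f) = F1 g \<bullet> F1 f" "cod2 (Fcmp g f) = F1 (g \<bullet> f)"
    "(Fcmp g f \<lhd> \<eta> X) \<odot> (F1 g \<rhd> nu f) \<odot> (nu g \<lhd> f) = nu (g \<bullet> f)"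
    using lift[of X "F0 (tgt0 T g)" "F1 g \<bullet> F1 f" "F1 (g \<bullet> f)" "(F1 g \<rhd> nu f) \<odot> (nu g \<lhd> f)" "nu (g \<bullet> f)"]
      isos_lift[of X "F0 (tgt0 T g)" "F1 g \<bullet> F1 f" "F1 (g \<bullet> f)" "(F1 g \<rhd> nu f) \<odot> (nu g \<lhd> f)" "nu (g \<bullet> f)"]
      assms by (simp_all add: Fcmp_def)
qed

text \<open>Both \<open>\<eta> X \<bullet> one T X\<close> and
  \<open>one T (F0 X) \<bullet> \<eta> X\<close> are equal to \<open>\<eta> X\<close>, so the
  reference 2-cell is an identity.\<close>

definition Fone :: "'z \<Rightarrow> 't" where
  "Fone X = lift X (one T (F0 X)) (F1 (one T X)) (one2 T (\<eta> X)) (nu (one T X))"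

lemma Fone_simps:
  assumes [simp]: "X \<in> cell0 T"
  shows "Fone X \<in> arr" "isos2 (Fone X)" "dom2 (Fone X) = one T (F0 X)" "cod2 (Fone X) = F1 (one T X)"
    "Fone X \<lhd> \<eta> X = nu (one T X)"
proof -
  note * = lift[of X "F0 X" "one T (F0 X)" "F1 (one T X)" "one2 T (\<eta> X)" "nu (one T X)"]
      isos_lift[of X "F0 X" "one T (F0 X)" "F1 (one T X)" "one2 T (\<eta> X)" "nu (one T X)"]
  from * show "Fone X \<in> arr" "isos2 (Fone X)" "dom2 (Fone X) = one T (F0 X)" "cod2 (Fone X) = F1 (one T X)"
    "Fone X \<lhd> \<eta> X = nu (one T X)"
    by (simp_all add: Fone_def)
qed

definition F :: "('z, 'f, 't, 'z, 'f, 't) pfun" where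
  "F = \<lparr>on0 = F0, on1 = F1, on2 = F2, pcmp = Fcmp, pone = Fone\<rparr>"

lemma F_sel [simp]: "on0 F = F0" "on1 F = F1" "on2 F = F2" "pcmp F = Fcmp" "pone F = Fone"
  by (simp_all add: F_def)

lemma F2_idn:
  assumes [simp]: "h \<in> obj"
  shows "F2 (one2 T h) = one2 T (F1 h)"
  using F2_simps[of "one2 T h" h h "src0 T h" "tgt0 T h"]
  by - (rule faithful[of "src0 T h" "F0 (tgt0 T h)" "F1 h" "F1 h" _ _ "nu h"], auto)

lemma F2_cmp:
  assumes [simp]: "\<alpha> \<in> arr" "\<beta> \<in> arr" "dom2 \<beta> = cod2 \<alpha>"
  shows "F2 (\<beta> \<odot> \<alpha>) = F2 \<beta> \<odot> F2 \<alpha>"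
proof -
  define h h' h'' X Y where e: "h = dom2 \<alpha>" "h' = cod2 \<alpha>" "h'' = cod2 \<beta>" "X = src0 T h" "Y = tgt0 T h"
  have [simp]: "h \<in> obj" "h' \<in> obj" "h'' \<in> obj" "src0 T h' = X" "tgt0 T h' = Y" "src0 T h'' = X" "tgt0 T h'' = Y"
    using globular'[of \<beta>] by (auto simp: e)
  have [simp]: "X \<in> cell0 T" "Y \<in> cell0 T" by (auto simp: e)
  note [simp] = e[symmetric]
  note [simp] = F2_simps[of \<alpha> h h' X Y, simplified] F2_simps[of \<beta> h' h'' X Y, simplified]
    F2_simps[of "\<beta> \<odot> \<alpha>" h h'' X Y, simplified] V.reassoc[OF F2_simps(4)[of \<beta> h' h'' X Y], simplified]
  show ?thesis
    by (rule faithful[of X "F0 Y" "F1 h" "F1 h''" _ _ "nu h"]) auto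
qed

text \<open>Whiskered with \<open>\<eta> X\<close> and composed with the pasting \<open>?A\<close>
  of \<open>nu g\<close> and \<open>nu f\<close>, both sides become \<open>nu (g' \<bullet> f')
  \<odot> (\<eta> Z \<rhd> (\<beta> \<star> \<alpha>))\<close>.\<close>

lemma F2_hcmp2:
  assumes a [simp]: "\<alpha> \<in> arr" "\<beta> \<in> arr" "src0 T (dom2 \<beta>) = tgt0 T (dom2 \<alpha>)"
  shows "Fcmp (cod2 \<beta>) (cod2 \<alpha>) \<odot> (F2 \<beta> \<star> F2 \<alpha>) = F2 (\<beta> \<star> \<alpha>) \<odot> Fcmp (dom2 \<beta>) (dom2 \<alpha>)"
proof -
  define f f' g g' X Y Z where e: "f = dom2 \<alpha>" "f' = cod2 \<alpha>" "g = dom2 \<beta>" "g' = cod2 \<beta>" "X = src0 T f" "Y = tgt0 T f" "Z = tgt0 T g"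
  have [simp]: "f \<in> obj" "f' \<in> obj" "g \<in> obj" "g' \<in> obj" "src0 T f' = X" "tgt0 T f' = Y" "src0 T g = Y"
     "src0 T g' = Y" "tgt0 T g' = Z"
    by (auto simp: e)
  have [simp]: "X \<in> cell0 T" "Y \<in> cell0 T" "Z \<in> cell0 T" by (auto simp: e)
  note [simp] = e[symmetric]
  note [simp] = hcmp2_simps[OF a, simplified]
  note [simp] = F2_simps(1-3)[of \<alpha> f f' X Y, simplified] F2_simps(1-3)[of \<beta> g g' Y Z, simplified]
    F2_simps(1-3)[of "\<beta> \<star> \<alpha>" "g \<bullet> f" "g' \<bullet> f'" X Z, simplified] Fcmp_simps(1-4)[of f g, simplified]
     Fcmp_simps(1-4)[of f' g', simplified]
  note [simp] = hcmp2_simps[of "F2 \<alpha>" "F2 \<beta>", simplified]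
  let ?A = "(F1 g \<rhd> nu f) \<odot> (nu g \<lhd> f)"
  have "((Fcmp g' f' \<odot> (F2 \<beta> \<star> F2 \<alpha>)) \<lhd> \<eta> X) \<odot> ?A
      = (Fcmp g' f' \<lhd> \<eta> X) \<odot> (F1 g' \<rhd> (F2 \<alpha> \<lhd> \<eta> X)) \<odot> (F2 \<beta> \<lhd> (F1 f \<bullet> \<eta> X)) \<odot> (F1 g \<rhd> nu f) \<odot> (nu g \<lhd> f)"
    by (simp add: hcmp2_whisker(1))
  \<comment> \<open>Exchange brings \<open>F2 \<alpha>\<close> next to \<open>nu f\<close> and
    \<open>F2 \<beta>\<close> next to \<open>nu g\<close>, where the defining equation of
    \<open>F2\<close> applies.\<close>
  also have "\<dots> = (Fcmp g' f' \<lhd> \<eta> X) \<odot> (F1 g' \<rhd> ((F2 \<alpha> \<lhd> \<eta> X) \<odot> nu f)) \<odot> (((F2 \<beta> \<lhd> \<eta> Y) \<odot> nu g) \<lhd> f)"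
    by (simp add: exchange)
  also have "\<dots> = (Fcmp g' f' \<lhd> \<eta> X) \<odot> (F1 g' \<rhd> nu f') \<odot> ((F1 g' \<bullet> \<eta> Y) \<rhd> \<alpha>) \<odot> (nu g' \<lhd> f) \<odot> (\<eta> Z \<rhd> (\<beta> \<lhd> f))"
    using F2_simps(4)[of \<alpha> f f' X Y] F2_simps(4)[of \<beta> g g' Y Z] by simp
  also have "\<dots> = ((Fcmp g' f' \<lhd> \<eta> X) \<odot> (F1 g' \<rhd> nu f') \<odot> (nu g' \<lhd> f')) \<odot> (\<eta> Z \<rhd> (\<beta> \<star> \<alpha>))"
    using exchange(2)[of \<alpha> "nu g'" "\<eta> Z \<bullet> g'" f' "\<eta> Z \<rhd> (\<beta> \<lhd> f)"] by (simp add: hcmp2_whisker(1))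
  also have "\<dots> = nu (g' \<bullet> f') \<odot> (\<eta> Z \<rhd> (\<beta> \<star> \<alpha>))"
    using Fcmp_simps(5)[of f' g' X] by simp
  also have "\<dots> = (F2 (\<beta> \<star> \<alpha>) \<lhd> \<eta> X) \<odot> nu (g \<bullet> f)"
    using F2_simps(4)[of "\<beta> \<star> \<alpha>" "g \<bullet> f" "g' \<bullet> f'" X Z] by simp
  also have "\<dots> = ((F2 (\<beta> \<star> \<alpha>) \<odot> Fcmp g f) \<lhd> \<eta> X) \<odot> ?A"
    using Fcmp_simps(5)[of f g X] by simp
  finally show ?thesis
    by - (rule faithful[of X "F0 Z" "F1 g \<bullet> F1 f" "F1 (g' \<bullet> f')" _ _ ?A], auto)
qed

text \<open>\<open>?A\<close> pastes the three 2-cells \<open>nu f\<close>, \<open>nu g\<close> and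
  \<open>nu h\<close>; after whiskering, each side turns this pasting into
  \<open>nu (h \<bullet> g \<bullet> f)\<close>.\<close>

lemma Fcmp_assoc:
  assumes [simp]: "f \<in> obj" "g \<in> obj" "h \<in> obj" "src0 T g = tgt0 T f" "src0 T h = tgt0 T g"
  shows "Fcmp (h \<bullet> g) f \<odot> (Fcmp h g \<lhd> F1 f) = Fcmp h (g \<bullet> f) \<odot> (F1 h \<rhd> Fcmp g f)"
proof -
  let ?X = "src0 T f"
  let ?A = "((F1 h \<bullet> F1 g) \<rhd> nu f) \<odot> (F1 h \<rhd> (nu g \<lhd> f)) \<odot> (nu h \<lhd> (g \<bullet> f))"
  note [simp] = Fcmp_simps(1-4)
  have "((Fcmp (h \<bullet> g) f \<odot> (Fcmp h g \<lhd> F1 f)) \<lhd> \<eta> ?X) \<odot> ?A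
     = (Fcmp (h \<bullet> g) f \<lhd> \<eta> ?X) \<odot> (F1 (h \<bullet> g) \<rhd> nu f) \<odot> (((Fcmp h g \<lhd> \<eta> (tgt0 T f)) \<odot> (F1 h \<rhd> nu g) \<odot> (nu h \<lhd> g)) \<lhd> f)"
    by (simp add: exchange)
  also have "\<dots> = nu (h \<bullet> g \<bullet> f)"
    using Fcmp_simps(5)[of f "h \<bullet> g" ?X] by (simp add: Fcmp_simps(5) del: whisker_right_cmp)
  finally have 1: "((Fcmp (h \<bullet> g) f \<odot> (Fcmp h g \<lhd> F1 f)) \<lhd> \<eta> ?X) \<odot> ?A = nu (h \<bullet> g \<bullet> f)" .
  have "((Fcmp h (g \<bullet> f) \<odot> (F1 h \<rhd> Fcmp g f)) \<lhd> \<eta> ?X) \<odot> ?A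
     = (Fcmp h (g \<bullet> f) \<lhd> \<eta> ?X) \<odot> (F1 h \<rhd> ((Fcmp g f \<lhd> \<eta> ?X) \<odot> (F1 g \<rhd> nu f) \<odot> (nu g \<lhd> f))) \<odot> (nu h \<lhd> (g \<bullet> f))"
    by simp
  also have "\<dots> = nu (h \<bullet> g \<bullet> f)"
    using Fcmp_simps(5)[of "g \<bullet> f" h ?X] by (simp add: Fcmp_simps(5) del: whisker_left_cmp)
  finally show ?thesis
    using 1 by - (rule faithful[of ?X "F0 (tgt0 T h)" "F1 h \<bullet> F1 g \<bullet> F1 f" "F1 (h \<bullet> g \<bullet> f)" _ _ ?A], simp_all)
qed

lemma Fcmp_one:
  assumes [simp]: "f \<in> obj"
  shows "Fcmp f (one T (src0 T f)) \<odot> (F1 f \<rhd> Fone (src0 T f)) = one2 T (F1 f)"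
    "Fcmp (one T (tgt0 T f)) f \<odot> (Fone (tgt0 T f) \<lhd> F1 f) = one2 T (F1 f)"
proof -
  let ?X = "src0 T f" and ?Y = "tgt0 T f"
  note [simp] = Fcmp_simps(1-4) Fone_simps
  show "Fcmp f (one T ?X) \<odot> (F1 f \<rhd> Fone ?X) = one2 T (F1 f)"
    using Fcmp_simps(5)[of "one T ?X" f ?X]
    by - (rule faithful[of ?X "F0 ?Y" "F1 f" "F1 f" _ _ "nu f"], simp_all)
  \<comment> \<open>\<open>nu f\<close> is written as a whiskering by an identity 1-cell, so that
    exchange can carry it past \<open>Fone ?Y\<close>. What remains is \<open>Fone ?Y\<close>
    whiskered with \<open>\<eta> ?Y\<close>, which is \<open>nu (one T ?Y)\<close>.\<close>
  have "((Fcmp (one T ?Y) f \<odot> (Fone ?Y \<lhd> F1 f)) \<lhd> \<eta> ?X) \<odot> nu f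
      = (Fcmp (one T ?Y) f \<lhd> \<eta> ?X) \<odot> (Fone ?Y \<lhd> (F1 f \<bullet> \<eta> ?X)) \<odot> (one T (F0 ?Y) \<rhd> nu f)" by simp
  also have "\<dots> = (Fcmp (one T ?Y) f \<lhd> \<eta> ?X) \<odot> (F1 (one T ?Y) \<rhd> nu f) \<odot> ((Fone ?Y \<lhd> \<eta> ?Y) \<lhd> f)"
    by (simp add: exchange del: whisker_one Fone_simps(5))
  also have "\<dots> = nu f" using Fcmp_simps(5)[of f "one T ?Y" ?X] by simp
  finally show "Fcmp (one T ?Y) f \<odot> (Fone ?Y \<lhd> F1 f) = one2 T (F1 f)"
    by - (rule faithful[of ?X "F0 ?Y" "F1 f" "F1 f" _ _ "nu f"], simp_all)
qed

lemma pseudofunctor_F: "pseudofunctor T K F"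
proof -
  interpret K: two_category K by (rule full_sub2cat)
  note [simp] = F2_simps(1-3)[OF _ HOL.refl HOL.refl HOL.refl HOL.refl] Fcmp_simps(1-4) Fone_simps(1-4)
  have "local_functor T K F"
    unfolding local_functor_def is_functor_def using homcat_category K.homcat_category
    by (auto simp: cell1_def hom_iff F2_idn F2_cmp)
  moreover note Fcmp_assoc Fcmp_one F2_hcmp2
  ultimately show ?thesis
    unfolding whisker_left_def whisker_right_def
    by unfold_locales (auto simp: cell1_def hom_iff iso_iff isos_full_subcat)
qed

text \<open>Transposition is composition with \<open>\<eta>\<close>, so \<open>k\<close> and
  \<open>u\<close> pass through unchanged and the constraint consists of \<open>nu h\<close>
  alone.\<close>

definition theta :: "'f \<Rightarrow> 'f \<Rightarrow> 'f \<Rightarrow> 't" where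
  "theta h k u = (k \<bullet> u) \<rhd> nu h"

text \<open>The equivalence of hom-categories is \<open>free_for\<close> itself. Naturality of the
  constraint is the defining equation of \<open>F2\<close>; its compatibility with identities and
  with composition is the defining equation of \<open>Fone\<close> and of
  \<open>Fcmp\<close>.\<close>

lemma biadjunction_F:
  "biadjunction K T inclusion F (\<lambda>X A u. u \<bullet> \<eta> X) (\<lambda>X A \<mu>. \<mu> \<lhd> \<eta> X) theta"
proof -
  interpret K: two_category K by (rule full_sub2cat)
  interpret two_functor K T inclusion by (rule inclusion_two_functor)
  interpret pseudofunctor T K F by (rule pseudofunctor_F)
  show ?thesis
  proof
    fix X A assume "X \<in> cell0 T" "A \<in> cell0 K"
    then have [simp]: "X \<in> cell0 T" "A \<in> cell0 T" "A \<in> S" by auto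
    show "is_equivalence (homcat K (on0 F X) A) (homcat T X (on0 inclusion A)) (\<lambda>u. u \<bullet> \<eta> X) (\<lambda>\<mu>. \<mu> \<lhd> \<eta> X)"
    proof (rule equivalenceI)
      show "is_functor (homcat K (on0 F X) A) (homcat T X (on0 inclusion A)) (\<lambda>u. u \<bullet> \<eta> X) (\<lambda>\<mu>. \<mu> \<lhd> \<eta> X)"
        unfolding is_functor_def using homcat_category K.homcat_category
        by (auto simp: cell1_def hom_iff)
      fix f assume "f \<in> ob (homcat T X (on0 inclusion A))"
      then have "f \<in> cell1 T X A" by (simp add: cell1_iff)
      then obtain g where g: "g \<in> cell1 T (F0 X) A" "invcell2 T f (g \<bullet> \<eta> X) \<noteq> {}"
        using free[of X A, simplified] unfolding free_for_def by blast
      from g(2) obtain \<sigma> where "\<sigma> \<in> invcell2 T f (g \<bullet> \<eta> X)" by blast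
      then have "\<sigma> \<in> iso (homcat T X (on0 inclusion A)) f (g \<bullet> \<eta> X)"
        using g(1) \<open>f \<in> cell1 T X A\<close> by (auto simp: cell1_iff iso_iff isos_homcat)
      moreover have "g \<in> ob (homcat K (on0 F X) A)" using g(1) by (simp add: cell1_iff)
      ultimately show "\<exists>a\<in>ob (homcat K (on0 F X) A). iso (homcat T X (on0 inclusion A)) f (a \<bullet> \<eta> X) \<noteq> {}"
        by blast
    next
      fix g g' \<sigma>
      assume "g \<in> ob (homcat K (on0 F X) A)" "g' \<in> ob (homcat K (on0 F X) A)"
        "\<sigma> \<in> hom (homcat T X (on0 inclusion A)) (g \<bullet> \<eta> X) (g' \<bullet> \<eta> X)"
      then show "\<exists>!f. f \<in> hom (homcat K (on0 F X) A) g g' \<and> f \<lhd> \<eta> X = \<sigma>"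
        using factor_unique[of X A g g' \<sigma>] by (auto simp: hom_iff cell1_def)
    qed
  next
    fix h k u X Y A B
    assume "h \<in> cell1 T X Y" "k \<in> cell1 K A B" "u \<in> cell1 K (on0 F Y) A"
    then have *: "h \<in> obj" "src0 T h = X" "tgt0 T h = Y" "k \<in> obj" "src0 T k = A" "tgt0 T k = B"
      "u \<in> obj" "src0 T u = F0 Y" "tgt0 T u = A" by (auto simp: cell1_def)
    note [simp] = * src0_cell0[OF \<open>h \<in> obj\<close>, simplified *] tgt0_cell0[OF \<open>h \<in> obj\<close>, simplified *]
    show "theta h k u \<in> invcell2 T (on1 inclusion k \<bullet> (u \<bullet> \<eta> Y) \<bullet> h) ((k \<bullet>\<^bsub>K\<^esub> u \<bullet>\<^bsub>K\<^esub> on1 F h) \<bullet> \<eta> X)"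
      by (simp add: theta_def iso_iff)
    fix \<alpha> h' \<beta> k' \<mu> u'
    assume "\<alpha> \<in> cell2 T h h'" "\<beta> \<in> cell2 K k k'" "\<mu> \<in> cell2 K u u'"
    then have **: "\<alpha> \<in> arr" "dom2 \<alpha> = h" "cod2 \<alpha> = h'" "\<beta> \<in> arr" "dom2 \<beta> = k" "cod2 \<beta> = k'" "\<mu> \<in> arr" "dom2 \<mu> = u" "cod2 \<mu> = u'"
      by (auto simp: hom_iff)
    then have [simp]: "h' \<in> obj" "src0 T h' = X" "tgt0 T h' = Y" "k' \<in> obj" "src0 T k' = A" "tgt0 T k' = B"
      "u' \<in> obj" "src0 T u' = F0 Y" "tgt0 T u' = A" using globular'[of \<alpha>] globular'[of \<beta>] globular'[of \<mu>] * by auto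
    note [simp] = ** F2_simps(1-3)[of \<alpha> h h' X Y, simplified]
    note [simp] = hcmp2_simps[of \<mu> \<beta>, simplified]
    let ?n = "\<beta> \<star> \<mu>"
    have "theta h' k' u' \<odot> (\<beta> \<star> (\<mu> \<lhd> \<eta> Y) \<star> \<alpha>) = theta h' k' u' \<odot> (?n \<star> (\<eta> Y \<rhd> \<alpha>))"
      by (simp add: whisker_right_def whisker_left_def hcmp2_assoc' hcmp2_simps)
    also have "\<dots> = ((k' \<bullet> u') \<rhd> (nu h' \<odot> (\<eta> Y \<rhd> \<alpha>))) \<odot> (?n \<lhd> (\<eta> Y \<bullet> h))"
      by (simp add: theta_def hcmp2_whisker(1)[of _ ?n])
    also have "\<dots> = ((k' \<bullet> u') \<rhd> ((F2 \<alpha> \<lhd> \<eta> X) \<odot> nu h)) \<odot> (?n \<lhd> (\<eta> Y \<bullet> h))"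
      by (simp only: F2_simps(4)[of \<alpha> h h' X Y, simplified])
    \<comment> \<open>\<open>?n\<close> acts on the factor \<open>k \<bullet> u\<close> and
      \<open>nu h\<close> on the other one, so they change places.\<close>
    also have "\<dots> = ((k' \<bullet> u') \<rhd> (F2 \<alpha> \<lhd> \<eta> X)) \<odot> (?n \<lhd> (F1 h \<bullet> \<eta> X)) \<odot> ((k \<bullet> u) \<rhd> nu h)"
      using exchange(1)[of "nu h" ?n "k \<bullet> u" "F1 h \<bullet> \<eta> X"] by simp
    also have "\<dots> = ((?n \<star> F2 \<alpha>) \<lhd> \<eta> X) \<odot> theta h k u"
      by (simp add: theta_def hcmp2_whisker(1)[of _ ?n])
    finally show "theta h' k' u' \<odot> (on2 inclusion \<beta> \<star> (\<mu> \<lhd> \<eta> Y) \<star> \<alpha>)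
        = ((\<beta> \<star>\<^bsub>K\<^esub> \<mu> \<star>\<^bsub>K\<^esub> on2 F \<alpha>) \<lhd> \<eta> X) \<odot> theta h k u"
      by (simp add: hcmp2_assoc')
  next
    fix X A u assume "X \<in> cell0 T" "A \<in> cell0 K" "u \<in> cell1 K (on0 F X) A"
    then have [simp]: "X \<in> cell0 T" "A \<in> cell0 T" "u \<in> obj" "src0 T u = F0 X" "tgt0 T u = A" by (auto simp: cell1_def)
    note [simp] = Fone_simps
    show "theta (one T X) (one K A) u = (one2 K u \<star>\<^bsub>K\<^esub> pone F X) \<lhd> \<eta> X"
      by (simp add: theta_def flip: whisker_left_def)
  next
    fix h' h k k' u W X Y A B D
    assume "h' \<in> cell1 T W X" "h \<in> cell1 T X Y" "k \<in> cell1 K A B" "k' \<in> cell1 K B D" "u \<in> cell1 K (on0 F Y) A"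
    then have *: "h \<in> obj" "src0 T h = X" "tgt0 T h = Y" "k \<in> obj" "src0 T k = A" "tgt0 T k = B"
      "u \<in> obj" "src0 T u = F0 Y" "tgt0 T u = A" "h' \<in> obj" "src0 T h' = W" "tgt0 T h' = X"
      "k' \<in> obj" "src0 T k' = B" "tgt0 T k' = D" by (auto simp: cell1_def)
    note [simp] = * src0_cell0[OF \<open>h \<in> obj\<close>, simplified *] tgt0_cell0[OF \<open>h \<in> obj\<close>, simplified *]
      src0_cell0[OF \<open>h' \<in> obj\<close>, simplified *] Fcmp_simps(1-4)[of h' h W, simplified]
    have "theta (h \<bullet> h') (k' \<bullet> k) u = (k' \<bullet> k \<bullet> u) \<rhd> ((Fcmp h h' \<lhd> \<eta> W) \<odot> (F1 h \<rhd> nu h') \<odot> (nu h \<lhd> h'))"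
      using Fcmp_simps(5)[of h' h W] by (simp add: theta_def del: whisker_left_cmp)
    also have "\<dots> = (((k' \<bullet> k \<bullet> u) \<rhd> Fcmp h h') \<lhd> \<eta> W) \<odot> theta h' k' (k \<bullet> u \<bullet> F1 h) \<odot> (k' \<rhd> (theta h k u \<lhd> h'))"
      by (simp add: theta_def)
    finally show "theta (h \<bullet> h') (k' \<bullet>\<^bsub>K\<^esub> k) u =
       ((one2 K (k' \<bullet>\<^bsub>K\<^esub> k \<bullet>\<^bsub>K\<^esub> u) \<star>\<^bsub>K\<^esub> pcmp F h h') \<lhd> \<eta> W) \<odot>
         theta h' k' (k \<bullet>\<^bsub>K\<^esub> u \<bullet>\<^bsub>K\<^esub> on1 F h) \<odot> (one2 T (on1 inclusion k') \<star> theta h k u \<star> one2 T h')"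
      by (simp flip: whisker_left_def whisker_right_def)
  qed
qed

text \<open>The unit at \<open>X\<close> is the transpose
  \<open>one T (F0 X) \<bullet> \<eta> X\<close> of an identity, which equals
  \<open>\<eta> X\<close> because identities in \<open>T\<close> are strict.\<close>

theorem has_left_biadjoint: "has_left_biadjoint K T inclusion F0 \<eta>"
  unfolding has_left_biadjoint_def
  by (rule exI[of _ F], rule exI, rule exI, rule exI, rule conjI[OF biadjunction_F]) auto

end

section \<open>Invariance of freeness under equivalences\<close>

context two_category
begin

lemma equivalence_cell1E:
  assumes "equivalence_cell1 T X Y f"
  obtains r \<gamma> \<beta> where "f \<in> obj" "src0 T f = X" "tgt0 T f = Y" "r \<in> obj" "src0 T r = Y" "tgt0 T r = X"
    "isos2 \<gamma>" "\<gamma> \<in> arr" "dom2 \<gamma> = r \<bullet> f" "cod2 \<gamma> = one T X"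
    "isos2 \<beta>" "\<beta> \<in> arr" "dom2 \<beta> = f \<bullet> r" "cod2 \<beta> = one T Y" "X \<in> cell0 T" "Y \<in> cell0 T"
proof -
  from assms obtain r where r: "f \<in> cell1 T X Y" "r \<in> cell1 T Y X"
    and "invcell2 T (r \<bullet> f) (one T X) \<noteq> {}" "invcell2 T (f \<bullet> r) (one T Y) \<noteq> {}"
    unfolding equivalence_cell1_def by blast
  then obtain \<gamma> \<beta> where "\<gamma> \<in> invcell2 T (r \<bullet> f) (one T X)" "\<beta> \<in> invcell2 T (f \<bullet> r) (one T Y)" by blast
  with r that[of r \<gamma> \<beta>] show ?thesis by (auto simp: cell1_iff iso_iff)
qed

text \<open>Exchange with \<open>\<beta> : f \<bullet> r \<Rightarrow> 1\<close> exhibits \<tau> as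
  a conjugate of \<open>(\<tau> \<lhd> f) \<lhd> r\<close>, so \<tau> is determined by
  \<open>\<tau> \<lhd> f\<close>. An equivalence comes without triangle identities, so the argument
  has to rely on the invertibility of \<beta>.\<close>

lemma whisker_right_faithful:
  assumes "f \<in> obj" "r \<in> obj" "src0 T r = tgt0 T f" "tgt0 T r = src0 T f" "isos2 \<beta>" "dom2 \<beta> = f \<bullet> r" "cod2 \<beta> = one T (tgt0 T f)"
    "\<tau> \<in> arr" "\<tau>' \<in> arr" "dom2 \<tau> = dom2 \<tau>'" "cod2 \<tau> = cod2 \<tau>'" "src0 T (dom2 \<tau>') = tgt0 T f" "\<tau> \<lhd> f = \<tau>' \<lhd> f"
  shows "\<tau> = \<tau>'"
proof -
  note [simp] = assms(1-12) V.isos_ar[OF assms(5)]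
  have *: "\<sigma> \<odot> (dom2 \<sigma> \<rhd> \<beta>) = (cod2 \<sigma> \<rhd> \<beta>) \<odot> ((\<sigma> \<lhd> f) \<lhd> r)" if "\<sigma> \<in> arr" "src0 T (dom2 \<sigma>) = tgt0 T f" for \<sigma>
    using exchange(1)[of \<beta> \<sigma> "dom2 \<sigma>" "one T (tgt0 T f)"] that by simp
  have "\<tau> \<odot> (dom2 \<tau>' \<rhd> \<beta>) = \<tau>' \<odot> (dom2 \<tau>' \<rhd> \<beta>)"
    using *[of \<tau>] *[of \<tau>'] assms(13) by (simp del: whisker_right_right)
  then show ?thesis by (rule V.iso_cancel_right[rotated -1]) auto
qed

lemma whisker_left_faithful:
  assumes "f \<in> obj" "r \<in> obj" "src0 T r = tgt0 T f" "tgt0 T r = src0 T f" "isos2 \<gamma>" "dom2 \<gamma> = r \<bullet> f" "cod2 \<gamma> = one T (src0 T f)"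
    "\<tau> \<in> arr" "\<tau>' \<in> arr" "dom2 \<tau> = dom2 \<tau>'" "cod2 \<tau> = cod2 \<tau>'" "tgt0 T (dom2 \<tau>') = src0 T f" "f \<rhd> \<tau> = f \<rhd> \<tau>'"
  shows "\<tau> = \<tau>'"
proof -
  note [simp] = assms(1-12) V.isos_ar[OF assms(5)]
  have *: "(\<gamma> \<lhd> cod2 \<sigma>) \<odot> (r \<rhd> f \<rhd> \<sigma>) = \<sigma> \<odot> (\<gamma> \<lhd> dom2 \<sigma>)" if "\<sigma> \<in> arr" "tgt0 T (dom2 \<sigma>) = src0 T f" for \<sigma>
    using exchange(1)[of \<sigma> \<gamma> "r \<bullet> f" "cod2 \<sigma>"] that by simp
  have "\<tau> \<odot> (\<gamma> \<lhd> dom2 \<tau>') = \<tau>' \<odot> (\<gamma> \<lhd> dom2 \<tau>')"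
    using *[of \<tau>] *[of \<tau>'] assms(13) by (simp del: whisker_left_left)
  then show ?thesis by (rule V.iso_cancel_right[rotated -1]) auto
qed

text \<open>The preimage is \<open>\<sigma> \<lhd> r\<close> conjugated by \<beta>. Its whiskering
  with \<open>f\<close> is compared with \<sigma> after a further whiskering with \<open>r\<close>,
  which loses nothing because \<open>r\<close> is an equivalence as well, by \<gamma>.\<close>

lemma whisker_right_full:
  assumes "f \<in> obj" "r \<in> obj" "src0 T r = tgt0 T f" "tgt0 T r = src0 T f" "isos2 \<beta>" "dom2 \<beta> = f \<bullet> r" "cod2 \<beta> = one T (tgt0 T f)"
    "isos2 \<gamma>" "dom2 \<gamma> = r \<bullet> f" "cod2 \<gamma> = one T (src0 T f)"
    "g \<in> obj" "g' \<in> obj" "src0 T g = tgt0 T f" "src0 T g' = tgt0 T f" "tgt0 T g = tgt0 T g'"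
    "\<sigma> \<in> arr" "dom2 \<sigma> = g \<bullet> f" "cod2 \<sigma> = g' \<bullet> f"
  shows "\<exists>\<tau>. \<tau> \<in> arr \<and> dom2 \<tau> = g \<and> cod2 \<tau> = g' \<and> \<tau> \<lhd> f = \<sigma>"
proof -
  note [simp] = assms V.isos_ar[OF assms(5)]
  define \<tau> where "\<tau> = (g' \<rhd> \<beta>) \<odot> (\<sigma> \<lhd> r) \<odot> inv_ar (vert T) (g \<rhd> \<beta>)"
  have [simp]: "\<tau> \<in> arr" "dom2 \<tau> = g" "cod2 \<tau> = g'" by (simp_all add: \<tau>_def)
  have "(g' \<rhd> \<beta>) \<odot> (\<tau> \<lhd> (f \<bullet> r)) = \<tau> \<odot> (g \<rhd> \<beta>)"
    using exchange(1)[of \<beta> \<tau> g "one T (tgt0 T f)"] by simp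
  also have "\<dots> = (g' \<rhd> \<beta>) \<odot> (\<sigma> \<lhd> r)" by (simp add: \<tau>_def)
  finally have "\<tau> \<lhd> (f \<bullet> r) = \<sigma> \<lhd> r" by (rule V.iso_cancel_left[rotated -1]) auto
  then have "(\<tau> \<lhd> f) \<lhd> r = \<sigma> \<lhd> r" by simp
  then have "\<tau> \<lhd> f = \<sigma>" by (rule whisker_right_faithful[of r f \<gamma>, rotated -1]) auto
  then show ?thesis by (intro exI[of _ \<tau>]) simp
qed

text \<open>As for \<open>whisker_right_full\<close>, with \<gamma> conjugating and \<beta>
  supplying the faithfulness of whiskering with \<open>r\<close>.\<close>

lemma whisker_left_full:
  assumes "f \<in> obj" "r \<in> obj" "src0 T r = tgt0 T f" "tgt0 T r = src0 T f" "isos2 \<beta>" "dom2 \<beta> = f \<bullet> r" "cod2 \<beta> = one T (tgt0 T f)"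
    "isos2 \<gamma>" "dom2 \<gamma> = r \<bullet> f" "cod2 \<gamma> = one T (src0 T f)"
    "g \<in> obj" "g' \<in> obj" "tgt0 T g = src0 T f" "tgt0 T g' = src0 T f" "src0 T g = src0 T g'"
    "\<sigma> \<in> arr" "dom2 \<sigma> = f \<bullet> g" "cod2 \<sigma> = f \<bullet> g'"
  shows "\<exists>\<tau>. \<tau> \<in> arr \<and> dom2 \<tau> = g \<and> cod2 \<tau> = g' \<and> f \<rhd> \<tau> = \<sigma>"
proof -
  note [simp] = assms V.isos_ar[OF assms(8)]
  define \<tau> where "\<tau> = (\<gamma> \<lhd> g') \<odot> (r \<rhd> \<sigma>) \<odot> inv_ar (vert T) (\<gamma> \<lhd> g)"
  have [simp]: "\<tau> \<in> arr" "dom2 \<tau> = g" "cod2 \<tau> = g'" by (simp_all add: \<tau>_def)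
  have "(\<gamma> \<lhd> g') \<odot> ((r \<bullet> f) \<rhd> \<tau>) = \<tau> \<odot> (\<gamma> \<lhd> g)"
    using exchange(1)[of \<tau> \<gamma> "r \<bullet> f" g'] by simp
  also have "\<dots> = (\<gamma> \<lhd> g') \<odot> (r \<rhd> \<sigma>)" by (simp add: \<tau>_def)
  finally have "(r \<bullet> f) \<rhd> \<tau> = r \<rhd> \<sigma>" by (rule V.iso_cancel_left[rotated -1]) auto
  then have "r \<rhd> f \<rhd> \<tau> = r \<rhd> \<sigma>" by simp
  then have "f \<rhd> \<tau> = \<sigma>" by (rule whisker_left_faithful[of r f \<beta>, rotated -1]) auto
  then show ?thesis by (intro exI[of _ \<tau>]) simp
qed

lemma free_forD:
  assumes "free_for T X P e A"
  shows "e \<in> obj" "src0 T e = X" "tgt0 T e = P"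
    "f \<in> obj \<Longrightarrow> src0 T f = X \<Longrightarrow> tgt0 T f = A \<Longrightarrow>
      \<exists>g \<sigma>. g \<in> obj \<and> src0 T g = P \<and> tgt0 T g = A \<and> \<sigma> \<in> arr \<and> isos2 \<sigma> \<and> dom2 \<sigma> = f \<and> cod2 \<sigma> = g \<bullet> e"
    "g \<in> obj \<Longrightarrow> src0 T g = P \<Longrightarrow> tgt0 T g = A \<Longrightarrow> g' \<in> obj \<Longrightarrow> src0 T g' = P \<Longrightarrow> tgt0 T g' = A \<Longrightarrow>
      \<sigma> \<in> arr \<Longrightarrow> dom2 \<sigma> = g \<bullet> e \<Longrightarrow> cod2 \<sigma> = g' \<bullet> e \<Longrightarrow>
      \<exists>!\<tau>. \<tau> \<in> arr \<and> dom2 \<tau> = g \<and> cod2 \<tau> = g' \<and> \<tau> \<lhd> e = \<sigma>"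
proof -
  show "e \<in> obj" "src0 T e = X" "tgt0 T e = P" using assms by (auto simp: free_for_def cell1_iff)
  { assume "f \<in> obj" "src0 T f = X" "tgt0 T f = A"
    then have "f \<in> cell1 T X A" by (simp add: cell1_iff)
    then obtain g \<sigma> where "g \<in> cell1 T P A" "\<sigma> \<in> invcell2 T f (g \<bullet> e)" using assms unfolding free_for_def by blast
    then show "\<exists>g \<sigma>. g \<in> obj \<and> src0 T g = P \<and> tgt0 T g = A \<and> \<sigma> \<in> arr \<and> isos2 \<sigma> \<and> dom2 \<sigma> = f \<and> cod2 \<sigma> = g \<bullet> e"
      by (auto simp: cell1_iff iso_iff) }
  assume "g \<in> obj" "src0 T g = P" "tgt0 T g = A" "g' \<in> obj" "src0 T g' = P" "tgt0 T g' = A"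
      "\<sigma> \<in> arr" "dom2 \<sigma> = g \<bullet> e" "cod2 \<sigma> = g' \<bullet> e"
  then have "g \<in> cell1 T P A" "g' \<in> cell1 T P A" "\<sigma> \<in> cell2 T (g \<bullet> e) (g' \<bullet> e)" by (auto simp: cell1_iff hom_iff)
  then have "\<exists>!\<tau>. \<tau> \<in> cell2 T g g' \<and> \<tau> \<lhd> e = \<sigma>" using assms unfolding free_for_def by blast
  then show "\<exists>!\<tau>. \<tau> \<in> arr \<and> dom2 \<tau> = g \<and> cod2 \<tau> = g' \<and> \<tau> \<lhd> e = \<sigma>" by (simp add: hom_iff)
qed

lemma free_for_faithful:
  assumes e: "free_for T X P e A"
    and t: "\<tau> \<in> arr" "\<tau>' \<in> arr" "dom2 \<tau> = dom2 \<tau>'" "cod2 \<tau> = cod2 \<tau>'" "src0 T (dom2 \<tau>') = P"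
      "tgt0 T (dom2 \<tau>') = A" "\<tau> \<lhd> e = \<tau>' \<lhd> e"
  shows "\<tau> = \<tau>'"
proof -
  note [simp] = free_forD(1-3)[OF e]
  have "src0 T (cod2 \<tau>') = P" "tgt0 T (cod2 \<tau>') = A" "dom2 \<tau>' \<in> obj" "cod2 \<tau>' \<in> obj" using t(1-6) by auto
  then have "\<exists>!\<rho>. \<rho> \<in> arr \<and> dom2 \<rho> = dom2 \<tau>' \<and> cod2 \<rho> = cod2 \<tau>' \<and> \<rho> \<lhd> e = \<tau>' \<lhd> e"
    using t(2,5,6) by (intro free_forD(5)[OF e]) simp_all
  then show ?thesis using t(1-4,7) by blast
qed

lemma free_forI:
  assumes "e \<in> obj" "src0 T e = X" "tgt0 T e = P"
    "\<And>f. f \<in> obj \<Longrightarrow> src0 T f = X \<Longrightarrow> tgt0 T f = A \<Longrightarrow>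
      \<exists>g \<sigma>. g \<in> obj \<and> src0 T g = P \<and> tgt0 T g = A \<and> \<sigma> \<in> arr \<and> isos2 \<sigma> \<and> dom2 \<sigma> = f \<and> cod2 \<sigma> = g \<bullet> e"
    "\<And>g g' \<sigma>. g \<in> obj \<Longrightarrow> src0 T g = P \<Longrightarrow> tgt0 T g = A \<Longrightarrow> g' \<in> obj \<Longrightarrow> src0 T g' = P \<Longrightarrow> tgt0 T g' = A \<Longrightarrow>
      \<sigma> \<in> arr \<Longrightarrow> dom2 \<sigma> = g \<bullet> e \<Longrightarrow> cod2 \<sigma> = g' \<bullet> e \<Longrightarrow>
      \<exists>\<tau>. \<tau> \<in> arr \<and> dom2 \<tau> = g \<and> cod2 \<tau> = g' \<and> \<tau> \<lhd> e = \<sigma>"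
    "\<And>\<tau> \<tau>'. \<tau> \<in> arr \<Longrightarrow> \<tau>' \<in> arr \<Longrightarrow> dom2 \<tau> = dom2 \<tau>' \<Longrightarrow> cod2 \<tau> = cod2 \<tau>' \<Longrightarrow> src0 T (dom2 \<tau>') = P \<Longrightarrow>
      tgt0 T (dom2 \<tau>') = A \<Longrightarrow> \<tau> \<lhd> e = \<tau>' \<lhd> e \<Longrightarrow> \<tau> = \<tau>'"
  shows "free_for T X P e A"
  unfolding free_for_def
proof (intro conjI ballI)
  show "e \<in> cell1 T X P" using assms(1-3) by (simp add: cell1_iff)
next
  fix f assume "f \<in> cell1 T X A"
  then obtain g \<sigma> where "g \<in> obj" "src0 T g = P" "tgt0 T g = A" "\<sigma> \<in> invcell2 T f (g \<bullet> e)"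
    using assms(4)[of f] by (auto simp: cell1_iff iso_iff)
  then show "\<exists>g\<in>cell1 T P A. invcell2 T f (g \<bullet> e) \<noteq> {}" by (intro bexI[of _ g]) (auto simp: cell1_iff)
next
  fix g g' \<sigma> assume *: "g \<in> cell1 T P A" "g' \<in> cell1 T P A" "\<sigma> \<in> cell2 T (g \<bullet> e) (g' \<bullet> e)"
  then obtain \<tau> where \<tau>: "\<tau> \<in> cell2 T g g'" "\<tau> \<lhd> e = \<sigma>"
    using assms(5)[of g g' \<sigma>] by (auto simp: cell1_iff hom_iff)
  show "\<exists>!\<tau>. \<tau> \<in> cell2 T g g' \<and> \<tau> \<lhd> e = \<sigma>"
  proof (rule ex1I[of _ \<tau>])
    fix \<tau>' assume "\<tau>' \<in> cell2 T g g' \<and> \<tau>' \<lhd> e = \<sigma>"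
    then show "\<tau>' = \<tau>" using \<tau> * by - (rule assms(6), auto simp: hom_iff cell1_iff)
  qed (use \<tau> in auto)
qed

text \<open>Precomposition with \<open>e \<bullet> f\<close> is precomposition with \<open>e\<close>
  followed by precomposition with \<open>f\<close>, and the latter is fully faithful and, up to
  \<gamma>, surjective.\<close>

lemma free_for_precomp:
  assumes e: "free_for T Y P e A" and f: "equivalence_cell1 T X Y f"
  shows "free_for T X P (e \<bullet> f) A"
proof -
  note e1 [simp] = free_forD(1-3)[OF e]
  from f obtain r \<gamma> \<beta> where fr [simp]: "f \<in> obj" "src0 T f = X" "tgt0 T f = Y" "r \<in> obj" "src0 T r = Y" "tgt0 T r = X"
    "isos2 \<gamma>" "\<gamma> \<in> arr" "dom2 \<gamma> = r \<bullet> f" "cod2 \<gamma> = one T X"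
    "isos2 \<beta>" "\<beta> \<in> arr" "dom2 \<beta> = f \<bullet> r" "cod2 \<beta> = one T Y" "X \<in> cell0 T" "Y \<in> cell0 T"
    by (rule equivalence_cell1E)
  show ?thesis
  proof (rule free_forI)
    fix h assume [simp]: "h \<in> obj" "src0 T h = X" "tgt0 T h = A"
    \<comment> \<open>\<open>h \<bullet> r\<close> is a 1-cell out of \<open>Y\<close>, to which
      freeness of \<open>e\<close> applies; \<gamma> identifies
      \<open>h \<bullet> r \<bullet> f\<close> with \<open>h\<close>.\<close>
    obtain g \<sigma> where "g \<in> obj" "src0 T g = P" "tgt0 T g = A" "\<sigma> \<in> arr" "isos2 \<sigma>" "dom2 \<sigma> = h \<bullet> r" "cod2 \<sigma> = g \<bullet> e"
      using free_forD(4)[OF e, of "h \<bullet> r"] by auto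
    then show "\<exists>g \<sigma>. g \<in> obj \<and> src0 T g = P \<and> tgt0 T g = A \<and> \<sigma> \<in> arr \<and> isos2 \<sigma> \<and> dom2 \<sigma> = h \<and> cod2 \<sigma> = g \<bullet> e \<bullet> f"
      by (intro exI[of _ g] exI[of _ "(\<sigma> \<lhd> f) \<odot> inv_ar (vert T) (h \<rhd> \<gamma>)"]) simp
  next
    fix g g' \<sigma>
    assume g [simp]: "g \<in> obj" "src0 T g = P" "tgt0 T g = A" "g' \<in> obj" "src0 T g' = P" "tgt0 T g' = A"
      "\<sigma> \<in> arr" "dom2 \<sigma> = g \<bullet> e \<bullet> f" "cod2 \<sigma> = g' \<bullet> e \<bullet> f"
    obtain \<rho> where \<rho>: "\<rho> \<in> arr" "dom2 \<rho> = g \<bullet> e" "cod2 \<rho> = g' \<bullet> e" "\<rho> \<lhd> f = \<sigma>"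
      using whisker_right_full[of f r \<beta> \<gamma> "g \<bullet> e" "g' \<bullet> e" \<sigma>] by auto
    obtain \<tau> where \<tau>: "\<tau> \<in> arr" "dom2 \<tau> = g" "cod2 \<tau> = g'" "\<tau> \<lhd> e = \<rho>"
      using free_forD(5)[OF e g(1-6) \<rho>(1-3)] by blast
    show "\<exists>\<tau>. \<tau> \<in> arr \<and> dom2 \<tau> = g \<and> cod2 \<tau> = g' \<and> \<tau> \<lhd> (e \<bullet> f) = \<sigma>"
      using \<tau> \<rho>(4) whisker_right_right[of e f \<tau>] by (intro exI[of _ \<tau>]) simp
  next
    fix \<tau> \<tau>' assume t: "\<tau> \<in> arr" "\<tau>' \<in> arr" "dom2 \<tau> = dom2 \<tau>'" "cod2 \<tau> = cod2 \<tau>'" "src0 T (dom2 \<tau>') = P"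
      "tgt0 T (dom2 \<tau>') = A" "\<tau> \<lhd> (e \<bullet> f) = \<tau>' \<lhd> (e \<bullet> f)"
    then have "(\<tau> \<lhd> e) \<lhd> f = (\<tau>' \<lhd> e) \<lhd> f" by simp
    then have *: "\<tau> \<lhd> e = \<tau>' \<lhd> e" using t by - (rule whisker_right_faithful[of f r \<beta>], simp_all)
    show "\<tau> = \<tau>'" using free_for_faithful[OF e t(1-6) *] .
  qed auto
qed

text \<open>Postcomposition with \<open>f\<close> commutes with precomposition with \<open>e\<close>
  and is fully faithful. A 1-cell into \<open>A\<close> is pushed to \<open>B\<close>, factored
  there and sent back by \<open>r\<close>; a 2-cell is sent back by fullness.\<close>

lemma free_for_postcomp:
  assumes e: "free_for T X P e B" and f: "equivalence_cell1 T A B f"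
  shows "free_for T X P e A"
proof -
  note e1 [simp] = free_forD(1-3)[OF e]
  from f obtain r \<gamma> \<beta> where fr [simp]: "f \<in> obj" "src0 T f = A" "tgt0 T f = B" "r \<in> obj" "src0 T r = B" "tgt0 T r = A"
    "isos2 \<gamma>" "\<gamma> \<in> arr" "dom2 \<gamma> = r \<bullet> f" "cod2 \<gamma> = one T A"
    "isos2 \<beta>" "\<beta> \<in> arr" "dom2 \<beta> = f \<bullet> r" "cod2 \<beta> = one T B" "A \<in> cell0 T" "B \<in> cell0 T"
    by (rule equivalence_cell1E)
  show ?thesis
  proof (rule free_forI)
    fix h assume [simp]: "h \<in> obj" "src0 T h = X" "tgt0 T h = A"
    obtain g \<sigma> where "g \<in> obj" "src0 T g = P" "tgt0 T g = B" "\<sigma> \<in> arr" "isos2 \<sigma>" "dom2 \<sigma> = f \<bullet> h" "cod2 \<sigma> = g \<bullet> e"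
      using free_forD(4)[OF e, of "f \<bullet> h"] by auto
    then show "\<exists>g \<sigma>. g \<in> obj \<and> src0 T g = P \<and> tgt0 T g = A \<and> \<sigma> \<in> arr \<and> isos2 \<sigma> \<and> dom2 \<sigma> = h \<and> cod2 \<sigma> = g \<bullet> e"
      by (intro exI[of _ "r \<bullet> g"] exI[of _ "(r \<rhd> \<sigma>) \<odot> inv_ar (vert T) (\<gamma> \<lhd> h)"]) simp
  next
    fix g g' \<sigma>
    assume g [simp]: "g \<in> obj" "src0 T g = P" "tgt0 T g = A" "g' \<in> obj" "src0 T g' = P" "tgt0 T g' = A"
      "\<sigma> \<in> arr" "dom2 \<sigma> = g \<bullet> e" "cod2 \<sigma> = g' \<bullet> e"
    obtain \<rho> where \<rho> [simp]: "\<rho> \<in> arr" "dom2 \<rho> = f \<bullet> g" "cod2 \<rho> = f \<bullet> g'" "\<rho> \<lhd> e = f \<rhd> \<sigma>"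
      using free_forD(5)[OF e, of "f \<bullet> g" "f \<bullet> g'" "f \<rhd> \<sigma>"] by auto
    obtain \<tau> where \<tau> [simp]: "\<tau> \<in> arr" "dom2 \<tau> = g" "cod2 \<tau> = g'" "f \<rhd> \<tau> = \<rho>"
      using whisker_left_full[of f r \<beta> \<gamma> g g' \<rho>] by auto
    have "f \<rhd> (\<tau> \<lhd> e) = f \<rhd> \<sigma>" by (simp flip: whisker_left_right)
    then have "\<tau> \<lhd> e = \<sigma>" by (rule whisker_left_faithful[of f r \<gamma>, rotated -1]) auto
    then show "\<exists>\<tau>. \<tau> \<in> arr \<and> dom2 \<tau> = g \<and> cod2 \<tau> = g' \<and> \<tau> \<lhd> e = \<sigma>"
      by (intro exI[of _ \<tau>]) simp
  next
    fix \<tau> \<tau>' assume t: "\<tau> \<in> arr" "\<tau>' \<in> arr" "dom2 \<tau> = dom2 \<tau>'" "cod2 \<tau> = cod2 \<tau>'" "src0 T (dom2 \<tau>') = P"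
      "tgt0 T (dom2 \<tau>') = A" "\<tau> \<lhd> e = \<tau>' \<lhd> e"
    then have *: "(f \<rhd> \<tau>) \<lhd> e = (f \<rhd> \<tau>') \<lhd> e" by simp
    have "src0 T (cod2 \<tau>') = P" "tgt0 T (cod2 \<tau>') = A" using t(1-6) by auto
    then have "f \<rhd> \<tau> = f \<rhd> \<tau>'"
      using t(1-6) * by - (rule free_for_faithful[OF e], simp_all)
    then show "\<tau> = \<tau>'" using t by - (rule whisker_left_faithful[of f r \<gamma>], simp_all)
  qed auto
qed

end

section \<open>Coherent families and strictification\<close>

text \<open>A coherent family is a strong monoidal functor from a discrete strict monoidal category, i.e.
  from a monoid, to \<open>D\<close>.\<close>

locale coherent_family = D: monoidal_category D
  for D :: "('p, 'n, 'x) moncat_scheme" (structure) and M :: "'a set" and mu :: "'a \<Rightarrow> 'a \<Rightarrow> 'a" and e :: 'a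
    and T :: "'a \<Rightarrow> 'p" and m :: "'a \<Rightarrow> 'a \<Rightarrow> 'n" and u :: 'n +
  assumes mu_closed [simp]: "a \<in> M \<Longrightarrow> b \<in> M \<Longrightarrow> mu a b \<in> M"
    and e_closed [simp]: "e \<in> M"
    and mu_assoc [simp]: "a \<in> M \<Longrightarrow> b \<in> M \<Longrightarrow> c \<in> M \<Longrightarrow> mu (mu a b) c = mu a (mu b c)"
    and mu_unit [simp]: "a \<in> M \<Longrightarrow> mu e a = a" "a \<in> M \<Longrightarrow> mu a e = a"
    and T_ob [simp]: "a \<in> M \<Longrightarrow> T a \<in> ob D"
    and m_iso: "a \<in> M \<Longrightarrow> b \<in> M \<Longrightarrow> m a b \<in> iso D (T a \<otimes> T b) (T (mu a b))"
    and u_iso: "u \<in> iso D (unit D) (T e)"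
    and m_assoc: "a \<in> M \<Longrightarrow> b \<in> M \<Longrightarrow> c \<in> M \<Longrightarrow>
      m (mu a b) c \<cdot> m a b \<otimes>\<^sub>a idn D (T c)
      = m a (mu b c) \<cdot> idn D (T a) \<otimes>\<^sub>a m b c \<cdot> asc D (T a) (T b) (T c)"
    and m_unit_left: "a \<in> M \<Longrightarrow> m e a \<cdot> u \<otimes>\<^sub>a idn D (T a) = lun D (T a)"
    and m_unit_right: "a \<in> M \<Longrightarrow> m a e \<cdot> idn D (T a) \<otimes>\<^sub>a u = run D (T a)"
begin

lemma m_simps [simp]:
  assumes "a \<in> M" "b \<in> M"
  shows "m a b \<in> ar D" "src D (m a b) = T a \<otimes> T b" "tgt D (m a b) = T (mu a b)" "isos D (m a b)"
  using m_iso[OF assms] by (auto simp: iso_iff)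

lemma u_simps [simp]: "u \<in> ar D" "src D u = unit D" "tgt D u = T e" "isos D u"
  using u_iso by (auto simp: iso_iff)

end

text \<open>The tensor product of arrows between members of two coherent families; unlike that of \<open>D\<close>
  it is strictly associative and unital.\<close>

definition box ::
  "('p, 'n, 'x) moncat_scheme \<Rightarrow> ('a \<Rightarrow> 'a \<Rightarrow> 'n) \<Rightarrow> ('a \<Rightarrow> 'a \<Rightarrow> 'n) \<Rightarrow> 'a \<Rightarrow> 'a \<Rightarrow> 'a \<Rightarrow> 'a \<Rightarrow> 'n \<Rightarrow> 'n \<Rightarrow> 'n" where
  "box D m m' a b a' b' x y = m' a' b' \<cdot>\<^bsub>D\<^esub> (x \<otimes>\<^sub>a\<^bsub>D\<^esub> y) \<cdot>\<^bsub>D\<^esub> inv_ar D (m a b)"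

locale coherent_families =
  coherent_family D M mu e T m u + F': coherent_family D M mu e T' m' u'
  for D :: "('p, 'n, 'x) moncat_scheme" (structure) and M :: "'a set" and mu e T m u T' m' u'
begin

lemma box_simps [simp]:
  assumes "a \<in> M" "b \<in> M" "a' \<in> M" "b' \<in> M" "x \<in> ar D" "src D x = T a" "tgt D x = T' a'"
    "y \<in> ar D" "src D y = T b" "tgt D y = T' b'"
  shows "box D m m' a b a' b' x y \<in> ar D" "src D (box D m m' a b a' b' x y) = T (mu a b)"
    "tgt D (box D m m' a b a' b' x y) = T' (mu a' b')"
    "box D m m' a b a' b' x y \<cdot> m a b = m' a' b' \<cdot> (x \<otimes>\<^sub>a y)"
  using assms by (simp_all add: box_def)

text \<open>The box is characterised by its square with the multiplications of the two families;
  computing with the square keeps the inverse in its definition out of the way.\<close>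

lemma box_eqI:
  assumes "a \<in> M" "b \<in> M" "a' \<in> M" "b' \<in> M" "x \<in> ar D" "src D x = T a" "tgt D x = T' a'"
    "y \<in> ar D" "src D y = T b" "tgt D y = T' b'" "z \<in> ar D" "src D z = T (mu a b)"
    "z \<cdot> m a b = m' a' b' \<cdot> (x \<otimes>\<^sub>a y)"
  shows "box D m m' a b a' b' x y = z"
proof -
  have "z = (z \<cdot> m a b) \<cdot> inv_ar D (m a b)" using assms(1-12) by simp
  then show ?thesis using assms(1-12) unfolding assms(13) box_def by simp
qed

text \<open>The associator of \<open>D\<close> enters through \<open>m_assoc\<close> of the source
  family, is moved across \<open>x\<close>, \<open>y\<close> and \<open>z\<close> by its naturality,
  and is absorbed by \<open>m_assoc\<close> of the target family.\<close>

lemma box_assoc: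
  assumes [simp]: "a \<in> M" "b \<in> M" "c \<in> M" "a' \<in> M" "b' \<in> M" "c' \<in> M"
    "x \<in> ar D" "src D x = T a" "tgt D x = T' a'"
    "y \<in> ar D" "src D y = T b" "tgt D y = T' b'" "z \<in> ar D" "src D z = T c" "tgt D z = T' c'"
  shows "box D m m' (mu a b) c (mu a' b') c' (box D m m' a b a' b' x y) z
    = box D m m' a (mu b c) a' (mu b' c') x (box D m m' b c b' c' y z)"
proof (rule box_eqI)
  let ?y = "box D m m' a b a' b' x y" and ?z = "box D m m' b c b' c' y z"
  let ?r = "box D m m' a (mu b c) a' (mu b' c') x ?z"
  have "(?r \<cdot> m (mu a b) c) \<cdot> m a b \<otimes>\<^sub>a idn D (T c)
      = (?r \<cdot> m a (mu b c)) \<cdot> idn D (T a) \<otimes>\<^sub>a m b c \<cdot> asc D (T a) (T b) (T c)"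
    by (simp add: m_assoc del: box_simps(4))
  also have "\<dots> = m' a' (mu b' c') \<cdot> (x \<otimes>\<^sub>a (?z \<cdot> m b c)) \<cdot> asc D (T a) (T b) (T c)"
    using D.reassoc[OF box_simps(4)[of a "mu b c" a' "mu b' c'" x ?z]] by (simp add: D.tar_merge')
  also have "\<dots> = m' a' (mu b' c') \<cdot> (idn D (T' a') \<otimes>\<^sub>a m' b' c') \<cdot> (x \<otimes>\<^sub>a (y \<otimes>\<^sub>a z)) \<cdot> asc D (T a) (T b) (T c)"
    by (simp add: D.tar_merge')
  also have "\<dots> = (m' a' (mu b' c') \<cdot> (idn D (T' a') \<otimes>\<^sub>a m' b' c') \<cdot> asc D (T' a') (T' b') (T' c')) \<cdot> ((x \<otimes>\<^sub>a y) \<otimes>\<^sub>a z)"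
    using D.asc_nat[of x y z] by simp
  also have "\<dots> = m' (mu a' b') c' \<cdot> ((m' a' b' \<cdot> (x \<otimes>\<^sub>a y)) \<otimes>\<^sub>a z)"
    by (simp add: D.tar_merge flip: F'.m_assoc)
  also have "\<dots> = (m' (mu a' b') c' \<cdot> ?y \<otimes>\<^sub>a z) \<cdot> m a b \<otimes>\<^sub>a idn D (T c)"
    by (simp add: D.tar_merge)
  finally show "?r \<cdot> m (mu a b) c = m' (mu a' b') c' \<cdot> ?y \<otimes>\<^sub>a z"
    by (rule D.iso_cancel_right[rotated -1]) simp_all
qed simp_all

text \<open>The neutral arrow for boxes is the comparison \<open>u' \<cdot> inv_ar D u\<close> from
  \<open>T e\<close> to \<open>T' e\<close>; for a single family it is an identity.\<close>

lemma box_unit_left: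
  assumes [simp]: "a \<in> M" "a' \<in> M" "x \<in> ar D" "src D x = T a" "tgt D x = T' a'"
  shows "box D m m' e a e a' (u' \<cdot> inv_ar D u) x = x"
proof (rule box_eqI)
  have "(x \<cdot> m e a) \<cdot> u \<otimes>\<^sub>a idn D (T a) = lun D (T' a') \<cdot> idn D (unit D) \<otimes>\<^sub>a x"
    using D.lun_nat[of x] by (simp add: m_unit_left)
  also have "\<dots> = (m' e a' \<cdot> (u' \<cdot> inv_ar D u) \<otimes>\<^sub>a x) \<cdot> u \<otimes>\<^sub>a idn D (T a)"
    by (simp add: D.tar_merge flip: F'.m_unit_left)
  finally show "x \<cdot> m e a = m' e a' \<cdot> (u' \<cdot> inv_ar D u) \<otimes>\<^sub>a x"
    by (rule D.iso_cancel_right[rotated -1]) simp_all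
qed simp_all

lemma box_unit_right:
  assumes [simp]: "a \<in> M" "a' \<in> M" "x \<in> ar D" "src D x = T a" "tgt D x = T' a'"
  shows "box D m m' a e a' e x (u' \<cdot> inv_ar D u) = x"
proof (rule box_eqI)
  have "(x \<cdot> m a e) \<cdot> idn D (T a) \<otimes>\<^sub>a u = run D (T' a') \<cdot> x \<otimes>\<^sub>a idn D (unit D)"
    using D.run_nat[of x] by (simp add: m_unit_right)
  also have "\<dots> = (m' a' e \<cdot> x \<otimes>\<^sub>a (u' \<cdot> inv_ar D u)) \<cdot> idn D (T a) \<otimes>\<^sub>a u"
    by (simp add: D.tar_merge flip: F'.m_unit_right)
  finally show "x \<cdot> m a e = m' a' e \<cdot> x \<otimes>\<^sub>a (u' \<cdot> inv_ar D u)"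
    by (rule D.iso_cancel_right[rotated -1]) simp_all
qed simp_all

end

text \<open>An arrow is stored with its ends because \<open>T\<close> need not be injective. Objects
  multiply in the monoid \<open>M\<close>, hence strictly even when \<open>D\<close> is not strict;
  boxes make the tensor product of arrows match this, which allows identities as structure
  isomorphisms.\<close>

definition full_image ::
  "('p, 'n) pmoncat \<Rightarrow> 'a set \<Rightarrow> ('a \<Rightarrow> 'a \<Rightarrow> 'a) \<Rightarrow> 'a \<Rightarrow> ('a \<Rightarrow> 'p) \<Rightarrow> ('a \<Rightarrow> 'a \<Rightarrow> 'n) \<Rightarrow> 'a \<Rightarrow>
    ('a, 'a \<times> 'n \<times> 'a) pmoncat" where
  "full_image D M mu e T m p =
     \<lparr>ob = M, ar = {(a, f, b). a \<in> M \<and> b \<in> M \<and> f \<in> hom D (T a) (T b)},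
      src = fst, tgt = (\<lambda>f. snd (snd f)), idn = (\<lambda>a. (a, idn D (T a), a)),
      cmp = (\<lambda>g f. (fst f, fst (snd g) \<cdot>\<^bsub>D\<^esub> fst (snd f), snd (snd g))),
      tob = mu,
      tar = (\<lambda>f g. (mu (fst f) (fst g),
        box D m m (fst f) (fst g) (snd (snd f)) (snd (snd g)) (fst (snd f)) (fst (snd g)),
        mu (snd (snd f)) (snd (snd g)))),
      unit = e, asc = (\<lambda>a b c. (mu a (mu b c), idn D (T (mu a (mu b c))), mu a (mu b c))),
      lun = (\<lambda>a. (a, idn D (T a), a)), run = (\<lambda>a. (a, idn D (T a), a)), pt = p\<rparr>"

lemma full_image_simps [simp]:
  "ob (full_image D M mu e T m p) = M"
  "(a, f, b) \<in> ar (full_image D M mu e T m p) \<longleftrightarrow> a \<in> M \<and> b \<in> M \<and> f \<in> ar D \<and> src D f = T a \<and> tgt D f = T b"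
  "src (full_image D M mu e T m p) (a, f, b) = a" "tgt (full_image D M mu e T m p) (a, f, b) = b"
  "idn (full_image D M mu e T m p) a = (a, idn D (T a), a)"
  "cmp (full_image D M mu e T m p) (b', g, c) (a, f, b) = (a, g \<cdot>\<^bsub>D\<^esub> f, c)"
  "tob (full_image D M mu e T m p) = mu"
  "tar (full_image D M mu e T m p) (a, f, b) (c, g, d) = (mu a c, box D m m a c b d f g, mu b d)"
  "unit (full_image D M mu e T m p) = e"
  "asc (full_image D M mu e T m p) a b c = (mu a (mu b c), idn D (T (mu a (mu b c))), mu a (mu b c))"
  "lun (full_image D M mu e T m p) a = (a, idn D (T a), a)"
  "run (full_image D M mu e T m p) a = (a, idn D (T a), a)"
  "pt (full_image D M mu e T m p) = p"
  by (simp_all add: full_image_def hom_iff)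

definition full_image_proj ::
  "('p, 'n) pmoncat \<Rightarrow> 'a set \<Rightarrow> ('a \<Rightarrow> 'a \<Rightarrow> 'a) \<Rightarrow> 'a \<Rightarrow> ('a \<Rightarrow> 'p) \<Rightarrow> ('a \<Rightarrow> 'a \<Rightarrow> 'n) \<Rightarrow> 'n \<Rightarrow> 'a \<Rightarrow> 'n \<Rightarrow>
    ('a, 'a \<times> 'n \<times> 'a, 'p, 'n) pmonfun" where
  "full_image_proj D M mu e T m u p \<phi> = \<lparr>fdom = full_image D M mu e T m p, fcod = D,
     fob = restrict T M, far = (\<lambda>f\<in>ar (full_image D M mu e T m p). fst (snd f)),
     fmul = (\<lambda>a\<in>M. \<lambda>b\<in>M. m a b), funit = u, fpt = \<phi>\<rparr>"

lemma full_image_proj_simps [simp]: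
  "fdom (full_image_proj D M mu e T m u p \<phi>) = full_image D M mu e T m p"
  "fcod (full_image_proj D M mu e T m u p \<phi>) = D"
  "a \<in> M \<Longrightarrow> fob (full_image_proj D M mu e T m u p \<phi>) a = T a"
  "(a, f, b) \<in> ar (full_image D M mu e T m p) \<Longrightarrow> far (full_image_proj D M mu e T m u p \<phi>) (a, f, b) = f"
  "a \<in> M \<Longrightarrow> b \<in> M \<Longrightarrow> fmul (full_image_proj D M mu e T m u p \<phi>) a b = m a b"
  "funit (full_image_proj D M mu e T m u p \<phi>) = u" "fpt (full_image_proj D M mu e T m u p \<phi>) = \<phi>"
  by (simp_all add: full_image_proj_def del: full_image_simps)

context coherent_family
begin

sublocale FF: coherent_families D M mu e T m u T m u
  by unfold_locales

lemma box_idn [simp]: "a \<in> M \<Longrightarrow> b \<in> M \<Longrightarrow> box D m m a b a b (idn D (T a)) (idn D (T b)) = idn D (T (mu a b))"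
  by (simp add: box_def)

lemma box_unit [simp]:
  "a \<in> M \<Longrightarrow> a' \<in> M \<Longrightarrow> x \<in> ar D \<Longrightarrow> src D x = T a \<Longrightarrow> tgt D x = T a' \<Longrightarrow> box D m m e a e a' (idn D (T e)) x = x"
  "a \<in> M \<Longrightarrow> a' \<in> M \<Longrightarrow> x \<in> ar D \<Longrightarrow> src D x = T a \<Longrightarrow> tgt D x = T a' \<Longrightarrow> box D m m a e a' e x (idn D (T e)) = x"
  using FF.box_unit_left[of a a' x] FF.box_unit_right[of a a' x] by simp_all

end

text \<open>The multiplication \<open>m'\<close> of the middle family meets its inverse and
  cancels.\<close>

lemma box_cmp:
  fixes D (structure)
  assumes "coherent_families D M mu e T m u T' m' u'" "coherent_families D M mu e T' m' u' T'' m'' u''"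
  assumes [simp]: "a \<in> M" "b \<in> M" "a' \<in> M" "b' \<in> M" "a'' \<in> M" "b'' \<in> M"
    "x \<in> ar D" "src D x = T a" "tgt D x = T' a'" "y \<in> ar D" "src D y = T b" "tgt D y = T' b'"
    "x' \<in> ar D" "src D x' = T' a'" "tgt D x' = T'' a''" "y' \<in> ar D" "src D y' = T' b'" "tgt D y' = T'' b''"
  shows "box D m m'' a b a'' b'' (x' \<cdot> x) (y' \<cdot> y)
    = box D m' m'' a' b' a'' b'' x' y' \<cdot> box D m m' a b a' b' x y"
proof -
  interpret F: coherent_families D M mu e T m u T' m' u' by fact
  interpret G: coherent_families D M mu e T' m' u' T'' m'' u'' by fact
  show ?thesis by (simp add: box_def F.D.tar_merge')
qed

locale pointed_coherent_family = D: pointed_monoidal_category D + coherent_family D M mu e T m u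
  for D :: "('p, 'n) pmoncat" (structure) and M :: "'a set" and mu e T m u +
  fixes p :: 'a and \<phi> :: 'n
  assumes p_M [simp]: "p \<in> M" and phi: "\<phi> \<in> iso D (T p) (pt D)"
begin

abbreviation "I \<equiv> full_image D M mu e T m p"
abbreviation "P \<equiv> full_image_proj D M mu e T m u p \<phi>"

lemma full_image_category: "category I"
  by unfold_locales (auto simp: hom_iff)

lemma isos_full_image: "(a, f, b) \<in> ar I \<Longrightarrow> isos D f \<Longrightarrow> isos I (a, f, b)"
  by (rule category.isosI(1)[OF full_image_category, of _ "(b, inv_ar D f, a)"]) auto

lemma full_image_strict: "strict_monoidal_category I"
proof -
  interpret I: category I by (rule full_image_category)
  have FF: "coherent_families D M mu e T m u T m u" by unfold_locales
  show ?thesis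
    by unfold_locales (auto simp: hom_iff iso_iff isos_full_image box_cmp[OF FF FF] FF.box_assoc)
qed

lemma full_image_pmcat: "pmcat I"
proof -
  interpret I: strict_monoidal_category I by (rule full_image_strict)
  show ?thesis by unfold_locales simp
qed

text \<open>The structure isomorphisms of \<open>I\<close> project to identities, so the axioms of a
  monoidal functor reduce to those of the coherent family.\<close>

lemma full_image_proj_pmfun: "pmfun I D P"
proof -
  interpret I: pointed_monoidal_category I by (rule full_image_pmcat)
  have "is_functor I D (fob P) (far P)"
    unfolding is_functor_def using I.category_axioms D.category_axioms by (auto simp: hom_iff)
  then show ?thesis
    using phi by unfold_locales
      (auto simp: hom_iff iso_iff m_assoc m_unit_left m_unit_right, auto simp: full_image_proj_def)
qed

end

section \<open>Tensor products of lists\<close>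

primrec tens :: "('o, 'm, 'x) moncat_scheme \<Rightarrow> 'o list \<Rightarrow> 'o" where
  "tens C [] = unit C"
| "tens C (x # U) = (if U = [] then x else x \<otimes>\<^bsub>C\<^esub> tens C U)"

text \<open>A one-letter list tensors to its letter, without a unit factor, which makes the
  projection of \<open>[x]\<close> equal to \<open>x\<close>. The cases of the multiplication follow
  from this: unitors for empty lists, an identity for a single first letter, associators for longer
  lists.\<close>

primrec tens_mul :: "('o, 'm, 'x) moncat_scheme \<Rightarrow> 'o list \<Rightarrow> 'o list \<Rightarrow> 'm" where
  "tens_mul C [] V = lun C (tens C V)"
| "tens_mul C (x # U) V =
     (if V = [] then run C (tens C (x # U)) else if U = [] then idn C (x \<otimes>\<^bsub>C\<^esub> tens C V)
      else idn C x \<otimes>\<^sub>a\<^bsub>C\<^esub> tens_mul C U V \<cdot>\<^bsub>C\<^esub> asc C x (tens C U) (tens C V))"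

context monoidal_category
begin

lemma tens_ob [simp]: "set U \<subseteq> ob C \<Longrightarrow> tens C U \<in> ob C"
  by (induction U) auto

lemma tens_mul_simps:
  "set U \<subseteq> ob C \<Longrightarrow> set V \<subseteq> ob C \<Longrightarrow> tens_mul C U V \<in> ar C \<and> src C (tens_mul C U V) = tens C U \<otimes> tens C V \<and>
    tgt C (tens_mul C U V) = tens C (U @ V) \<and> isos C (tens_mul C U V)"
  by (induction U) auto

text \<open>If a list is empty, the law is one of the unit coherences \<open>lun_tob\<close>,
  \<open>triangle\<close> and \<open>run_tob\<close>. Otherwise the first letter of \<open>U\<close>
  is split off, and the inductive step is the pentagon.\<close>

lemma tens_mul_assoc:
  assumes "set U \<subseteq> ob C" and [simp]: "set V \<subseteq> ob C" "set W \<subseteq> ob C"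
  shows "tens_mul C (U @ V) W \<cdot> tens_mul C U V \<otimes>\<^sub>a idn C (tens C W)
    = tens_mul C U (V @ W) \<cdot> idn C (tens C U) \<otimes>\<^sub>a tens_mul C V W \<cdot> asc C (tens C U) (tens C V) (tens C W)"
proof -
  note [simp] = tens_mul_simps
  consider "U = []" | "U \<noteq> []" "V = []" | "U \<noteq> []" "V \<noteq> []" "W = []" | "U \<noteq> []" "V \<noteq> []" "W \<noteq> []" by blast
  then show ?thesis
  proof cases
    case 1
    have "lun C (tens C (V @ W)) \<cdot> idn C (unit C) \<otimes>\<^sub>a tens_mul C V W \<cdot> asc C (unit C) (tens C V) (tens C W)
        = tens_mul C V W \<cdot> lun C (tens C V \<otimes> tens C W) \<cdot> asc C (unit C) (tens C V) (tens C W)"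
      using reassoc[OF lun_nat[of "tens_mul C V W"]] by simp
    then show ?thesis using 1 by (simp add: lun_tob)
  next
    case 2
    then obtain x U' where "U = x # U'" by (cases U) auto
    then have "tens_mul C U [] = run C (tens C U)" by simp
    then show ?thesis using 2 assms(1) by (simp add: triangle)
  next
    case 3
    then obtain x U' y V' where "U = x # U'" "V = y # V'" by (cases U; cases V) auto
    then have "tens_mul C (U @ V) [] = run C (tens C (U @ V))" "tens_mul C V [] = run C (tens C V)" by simp_all
    moreover have "run C (tens C (U @ V)) \<cdot> tens_mul C U V \<otimes>\<^sub>a idn C (unit C) = tens_mul C U V \<cdot> run C (tens C U \<otimes> tens C V)"
      using run_nat[of "tens_mul C U V"] assms(1) by simp
    ultimately show ?thesis using 3 assms(1) by (simp add: run_tob)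
  next
    case 4
    from 4(1) assms(1) show ?thesis
    proof (induction U rule: list_nonempty_induct)
      case (single x)
      then show ?case using 4 by simp
    next
      case (cons x U)
      let ?U = "tens C U" and ?V = "tens C V" and ?W = "tens C W"
      have [simp]: "set U \<subseteq> ob C" "x \<in> ob C" "U \<noteq> []" "V \<noteq> []" "W \<noteq> []" using cons 4 by auto
      have "tens_mul C ((x # U) @ V) W \<cdot> tens_mul C (x # U) V \<otimes>\<^sub>a idn C ?W
          = idn C x \<otimes>\<^sub>a tens_mul C (U @ V) W \<cdot> (asc C x (tens C (U @ V)) ?W \<cdot> (idn C x \<otimes>\<^sub>a tens_mul C U V) \<otimes>\<^sub>a idn C ?W)
            \<cdot> asc C x ?U ?V \<otimes>\<^sub>a idn C ?W"
        by (simp add: tar_merge)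
      also have "\<dots> = (idn C x \<otimes>\<^sub>a (tens_mul C (U @ V) W \<cdot> tens_mul C U V \<otimes>\<^sub>a idn C ?W))
          \<cdot> asc C x (?U \<otimes> ?V) ?W \<cdot> asc C x ?U ?V \<otimes>\<^sub>a idn C ?W"
        using asc_nat[of "idn C x" "tens_mul C U V" "idn C ?W"] by (simp add: tar_merge')
      also have "\<dots> = (idn C x \<otimes>\<^sub>a tens_mul C U (V @ W)) \<cdot> (idn C x \<otimes>\<^sub>a (idn C ?U \<otimes>\<^sub>a tens_mul C V W))
          \<cdot> (idn C x \<otimes>\<^sub>a asc C ?U ?V ?W) \<cdot> asc C x (?U \<otimes> ?V) ?W \<cdot> asc C x ?U ?V \<otimes>\<^sub>a idn C ?W"
        using cons.IH by (simp add: tar_merge')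
      also have "\<dots> = (idn C x \<otimes>\<^sub>a tens_mul C U (V @ W)) \<cdot> (idn C x \<otimes>\<^sub>a (idn C ?U \<otimes>\<^sub>a tens_mul C V W))
          \<cdot> asc C x ?U (?V \<otimes> ?W) \<cdot> asc C (x \<otimes> ?U) ?V ?W"
        by (simp add: pentagon)
      also have "\<dots> = (idn C x \<otimes>\<^sub>a tens_mul C U (V @ W)) \<cdot> asc C x ?U (tens C (V @ W)) \<cdot> (idn C (x \<otimes> ?U) \<otimes>\<^sub>a tens_mul C V W)
          \<cdot> asc C (x \<otimes> ?U) ?V ?W"
        using reassoc[OF asc_nat[of "idn C x" "idn C ?U" "tens_mul C V W"]] by simp
      finally show ?case by simp
    qed
  qed
qed

lemma coherent_family_tens:
  "coherent_family C {U. set U \<subseteq> ob C} (@) [] (tens C) (tens_mul C) (idn C (unit C))"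
proof unfold_locales
  fix U V W assume "U \<in> {U. set U \<subseteq> ob C}" "V \<in> {U. set U \<subseteq> ob C}" "W \<in> {U. set U \<subseteq> ob C}"
  then show "tens_mul C (U @ V) W \<cdot> tens_mul C U V \<otimes>\<^sub>a idn C (tens C W)
    = tens_mul C U (V @ W) \<cdot> idn C (tens C U) \<otimes>\<^sub>a tens_mul C V W \<cdot> asc C (tens C U) (tens C V) (tens C W)"
    by (simp add: tens_mul_assoc)
next
  fix U assume "U \<in> {U. set U \<subseteq> ob C}"
  then show "tens_mul C U [] \<cdot> idn C (tens C U) \<otimes>\<^sub>a idn C (unit C) = run C (tens C U)"
    \<comment> \<open>For the empty list the law compares \<open>lun\<close> and \<open>run\<close>
      at the unit.\<close>
    by (cases U) (auto simp: lun_unit)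
qed (auto simp: tens_mul_simps iso_iff)

end

section \<open>Strictification by lists of objects\<close>

locale strictify = C: pointed_monoidal_category C
  for C :: "('o, 'm) pmoncat"
begin

sublocale coherent_family C "{U. set U \<subseteq> ob C}" "(@)" "[]" "tens C" "tens_mul C" "idn C (unit C)"
  by (rule C.coherent_family_tens)

sublocale pointed_coherent_family C "{U. set U \<subseteq> ob C}" "(@)" "[]" "tens C" "tens_mul C" "idn C (unit C)" "[pt C]" "idn C (pt C)"
  by unfold_locales (auto simp: iso_iff)

text \<open>The section of the projection by one-letter lists. It is strong and not strict:
  \<open>[x, y]\<close> and the one-letter list of their tensor product, or \<open>[]\<close> and
  \<open>[unit C]\<close>, are different lists with the same image in \<open>C\<close>, and the
  constraints are the identities of that image.\<close>

definition G where
  "G = \<lparr>fdom = C, fcod = I, fob = (\<lambda>x\<in>ob C. [x]), far = (\<lambda>f\<in>ar C. ([src C f], f, [tgt C f])),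
     fmul = (\<lambda>x\<in>ob C. \<lambda>y\<in>ob C. ([x, y], idn C (x \<otimes>\<^bsub>C\<^esub> y), [x \<otimes>\<^bsub>C\<^esub> y])),
     funit = ([], idn C (unit C), [unit C]), fpt = ([pt C], idn C (pt C), [pt C])\<rparr>"

lemma G_simps [simp]:
  "fdom G = C" "fcod G = I" "x \<in> ob C \<Longrightarrow> fob G x = [x]" "f \<in> ar C \<Longrightarrow> far G f = ([src C f], f, [tgt C f])"
  "x \<in> ob C \<Longrightarrow> y \<in> ob C \<Longrightarrow> fmul G x y = ([x, y], idn C (x \<otimes>\<^bsub>C\<^esub> y), [x \<otimes>\<^bsub>C\<^esub> y])"
  "funit G = ([], idn C (unit C), [unit C])" "fpt G = ([pt C], idn C (pt C), [pt C])"
  by (simp_all add: G_def)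

lemma G_pmfun: "pmfun C I G"
proof -
  interpret I: strict_monoidal_category I by (rule full_image_strict)
  interpret I: pointed_monoidal_category I by (rule full_image_pmcat)
  have "is_functor C I (fob G) (far G)"
    unfolding is_functor_def using I.category_axioms C.category_axioms by (auto simp: hom_iff)
  then show ?thesis
    by unfold_locales (auto simp: hom_iff iso_iff isos_full_image box_def, auto simp: G_def)
qed

text \<open>A list and the one-letter list of its tensor product have the same image in
  \<open>C\<close>, so an identity of \<open>C\<close> is an isomorphism between them in the full
  image.\<close>

definition retract where
  "retract = \<lparr>ndom = comp_pmonfun G P, ncod = id_pmonfun I,
     ncmp = (\<lambda>U\<in>{U. set U \<subseteq> ob C}. ([tens C U], idn C (tens C U), U))\<rparr>"

lemma retract_simps [simp]:
  "ndom retract = comp_pmonfun G P" "ncod retract = id_pmonfun I"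
  "set U \<subseteq> ob C \<Longrightarrow> ncmp retract U = ([tens C U], idn C (tens C U), U)"
  by (simp_all add: retract_def)

lemma retract_pmnat: "pmnat I I (comp_pmonfun G P) (id_pmonfun I) retract"
proof -
  interpret GP: pointed_monoidal_functor I I "comp_pmonfun G P"
    by (rule comp_pmfun[OF full_image_proj_pmfun G_pmfun])
  interpret id: pointed_monoidal_functor I I "id_pmonfun I"
    by (rule GP.C.id_pmfun)
  show ?thesis
    by unfold_locales (auto simp: hom_iff box_def C.tens_mul_simps, auto simp: retract_def)
qed

lemma P_G: "comp_pmonfun P G = id_pmonfun C"
  by (rule pmonfun_eqI[OF comp_pmfun[OF G_pmfun full_image_proj_pmfun] C.id_pmfun]) (auto simp: C.tens_mul_simps)

end

section \<open>Transport along injective renamings\<close>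

locale renaming = C: pointed_monoidal_category C
  for C :: "('o, 'm) pmoncat" + 
  fixes i :: "'o \<Rightarrow> 'p" and j :: "'m \<Rightarrow> 'n"
  assumes i: "inj_on i (ob C)" and j: "inj_on j (ar C)"
begin

abbreviation "C' \<equiv> rename i j C"

lemma ij_inv [simp]:
  "a \<in> ob C \<Longrightarrow> inv_into (ob C) i (i a) = a" "f \<in> ar C \<Longrightarrow> inv_into (ar C) j (j f) = f"
  "a \<in> ob C \<Longrightarrow> b \<in> ob C \<Longrightarrow> i a = i b \<longleftrightarrow> a = b" "f \<in> ar C \<Longrightarrow> g \<in> ar C \<Longrightarrow> j f = j g \<longleftrightarrow> f = g"
  using i j by (auto dest: inj_onD)

lemma rename_simps [simp]:
  "ob C' = i ` ob C" "ar C' = j ` ar C"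
  "f \<in> ar C \<Longrightarrow> src C' (j f) = i (src C f)" "f \<in> ar C \<Longrightarrow> tgt C' (j f) = i (tgt C f)"
  "a \<in> ob C \<Longrightarrow> idn C' (i a) = j (idn C a)"
  "f \<in> ar C \<Longrightarrow> g \<in> ar C \<Longrightarrow> j g \<cdot>\<^bsub>C'\<^esub> j f = j (g \<cdot>\<^bsub>C\<^esub> f)"
  "a \<in> ob C \<Longrightarrow> b \<in> ob C \<Longrightarrow> i a \<otimes>\<^bsub>C'\<^esub> i b = i (a \<otimes>\<^bsub>C\<^esub> b)"
  "f \<in> ar C \<Longrightarrow> g \<in> ar C \<Longrightarrow> j f \<otimes>\<^sub>a\<^bsub>C'\<^esub> j g = j (f \<otimes>\<^sub>a\<^bsub>C\<^esub> g)"
  "unit C' = i (unit C)" "pt C' = i (pt C)"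
  "a \<in> ob C \<Longrightarrow> b \<in> ob C \<Longrightarrow> c \<in> ob C \<Longrightarrow> asc C' (i a) (i b) (i c) = j (asc C a b c)"
  "a \<in> ob C \<Longrightarrow> lun C' (i a) = j (lun C a)" "a \<in> ob C \<Longrightarrow> run C' (i a) = j (run C a)"
  by (simp_all add: rename_def Let_def)

lemma rename_category: "category C'"
  by unfold_locales (auto simp: hom_iff)

lemma isos_rename [simp]: "isos C f \<Longrightarrow> isos C' (j f)"
  using C.isos_ar[of f] by (intro category.isosI(1)[OF rename_category, of _ "j (inv_ar C f)"]) auto

lemma rename_pmcat: "pmcat C'"
proof -
  interpret C': category C' by (rule rename_category)
  show ?thesis
    by unfold_locales (auto simp: hom_iff iso_iff C.tar_merge C.asc_nat C.lun_nat C.run_nat C.pentagon C.triangle)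
qed

lemma rename_strict:
  assumes "strict_monoidal_category C"
  shows "strict_monoidal_category C'"
proof -
  interpret S: strict_monoidal_category C by fact
  interpret C': pointed_monoidal_category C' by (rule rename_pmcat)
  show ?thesis
    by unfold_locales (auto simp: S.asc_idn S.lun_idn S.run_idn)
qed

definition R where
  "R = rename_cod i j (id_pmonfun C)"

definition R' where
  "R' = \<lparr>fdom = C', fcod = C, fob = restrict (inv_into (ob C) i) (ob C'), far = restrict (inv_into (ar C) j) (ar C'),
     fmul = (\<lambda>a\<in>ob C'. \<lambda>b\<in>ob C'. inv_into (ar C) j (idn C' (a \<otimes>\<^bsub>C'\<^esub> b))), funit = idn C (unit C), fpt = idn C (pt C)\<rparr>"

lemma R_simps [simp]:
  "fdom R = C" "fcod R = C'" "a \<in> ob C \<Longrightarrow> fob R a = i a" "f \<in> ar C \<Longrightarrow> far R f = j f"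
  "a \<in> ob C \<Longrightarrow> b \<in> ob C \<Longrightarrow> fmul R a b = j (idn C (a \<otimes>\<^bsub>C\<^esub> b))"
  "funit R = j (idn C (unit C))" "fpt R = j (idn C (pt C))"
  by (simp_all add: R_def rename_cod_def)

lemma R'_simps [simp]:
  "fdom R' = C'" "fcod R' = C" "a \<in> ob C \<Longrightarrow> fob R' (i a) = a" "f \<in> ar C \<Longrightarrow> far R' (j f) = f"
  "a \<in> ob C \<Longrightarrow> b \<in> ob C \<Longrightarrow> fmul R' (i a) (i b) = idn C (a \<otimes>\<^bsub>C\<^esub> b)"
  "funit R' = idn C (unit C)" "fpt R' = idn C (pt C)"
  by (simp_all add: R'_def)

lemma R_pmfun: "pmfun C C' R"
proof -
  interpret C': pointed_monoidal_category C' by (rule rename_pmcat)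
  have "is_functor C C' (fob R) (far R)"
    unfolding is_functor_def using C.category_axioms C'.category_axioms by (auto simp: hom_iff)
  then show ?thesis
    by unfold_locales (auto simp: hom_iff iso_iff, auto simp: R_def rename_cod_def)
qed

lemma R'_pmfun: "pmfun C' C R'"
proof -
  interpret C': pointed_monoidal_category C' by (rule rename_pmcat)
  have "is_functor C' C (fob R') (far R')"
    unfolding is_functor_def using C.category_axioms C'.category_axioms by (auto simp: hom_iff)
  then show ?thesis
    by unfold_locales (auto simp: hom_iff iso_iff, auto simp: R'_def)
qed

lemma R'_R: "comp_pmonfun R' R = id_pmonfun C"
  by (rule pmonfun_eqI[OF comp_pmfun[OF R_pmfun R'_pmfun] C.id_pmfun]) auto

lemma R_R': "comp_pmonfun R R' = id_pmonfun C'"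
  by (rule pmonfun_eqI[OF comp_pmfun[OF R'_pmfun R_pmfun] pointed_monoidal_category.id_pmfun[OF rename_pmcat]]) auto

text \<open>Renaming the codomain thus becomes composition with the invertible functor
  \<open>R\<close>, which makes \<open>Omega_u\<close> accessible to the calculus of
  composites.\<close>

lemma rename_cod_eq:
  assumes "pmfun B C F"
  shows "rename_cod i j F = comp_pmonfun R F"
proof -
  interpret F: pointed_monoidal_functor B C F by fact
  show ?thesis
    by (simp add: rename_cod_def comp_pmonfun_def Let_def F.fdom F.fcod cong: restrict_cong)
qed

end

text \<open>The full image lies over lists and triples and is renamed into \<open>'u\<close>, which
  is possible because \<open>'u\<close> is infinite. One composite with the quasi-inverse is the
  identity on the nose; the other is isomorphic to it by \<open>S.retract\<close>, whiskered with
  the renaming.\<close>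

lemma ex_strict:
  assumes "pmcat (X :: 'u::infinite pmc)"
  shows "\<exists>Y E. pmcat Y \<and> strict_monoidal_category Y \<and> equivalence_cell1 (JJ :: ('u pmc, 'u pmf, 'u pmn) twocat) X Y E"
proof -
  interpret pointed_monoidal_category X by fact
  interpret S: strictify X by unfold_locales
  interpret I: pointed_monoidal_category S.I by (rule S.full_image_pmcat)
  obtain l :: "'u list \<Rightarrow> 'u" where l: "inj l" using ex_inj_list by blast
  \<comment> \<open>A triple is coded as a three-letter list: the codes of its ends, and the arrow
    itself in the middle.\<close>
  define k where "k = (\<lambda>(a, f, b). l [l a, f, l b])"
  have "inj k" by (auto simp: inj_def k_def dest!: injD[OF l])
  then interpret R: renaming S.I l k
    using l by unfold_locales (auto intro: inj_on_subset)
  let ?Y = "rename l k S.I" and ?E = "comp_pmonfun R.R S.G" and ?E' = "comp_pmonfun S.P R.R'"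
  note pf [simp] = S.G_pmfun S.full_image_proj_pmfun R.R_pmfun R.R'_pmfun
  have E: "pmfun X ?Y ?E" "pmfun ?Y X ?E'" by (auto intro: comp_pmfun pf)
  have "comp_pmonfun ?E' ?E = comp_pmonfun S.P (comp_pmonfun (comp_pmonfun R.R' R.R) S.G)"
    by (simp only: comp_pmonfun_assoc[OF pf(1) pf(3) pf(4)] comp_pmonfun_assoc[OF E(1) pf(4) pf(2)])
  also have "\<dots> = id_pmonfun X" by (simp add: R.R'_R comp_pmonfun_id_left[OF pf(1)] S.P_G)
  finally have 1: "comp_pmonfun ?E' ?E = id_pmonfun X" .
  let ?w = "\<lambda>F. idn pmoncat_vert F"
  let ?\<tau> = "hcomp_pmonnat (?w R.R) (hcomp_pmonnat S.retract (?w R.R'))"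
  have t: "pmnat S.I S.I (comp_pmonfun S.G S.P) (id_pmonfun S.I) S.retract" by (rule S.retract_pmnat)
  have "pmnat ?Y ?Y (comp_pmonfun R.R (comp_pmonfun (comp_pmonfun S.G S.P) R.R'))
      (comp_pmonfun R.R (comp_pmonfun (id_pmonfun S.I) R.R')) ?\<tau>"
    by (rule hcomp_pmnat[OF hcomp_pmnat[OF id_pmnat[OF pf(4)] t] id_pmnat[OF pf(3)]])
  moreover have "comp_pmonfun R.R (comp_pmonfun (id_pmonfun S.I) R.R') = id_pmonfun ?Y"
    by (simp add: comp_pmonfun_id_left[OF pf(4)] R.R_R')
  moreover have "comp_pmonfun R.R (comp_pmonfun (comp_pmonfun S.G S.P) R.R') = comp_pmonfun ?E ?E'"
    by (simp only: comp_pmonfun_assoc[OF pf(4) pf(2) pf(1)] comp_pmonfun_assoc[OF E(2) pf(1) pf(3)])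
  ultimately have 2: "pmnat ?Y ?Y (comp_pmonfun ?E ?E') (id_pmonfun ?Y) ?\<tau>" by simp
  have "isos ?Y (ncmp ?\<tau> a)" if a: "a \<in> ob ?Y" for a
  proof -
    interpret Y: category ?Y by (rule R.rename_category)
    from a obtain U where U: "a = l U" "set U \<subseteq> ob X" by auto
    have "ncmp ?\<tau> a = k ([tens X U], idn X (tens X U), U)" using U by simp
    moreover have "isos S.I ([tens X U], idn X (tens X U), U)" using U by (intro S.isos_full_image) simp_all
    ultimately show ?thesis by (simp add: R.isos_rename)
  qed
  then have "isos pmoncat_vert ?\<tau>" by (rule isos_vertI[OF 2])
  with 2 have "?\<tau> \<in> invcell2 JJ (comp_pmonfun ?E ?E') (id_pmonfun ?Y)"
    by (simp add: iso_iff pmnat_ar del: pmoncat_vert_simps(4))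
  moreover have "?w (id_pmonfun X) \<in> invcell2 JJ (comp_pmonfun ?E' ?E) (id_pmonfun X)"
    using category.isos_idn[OF category_vert, of "id_pmonfun X"] id_pmnat[OF id_pmfun]
    by (simp add: 1 iso_iff id_pmfun)
  ultimately have "equivalence_cell1 JJ X ?Y ?E"
    using E unfolding equivalence_cell1_def by (auto intro!: bexI[of _ ?E'])
  then show ?thesis using R.rename_pmcat R.rename_strict[OF S.full_image_strict] by blast
qed

lemma equivalence_cell1_one: "pmcat X \<Longrightarrow> equivalence_cell1 JJ X X (id_pmonfun X)"
proof -
  assume X: "pmcat X"
  interpret pointed_monoidal_category X by fact
  have "idn pmoncat_vert (id_pmonfun X) \<in> iso pmoncat_vert (id_pmonfun X) (id_pmonfun X)"
    using category.isos_idn[OF category_vert, of "id_pmonfun X"] id_pmnat[OF id_pmfun]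
    by (simp add: iso_iff id_pmfun)
  then show ?thesis using id_pmfun unfolding equivalence_cell1_def
    by (auto simp: comp_pmonfun_id_left[OF id_pmfun] intro!: bexI[of _ "id_pmonfun X"])
qed

theorem ex_strictification:
  "\<exists>S E. strictification S E \<and> (\<forall>X \<in> cell0 (JJ :: (('u::infinite) pmc, 'u pmf, 'u pmn) twocat).
          strict_monoidal_category X \<longrightarrow> S X = X \<and> E X = one JJ X)"
proof -
  let ?Q = "\<lambda>X Y E. pmcat Y \<and> strict_monoidal_category Y \<and> equivalence_cell1 (JJ :: ('u pmc, 'u pmf, 'u pmn) twocat) X Y E
    \<and> (strict_monoidal_category X \<longrightarrow> Y = X \<and> E = id_pmonfun X)"
  have "\<exists>Y E. ?Q X Y E" if "pmcat X" for X :: "'u pmc"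
    using ex_strict[OF that] equivalence_cell1_one[OF that] that
    by (cases "strict_monoidal_category X") blast+
  then obtain S E where "\<And>X. pmcat X \<Longrightarrow> ?Q X (S X) (E X)" by metis
  then show ?thesis
    by (intro exI[of _ S] exI[of _ E]) (simp add: strictification_def)
qed

section \<open>The free adjunction of a right dual\<close>

lemma (in strict_monoidal_category) is_right_dual_strict:
  "is_right_dual C x y e n \<longleftrightarrow> x \<in> ob C \<and> y \<in> ob C \<and> e \<in> ar C \<and> src C e = x \<otimes> y \<and> tgt C e = unit C \<and>
     n \<in> ar C \<and> src C n = unit C \<and> tgt C n = y \<otimes> x \<and>
     e \<otimes>\<^sub>a idn C x \<cdot> idn C x \<otimes>\<^sub>a n = idn C x \<and> idn C y \<otimes>\<^sub>a e \<cdot> n \<otimes>\<^sub>a idn C y = idn C y"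
proof -
  have "lun C x \<cdot> (e \<otimes>\<^sub>a idn C x) \<cdot> inv_ar C (asc C x y x) \<cdot> (idn C x \<otimes>\<^sub>a n) \<cdot> inv_ar C (run C x)
      = e \<otimes>\<^sub>a idn C x \<cdot> idn C x \<otimes>\<^sub>a n"
    "run C y \<cdot> (idn C y \<otimes>\<^sub>a e) \<cdot> asc C y x y \<cdot> (n \<otimes>\<^sub>a idn C y) \<cdot> inv_ar C (lun C y)
      = idn C y \<otimes>\<^sub>a e \<cdot> n \<otimes>\<^sub>a idn C y"
    if "x \<in> ob C" "y \<in> ob C" "e \<in> ar C" "src C e = x \<otimes> y" "tgt C e = unit C"
     "n \<in> ar C" "src C n = unit C" "tgt C n = y \<otimes> x"
    using that by (simp_all add: lun_idn run_idn asc_idn)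
  then show ?thesis unfolding is_right_dual_def hom_iff by auto
qed

section \<open>Words, paths and their congruence\<close>

locale strict_pointed = pointed_monoidal_category C + strict_monoidal_category C
  for C :: "('o, 'm) pmoncat" (structure)
begin

lemma words_iff: "U \<in> words C \<longleftrightarrow> U \<noteq> [] \<and> set U \<subseteq> ob C"
  by (auto simp: words_def)

lemma single_words [simp]: "[a] \<in> words C \<longleftrightarrow> a \<in> ob C"
  by (simp add: words_iff)

lemma Cons_words [simp]: "a # b # U \<in> words C \<longleftrightarrow> a \<in> ob C \<and> b # U \<in> words C"
  by (auto simp: words_iff)

lemma wtensor_single [simp]: "[a] \<otimes>\<^sub>w (b # V) = (a \<otimes> b) # V"
  by (simp add: wtensor_def)

lemma wtensor_Cons [simp]: "(a # b # U) \<otimes>\<^sub>w V = a # ((b # U) \<otimes>\<^sub>w V)"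
  by (simp add: wtensor_def)

text \<open>Words are non-empty and their product merges two letters, so the induction starts at
  single letters.\<close>

lemma words_induct [consumes 1, case_names single Cons]:
  assumes "U \<in> words C" "\<And>a. a \<in> ob C \<Longrightarrow> P [a]"
    "\<And>a b U. a \<in> ob C \<Longrightarrow> b # U \<in> words C \<Longrightarrow> P (b # U) \<Longrightarrow> P (a # b # U)"
  shows "P U"
  using assms(1)
proof (induction U)
  case (Cons a U)
  then show ?case using assms(2,3) by (cases U) auto
qed (simp add: words_iff)

lemma words_cases:
  assumes "U \<in> words C" obtains a U' where "U = a # U'" "a \<in> ob C" "U' = [] \<or> U' \<in> words C"
  using assms by (cases U) (auto simp: words_iff)

lemma wtensor_words [simp]: "U \<in> words C \<Longrightarrow> V \<in> words C \<Longrightarrow> U \<otimes>\<^sub>w V \<in> words C"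
  by (auto simp: words_iff wtensor_def dest: in_set_butlastD list.set_sel(2) intro!: tob_ob)

lemma wunit_words [simp]: "wunit C \<in> words C" and jdual_words [simp]: "jdual C \<in> words C"
  by (auto simp: wunit_def jdual_def)

lemma wtensor_assoc [simp]:
  assumes "U \<in> words C" "V \<in> words C" "W \<in> words C"
  shows "(U \<otimes>\<^sub>w V) \<otimes>\<^sub>w W = U \<otimes>\<^sub>w V \<otimes>\<^sub>w W"
  using assms(1)
proof (induction U rule: words_induct)
  case (single a)
  from assms(2) show ?case
  proof (cases V rule: words_cases)
    case (1 b V')
    from assms(3) show ?thesis
      by (cases W rule: words_cases, cases V') (use single 1 in auto)
  qed
next
  case (Cons a b U)
  obtain d Z where "(b # U) \<otimes>\<^sub>w V = d # Z" by (metis Cons.hyps(2) assms(2) wtensor_words words_cases)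
  with Cons.IH show ?case by simp
qed

lemma wtensor_unit [simp]:
  assumes "U \<in> words C" shows "wunit C \<otimes>\<^sub>w U = U" "U \<otimes>\<^sub>w wunit C = U"
proof -
  from assms show "wunit C \<otimes>\<^sub>w U = U" by (cases U rule: words_cases) (auto simp: wunit_def)
  from assms show "U \<otimes>\<^sub>w wunit C = U"
    by (induction U rule: words_induct) (auto simp: wunit_def)
qed

lemma edges_iff [simp]: "(U, p, V) \<in> edges C \<longleftrightarrow> U \<in> words C \<and> V \<in> words C \<and> (\<forall>f. p = Bar f \<longrightarrow> f \<in> ar C)"
  by (auto simp: edges_def)

lemma prim_words [simp]:
  "(\<forall>f. p = Bar f \<longrightarrow> f \<in> ar C) \<Longrightarrow> prim_src C p \<in> words C" "(\<forall>f. p = Bar f \<longrightarrow> f \<in> ar C) \<Longrightarrow> prim_tgt C p \<in> words C"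
  by (cases p; simp)+

lemma edge_words [simp]: "e \<in> edges C \<Longrightarrow> edge_src C e \<in> words C" "e \<in> edges C \<Longrightarrow> edge_tgt C e \<in> words C"
  by (cases e; simp)+

lemma prim_edge_simps [simp]:
  "prim_edge C p \<in> edges C \<longleftrightarrow> (\<forall>f. p = Bar f \<longrightarrow> f \<in> ar C)"
  "(\<forall>f. p = Bar f \<longrightarrow> f \<in> ar C) \<Longrightarrow> edge_src C (prim_edge C p) = prim_src C p"
  "(\<forall>f. p = Bar f \<longrightarrow> f \<in> ar C) \<Longrightarrow> edge_tgt C (prim_edge C p) = prim_tgt C p"
  by (simp_all add: prim_edge_def)

lemma whisker_edge_simps [simp]:
  assumes "e \<in> edges C" "T \<in> words C" "W \<in> words C"
  shows "whisker_edge C T e W \<in> edges C" "edge_src C (whisker_edge C T e W) = T \<otimes>\<^sub>w edge_src C e \<otimes>\<^sub>w W"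
    "edge_tgt C (whisker_edge C T e W) = T \<otimes>\<^sub>w edge_tgt C e \<otimes>\<^sub>w W"
  using assms by (cases e; simp)+

lemma whisker_edge_unit [simp]: "e \<in> edges C \<Longrightarrow> whisker_edge C (wunit C) e (wunit C) = e"
  by (cases e) simp

lemma whisker_edge_whisker [simp]:
  "e \<in> edges C \<Longrightarrow> T \<in> words C \<Longrightarrow> W \<in> words C \<Longrightarrow> T' \<in> words C \<Longrightarrow> W' \<in> words C \<Longrightarrow>
    whisker_edge C T' (whisker_edge C T e W) W' = whisker_edge C (T' \<otimes>\<^sub>w T) e (W \<otimes>\<^sub>w W')"
  by (cases e) simp

lemma is_chain_words: "is_chain C U es \<Longrightarrow> U \<in> words C"
  by (cases es) auto

lemma is_chain_edges: "is_chain C U es \<Longrightarrow> set es \<subseteq> edges C"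
  by (induction es arbitrary: U) auto

text \<open>Recursion along the first edge matches \<open>is_chain\<close>; the defining equation,
  which looks at the last edge, is withdrawn from simplification.\<close>

lemma path_tgt_Cons [simp]: "path_tgt C (U, e # es) = path_tgt C (edge_tgt C e, es)"
  by simp

declare path_tgt.simps [simp del]

lemma path_tgt_Nil [simp]: "path_tgt C (U, []) = U"
  by (simp add: path_tgt.simps)

lemma is_chain_tgt: "is_chain C U es \<Longrightarrow> path_tgt C (U, es) \<in> words C"
  by (induction es arbitrary: U) auto

lemma path_tgt_append: "path_tgt C (U, es @ fs) = path_tgt C (path_tgt C (U, es), fs)"
  by (induction es arbitrary: U) auto

lemma is_chain_append:
  "is_chain C U (es @ fs) \<longleftrightarrow> is_chain C U es \<and> is_chain C (path_tgt C (U, es)) fs"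
  by (induction es arbitrary: U) (auto dest: is_chain_words)

lemma is_chain_whisker:
  assumes "T \<in> words C" "W \<in> words C" "is_chain C U es"
  shows "is_chain C (T \<otimes>\<^sub>w U \<otimes>\<^sub>w W) (map (\<lambda>e. whisker_edge C T e W) es) \<and>
    path_tgt C (T \<otimes>\<^sub>w U \<otimes>\<^sub>w W, map (\<lambda>e. whisker_edge C T e W) es) = T \<otimes>\<^sub>w path_tgt C (U, es) \<otimes>\<^sub>w W"
  using assms(3) by (induction es arbitrary: U) (auto simp: assms(1,2))

lemma paths_iff [simp]: "(U, es) \<in> paths C \<longleftrightarrow> is_chain C U es"
  by (simp add: paths_def)

lemma path_words [simp]: "p \<in> paths C \<Longrightarrow> path_src p \<in> words C" "p \<in> paths C \<Longrightarrow> path_tgt C p \<in> words C"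
  by (cases p; simp add: is_chain_words is_chain_tgt)+

lemma empty_path_simps [simp]:
  "empty_path U \<in> paths C \<longleftrightarrow> U \<in> words C" "path_src (empty_path U) = U" "path_tgt C (empty_path U) = U"
  by (auto simp: empty_path_def)

lemma edge_path_simps [simp]:
  "edge_path C e \<in> paths C \<longleftrightarrow> e \<in> edges C" "path_src (edge_path C e) = edge_src C e" "path_tgt C (edge_path C e) = edge_tgt C e"
  by (auto simp: edge_path_def)

lemma path_comp_simps [simp]:
  assumes "p \<in> paths C" "q \<in> paths C" "path_src q = path_tgt C p"
  shows "path_comp q p \<in> paths C" "path_src (path_comp q p) = path_src p" "path_tgt C (path_comp q p) = path_tgt C q"
  using assms by (cases p; cases q; simp add: is_chain_append path_tgt_append)+

lemma path_comp_assoc [simp]: "path_comp (path_comp r q) p = path_comp r (path_comp q p)"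
  by (cases p; cases q; cases r) simp

lemma path_comp_empty [simp]:
  "path_comp (empty_path V) p = p" "path_src p = U \<Longrightarrow> path_comp p (empty_path U) = p"
  by (cases p; auto simp: empty_path_def)+

lemma whisker_path_simps [simp]:
  assumes "p \<in> paths C" "T \<in> words C" "W \<in> words C"
  shows "whisker_path C T p W \<in> paths C" "path_src (whisker_path C T p W) = T \<otimes>\<^sub>w path_src p \<otimes>\<^sub>w W"
    "path_tgt C (whisker_path C T p W) = T \<otimes>\<^sub>w path_tgt C p \<otimes>\<^sub>w W"
  using assms by (cases p; simp add: is_chain_whisker)+

lemma whisker_path_comp [simp]: "whisker_path C T (path_comp q p) W = path_comp (whisker_path C T q W) (whisker_path C T p W)"
  by (cases p; cases q) simp

lemma whisker_path_empty [simp]: "whisker_path C T (empty_path U) W = empty_path (T \<otimes>\<^sub>w U \<otimes>\<^sub>w W)"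
  by (simp add: empty_path_def)

lemma whisker_path_edge [simp]:
  "e \<in> edges C \<Longrightarrow> T \<in> words C \<Longrightarrow> W \<in> words C \<Longrightarrow>
    whisker_path C T (edge_path C e) W = edge_path C (whisker_edge C T e W)"
  by (simp add: edge_path_def)

lemma whisker_path_unit [simp]: "p \<in> paths C \<Longrightarrow> whisker_path C (wunit C) p (wunit C) = p"
proof (cases p)
  case (Pair U es)
  assume "p \<in> paths C"
  with Pair have "is_chain C U es" by simp
  then have "map (\<lambda>e. whisker_edge C (wunit C) e (wunit C)) es = es" "U \<in> words C"
    using is_chain_edges[of U es] by (auto intro!: map_idI whisker_edge_unit is_chain_words)
  then show ?thesis using Pair by simp
qed

lemma whisker_path_whisker [simp]:
  assumes "p \<in> paths C" "T \<in> words C" "W \<in> words C" "T' \<in> words C" "W' \<in> words C"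
  shows "whisker_path C T' (whisker_path C T p W) W' = whisker_path C (T' \<otimes>\<^sub>w T) p (W \<otimes>\<^sub>w W')"
proof (cases p)
  case (Pair U es)
  with assms(1) have "is_chain C U es" by simp
  then have "set es \<subseteq> edges C" "U \<in> words C" by (auto dest: is_chain_edges is_chain_words)
  then show ?thesis using Pair assms(2-5) by (auto simp del: split_paired_All intro!: whisker_edge_whisker)
qed

lemma path_induct [consumes 1, case_names empty edge]:
  assumes "p \<in> paths C" "\<And>U. U \<in> words C \<Longrightarrow> P (empty_path U)"
    "\<And>e p. e \<in> edges C \<Longrightarrow> p \<in> paths C \<Longrightarrow> path_src p = edge_tgt C e \<Longrightarrow> P p \<Longrightarrow> P (path_comp p (edge_path C e))"
  shows "P p"
proof -
  have "is_chain C U es \<Longrightarrow> P (U, es)" for U es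
  proof (induction es arbitrary: U)
    case Nil
    then show ?case using assms(2)[of U] by (simp add: empty_path_def)
  next
    case (Cons e es)
    then show ?case using assms(3)[of e "(edge_tgt C e, es)"] by (auto simp: edge_path_def)
  qed
  then show ?thesis using assms(1) by (cases p) simp
qed

lemma bar_simps [simp]:
  "bar C f \<in> paths C \<longleftrightarrow> f \<in> ar C" "f \<in> ar C \<Longrightarrow> path_src (bar C f) = [src C f]" "f \<in> ar C \<Longrightarrow> path_tgt C (bar C f) = [tgt C f]"
  by (simp_all add: bar_def)

definition parallel :: "('o, 'm) path \<Rightarrow> ('o, 'm) path \<Rightarrow> bool" where
  "parallel p q \<longleftrightarrow> p \<in> paths C \<and> q \<in> paths C \<and> path_src p = path_src q \<and> path_tgt C p = path_tgt C q"

lemma relator_parallel: "relator C p q \<Longrightarrow> parallel p q"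
proof (induction rule: relator.induct)
  case (bar_cmp f x y g)
  then show ?case by (simp add: parallel_def hom_iff)
next
  case (exchange a b U V W X)
  then show ?case by (auto simp: parallel_def)
qed (auto simp: parallel_def wunit_def jdual_def)

text \<open>Source and target of a class can hence be read off any representative.\<close>

lemma congr_parallel: "congr C p q \<Longrightarrow> parallel p q"
proof (induction rule: congr.induct)
  case (relator p q)
  then show ?case by (rule relator_parallel)
qed (auto simp: parallel_def)

lemma congr_whisker:
  assumes "congr C p q" "Y \<in> words C" "Z \<in> words C"
  shows "congr C (whisker_path C Y p Z) (whisker_path C Y q Z)"
  using assms(1)
proof (induction rule: congr.induct)
  case (relator p q)
  then show ?case by (intro congr.relator relator.whisker assms)
next
  case (refl p)
  then show ?case by (intro congr.refl) (simp add: assms)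
next
  case (comp p p' q q')
  then show ?case using assms congr_parallel[OF comp(1)] congr_parallel[OF comp(2)]
    by (auto intro!: congr.comp simp: parallel_def)
qed (blast intro: congr.sym congr.trans)+

lemma congr_comp_left:
  "congr C q q' \<Longrightarrow> p \<in> paths C \<Longrightarrow> path_tgt C p = path_src q \<Longrightarrow> congr C (path_comp q p) (path_comp q' p)"
  by (intro congr.comp congr.refl)

lemma congr_comp_right:
  "congr C p p' \<Longrightarrow> q \<in> paths C \<Longrightarrow> path_tgt C p = path_src q \<Longrightarrow> congr C (path_comp q p) (path_comp q p')"
  by (intro congr.comp congr.refl)

text \<open>The edge \<open>a\<close> passes the edges of \<open>q\<close> one at a time, each by
  one instance of the exchange relation.\<close>

lemma exchange_edge_path:
  assumes "a \<in> edges C" "q \<in> paths C"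
  shows "congr C
    (path_comp (whisker_path C (edge_tgt C a) q (wunit C)) (edge_path C (whisker_edge C (wunit C) a (path_src q))))
    (path_comp (edge_path C (whisker_edge C (wunit C) a (path_tgt C q))) (whisker_path C (edge_src C a) q (wunit C)))"
  using assms(2)
proof (induction q rule: path_induct)
  case (empty U)
  then show ?case using assms(1) by (auto intro!: congr.refl)
next
  case (edge b q)
  let ?V = "edge_tgt C a" and ?U = "edge_src C a" and ?W = "edge_src C b" and ?X = "edge_tgt C b"
  let ?a = "\<lambda>W. edge_path C (whisker_edge C (wunit C) a W)"
  let ?b = "\<lambda>V. edge_path C (whisker_edge C V b (wunit C))"
  let ?q = "\<lambda>V. whisker_path C V q (wunit C)"
  have "congr C (path_comp (?q ?V) (path_comp (?b ?V) (?a ?W))) (path_comp (?q ?V) (path_comp (?a ?X) (?b ?U)))"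
    using assms(1) edge by (intro congr_comp_right congr.relator relator.exchange) auto
  moreover have "congr C (path_comp (path_comp (?q ?V) (?a ?X)) (?b ?U)) (path_comp (path_comp (?a (path_tgt C q)) (?q ?U)) (?b ?U))"
    using assms(1) edge by (intro congr_comp_left) auto
  ultimately show ?case using edge assms(1) by (auto intro: congr.trans)
qed

text \<open>The edges of \<open>p\<close> are moved in turn past the whole of
  \<open>q\<close>.\<close>

lemma exchange_path:
  assumes "p \<in> paths C" "q \<in> paths C"
  shows "congr C
    (path_comp (whisker_path C (path_tgt C p) q (wunit C)) (whisker_path C (wunit C) p (path_src q)))
    (path_comp (whisker_path C (wunit C) p (path_tgt C q)) (whisker_path C (path_src p) q (wunit C)))"
  using assms(1)
proof (induction p rule: path_induct)
  case (empty U)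
  then show ?case using assms(2) by (auto intro!: congr.refl)
next
  case (edge a p)
  let ?q = "\<lambda>V. whisker_path C V q (wunit C)" and ?p = "\<lambda>W. whisker_path C (wunit C) p W"
  let ?a = "\<lambda>W. edge_path C (whisker_edge C (wunit C) a W)"
  have "congr C (path_comp (path_comp (?q (path_tgt C p)) (?p (path_src q))) (?a (path_src q)))
      (path_comp (path_comp (?p (path_tgt C q)) (?q (edge_tgt C a))) (?a (path_src q)))"
    using edge assms(2) by (intro congr_comp_left) auto
  moreover have "congr C (path_comp (?p (path_tgt C q)) (path_comp (?q (edge_tgt C a)) (?a (path_src q))))
     (path_comp (?p (path_tgt C q)) (path_comp (?a (path_tgt C q)) (?q (edge_src C a))))"
    using edge assms(2) by (intro congr_comp_right exchange_edge_path) auto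
  ultimately show ?case using edge assms(2) by (auto intro: congr.trans)
qed

lemma path_tensor_simps [simp]:
  assumes "p \<in> paths C" "q \<in> paths C"
  shows "path_tensor C p q \<in> paths C" "path_src (path_tensor C p q) = path_src p \<otimes>\<^sub>w path_src q"
    "path_tgt C (path_tensor C p q) = path_tgt C p \<otimes>\<^sub>w path_tgt C q"
  using assms by (simp_all add: path_tensor_def)

lemma congr_tensor:
  assumes "congr C p p'" "congr C q q'"
  shows "congr C (path_tensor C p q) (path_tensor C p' q')"
  unfolding path_tensor_def
  using assms[THEN congr_parallel] by (intro congr.comp) (auto simp: parallel_def intro: congr_whisker assms)

text \<open>Functoriality of the tensor product: \<open>p'\<close> and \<open>q\<close> act on
  different factors and have to change places, which is \<open>exchange_path\<close>.\<close>

lemma congr_tensor_comp: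
  assumes [simp]: "p \<in> paths C" "p' \<in> paths C" "path_src p' = path_tgt C p" "q \<in> paths C" "q' \<in> paths C" "path_src q' = path_tgt C q"
  shows "congr C (path_tensor C (path_comp p' p) (path_comp q' q)) (path_comp (path_tensor C p' q') (path_tensor C p q))"
proof -
  have "congr C (path_comp (path_comp (whisker_path C (path_tgt C p') q (wunit C)) (whisker_path C (wunit C) p' (path_src q))) (whisker_path C (wunit C) p (path_src q)))
      (path_comp (path_comp (whisker_path C (wunit C) p' (path_tgt C q)) (whisker_path C (path_src p') q (wunit C))) (whisker_path C (wunit C) p (path_src q)))"
    by (intro congr_comp_left exchange_path) auto
  then show ?thesis unfolding path_tensor_def by (auto intro!: congr_comp_right)
qed

text \<open>An equation between paths, so that associativity of the tensor product of arrows does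
  not involve the congruence.\<close>

lemma path_tensor_assoc:
  "p \<in> paths C \<Longrightarrow> q \<in> paths C \<Longrightarrow> r \<in> paths C \<Longrightarrow>
    path_tensor C (path_tensor C p q) r = path_tensor C p (path_tensor C q r)"
  by (simp add: path_tensor_def)

section \<open>The quotient category, the dual pair in it, and \<open>Omega\<close>\<close>

abbreviation "cl \<equiv> path_class C"
abbreviation "A \<equiv> adjoin_dual C"

lemma cl_eq: "p \<in> paths C \<Longrightarrow> cl p = cl q \<longleftrightarrow> congr C p q"
  unfolding path_class_def by (auto intro: congr.sym congr.trans congr.refl)

lemma cl_eqI: "congr C p q \<Longrightarrow> cl p = cl q"
  using cl_eq congr_parallel unfolding parallel_def by blast

text \<open>The operations of \<open>adjoin_dual\<close> are defined through \<open>rep\<close>;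
  this comparison with the chosen representative shows that they can be computed on any path of the
  class.\<close>

lemma rep_cl:
  assumes "p \<in> paths C" shows "congr C p (rep (cl p))"
proof -
  have "p \<in> cl p" using assms by (simp add: path_class_def congr.refl)
  then have "rep (cl p) \<in> cl p" unfolding rep_def by (rule someI)
  then show ?thesis by (simp add: path_class_def)
qed

lemma adjoin_dual_simps [simp]:
  "ob A = words C" "p \<in> paths C \<Longrightarrow> cl p \<in> ar A"
  "p \<in> paths C \<Longrightarrow> src A (cl p) = path_src p" "p \<in> paths C \<Longrightarrow> tgt A (cl p) = path_tgt C p"
  "idn A U = cl (empty_path U)"
  "p \<in> paths C \<Longrightarrow> q \<in> paths C \<Longrightarrow> path_src q = path_tgt C p \<Longrightarrow> cl q \<cdot>\<^bsub>A\<^esub> cl p = cl (path_comp q p)"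
  "tob A = wtensor C"
  "p \<in> paths C \<Longrightarrow> q \<in> paths C \<Longrightarrow> cl p \<otimes>\<^sub>a\<^bsub>A\<^esub> cl q = cl (path_tensor C p q)"
  "unit A = wunit C" "asc A U V W = cl (empty_path (U \<otimes>\<^sub>w V \<otimes>\<^sub>w W))" "lun A U = cl (empty_path U)"
  "run A U = cl (empty_path U)" "pt A = [pt C]"
proof -
  note r = rep_cl[THEN congr_parallel, unfolded parallel_def]
  show "p \<in> paths C \<Longrightarrow> src A (cl p) = path_src p" "p \<in> paths C \<Longrightarrow> tgt A (cl p) = path_tgt C p"
    using r[of p] by (simp_all add: adjoin_dual_def)
  show "cl q \<cdot>\<^bsub>A\<^esub> cl p = cl (path_comp q p)" if "p \<in> paths C" "q \<in> paths C" "path_src q = path_tgt C p"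
    using r[of p] r[of q] that unfolding adjoin_dual_def
    by (auto intro!: cl_eqI[symmetric] congr.comp rep_cl)
  show "p \<in> paths C \<Longrightarrow> q \<in> paths C \<Longrightarrow> cl p \<otimes>\<^sub>a\<^bsub>A\<^esub> cl q = cl (path_tensor C p q)"
    unfolding adjoin_dual_def by (auto intro!: cl_eqI[symmetric] congr_tensor rep_cl)
qed (simp_all add: adjoin_dual_def)

lemma adjoin_dual_arE:
  assumes "f \<in> ar A" obtains p where "p \<in> paths C" "f = cl p"
  using assms unfolding adjoin_dual_def by auto

end

context strict_pointed
begin

lemma adjoin_dual_category: "category A"
  by unfold_locales (unfold hom_iff, ((elim conjE adjoin_dual_arE, hypsubst)?, simp)+)

lemma adjoin_dual_strict: "strict_monoidal_category A"
proof -
  interpret A: category A by (rule adjoin_dual_category)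
  have [simp]: "isos A (cl (empty_path U))" if "U \<in> words C" for U
    using A.isos_idn[of U] that by simp
  have [simp]: "path_tensor C (empty_path (wunit C)) p = p" "path_tensor C p (empty_path (wunit C)) = p"
    if "p \<in> paths C" for p
    using that by (simp_all add: path_tensor_def)
  have [simp]: "path_tensor C (empty_path U) (empty_path V) = empty_path (U \<otimes>\<^sub>w V)"
    if "U \<in> words C" "V \<in> words C" for U V
    using that by (simp add: path_tensor_def)
  have [simp]: "cl (path_tensor C (path_comp p' p) (path_comp q' q)) = cl (path_comp (path_tensor C p' q') (path_tensor C p q))"
    if "p \<in> paths C" "p' \<in> paths C" "path_src p' = path_tgt C p" "q \<in> paths C" "q' \<in> paths C" "path_src q' = path_tgt C q" for p p' q q'
    using that by (intro cl_eqI congr_tensor_comp)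
  show ?thesis
    by unfold_locales (unfold hom_iff iso_iff, ((elim conjE adjoin_dual_arE, hypsubst)?, simp add: path_tensor_assoc)+)
qed

lemma adjoin_dual_pointed: "strict_pointed A"
proof -
  interpret A: strict_monoidal_category A by (rule adjoin_dual_strict)
  show ?thesis by unfold_locales simp
qed

definition pr where "pr p = cl (edge_path C (prim_edge C p))"

lemma pr_simps [simp]:
  assumes "\<forall>f. p = Bar f \<longrightarrow> f \<in> ar C"
  shows "pr p \<in> ar A" "src A (pr p) = prim_src C p" "tgt A (pr p) = prim_tgt C p"
  using assms by (simp_all add: pr_def)

text \<open>Every arrow of the quotient is thus obtained from the classes \<open>pr p\<close> by
  tensoring with identities and composing, so that naturality needs to be checked only at primitive
  edges.\<close>

lemma cl_edge:
  assumes "(U, p, V) \<in> edges C"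
  shows "cl (edge_path C (U, p, V)) = idn A U \<otimes>\<^sub>a\<^bsub>A\<^esub> pr p \<otimes>\<^sub>a\<^bsub>A\<^esub> idn A V"
proof -
  have [simp]: "U \<in> words C" "V \<in> words C" "\<forall>f. p = Bar f \<longrightarrow> f \<in> ar C" using assms by auto
  have "idn A U \<otimes>\<^sub>a\<^bsub>A\<^esub> pr p \<otimes>\<^sub>a\<^bsub>A\<^esub> idn A V = cl (path_tensor C (empty_path U) (path_tensor C (edge_path C (prim_edge C p)) (empty_path V)))"
    by (simp add: pr_def)
  also have "path_tensor C (empty_path U) (path_tensor C (edge_path C (prim_edge C p)) (empty_path V))
     = edge_path C (whisker_edge C U (prim_edge C p) V)"
    by (simp add: path_tensor_def)
  also have "whisker_edge C U (prim_edge C p) V = (U, p, V)" by (simp add: prim_edge_def)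
  finally show ?thesis by simp
qed

lemma cl_bar: "cl (bar C f) = pr (Bar f)"
  by (simp add: bar_def pr_def)

lemma pr_idn: "x \<in> ob C \<Longrightarrow> pr (Bar (idn C x)) = idn A [x]"
  using cl_eqI[OF congr.relator[OF relator.bar_idn[of x C]]] by (simp add: cl_bar)

lemma pr_cmp: "f \<in> ar C \<Longrightarrow> g \<in> ar C \<Longrightarrow> src C g = tgt C f \<Longrightarrow> pr (Bar (g \<cdot> f)) = pr (Bar g) \<cdot>\<^bsub>A\<^esub> pr (Bar f)"
  using cl_eqI[OF congr.relator[OF relator.bar_cmp[of f C "src C f" "tgt C f" g "tgt C g"]]]
  by (simp add: cl_bar[symmetric] hom_iff)

text \<open>The relation \<open>bar_tensor\<close> covers tensoring with identities only; the
  general case follows from the factorization of \<open>f \<otimes>\<^sub>a g\<close> into two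
  arrows of that kind.\<close>

lemma pr_tensor:
  assumes [simp]: "f \<in> ar C" "g \<in> ar C"
  shows "pr (Bar (f \<otimes>\<^sub>a g)) = pr (Bar f) \<otimes>\<^sub>a\<^bsub>A\<^esub> pr (Bar g)"
proof -
  interpret A: strict_pointed A by (rule adjoin_dual_pointed)
  have *: "pr (Bar (idn C x \<otimes>\<^sub>a f \<otimes>\<^sub>a idn C y)) = idn A [x] \<otimes>\<^sub>a\<^bsub>A\<^esub> pr (Bar f) \<otimes>\<^sub>a\<^bsub>A\<^esub> idn A [y]"
    if [simp]: "x \<in> ob C" "y \<in> ob C" "f \<in> ar C" for x y f
    using cl_eqI[OF congr.relator[OF relator.bar_tensor[of x C y f]]]
    by (simp add: cl_bar bar_def path_tensor_def pr_def)
  have wu: "[unit C] = unit A" by (simp add: wunit_def)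
  have "pr (Bar (f \<otimes>\<^sub>a g))
      = pr (Bar ((idn C (tgt C f) \<otimes>\<^sub>a g \<otimes>\<^sub>a idn C (unit C)) \<cdot> (idn C (unit C) \<otimes>\<^sub>a f \<otimes>\<^sub>a idn C (src C g))))"
    by (simp add: tar_merge)
  also have "\<dots> = pr (Bar (idn C (tgt C f) \<otimes>\<^sub>a g \<otimes>\<^sub>a idn C (unit C))) \<cdot>\<^bsub>A\<^esub>
      pr (Bar (idn C (unit C) \<otimes>\<^sub>a f \<otimes>\<^sub>a idn C (src C g)))"
    by (rule pr_cmp) simp_all
  also have "\<dots> = (idn A [tgt C f] \<otimes>\<^sub>a\<^bsub>A\<^esub> pr (Bar g) \<otimes>\<^sub>a\<^bsub>A\<^esub> idn A (unit A)) \<cdot>\<^bsub>A\<^esub> (idn A (unit A) \<otimes>\<^sub>a\<^bsub>A\<^esub> pr (Bar f) \<otimes>\<^sub>a\<^bsub>A\<^esub> idn A [src C g])"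
    using *[of "tgt C f" "unit C" g] *[of "unit C" "src C g" f] unfolding wu by (simp only: assms tgt_ob src_ob unit_ob simp_thms)
  also have "\<dots> = pr (Bar f) \<otimes>\<^sub>a\<^bsub>A\<^esub> pr (Bar g)"
  proof -
    have "(idn A [tgt C f] \<otimes>\<^sub>a\<^bsub>A\<^esub> pr (Bar g)) \<cdot>\<^bsub>A\<^esub> (pr (Bar f) \<otimes>\<^sub>a\<^bsub>A\<^esub> idn A [src C g]) = pr (Bar f) \<otimes>\<^sub>a\<^bsub>A\<^esub> pr (Bar g)"
      using A.tar_merge[of "pr (Bar f)" "idn A [tgt C f]" "idn A [src C g]" "pr (Bar g)"] A.cmp_idn(1)[of "pr (Bar f)"]
        A.cmp_idn(2)[of "pr (Bar g)"] A.idn_simps[of "[tgt C f]"] A.idn_simps[of "[src C g]"]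
      by (simp del: adjoin_dual_simps(5))
    moreover have "idn A (unit A) \<otimes>\<^sub>a\<^bsub>A\<^esub> pr (Bar f) = pr (Bar f)" "pr (Bar g) \<otimes>\<^sub>a\<^bsub>A\<^esub> idn A (unit A) = pr (Bar g)"
      by (rule A.tar_unit, simp)+
    moreover have "idn A (unit A) \<otimes>\<^sub>a\<^bsub>A\<^esub> pr (Bar f) \<otimes>\<^sub>a\<^bsub>A\<^esub> idn A [src C g] = pr (Bar f) \<otimes>\<^sub>a\<^bsub>A\<^esub> idn A [src C g]"
      by (rule A.tar_unit) (use A.idn_simps[of "[src C g]"] in \<open>simp del: adjoin_dual_simps(5)\<close>)
    ultimately show ?thesis by (simp only:)
  qed
  finally show ?thesis .
qed

lemma right_dual_jdual: "is_right_dual A [pt C] (jdual C) (pr Counit) (pr Unit)"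
proof -
  interpret A: strict_pointed A by (rule adjoin_dual_pointed)
  have 1: "pr Counit \<otimes>\<^sub>a\<^bsub>A\<^esub> idn A [pt C] \<cdot>\<^bsub>A\<^esub> idn A [pt C] \<otimes>\<^sub>a\<^bsub>A\<^esub> pr Unit = idn A [pt C]"
    using cl_eqI[OF congr.relator[OF relator.triangle_J[of C]]]
    by (simp add: pr_def path_tensor_def)
  have 2: "idn A (jdual C) \<otimes>\<^sub>a\<^bsub>A\<^esub> pr Counit \<cdot>\<^bsub>A\<^esub> pr Unit \<otimes>\<^sub>a\<^bsub>A\<^esub> idn A (jdual C) = idn A (jdual C)"
    using cl_eqI[OF congr.relator[OF relator.triangle_jdual[of C]]]
    by (simp add: pr_def path_tensor_def)
  show ?thesis
    unfolding A.is_right_dual_strict using 1 2 by simp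
qed

lemma Omega_simps [simp]:
  "fdom (Omega C) = C" "fcod (Omega C) = A" "a \<in> ob C \<Longrightarrow> fob (Omega C) a = [a]"
  "f \<in> ar C \<Longrightarrow> far (Omega C) f = pr (Bar f)"
  "a \<in> ob C \<Longrightarrow> b \<in> ob C \<Longrightarrow> fmul (Omega C) a b = idn A [a \<otimes> b]"
  "funit (Omega C) = idn A (wunit C)" "fpt (Omega C) = idn A [pt C]"
  by (simp_all add: Omega_def cl_bar)

lemma Omega_pmfun: "pmfun C A (Omega C)"
proof -
  interpret A: strict_pointed A by (rule adjoin_dual_pointed)
  have [simp]: "asc A U V W = idn A (U \<otimes>\<^sub>w V \<otimes>\<^sub>w W)" "lun A U = idn A U" "run A U = idn A U" for U V W
    by simp_all
  note [simp del] = adjoin_dual_simps(5,10-12)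
  have [simp]: "[unit C] = wunit C" by (simp add: wunit_def)
  have "is_functor C A (fob (Omega C)) (far (Omega C))"
    unfolding is_functor_def using category_axioms A.category_axioms by (auto simp: hom_iff pr_idn pr_cmp)
  then show ?thesis
    by unfold_locales (auto simp: hom_iff iso_iff pr_tensor pr_idn asc_idn lun_idn run_idn, auto simp: Omega_def)
qed

declare adjoin_dual_simps(5,10-12) [simp del]

end

section \<open>Right duals in strict monoidal categories\<close>

context strict_monoidal_category
begin

lemma idn_tob: "a \<in> ob C \<Longrightarrow> b \<in> ob C \<Longrightarrow> idn C (a \<otimes> b) = idn C a \<otimes>\<^sub>a idn C b"
  by simp

lemma tar_cmp_idn:
  assumes "f \<in> ar C" "g \<in> ar C" "src C g = tgt C f" "a \<in> ob C"
  shows "(g \<cdot> f) \<otimes>\<^sub>a idn C a = (g \<otimes>\<^sub>a idn C a) \<cdot> (f \<otimes>\<^sub>a idn C a)"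
    "idn C a \<otimes>\<^sub>a (g \<cdot> f) = (idn C a \<otimes>\<^sub>a g) \<cdot> (idn C a \<otimes>\<^sub>a f)"
  using assms by (simp_all add: tar_merge)

lemma tar_slide:
  assumes "f \<in> ar C" "g \<in> ar C"
  shows "f \<otimes>\<^sub>a g = (f \<otimes>\<^sub>a idn C (tgt C g)) \<cdot> (idn C (src C f) \<otimes>\<^sub>a g)"
    "f \<otimes>\<^sub>a g = (idn C (tgt C f) \<otimes>\<^sub>a g) \<cdot> (f \<otimes>\<^sub>a idn C (src C g))"
  using assms by (simp_all add: tar_merge)

text \<open>In each triangle equation one of the isomorphisms meets its inverse and disappears; the
  other slides past the counit and the unit and ends up conjugating the given triangle
  equation.\<close>

lemma right_dual_iso:
  assumes "is_right_dual C x y e n" "isos C i" "tgt C i = x" "isos C k" "tgt C k = y"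
  shows "is_right_dual C (src C i) (src C k) (e \<cdot> (i \<otimes>\<^sub>a k)) ((inv_ar C k \<otimes>\<^sub>a inv_ar C i) \<cdot> n)"
proof -
  have d: "x \<in> ob C" "y \<in> ob C" "e \<in> ar C" "src C e = x \<otimes> y" "tgt C e = unit C"
     "n \<in> ar C" "src C n = unit C" "tgt C n = y \<otimes> x"
     and t: "e \<otimes>\<^sub>a idn C x \<cdot> idn C x \<otimes>\<^sub>a n = idn C x" "idn C y \<otimes>\<^sub>a e \<cdot> n \<otimes>\<^sub>a idn C y = idn C y"
    using assms(1) unfolding is_right_dual_strict by auto
  note [simp] = d assms(2-5) isos_ar[OF assms(2)] isos_ar[OF assms(4)]
  let ?x = "src C i" and ?y = "src C k" and ?i = "inv_ar C i" and ?k = "inv_ar C k"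
  have "(e \<cdot> (i \<otimes>\<^sub>a k)) \<otimes>\<^sub>a idn C ?x \<cdot> idn C ?x \<otimes>\<^sub>a ((?k \<otimes>\<^sub>a ?i) \<cdot> n)
      = (e \<otimes>\<^sub>a idn C ?x) \<cdot> ((i \<otimes>\<^sub>a k \<otimes>\<^sub>a idn C ?x) \<cdot> (idn C ?x \<otimes>\<^sub>a ?k \<otimes>\<^sub>a ?i)) \<cdot> (idn C ?x \<otimes>\<^sub>a n)"
    by (simp add: tar_cmp_idn)
  also have "(i \<otimes>\<^sub>a k \<otimes>\<^sub>a idn C ?x) \<cdot> (idn C ?x \<otimes>\<^sub>a ?k \<otimes>\<^sub>a ?i)
      = (idn C (x \<otimes> y) \<otimes>\<^sub>a ?i) \<cdot> (i \<otimes>\<^sub>a idn C (y \<otimes> x))"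
    by (simp add: tar_merge idn_tob del: tar_idn)
  also have "(e \<otimes>\<^sub>a idn C ?x) \<cdot> ((idn C (x \<otimes> y) \<otimes>\<^sub>a ?i) \<cdot> (i \<otimes>\<^sub>a idn C (y \<otimes> x))) \<cdot> (idn C ?x \<otimes>\<^sub>a n)
      = ((e \<otimes>\<^sub>a idn C ?x) \<cdot> (idn C (x \<otimes> y) \<otimes>\<^sub>a ?i)) \<cdot> ((i \<otimes>\<^sub>a idn C (y \<otimes> x)) \<cdot> (idn C ?x \<otimes>\<^sub>a n))"
    by simp
  also have "(e \<otimes>\<^sub>a idn C ?x) \<cdot> (idn C (x \<otimes> y) \<otimes>\<^sub>a ?i) = ?i \<cdot> (e \<otimes>\<^sub>a idn C x)"
    using tar_slide[of e ?i] by simp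
  also have "(i \<otimes>\<^sub>a idn C (y \<otimes> x)) \<cdot> (idn C ?x \<otimes>\<^sub>a n) = (idn C x \<otimes>\<^sub>a n) \<cdot> i"
    using tar_slide[of i n] by simp
  also have "(?i \<cdot> (e \<otimes>\<^sub>a idn C x)) \<cdot> ((idn C x \<otimes>\<^sub>a n) \<cdot> i) = ?i \<cdot> ((e \<otimes>\<^sub>a idn C x) \<cdot> (idn C x \<otimes>\<^sub>a n)) \<cdot> i" by simp
  also have "\<dots> = idn C ?x" unfolding t by simp
  finally have 1: "(e \<cdot> (i \<otimes>\<^sub>a k)) \<otimes>\<^sub>a idn C ?x \<cdot> idn C ?x \<otimes>\<^sub>a ((?k \<otimes>\<^sub>a ?i) \<cdot> n) = idn C ?x" .
  have "idn C ?y \<otimes>\<^sub>a (e \<cdot> (i \<otimes>\<^sub>a k)) \<cdot> ((?k \<otimes>\<^sub>a ?i) \<cdot> n) \<otimes>\<^sub>a idn C ?y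
      = (idn C ?y \<otimes>\<^sub>a e) \<cdot> ((idn C ?y \<otimes>\<^sub>a i \<otimes>\<^sub>a k) \<cdot> (?k \<otimes>\<^sub>a ?i \<otimes>\<^sub>a idn C ?y)) \<cdot> (n \<otimes>\<^sub>a idn C ?y)"
    by (simp add: tar_cmp_idn)
  also have "(idn C ?y \<otimes>\<^sub>a i \<otimes>\<^sub>a k) \<cdot> (?k \<otimes>\<^sub>a ?i \<otimes>\<^sub>a idn C ?y)
      = (?k \<otimes>\<^sub>a idn C (x \<otimes> y)) \<cdot> (idn C (y \<otimes> x) \<otimes>\<^sub>a k)"
    by (simp add: tar_merge idn_tob del: tar_idn)
  also have "(idn C ?y \<otimes>\<^sub>a e) \<cdot> ((?k \<otimes>\<^sub>a idn C (x \<otimes> y)) \<cdot> (idn C (y \<otimes> x) \<otimes>\<^sub>a k)) \<cdot> (n \<otimes>\<^sub>a idn C ?y)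
      = ((idn C ?y \<otimes>\<^sub>a e) \<cdot> (?k \<otimes>\<^sub>a idn C (x \<otimes> y))) \<cdot> ((idn C (y \<otimes> x) \<otimes>\<^sub>a k) \<cdot> (n \<otimes>\<^sub>a idn C ?y))"
    by simp
  also have "(idn C ?y \<otimes>\<^sub>a e) \<cdot> (?k \<otimes>\<^sub>a idn C (x \<otimes> y)) = ?k \<cdot> (idn C y \<otimes>\<^sub>a e)"
    using tar_slide[of ?k e] by simp
  also have "(idn C (y \<otimes> x) \<otimes>\<^sub>a k) \<cdot> (n \<otimes>\<^sub>a idn C ?y) = (n \<otimes>\<^sub>a idn C y) \<cdot> k"
    using tar_slide[of n k] by simp
  also have "(?k \<cdot> (idn C y \<otimes>\<^sub>a e)) \<cdot> ((n \<otimes>\<^sub>a idn C y) \<cdot> k) = ?k \<cdot> ((idn C y \<otimes>\<^sub>a e) \<cdot> (n \<otimes>\<^sub>a idn C y)) \<cdot> k" by simp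
  also have "\<dots> = idn C ?y" unfolding t by simp
  finally have 2: "idn C ?y \<otimes>\<^sub>a (e \<cdot> (i \<otimes>\<^sub>a k)) \<cdot> ((?k \<otimes>\<^sub>a ?i) \<cdot> n) \<otimes>\<^sub>a idn C ?y = idn C ?y" .
  show ?thesis unfolding is_right_dual_strict using 1 2 by simp
qed

text \<open>The arrow \<open>k\<close> is the mate of the inverse of \<open>j\<close>. The condition
  on counits determines it, by a triangle equation of the second pair; the condition on units then
  follows.\<close>

lemma right_dual_mate:
  assumes "is_right_dual C x y e n" "is_right_dual C x' y' e' n'" "isos C j" "src C j = x" "tgt C j = x'"
  obtains k where "k \<in> ar C" "src C k = y" "tgt C k = y'" "e' \<cdot> (j \<otimes>\<^sub>a k) = e" "(k \<otimes>\<^sub>a j) \<cdot> n = n'"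
    "\<And>k'. k' \<in> ar C \<Longrightarrow> src C k' = y \<Longrightarrow> tgt C k' = y' \<Longrightarrow> e' \<cdot> (j \<otimes>\<^sub>a k') = e \<Longrightarrow> k' = k"
proof -
  have d: "x \<in> ob C" "y \<in> ob C" "e \<in> ar C" "src C e = x \<otimes> y" "tgt C e = unit C"
     "n \<in> ar C" "src C n = unit C" "tgt C n = y \<otimes> x"
     and t: "e \<otimes>\<^sub>a idn C x \<cdot> idn C x \<otimes>\<^sub>a n = idn C x" "idn C y \<otimes>\<^sub>a e \<cdot> n \<otimes>\<^sub>a idn C y = idn C y"
    using assms(1) unfolding is_right_dual_strict by auto
  have d': "x' \<in> ob C" "y' \<in> ob C" "e' \<in> ar C" "src C e' = x' \<otimes> y'" "tgt C e' = unit C"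
     "n' \<in> ar C" "src C n' = unit C" "tgt C n' = y' \<otimes> x'"
     and t': "e' \<otimes>\<^sub>a idn C x' \<cdot> idn C x' \<otimes>\<^sub>a n' = idn C x'" "idn C y' \<otimes>\<^sub>a e' \<cdot> n' \<otimes>\<^sub>a idn C y' = idn C y'"
    using assms(2) unfolding is_right_dual_strict by auto
  note [simp] = d d' assms(3-5) isos_ar[OF assms(3)]
  \<comment> \<open>The counit of the first pair, transported to \<open>x'\<close>. The arrow sought
    has to satisfy \<open>e' \<cdot> (idn C x' \<otimes>\<^sub>a k) = c\<close>, and
    \<open>k\<close> is taken to be the transpose of \<open>c\<close> under the second pair.\<close>
  define c where "c = e \<cdot> (inv_ar C j \<otimes>\<^sub>a idn C y)"
  have c [simp]: "c \<in> ar C" "src C c = x' \<otimes> y" "tgt C c = unit C" by (simp_all add: c_def)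
  have cj: "c \<cdot> (j \<otimes>\<^sub>a idn C y) = e" by (simp add: c_def tar_merge)
  define k where "k = (idn C y' \<otimes>\<^sub>a c) \<cdot> (n' \<otimes>\<^sub>a idn C y)"
  have k [simp]: "k \<in> ar C" "src C k = y" "tgt C k = y'" by (simp_all add: k_def)
  have "e' \<cdot> (idn C x' \<otimes>\<^sub>a k) = e' \<cdot> (idn C (x' \<otimes> y') \<otimes>\<^sub>a c) \<cdot> (idn C x' \<otimes>\<^sub>a n' \<otimes>\<^sub>a idn C y)"
    by (simp add: k_def tar_cmp_idn idn_tob del: tar_idn)
  also have "\<dots> = (e' \<otimes>\<^sub>a c) \<cdot> (idn C x' \<otimes>\<^sub>a n' \<otimes>\<^sub>a idn C y)"
    using reassoc[OF tar_slide(1)[of e' c, symmetric]] by simp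
  also have "\<dots> = c \<cdot> (e' \<otimes>\<^sub>a idn C x' \<otimes>\<^sub>a idn C y) \<cdot> ((idn C x' \<otimes>\<^sub>a n') \<otimes>\<^sub>a idn C y)"
    using tar_slide(2)[of e' c] by simp
  also have "\<dots> = c \<cdot> ((e' \<otimes>\<^sub>a idn C x' \<cdot> idn C x' \<otimes>\<^sub>a n') \<otimes>\<^sub>a idn C y)"
    by (simp add: tar_cmp_idn)
  also have "\<dots> = c" by (simp add: t')
  finally have ek: "e' \<cdot> (idn C x' \<otimes>\<^sub>a k) = c" .
  have "e' \<cdot> (j \<otimes>\<^sub>a k) = (e' \<cdot> (idn C x' \<otimes>\<^sub>a k)) \<cdot> (j \<otimes>\<^sub>a idn C y)"
    by (subst tar_slide(2)) simp_all
  then have 1: "e' \<cdot> (j \<otimes>\<^sub>a k) = e" by (simp only: ek cj)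
  have "(c \<otimes>\<^sub>a idn C x) \<cdot> (idn C x' \<otimes>\<^sub>a n) = (e \<otimes>\<^sub>a idn C x) \<cdot> (inv_ar C j \<otimes>\<^sub>a idn C (y \<otimes> x)) \<cdot> (idn C x' \<otimes>\<^sub>a n)"
    by (simp add: c_def tar_cmp_idn)
  also have "\<dots> = ((e \<otimes>\<^sub>a idn C x) \<cdot> (idn C x \<otimes>\<^sub>a n)) \<cdot> inv_ar C j"
    using tar_slide[of "inv_ar C j" n] by simp
  \<comment> \<open>Transposing \<open>c\<close> under the first pair gives back the inverse of
    \<open>j\<close>; this carries the condition from counits over to units.\<close>
  finally have cn: "(c \<otimes>\<^sub>a idn C x) \<cdot> (idn C x' \<otimes>\<^sub>a n) = inv_ar C j" by (simp add: t)
  have "(k \<otimes>\<^sub>a idn C x) \<cdot> n = (idn C y' \<otimes>\<^sub>a c \<otimes>\<^sub>a idn C x) \<cdot> (n' \<otimes>\<^sub>a idn C (y \<otimes> x)) \<cdot> n"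
    by (simp add: k_def tar_cmp_idn)
  also have "\<dots> = (idn C y' \<otimes>\<^sub>a c \<otimes>\<^sub>a idn C x) \<cdot> (idn C y' \<otimes>\<^sub>a idn C x' \<otimes>\<^sub>a n) \<cdot> n'"
    using tar_slide[of n' n] by (simp add: idn_tob del: tar_idn)
  also have "\<dots> = (idn C y' \<otimes>\<^sub>a ((c \<otimes>\<^sub>a idn C x) \<cdot> (idn C x' \<otimes>\<^sub>a n))) \<cdot> n'"
    by (simp add: tar_merge')
  finally have "(k \<otimes>\<^sub>a idn C x) \<cdot> n = (idn C y' \<otimes>\<^sub>a inv_ar C j) \<cdot> n'" unfolding cn .
  moreover have "(k \<otimes>\<^sub>a j) \<cdot> n = (idn C y' \<otimes>\<^sub>a j) \<cdot> (k \<otimes>\<^sub>a idn C x) \<cdot> n"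
    using tar_slide(2)[of k j] by simp
  ultimately have 2: "(k \<otimes>\<^sub>a j) \<cdot> n = n'" by (simp add: tar_merge')
  have 3: "k' = k" if [simp]: "k' \<in> ar C" "src C k' = y" "tgt C k' = y'" and k': "e' \<cdot> (j \<otimes>\<^sub>a k') = e" for k'
  proof -
    have "e' \<cdot> (idn C x' \<otimes>\<^sub>a k') = (e' \<cdot> (j \<otimes>\<^sub>a k')) \<cdot> (inv_ar C j \<otimes>\<^sub>a idn C y)"
      by (simp add: tar_merge)
    then have c': "e' \<cdot> (idn C x' \<otimes>\<^sub>a k') = c" by (simp only: k' c_def)
    have "k' = ((idn C y' \<otimes>\<^sub>a e') \<cdot> (n' \<otimes>\<^sub>a idn C y')) \<cdot> k'" by (simp add: t')
    also have "\<dots> = (idn C y' \<otimes>\<^sub>a e') \<cdot> (idn C (y' \<otimes> x') \<otimes>\<^sub>a k') \<cdot> (n' \<otimes>\<^sub>a idn C y)"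
      using tar_slide[of n' k'] by simp
    also have "\<dots> = (idn C y' \<otimes>\<^sub>a (e' \<cdot> (idn C x' \<otimes>\<^sub>a k'))) \<cdot> (n' \<otimes>\<^sub>a idn C y)"
      by (simp add: tar_merge' idn_tob del: tar_idn)
    finally show ?thesis by (simp only: c' k_def)
  qed
  show ?thesis by (rule that[OF k 1 2 3])
qed

end

text \<open>Counit and unit are conjugated by the constraints of \<open>F\<close>. Since
  \<open>C\<close> is not assumed strict, its associators and unitors occur in the given triangle
  equations; under \<open>far F\<close> they are expressed by the constraints, through
  \<open>fmul_assoc\<close>, \<open>fmul_lun\<close> and \<open>fmul_run\<close>, and
  cancel.\<close>

lemma right_dual_image:
  fixes D (structure)
  assumes "pmfun C D F" "strict_monoidal_category D" "is_right_dual C x y e n"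
  shows "is_right_dual D (fob F x) (fob F y)
    (inv_ar D (funit F) \<cdot> far F e \<cdot> fmul F x y) (inv_ar D (fmul F y x) \<cdot> far F n \<cdot> funit F)"
proof -
  interpret F: pointed_monoidal_functor C D F by fact
  interpret D: strict_monoidal_category D by fact
  let ?I = "unit C" and ?m = "fmul F" and ?u = "funit F"
  have d: "x \<in> ob C" "y \<in> ob C" "e \<in> ar C" "src C e = x \<otimes>\<^bsub>C\<^esub> y" "tgt C e = ?I" "n \<in> ar C" "src C n = ?I" "tgt C n = y \<otimes>\<^bsub>C\<^esub> x"
    and t: "lun C x \<cdot>\<^bsub>C\<^esub> (e \<otimes>\<^sub>a\<^bsub>C\<^esub> idn C x) \<cdot>\<^bsub>C\<^esub> inv_ar C (asc C x y x) \<cdot>\<^bsub>C\<^esub> (idn C x \<otimes>\<^sub>a\<^bsub>C\<^esub> n)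
       \<cdot>\<^bsub>C\<^esub> inv_ar C (run C x) = idn C x"
     "run C y \<cdot>\<^bsub>C\<^esub> (idn C y \<otimes>\<^sub>a\<^bsub>C\<^esub> e) \<cdot>\<^bsub>C\<^esub> asc C y x y \<cdot>\<^bsub>C\<^esub> (n \<otimes>\<^sub>a\<^bsub>C\<^esub> idn C y)
       \<cdot>\<^bsub>C\<^esub> inv_ar C (lun C y) = idn C y"
    using assms(3) by (auto simp: is_right_dual_def hom_iff)
  note [simp] = d
  let ?x = "idn D (fob F x)" and ?y = "idn D (fob F y)"
  let ?e = "inv_ar D ?u \<cdot> far F e \<cdot> ?m x y" and ?n = "inv_ar D (?m y x) \<cdot> far F n \<cdot> ?u"
  \<comment> \<open>The unitors of \<open>D\<close> are identities, so the unit axioms of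
    \<open>F\<close> compute the images of the inverse unitors of \<open>C\<close>.\<close>
  have ru: "inv_ar D (far F (run C a)) = ?m a ?I \<cdot> idn D (fob F a) \<otimes>\<^sub>a ?u"
    and lu: "inv_ar D (far F (lun C a)) = ?m ?I a \<cdot> ?u \<otimes>\<^sub>a idn D (fob F a)" if [simp]: "a \<in> ob C" for a
  proof -
    have "far F (run C a) \<cdot> (?m a ?I \<cdot> idn D (fob F a) \<otimes>\<^sub>a ?u) = idn D (fob F a)"
      using F.fmul_run[of a] by (simp add: D.run_idn)
    from F.D.inv_eq_left[OF _ _ _ this]
    show "inv_ar D (far F (run C a)) = ?m a ?I \<cdot> idn D (fob F a) \<otimes>\<^sub>a ?u" by simp
    have "far F (lun C a) \<cdot> (?m ?I a \<cdot> ?u \<otimes>\<^sub>a idn D (fob F a)) = idn D (fob F a)"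
      using F.fmul_lun[of a] by (simp add: D.lun_idn)
    from F.D.inv_eq_left[OF _ _ _ this]
    show "inv_ar D (far F (lun C a)) = ?m ?I a \<cdot> ?u \<otimes>\<^sub>a idn D (fob F a)" by simp
  qed
  have as: "?m (a \<otimes>\<^bsub>C\<^esub> b) c \<cdot> ?m a b \<otimes>\<^sub>a idn D (fob F c)
      = inv_ar D (far F (asc C a b c)) \<cdot> ?m a (b \<otimes>\<^bsub>C\<^esub> c) \<cdot> idn D (fob F a) \<otimes>\<^sub>a ?m b c"
    if [simp]: "a \<in> ob C" "b \<in> ob C" "c \<in> ob C" for a b c
    using F.fmul_assoc[of a b c] by (intro F.D.inv_eq_left[symmetric]) (simp_all add: D.asc_idn)
  have nat: "far F (f \<otimes>\<^sub>a\<^bsub>C\<^esub> g) \<cdot> ?m (src C f) (src C g) = ?m (tgt C f) (tgt C g) \<cdot> far F f \<otimes>\<^sub>a far F g"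
    if "f \<in> ar C" "g \<in> ar C" for f g
    using F.fmul_nat[OF that] by simp
  have "idn D (fob F x) = far F (lun C x) \<cdot> far F (e \<otimes>\<^sub>a\<^bsub>C\<^esub> idn C x) \<cdot> inv_ar D (far F (asc C x y x)) \<cdot> far F (idn C x \<otimes>\<^sub>a\<^bsub>C\<^esub> n)
       \<cdot> inv_ar D (far F (run C x))"
    using arg_cong[OF t(1), of "far F"] by (simp add: F.inv_far)
  also have "\<dots> = far F (lun C x) \<cdot> far F (e \<otimes>\<^sub>a\<^bsub>C\<^esub> idn C x) \<cdot> inv_ar D (far F (asc C x y x))
       \<cdot> (?m x (y \<otimes>\<^bsub>C\<^esub> x) \<cdot> ?x \<otimes>\<^sub>a far F n) \<cdot> ?x \<otimes>\<^sub>a ?u"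
    using F.D.reassoc[OF nat[of "idn C x" n]] by (simp add: ru)
  also have "\<dots> = far F (lun C x) \<cdot> far F (e \<otimes>\<^sub>a\<^bsub>C\<^esub> idn C x) \<cdot> (inv_ar D (far F (asc C x y x))
       \<cdot> ?m x (y \<otimes>\<^bsub>C\<^esub> x) \<cdot> ?x \<otimes>\<^sub>a ?m y x) \<cdot> ?x \<otimes>\<^sub>a ?n"
    by (simp add: F.D.tar_merge F.D.tar_merge')
  also have "\<dots> = far F (lun C x) \<cdot> (far F (e \<otimes>\<^sub>a\<^bsub>C\<^esub> idn C x) \<cdot> ?m (x \<otimes>\<^bsub>C\<^esub> y) x) \<cdot> ?m x y \<otimes>\<^sub>a ?x \<cdot> ?x \<otimes>\<^sub>a ?n"
    unfolding as[OF d(1,2,1), symmetric] by simp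
  also have "\<dots> = (far F (lun C x) \<cdot> ?m ?I x \<cdot> ?u \<otimes>\<^sub>a ?x) \<cdot> ?e \<otimes>\<^sub>a ?x \<cdot> ?x \<otimes>\<^sub>a ?n"
    using nat[of e "idn C x"] by (simp add: F.D.tar_merge')
  also have "\<dots> = ?e \<otimes>\<^sub>a ?x \<cdot> ?x \<otimes>\<^sub>a ?n"
    by (subst F.fmul_lun) (simp_all add: D.lun_idn)
  finally have 1: "?e \<otimes>\<^sub>a ?x \<cdot> ?x \<otimes>\<^sub>a ?n = ?x" by simp
  have "idn D (fob F y) = far F (run C y) \<cdot> far F (idn C y \<otimes>\<^sub>a\<^bsub>C\<^esub> e) \<cdot> far F (asc C y x y) \<cdot> far F (n \<otimes>\<^sub>a\<^bsub>C\<^esub> idn C y)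
       \<cdot> inv_ar D (far F (lun C y))"
    using arg_cong[OF t(2), of "far F"] by (simp add: F.inv_far)
  also have "\<dots> = far F (run C y) \<cdot> far F (idn C y \<otimes>\<^sub>a\<^bsub>C\<^esub> e) \<cdot> far F (asc C y x y)
       \<cdot> (?m (y \<otimes>\<^bsub>C\<^esub> x) y \<cdot> far F n \<otimes>\<^sub>a ?y) \<cdot> ?u \<otimes>\<^sub>a ?y"
    using F.D.reassoc[OF nat[of n "idn C y"]] by (simp add: lu)
  also have "\<dots> = far F (run C y) \<cdot> far F (idn C y \<otimes>\<^sub>a\<^bsub>C\<^esub> e) \<cdot> far F (asc C y x y)
       \<cdot> (?m (y \<otimes>\<^bsub>C\<^esub> x) y \<cdot> ?m y x \<otimes>\<^sub>a ?y) \<cdot> ?n \<otimes>\<^sub>a ?y"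
    by (simp add: F.D.tar_merge F.D.tar_merge')
  also have "\<dots> = far F (run C y) \<cdot> (far F (idn C y \<otimes>\<^sub>a\<^bsub>C\<^esub> e) \<cdot> ?m y (x \<otimes>\<^bsub>C\<^esub> y)) \<cdot> ?y \<otimes>\<^sub>a ?m x y \<cdot> ?n \<otimes>\<^sub>a ?y"
    unfolding as[OF d(2,1,2)] by simp
  also have "\<dots> = (far F (run C y) \<cdot> ?m y ?I \<cdot> ?y \<otimes>\<^sub>a ?u) \<cdot> ?y \<otimes>\<^sub>a ?e \<cdot> ?n \<otimes>\<^sub>a ?y"
    using nat[of "idn C y" e] by (simp add: F.D.tar_merge')
  also have "\<dots> = ?y \<otimes>\<^sub>a ?e \<cdot> ?n \<otimes>\<^sub>a ?y"
    by (subst F.fmul_run) (simp_all add: D.run_idn)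
  finally have 2: "?y \<otimes>\<^sub>a ?e \<cdot> ?n \<otimes>\<^sub>a ?y = ?y" by simp
  show ?thesis unfolding D.is_right_dual_strict using 1 2 by simp
qed

section \<open>The universal property of \<open>\<Omega>\<close>\<close>

locale evaluation = strict_pointed C + E: pointed_monoidal_category E + E: strict_monoidal_category E
  for C :: "('o, 'm) pmoncat" (structure) and E :: "('o list, 'k) pmoncat" +
  fixes h :: "'m \<Rightarrow> 'k" and e n :: 'k
  assumes E_ob [simp]: "ob E = words C" and E_tob [simp]: "tob E = wtensor C"
    and E_unit [simp]: "unit E = wunit C" and E_pt [simp]: "pt E = [pt C]"
    and h_simps [simp]: "f \<in> ar C \<Longrightarrow> h f \<in> ar E" "f \<in> ar C \<Longrightarrow> src E (h f) = [src C f]"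
      "f \<in> ar C \<Longrightarrow> tgt E (h f) = [tgt C f]"
    and h_idn: "a \<in> ob C \<Longrightarrow> h (idn C a) = idn E [a]"
    and h_cmp: "f \<in> ar C \<Longrightarrow> g \<in> ar C \<Longrightarrow> src C g = tgt C f \<Longrightarrow> h (g \<cdot> f) = h g \<cdot>\<^bsub>E\<^esub> h f"
    and h_tar: "f \<in> ar C \<Longrightarrow> g \<in> ar C \<Longrightarrow> h (f \<otimes>\<^sub>a g) = h f \<otimes>\<^sub>a\<^bsub>E\<^esub> h g"
    and dual: "is_right_dual E [pt C] (jdual C) e n"
begin

lemma dual_simps [simp]:
  "e \<in> ar E" "src E e = [pt C] \<otimes>\<^sub>w jdual C" "tgt E e = wunit C"
  "n \<in> ar E" "src E n = wunit C" "tgt E n = jdual C \<otimes>\<^sub>w [pt C]"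
  and triangles: "e \<otimes>\<^sub>a\<^bsub>E\<^esub> idn E [pt C] \<cdot>\<^bsub>E\<^esub> idn E [pt C] \<otimes>\<^sub>a\<^bsub>E\<^esub> n = idn E [pt C]"
    "idn E (jdual C) \<otimes>\<^sub>a\<^bsub>E\<^esub> e \<cdot>\<^bsub>E\<^esub> n \<otimes>\<^sub>a\<^bsub>E\<^esub> idn E (jdual C) = idn E (jdual C)"
  using dual unfolding E.is_right_dual_strict by auto

primrec ev_prim :: "'m prim \<Rightarrow> 'k" where
  "ev_prim Counit = e"
| "ev_prim Unit = n"
| "ev_prim (Bar f) = h f"

fun ev_edge :: "('o, 'm) edge \<Rightarrow> 'k" where
  "ev_edge (U, p, V) = idn E U \<otimes>\<^sub>a\<^bsub>E\<^esub> ev_prim p \<otimes>\<^sub>a\<^bsub>E\<^esub> idn E V"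

primrec ev_edges :: "('o, 'm) edge list \<Rightarrow> 'o list \<Rightarrow> 'k" where
  "ev_edges [] U = idn E U"
| "ev_edges (x # es) U = ev_edges es (edge_tgt C x) \<cdot>\<^bsub>E\<^esub> ev_edge x"

fun ev :: "('o, 'm) path \<Rightarrow> 'k" where
  "ev (U, es) = ev_edges es U"

lemma ev_prim_simps [simp]:
  assumes "\<forall>f. p = Bar f \<longrightarrow> f \<in> ar C"
  shows "ev_prim p \<in> ar E" "src E (ev_prim p) = prim_src C p" "tgt E (ev_prim p) = prim_tgt C p"
  using assms by (cases p; simp)+

lemma ev_edge_simps [simp]:
  assumes "x \<in> edges C"
  shows "ev_edge x \<in> ar E" "src E (ev_edge x) = edge_src C x" "tgt E (ev_edge x) = edge_tgt C x"
  using assms by (cases x; simp)+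

lemma ev_edges_simps:
  "is_chain C U es \<Longrightarrow> ev_edges es U \<in> ar E \<and> src E (ev_edges es U) = U \<and> tgt E (ev_edges es U) = path_tgt C (U, es)"
  by (induction es arbitrary: U) auto

lemma ev_simps [simp]:
  assumes "p \<in> paths C"
  shows "ev p \<in> ar E" "src E (ev p) = path_src p" "tgt E (ev p) = path_tgt C p"
  using assms by (cases p; simp add: ev_edges_simps)+

lemma ev_empty [simp]: "ev (empty_path U) = idn E U"
  by (simp add: empty_path_def)

lemma ev_edge_path [simp]: "x \<in> edges C \<Longrightarrow> ev (edge_path C x) = ev_edge x"
  by (simp add: edge_path_def)

lemma ev_comp [simp]:
  assumes "p \<in> paths C" "q \<in> paths C" "path_src q = path_tgt C p"
  shows "ev (path_comp q p) = ev q \<cdot>\<^bsub>E\<^esub> ev p"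
proof -
  have "is_chain C U es \<Longrightarrow> is_chain C (path_tgt C (U, es)) fs \<Longrightarrow>
    ev_edges (es @ fs) U = ev_edges fs (path_tgt C (U, es)) \<cdot>\<^bsub>E\<^esub> ev_edges es U" for U es fs
    by (induction es arbitrary: U) (auto simp: ev_edges_simps)
  then show ?thesis using assms by (cases p; cases q) auto
qed

lemma ev_whisker_edge:
  assumes "x \<in> edges C" and [simp]: "T \<in> words C" "W \<in> words C"
  shows "ev_edge (whisker_edge C T x W) = idn E T \<otimes>\<^sub>a\<^bsub>E\<^esub> ev_edge x \<otimes>\<^sub>a\<^bsub>E\<^esub> idn E W"
proof (cases x)
  case (fields U p V)
  with assms have [simp]: "U \<in> words C" "V \<in> words C" "\<forall>f. p = Bar f \<longrightarrow> f \<in> ar C" by auto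
  show ?thesis using fields E.idn_tob[of T U] E.idn_tob[of V W] by (simp del: E.tar_idn)
qed

lemma ev_whisker [simp]:
  assumes "p \<in> paths C" and [simp]: "T \<in> words C" "W \<in> words C"
  shows "ev (whisker_path C T p W) = idn E T \<otimes>\<^sub>a\<^bsub>E\<^esub> ev p \<otimes>\<^sub>a\<^bsub>E\<^esub> idn E W"
  using assms(1)
proof (induction p rule: path_induct)
  case (edge x p)
  then show ?case by (simp add: ev_whisker_edge E.tar_cmp_idn)
qed simp

lemma ev_prim_edge: "(\<forall>f. p = Bar f \<longrightarrow> f \<in> ar C) \<Longrightarrow> ev_edge (prim_edge C p) = ev_prim p"
  using E.tar_unit[of "ev_prim p"] by (simp add: prim_edge_def)

lemma ev_bar [simp]: "f \<in> ar C \<Longrightarrow> ev (bar C f) = h f"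
  by (simp add: bar_def ev_prim_edge)

text \<open>Each generating relation holds in \<open>E\<close>: those for \<open>bar\<close> because
  \<open>h\<close> preserves identities, composition and tensor products, exchange by functoriality
  of the tensor product, and the triangles by those of the given dual pair.\<close>

lemma ev_relator: "relator C p q \<Longrightarrow> ev p = ev q"
proof (induction rule: relator.induct)
  case (bar_tensor x y f)
  then show ?case by (simp add: h_tar h_idn)
next
  case (bar_idn x)
  then show ?case by (simp add: h_idn)
next
  case (bar_cmp f x y g)
  then show ?case by (simp add: h_cmp hom_iff)
next
  case (exchange a b U V W X)
  have l: "idn E (wunit C) \<otimes>\<^sub>a\<^bsub>E\<^esub> f = f" "f \<otimes>\<^sub>a\<^bsub>E\<^esub> idn E (wunit C) = f" if "f \<in> ar E" for f
    using E.tar_unit[OF that] by simp_all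
  from exchange have [simp]: "edge_src C a = U" "edge_tgt C a = V" "edge_src C b = W" "edge_tgt C b = X"
    "U \<in> words C" "V \<in> words C" "W \<in> words C" "X \<in> words C" by auto
  show ?case using exchange(1,2) E.tar_slide[of "ev_edge a" "ev_edge b"]
    by (simp add: ev_whisker_edge l)
next
  case triangle_J
  have l: "idn E (wunit C) \<otimes>\<^sub>a\<^bsub>E\<^esub> f = f" "f \<otimes>\<^sub>a\<^bsub>E\<^esub> idn E (wunit C) = f" if "f \<in> ar E" for f
    using E.tar_unit[OF that] by simp_all
  show ?case using triangles by (simp add: ev_whisker_edge ev_prim_edge l)
next
  case triangle_jdual
  have l: "idn E (wunit C) \<otimes>\<^sub>a\<^bsub>E\<^esub> f = f" "f \<otimes>\<^sub>a\<^bsub>E\<^esub> idn E (wunit C) = f" if "f \<in> ar E" for f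
    using E.tar_unit[OF that] by simp_all
  show ?case using triangles by (simp add: ev_whisker_edge ev_prim_edge l)
next
  case (whisker l l' Y Z)
  then show ?case using relator_parallel[OF whisker(1)] by (simp add: parallel_def)
qed

lemma ev_congr: "congr C p q \<Longrightarrow> ev p = ev q"
proof (induction rule: congr.induct)
  case (relator p q)
  then show ?case by (rule ev_relator)
next
  case (comp p p' q q')
  then show ?case using congr_parallel[OF comp(1)] congr_parallel[OF comp(2)] by (simp add: parallel_def)
qed auto

text \<open>\<open>E\<close> has the same objects as \<open>adjoin_dual C\<close> and the same
  tensor product of objects, so the interpretation is the identity on objects and its constraints
  are identities.\<close>

definition Ev :: "('o list, ('o, 'm) path set, 'o list, 'k) pmonfun" where
  "Ev = \<lparr>fdom = A, fcod = E, fob = (\<lambda>U\<in>words C. U), far = (\<lambda>c\<in>ar A. ev (rep c)),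
     fmul = (\<lambda>U\<in>words C. \<lambda>V\<in>words C. idn E (U \<otimes>\<^sub>w V)), funit = idn E (wunit C), fpt = idn E [pt C]\<rparr>"

lemma Ev_simps [simp]:
  "fdom Ev = A" "fcod Ev = E" "U \<in> words C \<Longrightarrow> fob Ev U = U"
  "p \<in> paths C \<Longrightarrow> far Ev (cl p) = ev p"
  "U \<in> words C \<Longrightarrow> V \<in> words C \<Longrightarrow> fmul Ev U V = idn E (U \<otimes>\<^sub>w V)"
  "funit Ev = idn E (wunit C)" "fpt Ev = idn E [pt C]"
  using ev_congr[OF rep_cl[of p]] by (simp_all add: Ev_def)

lemma Ev_pr: "\<forall>f. p = Bar f \<longrightarrow> f \<in> ar C \<Longrightarrow> far Ev (pr p) = ev_prim p"
  by (simp add: pr_def ev_prim_edge)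

lemma ev_path_tensor [simp]:
  assumes [simp]: "p \<in> paths C" "q \<in> paths C"
  shows "ev (path_tensor C p q) = ev p \<otimes>\<^sub>a\<^bsub>E\<^esub> ev q"
proof -
  have l: "idn E (wunit C) \<otimes>\<^sub>a\<^bsub>E\<^esub> f = f" "f \<otimes>\<^sub>a\<^bsub>E\<^esub> idn E (wunit C) = f" if "f \<in> ar E" for f
    using E.tar_unit[OF that] by simp_all
  show ?thesis using E.tar_slide(2)[of "ev p" "ev q"] by (simp add: path_tensor_def l)
qed

lemma Ev_pmfun: "pmfun A E Ev"
proof -
  interpret A: strict_pointed A by (rule adjoin_dual_pointed)
  have l: "idn E (wunit C) \<otimes>\<^sub>a\<^bsub>E\<^esub> f = f" "f \<otimes>\<^sub>a\<^bsub>E\<^esub> idn E (wunit C) = f" if "f \<in> ar E" for f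
    using E.tar_unit[OF that] by simp_all
  have co [simp]: "asc A U V W = idn A (U \<otimes>\<^sub>w V \<otimes>\<^sub>w W)" "lun A U = idn A U" "run A U = idn A U" for U V W
    by (simp_all add: adjoin_dual_simps(5,10-12))
  have far [simp]: "far Ev f \<in> ar E" "src E (far Ev f) = src A f" "tgt E (far Ev f) = tgt A f" if "f \<in> ar A" for f
    by (rule adjoin_dual_arE[OF that], simp)+
  have far_idn [simp]: "far Ev (idn A U) = idn E U" if "U \<in> words C" for U
    using that by (simp add: adjoin_dual_simps(5))
  have far_cmp [simp]: "far Ev (g \<cdot>\<^bsub>A\<^esub> f) = far Ev g \<cdot>\<^bsub>E\<^esub> far Ev f" if "f \<in> ar A" "g \<in> ar A" "src A g = tgt A f" for f g
    using that by - (erule adjoin_dual_arE, erule adjoin_dual_arE, simp)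
  have far_tar [simp]: "far Ev (f \<otimes>\<^sub>a\<^bsub>A\<^esub> g) = far Ev f \<otimes>\<^sub>a\<^bsub>E\<^esub> far Ev g" if "f \<in> ar A" "g \<in> ar A" for f g
    using that by - (erule adjoin_dual_arE, erule adjoin_dual_arE, simp)
  have ob [simp]: "src A f \<in> words C" "tgt A f \<in> words C" if "f \<in> ar A" for f
    using A.src_ob[OF that] A.tgt_ob[OF that] by simp_all
  have "is_functor A E (fob Ev) (far Ev)"
    unfolding is_functor_def using A.category_axioms E.category_axioms by (auto simp: hom_iff)
  then show ?thesis
    by unfold_locales (simp_all add: hom_iff iso_iff E.asc_idn E.lun_idn E.run_idn, simp_all add: Ev_def)
qed

end

section \<open>Extending a functor along \<open>Omega\<close>\<close>

locale extension = strict_pointed C + D: strict_pointed D + H: pointed_monoidal_functor C D H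
  for C :: "('o, 'm) pmoncat" and D :: "('p, 'n) pmoncat" (structure) and H :: "('o, 'm, 'p, 'n) pmonfun" +
  fixes K :: 'p and e n :: 'n
  assumes dual: "is_right_dual D (fob H (pt C)) K e n"
begin

lemma K_ob [simp]: "K \<in> ob D"
  using dual by (simp add: is_right_dual_def)

text \<open>\<open>T\<close> sends the word \<open>(a\<^sub>0, \<dots>, a\<^sub>m)\<close> to \<open>H a\<^sub>0 \<otimes> K \<otimes> H a\<^sub>1 \<otimes> \<dots> \<otimes> K \<otimes> H a\<^sub>m\<close>, so its full
  image receives a strict monoidal functor from \<open>adjoin_dual C\<close> that is the identity on objects.\<close>

primrec suf :: "'o list \<Rightarrow> 'p" where
  "suf [] = unit D"
| "suf (a # U) = K \<otimes> fob H a \<otimes> suf U"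

primrec T :: "'o list \<Rightarrow> 'p" where
  "T [] = unit D"
| "T (a # U) = fob H a \<otimes> suf U"

text \<open>In a product of words only the last letter of the first and the first letter of the
  second are merged, so a single \<open>fmul H\<close> occurs, surrounded by identities. The empty
  list is not a word, and its value is a default.\<close>

primrec mm :: "'o list \<Rightarrow> 'o list \<Rightarrow> 'n" where
  "mm [] V = idn D (unit D)"
| "mm (a # U) V = (if U = [] then fmul H a (hd V) \<otimes>\<^sub>a idn D (suf (tl V)) else idn D (fob H a \<otimes> K) \<otimes>\<^sub>a mm U V)"

lemma suf_ob [simp]: "set U \<subseteq> ob C \<Longrightarrow> suf U \<in> ob D"
  by (induction U) auto

lemma words_set: "U \<in> words C \<Longrightarrow> set U \<subseteq> ob C"
  by (simp add: words_iff)

lemma Cons_suf [simp]: "b # V \<in> words C \<Longrightarrow> suf V \<in> ob D" "b # V \<in> words C \<Longrightarrow> b \<in> ob C"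
  by (auto simp: words_iff)

lemma T_ob: "U \<in> words C \<Longrightarrow> T U \<in> ob D"
  by (induction U rule: words_induct) auto

lemma mm_iso:
  assumes "U \<in> words C" "V \<in> words C"
  shows "mm U V \<in> ar D \<and> src D (mm U V) = T U \<otimes> T V \<and> tgt D (mm U V) = T (U \<otimes>\<^sub>w\<^bsub>C\<^esub> V) \<and> isos D (mm U V)"
  using assms(1)
proof (induction U rule: words_induct)
  case (single a)
  from assms(2) show ?case by (cases V rule: words_cases) (use single assms(2) in auto)
next
  case (Cons a b U)
  obtain d Z where Z: "(b # U) \<otimes>\<^sub>w\<^bsub>C\<^esub> V = d # Z" "d # Z \<in> words C" by (metis Cons.hyps(2) assms(2) wtensor_words words_cases)
  from assms(2) have [simp]: "T V \<in> ob D" by (rule T_ob)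
  from Cons Z show ?case by (simp add: T_ob)
qed

lemma suf_Cons_ob [simp]: "a # U \<in> words C \<Longrightarrow> fob H a \<otimes> suf U \<in> ob D"
  by simp

text \<open>Associativity is decided at \<open>V\<close>: if \<open>V\<close> is a single letter,
  both products merge it and \<open>fmul_assoc\<close> is needed; if it is longer, the two merges
  take place in different tensor factors. All letters of \<open>U\<close> but the last contribute
  identities. The unit laws are those of \<open>H\<close> at the first and at the last
  letter.\<close>

lemma coherent_family_T: "coherent_family D (words C) (wtensor C) (wunit C) T mm (funit H)"
proof unfold_locales
  note [simp] = mm_iso T_ob
  fix U V W assume UVW [simp]: "U \<in> words C" "V \<in> words C" "W \<in> words C"
  have "mm (U \<otimes>\<^sub>w\<^bsub>C\<^esub> V) W \<cdot> mm U V \<otimes>\<^sub>a idn D (T W) = mm U (V \<otimes>\<^sub>w\<^bsub>C\<^esub> W) \<cdot> idn D (T U) \<otimes>\<^sub>a mm V W"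
    using UVW(1)
  proof (induction U rule: words_induct)
    case (single a)
    note [simp] = \<open>a \<in> ob C\<close>
    obtain b V' where V: "V = b # V'" "b \<in> ob C" "V' = [] \<or> V' \<in> words C" using UVW(2) by (rule words_cases)
    show ?case
    proof (cases "V' = []")
      case True
      obtain c W' where W: "W = c # W'" "c \<in> ob C" "W' = [] \<or> W' \<in> words C" using UVW(3) by (rule words_cases)
      then have [simp]: "suf W' \<in> ob D" using words_set by (cases "W' = []") auto
      have "mm ([a] \<otimes>\<^sub>w\<^bsub>C\<^esub> V) W \<cdot> mm [a] V \<otimes>\<^sub>a idn D (T W)
        = (fmul H (a \<otimes>\<^bsub>C\<^esub> b) c \<cdot> fmul H a b \<otimes>\<^sub>a idn D (fob H c)) \<otimes>\<^sub>a idn D (suf W')"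
        using V W True D.tar_cmp_idn(1)[of "fmul H a b \<otimes>\<^sub>a idn D (fob H c)" "fmul H (a \<otimes>\<^bsub>C\<^esub> b) c" "suf W'"] by simp
      also have "fmul H (a \<otimes>\<^bsub>C\<^esub> b) c \<cdot> fmul H a b \<otimes>\<^sub>a idn D (fob H c)
        = fmul H a (b \<otimes>\<^bsub>C\<^esub> c) \<cdot> idn D (fob H a) \<otimes>\<^sub>a fmul H b c"
        using H.fmul_assoc[of a b c] V W by (simp add: D.asc_idn asc_idn)
      also have "(fmul H a (b \<otimes>\<^bsub>C\<^esub> c) \<cdot> idn D (fob H a) \<otimes>\<^sub>a fmul H b c) \<otimes>\<^sub>a idn D (suf W')
        = mm [a] (V \<otimes>\<^sub>w\<^bsub>C\<^esub> W) \<cdot> idn D (T [a]) \<otimes>\<^sub>a mm V W"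
        using V W True by (simp add: D.tar_cmp_idn)
      finally show ?thesis .
    next
      case False
      then have V' [simp]: "V' \<in> words C" using V by auto
      obtain b' V'' where V'': "V' = b' # V''" "V'' = [] \<or> V'' \<in> words C" using V' by (rule words_cases)
      have w: "V' \<otimes>\<^sub>w\<^bsub>C\<^esub> W \<in> words C" by simp
      obtain d Z where Z: "V' \<otimes>\<^sub>w\<^bsub>C\<^esub> W = d # Z" "d # Z \<in> words C" by (metis w words_cases)
      have sufT: "suf X = K \<otimes> T X" if "X \<in> words C" for X using that by (cases X) (auto simp: words_iff)
      have VW: "(b # V') \<otimes>\<^sub>w\<^bsub>C\<^esub> W = b # (V' \<otimes>\<^sub>w\<^bsub>C\<^esub> W)" using V'' by simp
      have "mm ([a] \<otimes>\<^sub>w\<^bsub>C\<^esub> V) W \<cdot> mm [a] V \<otimes>\<^sub>a idn D (T W)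
        = (idn D (fob H (a \<otimes>\<^bsub>C\<^esub> b)) \<otimes>\<^sub>a idn D K \<otimes>\<^sub>a mm V' W) \<cdot> (fmul H a b \<otimes>\<^sub>a idn D K \<otimes>\<^sub>a idn D (T V' \<otimes> T W))"
        using V False by (simp add: sufT D.idn_tob del: D.tar_idn)
      also have "\<dots> = fmul H a b \<otimes>\<^sub>a idn D K \<otimes>\<^sub>a mm V' W"
        using V by (simp add: D.tar_merge)
      also have "\<dots> = (fmul H a b \<otimes>\<^sub>a idn D K \<otimes>\<^sub>a idn D (T (V' \<otimes>\<^sub>w\<^bsub>C\<^esub> W))) \<cdot>
         ((idn D (fob H a) \<otimes>\<^sub>a idn D (fob H b)) \<otimes>\<^sub>a idn D K \<otimes>\<^sub>a mm V' W)"
        using V by (simp add: D.tar_merge)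
      also have "\<dots> = mm [a] (V \<otimes>\<^sub>w\<^bsub>C\<^esub> W) \<cdot> idn D (T [a]) \<otimes>\<^sub>a mm V W"
        using V False by (simp add: VW sufT D.idn_tob del: D.tar_idn)
      finally show ?thesis .
    qed
  next
    case (Cons a b U)
    note [simp] = Cons.hyps
    have w: "(b # U) \<otimes>\<^sub>w\<^bsub>C\<^esub> V \<in> words C" by simp
    obtain d Z where Z: "(b # U) \<otimes>\<^sub>w\<^bsub>C\<^esub> V = d # Z" "d # Z \<in> words C" by (metis w words_cases)
    have i: "mm (d # Z) W \<cdot> mm (b # U) V \<otimes>\<^sub>a idn D (T W) = mm (b # U) (V \<otimes>\<^sub>w\<^bsub>C\<^esub> W) \<cdot> idn D (T (b # U)) \<otimes>\<^sub>a mm V W"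
      using Cons.IH by (simp only: Z)
    have ty: "tgt D (mm (b # U) V) = T (d # Z)" using mm_iso[of "b # U" V] by (simp add: Z)
    have tt: "T (a # b # U) = (fob H a \<otimes> K) \<otimes> T (b # U)" by simp
    have m2: "mm (a # x # X) Y = idn D (fob H a \<otimes> K) \<otimes>\<^sub>a mm (x # X) Y" for x X Y by simp
    have "mm ((a # b # U) \<otimes>\<^sub>w\<^bsub>C\<^esub> V) W \<cdot> mm (a # b # U) V \<otimes>\<^sub>a idn D (T W)
        = idn D (fob H a \<otimes> K) \<otimes>\<^sub>a (mm (d # Z) W \<cdot> mm (b # U) V \<otimes>\<^sub>a idn D (T W))"
      using Z ty unfolding wtensor_Cons Z(1) m2 by (simp add: D.tar_merge del: mm.simps T.simps)
    also have "\<dots> = mm (a # b # U) (V \<otimes>\<^sub>w\<^bsub>C\<^esub> W) \<cdot> idn D (T (a # b # U)) \<otimes>\<^sub>a mm V W"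
      unfolding i m2 tt
      using D.idn_tob[of "fob H a \<otimes> K" "T (b # U)"] by (simp add: D.tar_cmp_idn del: mm.simps T.simps D.tar_idn D.tob_assoc)
    finally show ?case .
  qed
  then show "mm (U \<otimes>\<^sub>w\<^bsub>C\<^esub> V) W \<cdot> mm U V \<otimes>\<^sub>a idn D (T W)
    = mm U (V \<otimes>\<^sub>w\<^bsub>C\<^esub> W) \<cdot> idn D (T U) \<otimes>\<^sub>a mm V W \<cdot> asc D (T U) (T V) (T W)"
    by (simp add: D.asc_idn)
next
  fix U assume U: "U \<in> words C"
  then obtain b V where V: "U = b # V" "b \<in> ob C" "V = [] \<or> V \<in> words C" by (rule words_cases)
  then have [simp]: "suf V \<in> ob D" using words_set by (cases "V = []") auto
  have "(fmul H (unit C) b \<cdot> funit H \<otimes>\<^sub>a idn D (fob H b)) \<otimes>\<^sub>a idn D (suf V) = idn D (T U)"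
    using H.fmul_lun[of b] V by (simp add: lun_idn D.lun_idn)
  then show "mm (wunit C) U \<cdot> funit H \<otimes>\<^sub>a idn D (T U) = lun D (T U)"
    using V D.idn_tob[of "fob H b" "suf V"] by (simp add: wunit_def D.lun_idn D.tar_cmp_idn del: D.tar_idn)
  from U have "mm U (wunit C) \<cdot> idn D (T U) \<otimes>\<^sub>a funit H = idn D (T U)"
  proof (induction U rule: words_induct)
    case (single a)
    then show ?case using H.fmul_run[of a] by (simp add: wunit_def run_idn D.run_idn)
  next
    case (Cons a b U)
    note [simp] = Cons.hyps mm_iso
    have tt: "T (a # b # U) = (fob H a \<otimes> K) \<otimes> T (b # U)" using Cons by simp
    have [simp]: "T (b # U) \<in> ob D" using Cons.hyps(2) by (rule T_ob)
    have m2: "mm (a # b # U) Y = idn D (fob H a \<otimes> K) \<otimes>\<^sub>a mm (b # U) Y" for Y by simp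
    have [simp]: "T (wunit C) = fob H (unit C)" by (simp add: wunit_def)
    have "mm (a # b # U) (wunit C) \<cdot> idn D (T (a # b # U)) \<otimes>\<^sub>a funit H
        = idn D (fob H a \<otimes> K) \<otimes>\<^sub>a (mm (b # U) (wunit C) \<cdot> idn D (T (b # U)) \<otimes>\<^sub>a funit H)"
      unfolding tt m2 using Cons.hyps(1) D.idn_tob[of "fob H a \<otimes> K" "T (b # U)"]
      by (simp add: D.tar_cmp_idn del: mm.simps T.simps D.tar_idn D.tob_assoc)
    then show ?case unfolding Cons.IH tt using Cons.hyps(1) by (simp del: T.simps)
  qed
  then show "mm U (wunit C) \<cdot> idn D (T U) \<otimes>\<^sub>a funit H = run D (T U)" using T_ob[OF U] by (simp add: D.run_idn)
qed (simp_all add: T_ob mm_iso iso_iff, simp add: wunit_def)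

end

text \<open>The projection to \<open>D\<close> is fully faithful, so counit and unit lift to the
  full image once they are corrected by the constraints.\<close>

lemma (in pointed_coherent_family) right_dual_full_image:
  assumes "strict_monoidal_category D" "a \<in> M" "b \<in> M" "is_right_dual D (T a) (T b) c n"
  shows "is_right_dual I a b (mu a b, u \<cdot> c \<cdot> inv_ar D (m a b), e) (e, m b a \<cdot> n \<cdot> inv_ar D u, mu b a)"
proof -
  interpret S: strict_monoidal_category D by fact
  interpret I: strict_monoidal_category I by (rule full_image_strict)
  note [simp] = assms(2,3)
  have d [simp]: "c \<in> ar D" "src D c = T a \<otimes> T b" "tgt D c = unit D"
     "n \<in> ar D" "src D n = unit D" "tgt D n = T b \<otimes> T a"
     and t: "c \<otimes>\<^sub>a idn D (T a) \<cdot> idn D (T a) \<otimes>\<^sub>a n = idn D (T a)"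
       "idn D (T b) \<otimes>\<^sub>a c \<cdot> n \<otimes>\<^sub>a idn D (T b) = idn D (T b)"
    using assms(4) unfolding S.is_right_dual_strict by auto
  have L: "m e x = inv_ar D u \<otimes>\<^sub>a idn D (T x)" and R: "inv_ar D (m x e) = idn D (T x) \<otimes>\<^sub>a u"
    and L': "inv_ar D (m e x) = u \<otimes>\<^sub>a idn D (T x)" and R': "m x e = idn D (T x) \<otimes>\<^sub>a inv_ar D u"
    if [simp]: "x \<in> M" for x
  proof -
    have 1: "m e x \<cdot> (u \<otimes>\<^sub>a idn D (T x)) = idn D (T x)" "m x e \<cdot> (idn D (T x) \<otimes>\<^sub>a u) = idn D (T x)"
      using m_unit_left[of x] m_unit_right[of x] by (simp_all add: S.lun_idn S.run_idn)
    show "m e x = inv_ar D u \<otimes>\<^sub>a idn D (T x)"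
      using D.inv_eq_right[OF _ _ _ 1(1)] by (simp add: D.inv_tar)
    show "m x e = idn D (T x) \<otimes>\<^sub>a inv_ar D u"
      using D.inv_eq_right[OF _ _ _ 1(2)] by (simp add: D.inv_tar)
    show "inv_ar D (m e x) = u \<otimes>\<^sub>a idn D (T x)" "inv_ar D (m x e) = idn D (T x) \<otimes>\<^sub>a u"
      using D.inv_eq_left[OF _ _ _ 1(1)] D.inv_eq_left[OF _ _ _ 1(2)] by simp_all
  qed
  \<comment> \<open>Two multiplications meet between the whiskered unit and counit; associativity
    replaces them by multiplications on separate factors, which cancel against those in
    \<open>?c\<close> and \<open>?n\<close>.\<close>
  have as: "inv_ar D (m (mu x y) z) \<cdot> m x (mu y z) = (m x y \<otimes>\<^sub>a idn D (T z)) \<cdot> (idn D (T x) \<otimes>\<^sub>a inv_ar D (m y z))"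
    if [simp]: "x \<in> M" "y \<in> M" "z \<in> M" for x y z
  proof -
    have "m (mu x y) z \<cdot> (m x y \<otimes>\<^sub>a idn D (T z)) \<cdot> (idn D (T x) \<otimes>\<^sub>a inv_ar D (m y z))
        = (m (mu x y) z \<cdot> (m x y \<otimes>\<^sub>a idn D (T z))) \<cdot> (idn D (T x) \<otimes>\<^sub>a inv_ar D (m y z))" by simp
    also have "\<dots> = m x (mu y z)" unfolding m_assoc[OF that] by (simp add: S.asc_idn D.tar_merge)
    finally show ?thesis by (intro D.inv_eq_left) simp_all
  qed
  have as': "m x (mu y z) \<cdot> (idn D (T x) \<otimes>\<^sub>a m y z) = m (mu x y) z \<cdot> (m x y \<otimes>\<^sub>a idn D (T z))"
    if [simp]: "x \<in> M" "y \<in> M" "z \<in> M" for x y z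
    using m_assoc[OF that] by (simp add: S.asc_idn)
  have as2: "inv_ar D (m x (mu y z)) \<cdot> m (mu x y) z = (idn D (T x) \<otimes>\<^sub>a m y z) \<cdot> (inv_ar D (m x y) \<otimes>\<^sub>a idn D (T z))"
    if [simp]: "x \<in> M" "y \<in> M" "z \<in> M" for x y z
  proof -
    have "m x (mu y z) \<cdot> (idn D (T x) \<otimes>\<^sub>a m y z) \<cdot> (inv_ar D (m x y) \<otimes>\<^sub>a idn D (T z))
        = (m x (mu y z) \<cdot> (idn D (T x) \<otimes>\<^sub>a m y z)) \<cdot> (inv_ar D (m x y) \<otimes>\<^sub>a idn D (T z))" by simp
    also have "\<dots> = m (mu x y) z" unfolding as'[OF that] by (simp add: D.tar_merge)
    finally show ?thesis by (intro D.inv_eq_left) simp_all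
  qed
  let ?c = "u \<cdot> c \<cdot> inv_ar D (m a b)" and ?n = "m b a \<cdot> n \<cdot> inv_ar D u"
  have "box D m m (mu a b) a e a ?c (idn D (T a)) \<cdot> box D m m a e a (mu b a) (idn D (T a)) ?n
      = (inv_ar D u \<otimes>\<^sub>a idn D (T a)) \<cdot> (?c \<otimes>\<^sub>a idn D (T a)) \<cdot> (m a b \<otimes>\<^sub>a idn D (T a)) \<cdot>
        (idn D (T a) \<otimes>\<^sub>a inv_ar D (m b a)) \<cdot> (idn D (T a) \<otimes>\<^sub>a ?n) \<cdot> (idn D (T a) \<otimes>\<^sub>a u)"
    using D.reassoc[OF as[of a b a]] by (simp add: box_def L R)
  also have "\<dots> = idn D (T a)" using t(1) by (simp add: D.tar_merge D.tar_merge')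
  finally have 1: "box D m m (mu a b) a e a ?c (idn D (T a)) \<cdot> box D m m a e a (mu b a) (idn D (T a)) ?n = idn D (T a)" .
  have "box D m m b (mu a b) b e (idn D (T b)) ?c \<cdot> box D m m e b (mu b a) b ?n (idn D (T b))
      = (idn D (T b) \<otimes>\<^sub>a inv_ar D u) \<cdot> (idn D (T b) \<otimes>\<^sub>a ?c) \<cdot> (idn D (T b) \<otimes>\<^sub>a m a b) \<cdot>
        (inv_ar D (m b a) \<otimes>\<^sub>a idn D (T b)) \<cdot> (?n \<otimes>\<^sub>a idn D (T b)) \<cdot> (u \<otimes>\<^sub>a idn D (T b))"
    using D.reassoc[OF as2[of b a b]] by (simp add: box_def L' R')
  also have "\<dots> = idn D (T b)" using t(2) by (simp add: D.tar_merge D.tar_merge')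
  finally have 2: "box D m m b (mu a b) b e (idn D (T b)) ?c \<cdot> box D m m e b (mu b a) b ?n (idn D (T b)) = idn D (T b)" .
  show ?thesis unfolding I.is_right_dual_strict using 1 2 by simp
qed

context extension
begin

sublocale PC: pointed_coherent_family D "words C" "wtensor C" "wunit C" T mm "funit H" "[pt C]" "fpt H"
proof -
  interpret coherent_family D "words C" "wtensor C" "wunit C" T mm "funit H" by (rule coherent_family_T)
  show "pointed_coherent_family D (words C) (wtensor C) (wunit C) T mm (funit H) [pt C] (fpt H)"
    by unfold_locales (auto simp: iso_iff)
qed

lemma full_image_dual: "\<exists>c n. is_right_dual PC.I [pt C] (jdual C) c n"
proof -
  \<comment> \<open>\<open>T (jdual C)\<close> is
    \<open>fob H (unit C) \<otimes> K \<otimes> fob H (unit C)\<close>; the inverse unit constraints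
    on both sides identify it with \<open>K\<close>.\<close>
  let ?k = "inv_ar D (funit H) \<otimes>\<^sub>a idn D K \<otimes>\<^sub>a inv_ar D (funit H)"
  have "is_right_dual D (T [pt C]) (T (jdual C)) (e \<cdot> (idn D (fob H (pt C)) \<otimes>\<^sub>a ?k))
      ((inv_ar D ?k \<otimes>\<^sub>a inv_ar D (idn D (fob H (pt C)))) \<cdot> n)"
    using D.right_dual_iso[OF dual, of "idn D (fob H (pt C))" ?k] by (simp add: jdual_def)
  moreover have "[pt C] \<in> words C" by simp
  ultimately show ?thesis
    using PC.right_dual_full_image[OF D.strict_monoidal_category_axioms _ jdual_words] by blast
qed

text \<open>On one-letter words \<open>T [a]\<close> is \<open>fob H a\<close> and
  \<open>mm [a] [b]\<close> is \<open>fmul H a b\<close>, and the constraints of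
  \<open>Omega\<close> and \<open>Ev\<close> are identities; hence the composite restricts to
  \<open>H\<close> with equality and not merely up to isomorphism.\<close>

theorem ex_extension: "\<exists>G. pmfun (adjoin_dual C) D G \<and> comp_pmonfun G (Omega C) = H"
proof -
  obtain c n' where cn: "is_right_dual PC.I [pt C] (jdual C) c n'" using full_image_dual by blast
  interpret I: strict_monoidal_category PC.I by (rule PC.full_image_strict)
  interpret I: pointed_monoidal_category PC.I by (rule PC.full_image_pmcat)
  let ?h = "\<lambda>f. ([src C f], far H f, [tgt C f])"
  have m1: "mm [a] [b] = fmul H a b" if "a \<in> ob C" "b \<in> ob C" for a b using that by simp
  interpret evaluation C PC.I ?h c n'
  proof unfold_locales
    fix f g assume [simp]: "f \<in> ar C" "g \<in> ar C"
    have "far H (f \<otimes>\<^sub>a\<^bsub>C\<^esub> g) = box D mm mm [src C f] [src C g] [tgt C f] [tgt C g] (far H f) (far H g)"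
      using H.fmul_nat[of f g] by (intro PC.FF.box_eqI[symmetric]) (simp_all add: m1)
    then show "?h (f \<otimes>\<^sub>a\<^bsub>C\<^esub> g) = ?h f \<otimes>\<^sub>a\<^bsub>PC.I\<^esub> ?h g" by simp
  qed (use cn in simp_all)
  let ?G = "comp_pmonfun PC.P Ev"
  have G: "pmfun (adjoin_dual C) D ?G" by (rule comp_pmfun[OF Ev_pmfun PC.full_image_proj_pmfun])
  have id: "far Ev (idn (adjoin_dual C) U) = idn PC.I U" if "U \<in> words C" for U
    using that by (simp add: adjoin_dual_simps(5))
  have id': "idn (adjoin_dual C) U \<in> ar (adjoin_dual C)" if "U \<in> words C" for U
    using that by (simp add: adjoin_dual_simps(5))
  have w [simp]: "T (wunit C) = fob H (unit C)" by (simp add: wunit_def)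
  have "comp_pmonfun ?G (Omega C) = H"
  proof (rule pmonfun_eqI[OF comp_pmfun[OF Omega_pmfun G] H.pointed_monoidal_functor_axioms])
    fix f assume f: "f \<in> ar C"
    have "far Ev (pr (Bar f)) = ?h f" using Ev_pr[of "Bar f"] f by simp
    then show "far (comp_pmonfun ?G (Omega C)) f = far H f" using f by simp
  next
    fix a b assume "a \<in> ob C" "b \<in> ob C"
    then show "fmul (comp_pmonfun ?G (Omega C)) a b = fmul H a b" by (simp add: id id' m1)
  next
    show "funit (comp_pmonfun ?G (Omega C)) = funit H" by (simp add: id id' PC.m_unit_left)
    show "fpt (comp_pmonfun ?G (Omega C)) = fpt H" by (simp add: id id')
  qed simp
  with G show ?thesis by blast
qed

end

text \<open>Over a strict source the associators and unitors are identities, so forgetting the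
  arrows leaves a coherent family on the monoid of objects. This makes boxes available for the
  components of transformations.\<close>

lemma coherent_family_pmfun:
  fixes D (structure)
  assumes "pmfun P D G" "strict_monoidal_category P"
  shows "coherent_family D (ob P) (tob P) (unit P) (fob G) (fmul G) (funit G)"
proof -
  interpret G: pointed_monoidal_functor P D G by fact
  interpret P: strict_monoidal_category P by fact
  show ?thesis
  proof unfold_locales
    fix a b c assume abc [simp]: "a \<in> ob P" "b \<in> ob P" "c \<in> ob P"
    show "fmul G (a \<otimes>\<^bsub>P\<^esub> b) c \<cdot> fmul G a b \<otimes>\<^sub>a idn D (fob G c)
        = fmul G a (b \<otimes>\<^bsub>P\<^esub> c) \<cdot> idn D (fob G a) \<otimes>\<^sub>a fmul G b c \<cdot> asc D (fob G a) (fob G b) (fob G c)"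
      using G.fmul_assoc[of a b c] by (simp add: P.asc_idn)
  next
    fix a assume [simp]: "a \<in> ob P"
    show "fmul G (unit P) a \<cdot> funit G \<otimes>\<^sub>a idn D (fob G a) = lun D (fob G a)"
      "fmul G a (unit P) \<cdot> idn D (fob G a) \<otimes>\<^sub>a funit G = run D (fob G a)"
      using G.fmul_lun[of a] G.fmul_run[of a] by (simp_all add: P.lun_idn P.run_idn)
  qed (auto simp: iso_iff)
qed

section \<open>Extending a transformation along \<open>Omega\<close>\<close>

locale transformation_extension = strict_pointed C + D: strict_pointed D +
  G: pointed_monoidal_functor "adjoin_dual C" D G + G': pointed_monoidal_functor "adjoin_dual C" D G'
  for C :: "('o, 'm) pmoncat" (structure) and D :: "('p, 'n) pmoncat" and G G' +
  fixes \<sigma> :: "('o, 'm, 'p, 'n) pmonnat"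
  assumes sigma: "pmnat C D (comp_pmonfun G (Omega C)) (comp_pmonfun G' (Omega C)) \<sigma>"
begin

sublocale A: strict_monoidal_category "adjoin_dual C"
  by (rule adjoin_dual_strict)

sublocale BX: coherent_families D "words C" "wtensor C" "wunit C" "fob G" "fmul G" "funit G" "fob G'" "fmul G'" "funit G'"
proof -
  interpret c: coherent_family D "words C" "wtensor C" "wunit C" "fob G" "fmul G" "funit G"
    using coherent_family_pmfun[OF G.pointed_monoidal_functor_axioms A.strict_monoidal_category_axioms] by simp
  interpret c': coherent_family D "words C" "wtensor C" "wunit C" "fob G'" "fmul G'" "funit G'"
    using coherent_family_pmfun[OF G'.pointed_monoidal_functor_axioms A.strict_monoidal_category_axioms] by simp
  show "coherent_families D (words C) (wtensor C) (wunit C) (fob G) (fmul G) (funit G) (fob G') (fmul G') (funit G')"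
    by unfold_locales
qed

abbreviation "s \<equiv> ncmp \<sigma>"
abbreviation "bx U V x y \<equiv> box D (fmul G) (fmul G') U V U V x y"

lemma wunit_eq: "[unit C] = wunit C"
  by (simp add: wunit_def)

lemma s_simps [simp]:
  assumes "a \<in> ob C"
  shows "s a \<in> ar D" "src D (s a) = fob G [a]" "tgt D (s a) = fob G' [a]"
  using pointed_monoidal_transformation.ncmp_simps[OF sigma assms] assms by simp_all

lemma s_natural: "f \<in> ar C \<Longrightarrow> s (tgt C f) \<cdot>\<^bsub>D\<^esub> far G (pr (Bar f)) = far G' (pr (Bar f)) \<cdot>\<^bsub>D\<^esub> s (src C f)"
  using pointed_monoidal_transformation.ncmp_nat[OF sigma, of f] by simp

text \<open>Monoidality of \<sigma>, restated with boxes because these associate strictly.\<close>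

lemma s_tensor:
  assumes [simp]: "a \<in> ob C" "b \<in> ob C"
  shows "s (a \<otimes> b) = bx [a] [b] (s a) (s b)"
  using pointed_monoidal_transformation.ncmp_fmul[OF sigma assms]
  by (intro BX.box_eqI[symmetric]) (simp_all add: G.fcod G'.fcod)

text \<open>The component at the unit is thereby the neutral arrow for boxes.\<close>

lemma s_unit: "s (unit C) = funit G' \<cdot>\<^bsub>D\<^esub> inv_ar D (funit G)"
proof -
  have [simp]: "s (unit C) \<in> ar D" "src D (s (unit C)) = fob G (wunit C)" "tgt D (s (unit C)) = fob G' (wunit C)"
    using s_simps[of "unit C"] by (simp_all add: wunit_eq)
  have "s (unit C) \<cdot>\<^bsub>D\<^esub> funit G = funit G'"
    using pointed_monoidal_transformation.ncmp_funit[OF sigma] by (simp add: G.fcod G'.fcod)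
  from D.inv_eq_right[OF _ _ _ this] show ?thesis by simp
qed

lemma isos_s_pt: "isos D (s (pt C))"
proof -
  have "fpt G' \<cdot>\<^bsub>D\<^esub> s (pt C) = fpt G"
    using pointed_monoidal_transformation.ncmp_fpt[OF sigma] by (simp add: G.fcod G'.fcod)
  from D.inv_eq_left[OF _ _ _ this] have "s (pt C) = inv_ar D (fpt G') \<cdot>\<^bsub>D\<^esub> fpt G" by simp
  then show ?thesis by simp
qed

text \<open>The component at \<open>J\<^sup>\<or>\<close> is forced to be the mate of the inverse of \<open>s J\<close>; that inverse exists
  because \<open>\<sigma>\<close> is compatible with the isomorphisms \<open>fpt\<close>.\<close>

lemma ex_mate:
  "\<exists>k. k \<in> ar D \<and> src D k = fob G (jdual C) \<and> tgt D k = fob G' (jdual C) \<and>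
    far G' (pr Counit) \<cdot>\<^bsub>D\<^esub> bx [pt C] (jdual C) (s (pt C)) k = s (unit C) \<cdot>\<^bsub>D\<^esub> far G (pr Counit) \<and>
    bx (jdual C) [pt C] k (s (pt C)) \<cdot>\<^bsub>D\<^esub> far G (pr Unit) = far G' (pr Unit) \<cdot>\<^bsub>D\<^esub> s (unit C) \<and>
    (\<forall>k'. k' \<in> ar D \<longrightarrow> src D k' = fob G (jdual C) \<longrightarrow> tgt D k' = fob G' (jdual C) \<longrightarrow>
      far G' (pr Counit) \<cdot>\<^bsub>D\<^esub> bx [pt C] (jdual C) (s (pt C)) k' = s (unit C) \<cdot>\<^bsub>D\<^esub> far G (pr Counit) \<longrightarrow> k' = k)"
proof -
  let ?J = "[pt C]" and ?V = "jdual C" and ?j = "s (pt C)"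
  let ?e = "inv_ar D (funit G) \<cdot>\<^bsub>D\<^esub> far G (pr Counit) \<cdot>\<^bsub>D\<^esub> fmul G ?J ?V"
  let ?e' = "inv_ar D (funit G') \<cdot>\<^bsub>D\<^esub> far G' (pr Counit) \<cdot>\<^bsub>D\<^esub> fmul G' ?J ?V"
  let ?n = "inv_ar D (fmul G ?V ?J) \<cdot>\<^bsub>D\<^esub> far G (pr Unit) \<cdot>\<^bsub>D\<^esub> funit G"
  let ?n' = "inv_ar D (fmul G' ?V ?J) \<cdot>\<^bsub>D\<^esub> far G' (pr Unit) \<cdot>\<^bsub>D\<^esub> funit G'"
  have d: "is_right_dual D (fob G ?J) (fob G ?V) ?e ?n"
    by (rule right_dual_image[OF G.pointed_monoidal_functor_axioms D.strict_monoidal_category_axioms right_dual_jdual])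
  have d': "is_right_dual D (fob G' ?J) (fob G' ?V) ?e' ?n'"
    by (rule right_dual_image[OF G'.pointed_monoidal_functor_axioms D.strict_monoidal_category_axioms right_dual_jdual])
  have [simp]: "s (unit C) \<in> ar D" "src D (s (unit C)) = fob G (wunit C)" "tgt D (s (unit C)) = fob G' (wunit C)"
    using s_simps[of "unit C"] by (simp_all add: wunit_eq)
  \<comment> \<open>The condition on \<open>k\<close> is translated into the form of
    \<open>right_dual_mate\<close>, for the images \<open>?e\<close> and \<open>?e'\<close> of the
    counit under \<open>G\<close> and \<open>G'\<close>; the two forms differ by invertible
    constraints.\<close>
  have e_iff: "far G' (pr Counit) \<cdot>\<^bsub>D\<^esub> bx ?J ?V ?j k = s (unit C) \<cdot>\<^bsub>D\<^esub> far G (pr Counit) \<longleftrightarrow> ?e' \<cdot>\<^bsub>D\<^esub> (?j \<otimes>\<^sub>a\<^bsub>D\<^esub> k) = ?e" (is "?P = ?Q")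
    if [simp]: "k \<in> ar D" "src D k = fob G ?V" "tgt D k = fob G' ?V" for k
  proof -
    have a: "?e' \<cdot>\<^bsub>D\<^esub> (?j \<otimes>\<^sub>a\<^bsub>D\<^esub> k) = inv_ar D (funit G') \<cdot>\<^bsub>D\<^esub> (far G' (pr Counit) \<cdot>\<^bsub>D\<^esub> bx ?J ?V ?j k) \<cdot>\<^bsub>D\<^esub> fmul G ?J ?V"
      by simp
    have b: "?e = inv_ar D (funit G') \<cdot>\<^bsub>D\<^esub> (s (unit C) \<cdot>\<^bsub>D\<^esub> far G (pr Counit)) \<cdot>\<^bsub>D\<^esub> fmul G ?J ?V"
      by (simp add: s_unit)
    show ?thesis
    proof
      assume ?P then show ?Q unfolding a b by simp
    next
      assume ?Q
      then have "(far G' (pr Counit) \<cdot>\<^bsub>D\<^esub> bx ?J ?V ?j k) \<cdot>\<^bsub>D\<^esub> fmul G ?J ?V = (s (unit C) \<cdot>\<^bsub>D\<^esub> far G (pr Counit)) \<cdot>\<^bsub>D\<^esub> fmul G ?J ?V"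
        unfolding a b by (rule D.iso_cancel_left[rotated -1]) simp_all
      then show ?P by (rule D.iso_cancel_right[rotated -1]) simp_all
    qed
  qed
  obtain k where k [simp]: "k \<in> ar D" "src D k = fob G ?V" "tgt D k = fob G' ?V"
    and ek: "?e' \<cdot>\<^bsub>D\<^esub> (?j \<otimes>\<^sub>a\<^bsub>D\<^esub> k) = ?e" and nk: "(k \<otimes>\<^sub>a\<^bsub>D\<^esub> ?j) \<cdot>\<^bsub>D\<^esub> ?n = ?n'"
    and un: "\<And>k'. k' \<in> ar D \<Longrightarrow> src D k' = fob G ?V \<Longrightarrow> tgt D k' = fob G' ?V \<Longrightarrow> ?e' \<cdot>\<^bsub>D\<^esub> (?j \<otimes>\<^sub>a\<^bsub>D\<^esub> k') = ?e \<Longrightarrow> k' = k"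
    by (rule D.right_dual_mate[OF d d' isos_s_pt s_simps(2,3)[OF pt_ob]]) (rule that)
  have "bx ?V ?J k ?j \<cdot>\<^bsub>D\<^esub> far G (pr Unit) = fmul G' ?V ?J \<cdot>\<^bsub>D\<^esub> ((k \<otimes>\<^sub>a\<^bsub>D\<^esub> ?j) \<cdot>\<^bsub>D\<^esub> ?n) \<cdot>\<^bsub>D\<^esub> inv_ar D (funit G)"
    by (simp add: box_def)
  also have "\<dots> = far G' (pr Unit) \<cdot>\<^bsub>D\<^esub> s (unit C)" unfolding nk by (simp add: s_unit)
  finally have nk': "bx ?V ?J k ?j \<cdot>\<^bsub>D\<^esub> far G (pr Unit) = far G' (pr Unit) \<cdot>\<^bsub>D\<^esub> s (unit C)" .
  show ?thesis
  proof (intro exI[of _ k] conjI allI impI)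
    show "far G' (pr Counit) \<cdot>\<^bsub>D\<^esub> bx [pt C] (jdual C) (s (pt C)) k = s (unit C) \<cdot>\<^bsub>D\<^esub> far G (pr Counit)"
      by (rule iffD2[OF e_iff[OF k] ek])
    fix k' assume k': "k' \<in> ar D" "src D k' = fob G (jdual C)" "tgt D k' = fob G' (jdual C)"
      "far G' (pr Counit) \<cdot>\<^bsub>D\<^esub> bx [pt C] (jdual C) (s (pt C)) k' = s (unit C) \<cdot>\<^bsub>D\<^esub> far G (pr Counit)"
    show "k' = k" by (rule un[OF k'(1-3) iffD1[OF e_iff[OF k'(1-3)] k'(4)]])
  qed (rule k nk')+
qed

definition k where
  "k = (SOME k. k \<in> ar D \<and> src D k = fob G (jdual C) \<and> tgt D k = fob G' (jdual C) \<and>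
    far G' (pr Counit) \<cdot>\<^bsub>D\<^esub> bx [pt C] (jdual C) (s (pt C)) k = s (unit C) \<cdot>\<^bsub>D\<^esub> far G (pr Counit) \<and>
    bx (jdual C) [pt C] k (s (pt C)) \<cdot>\<^bsub>D\<^esub> far G (pr Unit) = far G' (pr Unit) \<cdot>\<^bsub>D\<^esub> s (unit C) \<and>
    (\<forall>k'. k' \<in> ar D \<longrightarrow> src D k' = fob G (jdual C) \<longrightarrow> tgt D k' = fob G' (jdual C) \<longrightarrow>
      far G' (pr Counit) \<cdot>\<^bsub>D\<^esub> bx [pt C] (jdual C) (s (pt C)) k' = s (unit C) \<cdot>\<^bsub>D\<^esub> far G (pr Counit) \<longrightarrow> k' = k))"

lemma k_simps [simp]: "k \<in> ar D" "src D k = fob G (jdual C)" "tgt D k = fob G' (jdual C)"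
  and k_counit: "far G' (pr Counit) \<cdot>\<^bsub>D\<^esub> bx [pt C] (jdual C) (s (pt C)) k = s (unit C) \<cdot>\<^bsub>D\<^esub> far G (pr Counit)"
  and k_unit: "bx (jdual C) [pt C] k (s (pt C)) \<cdot>\<^bsub>D\<^esub> far G (pr Unit) = far G' (pr Unit) \<cdot>\<^bsub>D\<^esub> s (unit C)"
  and k_unique: "\<And>k'. k' \<in> ar D \<Longrightarrow> src D k' = fob G (jdual C) \<Longrightarrow> tgt D k' = fob G' (jdual C) \<Longrightarrow>
      far G' (pr Counit) \<cdot>\<^bsub>D\<^esub> bx [pt C] (jdual C) (s (pt C)) k' = s (unit C) \<cdot>\<^bsub>D\<^esub> far G (pr Counit) \<Longrightarrow> k' = k"
  using someI_ex[OF ex_mate, folded k_def] by blast+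

text \<open>The iterated box of \<open>s a\<^sub>0, k, s a\<^sub>1, ...\<close>, following the
  factorization of a word into its letters and copies of \<open>jdual C\<close>; strict
  associativity of boxes makes the bracketing immaterial. The value at \<open>[]\<close>, which is
  not a word, is a default.\<close>

primrec t :: "'o list \<Rightarrow> 'n" where
  "t [] = s (unit C)"
| "t (a # U) = (if U = [] then s a else bx [a] (jdual C \<otimes>\<^sub>w U) (s a) (bx (jdual C) U k (t U)))"

lemma Cons_eq_wtensor: "a \<in> ob C \<Longrightarrow> b # U \<in> words C \<Longrightarrow> [a] \<otimes>\<^sub>w jdual C \<otimes>\<^sub>w (b # U) = a # b # U"
  by (simp add: jdual_def words_iff)

lemma t_simps [simp]:
  assumes "U \<in> words C"
  shows "t U \<in> ar D" "src D (t U) = fob G U" "tgt D (t U) = fob G' U"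
proof -
  from assms have "t U \<in> ar D \<and> src D (t U) = fob G U \<and> tgt D (t U) = fob G' U"
  proof (induction U rule: words_induct)
    case (Cons a b U)
    then show ?case using Cons_eq_wtensor[of a b U] by simp
  qed simp
  then show "t U \<in> ar D" "src D (t U) = fob G U" "tgt D (t U) = fob G' U" by auto
qed

lemma t_Cons: "t (a # b # U) = bx [a] (jdual C \<otimes>\<^sub>w (b # U)) (s a) (bx (jdual C) (b # U) k (t (b # U)))"
  by simp

text \<open>Where the words are joined, two letters are multiplied and \<open>s_tensor\<close>
  applies; everything else is reassociation of boxes.\<close>

lemma t_wtensor:
  assumes "U \<in> words C" and V [simp]: "V \<in> words C"
  shows "t (U \<otimes>\<^sub>w V) = bx U V (t U) (t V)"
  using assms(1)
proof (induction U rule: words_induct)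
  case (single a)
  note [simp] = \<open>a \<in> ob C\<close>
  from V show ?case
  proof (cases V rule: words_cases)
    case (1 b V')
    show ?thesis
    proof (cases "V' = []")
      case True
      then show ?thesis using 1 by (simp add: s_tensor)
    next
      case False
      with 1 obtain c V'' where V': "V' = c # V''" "V' \<in> words C" by (cases V') auto
      note [simp] = \<open>b \<in> ob C\<close> \<open>V' \<in> words C\<close>
      have [simp]: "c # V'' \<in> words C" using V' by simp
      have e: "[b] \<otimes>\<^sub>w jdual C \<otimes>\<^sub>w V' = b # V'" using V' Cons_eq_wtensor[of b c V''] by simp
      have "t ([a] \<otimes>\<^sub>w V) = bx ([a] \<otimes>\<^sub>w [b]) (jdual C \<otimes>\<^sub>w V') (bx [a] [b] (s a) (s b)) (bx (jdual C) V' k (t V'))"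
        using 1 V'(1) by (simp add: s_tensor del: t.simps add: t_Cons)
      also have "\<dots> = bx [a] ([b] \<otimes>\<^sub>w jdual C \<otimes>\<^sub>w V') (s a) (bx [b] (jdual C \<otimes>\<^sub>w V') (s b) (bx (jdual C) V' k (t V')))"
        by (rule BX.box_assoc) simp_all
      also have "\<dots> = bx [a] V (t [a]) (t V)"
        unfolding e using 1 V'(1) by (simp del: wtensor_single)
      finally show ?thesis .
    qed
  qed
next
  case (Cons a b U)
  note [simp] = Cons.hyps
  have w: "(b # U) \<otimes>\<^sub>w V \<in> words C" by simp
  obtain d Z where Z: "(b # U) \<otimes>\<^sub>w V = d # Z" "d # Z \<in> words C" by (metis w words_cases)
  have "t ((a # b # U) \<otimes>\<^sub>w V) = bx [a] (jdual C \<otimes>\<^sub>w (b # U) \<otimes>\<^sub>w V) (s a) (bx (jdual C) ((b # U) \<otimes>\<^sub>w V) k (t ((b # U) \<otimes>\<^sub>w V)))"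
    unfolding wtensor_Cons Z t_Cons ..
  also have "\<dots> = bx [a] (jdual C \<otimes>\<^sub>w (b # U) \<otimes>\<^sub>w V) (s a) (bx (jdual C \<otimes>\<^sub>w (b # U)) V (bx (jdual C) (b # U) k (t (b # U))) (t V))"
    unfolding Cons.IH by (subst BX.box_assoc) (simp_all del: t.simps)
  also have "\<dots> = bx ([a] \<otimes>\<^sub>w jdual C \<otimes>\<^sub>w (b # U)) V (bx [a] (jdual C \<otimes>\<^sub>w (b # U)) (s a) (bx (jdual C) (b # U) k (t (b # U)))) (t V)"
    using BX.box_assoc[of "[a]" "jdual C \<otimes>\<^sub>w (b # U)" V "[a]" "jdual C \<otimes>\<^sub>w (b # U)" V "s a" "bx (jdual C) (b # U) k (t (b # U))" "t V"]
    by (simp del: t.simps)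
  also have "\<dots> = bx (a # b # U) V (t (a # b # U)) (t V)"
    unfolding t_Cons using Cons_eq_wtensor[of a b U] by simp
  finally show ?case .
qed

lemma t_wunit: "t (wunit C) = s (unit C)"
  by (simp add: wunit_def)

text \<open>The letters of \<open>jdual C\<close> are units, whose components are neutral for boxes,
  so only the middle factor \<open>k\<close> remains.\<close>

lemma t_jdual: "t (jdual C) = k"
proof -
  have "t (jdual C) = bx (wunit C) (jdual C) (funit G' \<cdot>\<^bsub>D\<^esub> inv_ar D (funit G)) (bx (jdual C) (wunit C) k (funit G' \<cdot>\<^bsub>D\<^esub> inv_ar D (funit G)))"
    using t_Cons[of "unit C" "unit C" "[]", folded jdual_def, unfolded wunit_eq] by (simp add: t_wunit s_unit)
  also have "\<dots> = k" by (simp add: BX.box_unit_right BX.box_unit_left)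
  finally show ?thesis .
qed

text \<open>After composition with the invertible multiplication, naturality of
  \<open>fmul G\<close> and \<open>fmul G'\<close> reduces the claim to the tensor product of the
  two given squares.\<close>

lemma bx_natural:
  assumes [simp]: "f \<in> ar A" "g \<in> ar A"
    and [simp]: "x \<in> ar D" "src D x = fob G (src A f)" "tgt D x = fob G' (src A f)"
      "x' \<in> ar D" "src D x' = fob G (tgt A f)" "tgt D x' = fob G' (tgt A f)"
      "y \<in> ar D" "src D y = fob G (src A g)" "tgt D y = fob G' (src A g)"
      "y' \<in> ar D" "src D y' = fob G (tgt A g)" "tgt D y' = fob G' (tgt A g)"
    and f: "x' \<cdot>\<^bsub>D\<^esub> far G f = far G' f \<cdot>\<^bsub>D\<^esub> x" and g: "y' \<cdot>\<^bsub>D\<^esub> far G g = far G' g \<cdot>\<^bsub>D\<^esub> y"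
  shows "bx (tgt A f) (tgt A g) x' y' \<cdot>\<^bsub>D\<^esub> far G (f \<otimes>\<^sub>a\<^bsub>A\<^esub> g) = far G' (f \<otimes>\<^sub>a\<^bsub>A\<^esub> g) \<cdot>\<^bsub>D\<^esub> bx (src A f) (src A g) x y"
proof -
  have [simp]: "src A f \<in> words C" "tgt A f \<in> words C" "src A g \<in> words C" "tgt A g \<in> words C"
    using G.C.src_ob[of f] G.C.tgt_ob[of f] G.C.src_ob[of g] G.C.tgt_ob[of g] by simp_all
  have "(bx (tgt A f) (tgt A g) x' y' \<cdot>\<^bsub>D\<^esub> far G (f \<otimes>\<^sub>a\<^bsub>A\<^esub> g)) \<cdot>\<^bsub>D\<^esub> fmul G (src A f) (src A g)
      = bx (tgt A f) (tgt A g) x' y' \<cdot>\<^bsub>D\<^esub> (fmul G (tgt A f) (tgt A g) \<cdot>\<^bsub>D\<^esub> (far G f \<otimes>\<^sub>a\<^bsub>D\<^esub> far G g))"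
    by (simp add: G.fmul_nat)
  also have "\<dots> = (bx (tgt A f) (tgt A g) x' y' \<cdot>\<^bsub>D\<^esub> fmul G (tgt A f) (tgt A g)) \<cdot>\<^bsub>D\<^esub> (far G f \<otimes>\<^sub>a\<^bsub>D\<^esub> far G g)"
    by (simp del: BX.box_simps(4))
  also have "\<dots> = fmul G' (tgt A f) (tgt A g) \<cdot>\<^bsub>D\<^esub> ((far G' f \<cdot>\<^bsub>D\<^esub> x) \<otimes>\<^sub>a\<^bsub>D\<^esub> (far G' g \<cdot>\<^bsub>D\<^esub> y))"
    by (simp add: D.tar_merge f g)
  also have "\<dots> = (far G' (f \<otimes>\<^sub>a\<^bsub>A\<^esub> g) \<cdot>\<^bsub>D\<^esub> fmul G' (src A f) (src A g)) \<cdot>\<^bsub>D\<^esub> (x \<otimes>\<^sub>a\<^bsub>D\<^esub> y)"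
    unfolding G'.fmul_nat[OF assms(1,2), symmetric] by (simp add: D.tar_merge)
  also have "\<dots> = (far G' (f \<otimes>\<^sub>a\<^bsub>A\<^esub> g) \<cdot>\<^bsub>D\<^esub> bx (src A f) (src A g) x y) \<cdot>\<^bsub>D\<^esub> fmul G (src A f) (src A g)"
    by simp
  finally show ?thesis by (rule D.iso_cancel_right[rotated -1]) simp_all
qed

definition natural where
  "natural f \<longleftrightarrow> t (tgt A f) \<cdot>\<^bsub>D\<^esub> far G f = far G' f \<cdot>\<^bsub>D\<^esub> t (src A f)"

lemma natural_idn: "U \<in> words C \<Longrightarrow> natural (idn A U)"
  by (simp add: natural_def)

lemma natural_tensor: "natural f \<Longrightarrow> natural g \<Longrightarrow> f \<in> ar A \<Longrightarrow> g \<in> ar A \<Longrightarrow> natural (f \<otimes>\<^sub>a\<^bsub>A\<^esub> g)"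
  using G.C.src_ob[of f] G.C.tgt_ob[of f] G.C.src_ob[of g] G.C.tgt_ob[of g]
  unfolding natural_def by (simp add: t_wtensor bx_natural)

lemma natural_cmp:
  assumes "natural f" "natural g" and [simp]: "f \<in> ar A" "g \<in> ar A" "src A g = tgt A f"
  shows "natural (g \<cdot>\<^bsub>A\<^esub> f)"
proof -
  have [simp]: "src A f \<in> words C" "tgt A f \<in> words C" "tgt A g \<in> words C"
    using G.C.src_ob[of f] G.C.tgt_ob[of f] G.C.tgt_ob[of g] by simp_all
  have "t (tgt A g) \<cdot>\<^bsub>D\<^esub> far G g \<cdot>\<^bsub>D\<^esub> far G f = far G' g \<cdot>\<^bsub>D\<^esub> t (tgt A f) \<cdot>\<^bsub>D\<^esub> far G f"
    using D.reassoc[of "t (tgt A g)" "far G g" _ "far G f"] assms(2) unfolding natural_def by simp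
  then show ?thesis using assms(1) unfolding natural_def by simp
qed

text \<open>At the counit and the unit the squares are the defining equations of \<open>k\<close>;
  at \<open>Bar f\<close> they are naturality of \<sigma>.\<close>

lemma natural_prim: "\<forall>f. p = Bar f \<longrightarrow> f \<in> ar C \<Longrightarrow> natural (pr p)"
proof (cases p)
  case Counit
  have "t ([pt C] \<otimes>\<^sub>w jdual C) = bx [pt C] (jdual C) (s (pt C)) k"
    using t_wtensor[of "[pt C]" "jdual C"] by (simp add: t_jdual)
  then show ?thesis unfolding natural_def using Counit by (simp add: k_counit t_wunit)
next
  case Unit
  have "t (jdual C \<otimes>\<^sub>w [pt C]) = bx (jdual C) [pt C] k (s (pt C))"
    using t_wtensor[of "jdual C" "[pt C]"] by (simp add: t_jdual)
  then show ?thesis unfolding natural_def using Unit by (simp add: k_unit t_wunit)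
next
  case (Bar f)
  assume "\<forall>f. p = Bar f \<longrightarrow> f \<in> ar C"
  then show ?thesis unfolding natural_def using Bar by (simp add: s_natural)
qed

text \<open>By \<open>cl_edge\<close> the arrows are generated by the primitive ones, and naturality
  is stable under tensor products and composition.\<close>

lemma natural: 
  assumes "f \<in> ar A" shows "natural f"
proof -
  obtain p where p: "p \<in> paths C" "f = cl p" using assms by (rule adjoin_dual_arE)
  have "natural (cl p)" using p(1)
  proof (induction p rule: path_induct)
    case (empty U)
    then show ?case using natural_idn[of U] by (simp add: adjoin_dual_simps(5))
  next
    case (edge x p)
    obtain U q V where x: "x = (U, q, V)" by (cases x)
    with edge have [simp]: "U \<in> words C" "V \<in> words C" "\<forall>f. q = Bar f \<longrightarrow> f \<in> ar C" by auto
    have "natural (cl (edge_path C x))"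
      unfolding x by (subst cl_edge) (auto intro!: natural_tensor natural_prim natural_idn)
    then have "natural (cl p \<cdot>\<^bsub>A\<^esub> cl (edge_path C x))" using edge by (intro natural_cmp) simp_all
    then show ?case using edge by simp
  qed
  then show ?thesis using p by simp
qed

definition \<tau> where "\<tau> = \<lparr>ndom = G, ncod = G', ncmp = (\<lambda>U\<in>words C. t U)\<rparr>"

lemma tau_pmnat: "pmnat A D G G' \<tau>"
proof unfold_locales
  fix f a b assume "f \<in> hom A a b"
  then have f: "f \<in> ar A" "src A f = a" "tgt A f = b" "a \<in> words C" "b \<in> words C"
    using G.C.src_ob[of f] G.C.tgt_ob[of f] by (auto simp: hom_iff)
  then show "ncmp \<tau> b \<cdot>\<^bsub>D\<^esub> far G f = far G' f \<cdot>\<^bsub>D\<^esub> ncmp \<tau> a"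
    using natural[OF f(1)] by (simp add: natural_def \<tau>_def)
next
  show "ncmp \<tau> (unit A) \<cdot>\<^bsub>D\<^esub> funit G = funit G'" by (simp add: \<tau>_def t_wunit s_unit)
  show "fpt G' \<cdot>\<^bsub>D\<^esub> ncmp \<tau> (pt A) = fpt G"
    using pointed_monoidal_transformation.ncmp_fpt[OF sigma] by (simp add: G.fcod G'.fcod \<tau>_def)
qed (simp_all add: \<tau>_def hom_iff t_wtensor)

lemma tau_Omega: "hcomp_pmonnat \<tau> (idn pmoncat_vert (Omega C)) = \<sigma>"
  by (rule pmonnat_eqI[OF hcomp_pmnat[OF id_pmnat[OF Omega_pmfun] tau_pmnat] sigma]) (simp add: \<tau>_def G.fcod)

text \<open>A transformation is multiplicative for boxes, so its values at single letters and at
  \<open>jdual C\<close> determine it. The former are given by \<sigma>; the latter is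
  \<open>k\<close>, by naturality at the counit and \<open>k_unique\<close>.\<close>

lemma tau_unique:
  assumes \<rho>: "pmnat A D G G' \<rho>" and eq: "hcomp_pmonnat \<rho> (idn pmoncat_vert (Omega C)) = \<sigma>"
  shows "\<rho> = \<tau>"
proof -
  interpret \<rho>: pointed_monoidal_transformation A D G G' \<rho> by fact
  have [simp]: "ncmp \<rho> U \<in> ar D" "src D (ncmp \<rho> U) = fob G U" "tgt D (ncmp \<rho> U) = fob G' U" if "U \<in> words C" for U
    using \<rho>.ncmp_simps[of U] that by simp_all
  have s: "ncmp \<rho> [a] = s a" if "a \<in> ob C" for a
    using that by (simp add: eq[symmetric] \<rho>.ndom G.fcod)
  have wt: "ncmp \<rho> (U \<otimes>\<^sub>w V) = bx U V (ncmp \<rho> U) (ncmp \<rho> V)" if "U \<in> words C" "V \<in> words C" for U V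
    using \<rho>.ncmp_fmul[of U V] that by (intro BX.box_eqI[symmetric]) simp_all
  have k: "ncmp \<rho> (jdual C) = k"
  proof (rule k_unique)
    have "far G' (pr Counit) \<cdot>\<^bsub>D\<^esub> ncmp \<rho> ([pt C] \<otimes>\<^sub>w jdual C) = ncmp \<rho> (wunit C) \<cdot>\<^bsub>D\<^esub> far G (pr Counit)"
      using \<rho>.ncmp_nat[of "pr Counit"] by simp
    moreover have "ncmp \<rho> (wunit C) = s (unit C)" using s[of "unit C"] by (simp add: wunit_eq)
    ultimately show "far G' (pr Counit) \<cdot>\<^bsub>D\<^esub> bx [pt C] (jdual C) (s (pt C)) (ncmp \<rho> (jdual C)) = s (unit C) \<cdot>\<^bsub>D\<^esub> far G (pr Counit)"
      using wt[of "[pt C]" "jdual C"] by (simp add: s)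
  qed simp_all
  have "ncmp \<rho> U = t U" if "U \<in> words C" for U
    using that
  proof (induction U rule: words_induct)
    case (Cons a b U)
    have "ncmp \<rho> ([a] \<otimes>\<^sub>w jdual C \<otimes>\<^sub>w (b # U)) = t (a # b # U)"
      using Cons s[of a] k by (simp only: wt wtensor_words jdual_words single_words t_Cons)
    then show ?case using Cons Cons_eq_wtensor[of a b U] by simp
  qed (simp add: s)
  then show ?thesis by (intro pmonnat_eqI[OF \<rho> tau_pmnat]) (simp add: \<tau>_def)
qed

end

section \<open>Freeness of \<open>Omega\<close> in the 2-category \<open>JJ\<close>\<close>

interpretation JJ: two_category "JJ :: ('u pmc, 'u pmf, 'u pmn) twocat"
  by (rule two_category_JJ)

lemma strict_pointedI: "pmcat C \<Longrightarrow> strict_monoidal_category C \<Longrightarrow> strict_pointed C"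
  by (simp add: strict_pointed_def)

lemma pmfun_iff: "pmfun C D F \<longleftrightarrow> F \<in> JJ.obj \<and> src0 JJ F = C \<and> tgt0 JJ F = D"
  using pmfun_self[of C D F] pmfunD[of C D F] by auto

lemma pmnat_iff:
  "pmfun C D F \<Longrightarrow> pmnat C D F G \<sigma> \<longleftrightarrow> \<sigma> \<in> JJ.arr \<and> JJ.dom2 \<sigma> = F \<and> JJ.cod2 \<sigma> = G"
  using pmfunD[of C D F] pmnat_ar[of C D F G \<sigma>] by (simp del: pmoncat_vert_simps(4))

lemma renaming_adjoin_dual:
  assumes "strict_pointed (C :: 'u::infinite pmc)"
  shows "renaming (adjoin_dual C) (injection (ob (adjoin_dual C)) :: _ \<Rightarrow> 'u) (injection (ar (adjoin_dual C)) :: _ \<Rightarrow> 'u)"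
proof -
  interpret strict_pointed C by fact
  interpret A: strict_pointed "adjoin_dual C" by (rule adjoin_dual_pointed)
  show ?thesis using inj_on_injection_ob[of C] inj_on_injection_ar[of C] by unfold_locales
qed

lemma adjoin_dual_u:
  assumes "strict_pointed (C :: 'u::infinite pmc)"
  shows "pmcat (adjoin_dual_u C)" "strict_monoidal_category (adjoin_dual_u C)"
    "has_right_dual (adjoin_dual_u C) (pt (adjoin_dual_u C))" "pmfun C (adjoin_dual_u C) (Omega_u C)"
proof -
  interpret strict_pointed C by fact
  interpret R: renaming "adjoin_dual C" "injection (ob (adjoin_dual C)) :: _ \<Rightarrow> 'u" "injection (ar (adjoin_dual C)) :: _ \<Rightarrow> 'u"
    by (rule renaming_adjoin_dual) fact
  show "pmcat (adjoin_dual_u C)" unfolding adjoin_dual_u_def by (rule R.rename_pmcat)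
  show s: "strict_monoidal_category (adjoin_dual_u C)"
    unfolding adjoin_dual_u_def by (rule R.rename_strict[OF adjoin_dual_strict])
  \<comment> \<open>The distinguished object is the image of \<open>[pt C]\<close> under the
    renaming functor, which preserves the dual pair.\<close>
  have "pt (adjoin_dual_u C) = fob R.R (pt (adjoin_dual C))"
    unfolding adjoin_dual_u_def R.rename_simps(10) by (rule R.R_simps(3)[OF R.C.pt_ob, symmetric])
  then have "pt (adjoin_dual_u C) = fob R.R [pt C]" by (simp only: adjoin_dual_simps(13))
  then show "has_right_dual (adjoin_dual_u C) (pt (adjoin_dual_u C))"
    using right_dual_image[OF R.R_pmfun[folded adjoin_dual_u_def] s right_dual_jdual]
    unfolding has_right_dual_def by metis
  show "pmfun C (adjoin_dual_u C) (Omega_u C)"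
    unfolding adjoin_dual_u_def Omega_u_def R.rename_cod_eq[OF Omega_pmfun]
    by (rule comp_pmfun[OF Omega_pmfun R.R_pmfun])
qed

text \<open>\<open>adjoin_dual C\<close> lies over another type and is not a 0-cell of this
  \<open>JJ\<close>. Extensions are therefore found out of it and transferred along the renaming
  \<open>R.R\<close>; since \<open>R.R'\<close> is its inverse on the nose, 1-cells and 2-cells
  correspond exactly.\<close>

lemma free_for_Omega_u_strict:
  assumes C: "strict_pointed (C :: 'u::infinite pmc)" and D: "strict_pointed (D :: 'u pmc)"
    and dual: "has_right_dual D (pt D)"
  shows "free_for JJ C (adjoin_dual_u C) (Omega_u C) D"
proof -
  interpret C: strict_pointed C by fact
  interpret D: strict_pointed D by fact
  interpret R: renaming "adjoin_dual C" "injection (ob (adjoin_dual C)) :: _ \<Rightarrow> 'u" "injection (ar (adjoin_dual C)) :: _ \<Rightarrow> 'u"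
    by (rule renaming_adjoin_dual) fact
  let ?A = "adjoin_dual C" and ?P = "adjoin_dual_u C" and ?O = "Omega C"
  note O = C.Omega_pmfun and R = R.R_pmfun[folded adjoin_dual_u_def] and R' = R.R'_pmfun[folded adjoin_dual_u_def]
  note R'_R = R.R'_R and R_R' = R.R_R'[folded adjoin_dual_u_def]
  have Ou: "Omega_u C = comp_pmonfun R.R ?O" unfolding Omega_u_def by (rule R.rename_cod_eq[OF O])
  have RO: "pmfun C ?P (comp_pmonfun R.R ?O)" by (rule comp_pmfun[OF O R])
  let ?w = "\<lambda>F. idn pmoncat_vert F"
  show ?thesis
  proof (rule JJ.free_forI)
    show "Omega_u C \<in> JJ.obj" "src0 JJ (Omega_u C) = C" "tgt0 JJ (Omega_u C) = ?P"
      using adjoin_dual_u(4)[OF C] unfolding pmfun_iff by blast+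
  next
    fix f assume "f \<in> JJ.obj" "src0 JJ f = C" "tgt0 JJ f = D"
    then have f: "pmfun C D f" unfolding pmfun_iff by blast
    then interpret f: pointed_monoidal_functor C D f .
    obtain y e n where "is_right_dual D (pt D) y e n" using dual unfolding has_right_dual_def by blast
    \<comment> \<open>The dual of \<open>pt D\<close> becomes a dual of \<open>fob f (pt C)\<close>
      along the isomorphism \<open>fpt f\<close>.\<close>
    then have "is_right_dual D (fob f (pt C)) y (e \<cdot>\<^bsub>D\<^esub> (fpt f \<otimes>\<^sub>a\<^bsub>D\<^esub> idn D y)) ((inv_ar D (idn D y) \<otimes>\<^sub>a\<^bsub>D\<^esub> inv_ar D (fpt f)) \<cdot>\<^bsub>D\<^esub> n)"
      using D.right_dual_iso[of "pt D" y e n "fpt f" "idn D y"] by (simp add: is_right_dual_def)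
    then interpret extension C D f y "e \<cdot>\<^bsub>D\<^esub> (fpt f \<otimes>\<^sub>a\<^bsub>D\<^esub> idn D y)" "(inv_ar D (idn D y) \<otimes>\<^sub>a\<^bsub>D\<^esub> inv_ar D (fpt f)) \<cdot>\<^bsub>D\<^esub> n"
      by unfold_locales
    obtain G where G: "pmfun ?A D G" "comp_pmonfun G ?O = f" using ex_extension by blast
    let ?g = "comp_pmonfun G R.R'"
    have g: "pmfun ?P D ?g" by (rule comp_pmfun[OF R' G(1)])
    have "comp_pmonfun ?g (Omega_u C) = comp_pmonfun G (comp_pmonfun (comp_pmonfun R.R' R.R) ?O)"
      unfolding Ou by (simp only: comp_pmonfun_assoc[OF RO R' G(1)] comp_pmonfun_assoc[OF O R R'])
    also have "\<dots> = f" by (simp only: R'_R comp_pmonfun_id_left[OF O] G)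
    finally have "comp_pmonfun ?g (Omega_u C) = f" .
    moreover have f': "f \<in> JJ.obj" using f unfolding pmfun_iff by blast
    \<comment> \<open>The factorization is an equality, so an identity 2-cell serves as the
      invertible one.\<close>
    ultimately have "JJ.cod2 (one2 JJ f) = ?g \<bullet>\<^bsub>JJ\<^esub> Omega_u C"
      by (simp only: JJ.V.idn_simps JJ_simps(6))
    moreover have "one2 JJ f \<in> JJ.arr" "JJ.isos2 (one2 JJ f)" "JJ.dom2 (one2 JJ f) = f"
      using f' by (simp_all only: JJ.V.idn_simps JJ.V.isos_idn)
    moreover have "?g \<in> JJ.obj" "src0 JJ ?g = ?P" "tgt0 JJ ?g = D" using g unfolding pmfun_iff by blast+
    ultimately show "\<exists>g \<sigma>. g \<in> JJ.obj \<and> src0 JJ g = ?P \<and> tgt0 JJ g = D \<and> \<sigma> \<in> JJ.arr \<and> JJ.isos2 \<sigma> \<and>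
        JJ.dom2 \<sigma> = f \<and> JJ.cod2 \<sigma> = g \<bullet>\<^bsub>JJ\<^esub> Omega_u C"
      by blast
  next
    fix g g' \<sigma> assume "g \<in> JJ.obj" "src0 JJ g = ?P" "tgt0 JJ g = D" "g' \<in> JJ.obj" "src0 JJ g' = ?P" "tgt0 JJ g' = D"
      and \<sigma>: "\<sigma> \<in> JJ.arr" "JJ.dom2 \<sigma> = g \<bullet>\<^bsub>JJ\<^esub> Omega_u C" "JJ.cod2 \<sigma> = g' \<bullet>\<^bsub>JJ\<^esub> Omega_u C"
    then have g: "pmfun ?P D g" "pmfun ?P D g'" unfolding pmfun_iff by blast+
    let ?G = "comp_pmonfun g R.R" and ?G' = "comp_pmonfun g' R.R"
    have G: "pmfun ?A D ?G" "pmfun ?A D ?G'" by (rule comp_pmfun[OF R g(1)] comp_pmfun[OF R g(2)])+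
    have e: "comp_pmonfun ?G ?O = comp_pmonfun g (Omega_u C)" "comp_pmonfun ?G' ?O = comp_pmonfun g' (Omega_u C)"
      unfolding Ou by (simp_all only: comp_pmonfun_assoc[OF O R g(1)] comp_pmonfun_assoc[OF O R g(2)])
    have "pmnat C D (comp_pmonfun ?G ?O) (comp_pmonfun ?G' ?O) \<sigma>"
      using \<sigma> unfolding e pmnat_iff[OF comp_pmfun[OF adjoin_dual_u(4)[OF C] g(1)]] JJ_simps(6) by blast
    then interpret TE: transformation_extension C D ?G ?G' \<sigma>
      using G by (intro transformation_extension.intro transformation_extension_axioms.intro C D)
    let ?\<tau> = "hcomp_pmonnat TE.\<tau> (?w R.R')"
    have t: "pmnat ?A D ?G ?G' TE.\<tau>" by (rule TE.tau_pmnat)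
    have c: "comp_pmonfun (comp_pmonfun k R.R) R.R' = k" if "pmfun ?P D k" for k
      by (simp only: comp_pmonfun_assoc[OF R' R that] R_R' comp_pmonfun_id_right[OF that])
    have "pmnat ?P D g g' ?\<tau>"
      using hcomp_pmnat[OF id_pmnat[OF R'] t] by (simp only: c[OF g(1)] c[OF g(2)])
    then have "?\<tau> \<in> JJ.arr \<and> JJ.dom2 ?\<tau> = g \<and> JJ.cod2 ?\<tau> = g'" unfolding pmnat_iff[OF g(1)] .
    moreover have "hcomp_pmonnat ?\<tau> (?w (Omega_u C)) = \<sigma>"
    proof -
      have "hcomp_pmonnat ?\<tau> (?w (Omega_u C)) = hcomp_pmonnat TE.\<tau> (hcomp_pmonnat (?w R.R') (hcomp_pmonnat (?w R.R) (?w ?O)))"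
        unfolding Ou hcomp_idn[OF O R, symmetric]
        by (rule hcomp_assoc[OF hcomp_pmnat[OF id_pmnat[OF O] id_pmnat[OF R]] id_pmnat[OF R'] t])
      also have "\<dots> = hcomp_pmonnat TE.\<tau> (?w ?O)"
        by (simp only: hcomp_assoc[OF id_pmnat[OF O] id_pmnat[OF R] id_pmnat[OF R'], symmetric]
            hcomp_idn[OF R R'] R'_R hcomp_idn_left(1)[OF id_pmnat[OF O]])
      finally show ?thesis by (simp only: TE.tau_Omega)
    qed
    ultimately show "\<exists>\<tau>. \<tau> \<in> JJ.arr \<and> JJ.dom2 \<tau> = g \<and> JJ.cod2 \<tau> = g' \<and> \<tau> \<lhd>\<^bsub>JJ\<^esub> Omega_u C = \<sigma>"
      unfolding whisker_right_def JJ_simps(2,7) by blast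
  next
    fix \<tau> \<tau>' assume a: "\<tau> \<in> JJ.arr" "\<tau>' \<in> JJ.arr" "JJ.dom2 \<tau> = JJ.dom2 \<tau>'" "JJ.cod2 \<tau> = JJ.cod2 \<tau>'"
      "src0 JJ (JJ.dom2 \<tau>') = ?P" "tgt0 JJ (JJ.dom2 \<tau>') = D" "\<tau> \<lhd>\<^bsub>JJ\<^esub> Omega_u C = \<tau>' \<lhd>\<^bsub>JJ\<^esub> Omega_u C"
    define g g' where "g = JJ.dom2 \<tau>'" "g' = JJ.cod2 \<tau>'"
    have g: "pmfun ?P D g" "pmfun ?P D g'"
      using a(1-6) JJ.V.src_ob[OF a(2)] JJ.V.tgt_ob[OF a(2)] JJ.globular'[OF a(2)]
      unfolding pmfun_iff g_g'_def by (simp_all only: simp_thms)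
    have t: "pmnat ?P D g g' \<tau>" "pmnat ?P D g g' \<tau>'"
      unfolding pmnat_iff[OF g(1)] using a(1-4) by (simp_all only: g_g'_def simp_thms)
    let ?G = "comp_pmonfun g R.R" and ?G' = "comp_pmonfun g' R.R"
    have G: "pmfun ?A D ?G" "pmfun ?A D ?G'" by (rule comp_pmfun[OF R g(1)] comp_pmfun[OF R g(2)])+
    let ?r = "\<lambda>\<tau>. hcomp_pmonnat \<tau> (?w R.R)"
    have r: "pmnat ?A D ?G ?G' (?r \<tau>)" "pmnat ?A D ?G ?G' (?r \<tau>')"
      by (rule hcomp_pmnat[OF id_pmnat[OF R] t(1)] hcomp_pmnat[OF id_pmnat[OF R] t(2)])+
    have w: "hcomp_pmonnat (?r \<rho>) (?w ?O) = \<rho> \<lhd>\<^bsub>JJ\<^esub> Omega_u C" if "pmnat ?P D g g' \<rho>" for \<rho>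
      by (simp only: whisker_right_def JJ_simps Ou hcomp_idn[OF O R, symmetric] hcomp_assoc[OF id_pmnat[OF O] id_pmnat[OF R] that])
    have "pmnat C D (comp_pmonfun ?G ?O) (comp_pmonfun ?G' ?O) (\<tau> \<lhd>\<^bsub>JJ\<^esub> Omega_u C)"
      using hcomp_pmnat[OF id_pmnat[OF O] r(1)] by (simp only: w[OF t(1)])
    then interpret TE: transformation_extension C D ?G ?G' "\<tau> \<lhd>\<^bsub>JJ\<^esub> Omega_u C"
      using G by (intro transformation_extension.intro transformation_extension_axioms.intro C D)
    \<comment> \<open>Both restrict along \<open>Omega\<close> to the same 2-cell and hence coincide
      with the extension constructed from it.\<close>
    have "?r \<tau> = ?r \<tau>'"
      using TE.tau_unique[OF r(1) w[OF t(1)]] TE.tau_unique[OF r(2) w[OF t(2), folded a(7)]] by (rule HOL.trans[OF _ HOL.sym])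
    moreover have "hcomp_pmonnat (?r \<rho>) (?w R.R') = \<rho>" if "pmnat ?P D g g' \<rho>" for \<rho>
      by (simp only: hcomp_assoc[OF id_pmnat[OF R'] id_pmnat[OF R] that] hcomp_idn[OF R' R] R_R' hcomp_idn_left(2)[OF that])
    ultimately show "\<tau> = \<tau>'" using t by metis
  qed
qed

text \<open>A general target is replaced by an equivalent strict one. The distinguished object keeps
  a dual on the way, because \<open>E\<close> preserves duals and \<open>fpt E\<close> identifies
  the image of \<open>pt D\<close> with \<open>pt D'\<close>.\<close>

lemma free_for_Omega_u:
  assumes C: "strict_pointed (C :: 'u::infinite pmc)" and D: "pmcat (D :: 'u pmc)"
    and dual: "has_right_dual D (pt D)"
  shows "free_for JJ C (adjoin_dual_u C) (Omega_u C) D"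
proof -
  obtain D' E where D': "pmcat D'" "strict_monoidal_category D'" and E: "equivalence_cell1 (JJ :: ('u pmc, 'u pmf, 'u pmn) twocat) D D' E"
    using ex_strict[OF D] by blast
  interpret D': strict_pointed D' using D' by (rule strict_pointedI)
  have "pmfun D D' E" using E by (simp add: equivalence_cell1_def)
  then interpret E: pointed_monoidal_functor D D' E .
  obtain y e n where "is_right_dual D (pt D) y e n" using dual unfolding has_right_dual_def by blast
  note d = right_dual_image[OF \<open>pmfun D D' E\<close> D'(2) this]
  then have [simp]: "fob E y \<in> ob D'" by (simp add: is_right_dual_def)
  have "has_right_dual D' (pt D')"
    using D'.right_dual_iso[OF d, of "inv_ar D' (fpt E)" "idn D' (fob E y)"] unfolding has_right_dual_def by auto
  from free_for_Omega_u_strict[OF C D'.strict_pointed_axioms this] E show ?thesis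
    by (rule JJ.free_for_postcomp)
qed

theorem corollary13:
  "(\<exists>S E. strictification S E \<and>
       (\<forall>X \<in> cell0 (JJ :: (('u::infinite) pmc, 'u pmf, 'u pmn) twocat).
          strict_monoidal_category X \<longrightarrow> S X = X \<and> E X = one JJ X)) \<and>
   (\<forall>(S :: 'u pmc \<Rightarrow> 'u pmc) (E :: 'u pmc \<Rightarrow> 'u pmf). strictification S E \<longrightarrow>
       has_left_biadjoint
         (JJ_dual :: ('u pmc, 'u pmf, 'u pmn) twocat) (JJ :: ('u pmc, 'u pmf, 'u pmn) twocat) inclusion
         (\<lambda>X. adjoin_dual_u (S X))
         (\<lambda>X. Omega_u (S X) \<bullet>\<^bsub>JJ\<^esub> E X))"
proof (intro conjI allI impI)
  show "\<exists>S E. strictification S E \<and>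
       (\<forall>X \<in> cell0 (JJ :: ('u pmc, 'u pmf, 'u pmn) twocat).
          strict_monoidal_category X \<longrightarrow> S X = X \<and> E X = one JJ X)"
    by (rule ex_strictification)
next
  fix S :: "'u pmc \<Rightarrow> 'u pmc" and E :: "'u pmc \<Rightarrow> 'u pmf"
  assume "strictification S E"
  then have S: "strict_pointed (S X)" "equivalence_cell1 JJ X (S X) (E X)" if "pmcat X" for X
    using that by (auto simp: strictification_def intro: strict_pointedI)
  have "free_objects JJ {C. has_right_dual C (pt C)} (\<lambda>X. adjoin_dual_u (S X)) (\<lambda>X. Omega_u (S X) \<bullet>\<^bsub>JJ\<^esub> E X)"
  proof unfold_locales
    fix X A :: "'u pmc" assume "X \<in> cell0 JJ"
    then have X: "pmcat X" by simp
    show "adjoin_dual_u (S X) \<in> cell0 JJ" "adjoin_dual_u (S X) \<in> {C. has_right_dual C (pt C)}"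
      using adjoin_dual_u[OF S(1)[OF X]] by simp_all
    assume "A \<in> cell0 JJ" "A \<in> {C. has_right_dual C (pt C)}"
    then have "free_for JJ (S X) (adjoin_dual_u (S X)) (Omega_u (S X)) A"
      using free_for_Omega_u[OF S(1)[OF X], of A] by simp
    \<comment> \<open>Freeness holds from the strict \<open>S X\<close> and is pulled back along the
      equivalence \<open>E X\<close>, which is the origin of the composite in the unit.\<close>
    then show "free_for JJ X (adjoin_dual_u (S X)) (Omega_u (S X) \<bullet>\<^bsub>JJ\<^esub> E X) A"
      using S(2)[OF X] by (rule JJ.free_for_precomp)
  qed
  from free_objects.has_left_biadjoint[OF this]
  show "has_left_biadjoint (JJ_dual :: ('u pmc, 'u pmf, 'u pmn) twocat) JJ inclusion
      (\<lambda>X. adjoin_dual_u (S X)) (\<lambda>X. Omega_u (S X) \<bullet>\<^bsub>JJ\<^esub> E X)"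
    unfolding JJ_dual_def .
qed

end
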